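(* Let $G$ be one of the groups $\mu_3$, $\mu_3^2$, $\mu_3^3$. Then there exist a field $\mathbb{K}$ of characteristic zero and a non-trivial Severi--Brauer surface $S$ over $\mathbb{K}$ such that the group $\mathrm{Bir}(S)$ contains a subgroup which is isomorphic to $G$ and is not conjugate in $\mathrm{Bir}(S)$ to a subgroup of $\mathrm{Aut}(S)$.
   Context: $\mu_n$ denotes the cyclic group of order $n$. A Severi--Brauer surface over a field $\mathbb{K}$ is a surface $S$ over $\mathbb{K}$ with $S_{\bar{\mathbb{K}}}\cong\mathbb{P}^2_{\bar{\mathbb{K}}}$, where $\bar{\mathbb{K}}$ is an algebraic closure of $\mathbb{K}$; it is called non-trivial if it is not isomorphic to $\mathbb{P}^2$ over $\mathbb{K}$. Equivalently, it is a del Pezzo surface of degree $9$ not isomorphic to $\mathbb{P}^2$ over $\mathbb{K}$. For a variety $S$ over $\mathbb{K}$, $\mathrm{Aut}(S)$ and $\mathrm{Bir}(S)$ denote the groups of automorphisms and of birational automorphisms of $S$ defined over $\mathbb{K}$, and $\mathrm{Aut}(S)\subset\mathrm{Bir}(S)$. *)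

theory Defs
  imports Complex_Main "HOL-Algebra.Algebra"
begin

text \<open>
  Throughout, \<open>L\<close> is an algebraic closure of its subfield \<open>K\<close> (locale \<open>algebraic_closure\<close>), of
  characteristic zero.  Projective varieties over \<open>K\<close> are treated classically: as sets of
  \<open>L\<close>-points cut out by forms over \<open>K\<close>, with morphisms given locally by forms over \<open>K\<close>.  Since
  \<open>K\<close> is perfect, this is equivalent to the category of reduced projective \<open>K\<close>-schemes.  The
  parameter \<open>k\<close> below is the field of definition: \<open>k = K\<close> for notions over \<open>K\<close>, and
  \<open>k = carrier L\<close> for notions after base change to the algebraic closure.
\<close>

definition has_char_zero :: "('a, 'b) ring_scheme \<Rightarrow> bool" where
  "has_char_zero R \<longleftrightarrow> (\<forall>m::nat. 0 < m \<longrightarrow> [m] \<cdot>\<^bsub>R\<^esub> \<one>\<^bsub>R\<^esub> \<noteq> \<zero>\<^bsub>R\<^esub>)"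


section \<open>Projective space and forms\<close>

definition hvec :: "('a, 'b) ring_scheme \<Rightarrow> nat \<Rightarrow> 'a list set" where
  "hvec L n = {v. length v = Suc n \<and> set v \<subseteq> carrier L \<and> v \<noteq> replicate (Suc n) \<zero>\<^bsub>L\<^esub>}"

text \<open>The point \<open>[v\<^sub>0 : \<dots> : v\<^sub>n]\<close> is the set of all its homogeneous coordinate vectors.\<close>

definition hpt :: "('a, 'b) ring_scheme \<Rightarrow> 'a list \<Rightarrow> 'a list set" where
  "hpt L v = (\<lambda>c. map (\<lambda>x. c \<otimes>\<^bsub>L\<^esub> x) v) ` (carrier L - {\<zero>\<^bsub>L\<^esub>})"

definition proj_space :: "('a, 'b) ring_scheme \<Rightarrow> nat \<Rightarrow> 'a list set set" where
  "proj_space L n = hpt L ` hvec L n"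

text \<open>
  A form of degree \<open>d\<close> in the variables \<open>x\<^sub>0, \<dots>, x\<^sub>n\<close> is given by its coefficients, indexed by the
  exponent vectors in \<open>hexps n d\<close>; values of the coefficient function elsewhere are ignored.
\<close>

definition hexps :: "nat \<Rightarrow> nat \<Rightarrow> nat list set" where
  "hexps n d = {e. length e = Suc n \<and> sum_list e = d}"

definition forms :: "'a set \<Rightarrow> nat \<Rightarrow> nat \<Rightarrow> (nat list \<Rightarrow> 'a) set" where
  "forms k n d = {F. F ` hexps n d \<subseteq> k}"

definition form_eval ::
    "('a, 'b) ring_scheme \<Rightarrow> nat \<Rightarrow> nat \<Rightarrow> (nat list \<Rightarrow> 'a) \<Rightarrow> 'a list \<Rightarrow> 'a" where
  "form_eval L n d F v =
     (\<Oplus>\<^bsub>L\<^esub>e\<in>hexps n d. F e \<otimes>\<^bsub>L\<^esub> (\<Otimes>\<^bsub>L\<^esub>i\<in>{..n}. (v ! i) [^]\<^bsub>L\<^esub> (e ! i)))"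

definition vanishes_at ::
    "('a, 'b) ring_scheme \<Rightarrow> nat \<Rightarrow> nat \<Rightarrow> (nat list \<Rightarrow> 'a) \<Rightarrow> 'a list set \<Rightarrow> bool" where
  "vanishes_at L n d F p \<longleftrightarrow> (\<forall>v\<in>p. form_eval L n d F v = \<zero>\<^bsub>L\<^esub>)"


section \<open>Varieties and morphisms over a field of definition\<close>

definition closed_over ::
    "('a, 'b) ring_scheme \<Rightarrow> 'a set \<Rightarrow> nat \<Rightarrow> 'a list set set \<Rightarrow> bool" where
  "closed_over L k n S \<longleftrightarrow>
     (\<exists>E. (\<forall>(d, F)\<in>E. F \<in> forms k n d) \<and>
          S = {p \<in> proj_space L n. \<forall>(d, F)\<in>E. vanishes_at L n d F p})"

definition open_over ::
    "('a, 'b) ring_scheme \<Rightarrow> 'a set \<Rightarrow> nat \<Rightarrow> 'a list set set \<Rightarrow> 'a list set set \<Rightarrow> bool" where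
  "open_over L k n S U \<longleftrightarrow> (\<exists>C. closed_over L k n C \<and> U = S - C)"

text \<open>
  Morphisms over \<open>k\<close> from a locally closed \<open>U\<close> in projective \<open>n\<close>-space to \<open>Y\<close> in projective
  \<open>m\<close>-space: around each point \<open>x\<close> of \<open>U\<close> the map is \<open>[F\<^sub>0 : \<dots> : F\<^sub>m]\<close> for forms of equal degree
  over \<open>k\<close>, not all vanishing at \<open>x\<close>.  Asking for agreement wherever the \<open>F\<^sub>j\<close> do not all vanish,
  and not only on a smaller neighbourhood of \<open>x\<close>, is no restriction: multiply all \<open>F\<^sub>j\<close> by a form
  that vanishes outside the neighbourhood but not at \<open>x\<close>.  Values of \<open>f\<close> outside \<open>U\<close> are irrelevant.
\<close>

definition regular_over ::
    "('a, 'b) ring_scheme \<Rightarrow> 'a set \<Rightarrow> nat \<Rightarrow> 'a list set set \<Rightarrow> nat \<Rightarrow> 'a list set set \<Rightarrow>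
     ('a list set \<Rightarrow> 'a list set) \<Rightarrow> bool" where
  "regular_over L k n U m Y f \<longleftrightarrow>
     f ` U \<subseteq> Y \<and>
     (\<forall>x\<in>U. \<exists>d F. (\<forall>j\<le>m. F j \<in> forms k n d) \<and>
        (\<exists>j\<le>m. \<not> vanishes_at L n d (F j) x) \<and>
        (\<forall>y\<in>U. (\<exists>j\<le>m. \<not> vanishes_at L n d (F j) y) \<longrightarrow>
           (\<forall>v\<in>y. f y = hpt L (map (\<lambda>j. form_eval L n d (F j) v) [0..<Suc m]))))"

definition inverse_morphisms ::
    "('a, 'b) ring_scheme \<Rightarrow> 'a set \<Rightarrow> nat \<Rightarrow> 'a list set set \<Rightarrow> nat \<Rightarrow> 'a list set set \<Rightarrow>
     ('a list set \<Rightarrow> 'a list set) \<Rightarrow> ('a list set \<Rightarrow> 'a list set) \<Rightarrow> bool" where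
  "inverse_morphisms L k n S m Y f g \<longleftrightarrow>
     regular_over L k n S m Y f \<and> regular_over L k m Y n S g \<and>
     (\<forall>x\<in>S. g (f x) = x) \<and> (\<forall>y\<in>Y. f (g y) = y)"

definition isomorphic_over ::
    "('a, 'b) ring_scheme \<Rightarrow> 'a set \<Rightarrow> nat \<Rightarrow> 'a list set set \<Rightarrow> nat \<Rightarrow> 'a list set set \<Rightarrow> bool" where
  "isomorphic_over L k n S m Y \<longleftrightarrow> (\<exists>f g. inverse_morphisms L k n S m Y f g)"

text \<open>
  Restricting to projective \<open>S\<close> loses nothing: a Severi--Brauer surface is projective over its
  base field, as projectivity descends along field extensions.
\<close>

definition severi_brauer_surface ::
    "('a, 'b) ring_scheme \<Rightarrow> 'a set \<Rightarrow> nat \<Rightarrow> 'a list set set \<Rightarrow> bool" where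
  "severi_brauer_surface L K n S \<longleftrightarrow>
     closed_over L K n S \<and> isomorphic_over L (carrier L) n S 2 (proj_space L 2)"

definition nontrivial_severi_brauer_surface ::
    "('a, 'b) ring_scheme \<Rightarrow> 'a set \<Rightarrow> nat \<Rightarrow> 'a list set set \<Rightarrow> bool" where
  "nontrivial_severi_brauer_surface L K n S \<longleftrightarrow>
     severi_brauer_surface L K n S \<and> \<not> isomorphic_over L K n S 2 (proj_space L 2)"


section \<open>Birational automorphisms\<close>

text \<open>
  For geometrically irreducible \<open>S\<close> (such as a Severi--Brauer surface), rational self-maps over
  \<open>K\<close> are classes of morphisms over \<open>K\<close> on nonempty (hence dense) open subsets defined over \<open>K\<close>,
  two of them being identified if they agree on the common domain.
\<close>

definition rat_reps ::
    "('a, 'b) ring_scheme \<Rightarrow> 'a set \<Rightarrow> nat \<Rightarrow> 'a list set set \<Rightarrow>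
     ('a list set set \<times> ('a list set \<Rightarrow> 'a list set)) set" where
  "rat_reps L K n S =
     {(U, f). open_over L K n S U \<and> U \<noteq> {} \<and> regular_over L K n U n S f}"

definition rat_rel ::
    "('a, 'b) ring_scheme \<Rightarrow> 'a set \<Rightarrow> nat \<Rightarrow> 'a list set set \<Rightarrow>
     (('a list set set \<times> ('a list set \<Rightarrow> 'a list set)) \<times>
      ('a list set set \<times> ('a list set \<Rightarrow> 'a list set))) set" where
  "rat_rel L K n S =
     {((U, f), (V, g)). (U, f) \<in> rat_reps L K n S \<and> (V, g) \<in> rat_reps L K n S \<and>
        (\<forall>x\<in>U \<inter> V. f x = g x)}"

definition rat_class ::
    "('a, 'b) ring_scheme \<Rightarrow> 'a set \<Rightarrow> nat \<Rightarrow> 'a list set set \<Rightarrow>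
     'a list set set \<times> ('a list set \<Rightarrow> 'a list set) \<Rightarrow>
     ('a list set set \<times> ('a list set \<Rightarrow> 'a list set)) set" where
  "rat_class L K n S r = rat_rel L K n S `` {r}"

text \<open>\<open>f\<close> and \<open>g\<close> can be composed in both orders, and both composites are the identity.\<close>

definition inverse_rat_reps ::
    "'a list set set \<times> ('a list set \<Rightarrow> 'a list set) \<Rightarrow>
     'a list set set \<times> ('a list set \<Rightarrow> 'a list set) \<Rightarrow> bool" where
  "inverse_rat_reps = (\<lambda>(U, f) (V, g).
     (\<exists>x\<in>U. f x \<in> V) \<and> (\<exists>y\<in>V. g y \<in> U) \<and>
     (\<forall>x\<in>U. f x \<in> V \<longrightarrow> g (f x) = x) \<and> (\<forall>y\<in>V. g y \<in> U \<longrightarrow> f (g y) = y))"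

definition bir_reps ::
    "('a, 'b) ring_scheme \<Rightarrow> 'a set \<Rightarrow> nat \<Rightarrow> 'a list set set \<Rightarrow>
     ('a list set set \<times> ('a list set \<Rightarrow> 'a list set)) set" where
  "bir_reps L K n S =
     {r \<in> rat_reps L K n S. \<exists>s\<in>rat_reps L K n S. inverse_rat_reps r s}"

text \<open>
  The product \<open>B \<otimes> A\<close> is ``first \<open>A\<close>, then \<open>B\<close>''.  All composites of representatives lie in one
  class, so the union below is that class.
\<close>

definition Bir ::
    "('a, 'b) ring_scheme \<Rightarrow> 'a set \<Rightarrow> nat \<Rightarrow> 'a list set set \<Rightarrow>
     ('a list set set \<times> ('a list set \<Rightarrow> 'a list set)) set monoid" where
  "Bir L K n S =
     \<lparr>carrier = rat_class L K n S ` bir_reps L K n S,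
      monoid.mult = (\<lambda>B A. \<Union>(V, g)\<in>B. \<Union>(U, f)\<in>A.
         rat_class L K n S ({x \<in> U. f x \<in> V}, g \<circ> f)),
      one = rat_class L K n S (S, id)\<rparr>"

text \<open>The group of automorphisms of \<open>S\<close> over \<open>K\<close>, as a subgroup of \<open>Bir\<close>.\<close>

definition Aut ::
    "('a, 'b) ring_scheme \<Rightarrow> 'a set \<Rightarrow> nat \<Rightarrow> 'a list set set \<Rightarrow>
     ('a list set set \<times> ('a list set \<Rightarrow> 'a list set)) set monoid" where
  "Aut L K n S =
     (Bir L K n S)\<lparr>carrier :=
        {rat_class L K n S (S, f) | f. \<exists>g. inverse_morphisms L K n S n S f g}\<rparr>"

definition conjugate_subgroup :: "('g, 'm) monoid_scheme \<Rightarrow> 'g \<Rightarrow> 'g set \<Rightarrow> 'g set" where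
  "conjugate_subgroup G g H = (\<lambda>h. g \<otimes>\<^bsub>G\<^esub> h \<otimes>\<^bsub>G\<^esub> inv\<^bsub>G\<^esub> g) ` H"

end

theory Submission
  imports Defs "HOL-Computational_Algebra.Computational_Algebra" "HOL-Computational_Algebra.Polynomial_Factorial" "HOL-Computational_Algebra.Field_as_Ring"
begin

text \<open>
  Inside \<open>L\<close>, the complex numbers, let \<open>K\<close> be a maximal subfield containing a primitive cube root of unity
  \<open>w\<close> over which the cyclic algebra \<open>(2, w)\<close> remains a division algebra; by maximality \<open>L\<close> is algebraic
  over \<open>K\<close>. The cubic monomials of the plane, twisted by this algebra, embed the plane as a Severi--Brauer surface
  \<open>S\<close> over \<open>K\<close>, and \<open>S\<close> has no \<open>K\<close>-point since the algebra has no zero divisors. A quartic Cremona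
  transformation \<open>sg\<close> of order three commutes with the Heisenberg group, so it descends to \<open>S\<close>, and
  together with the Heisenberg group it generates a group isomorphic to the cube of the cyclic group of order three.

  The transformation \<open>sg\<close> fixes a cubic curve pointwise. If a birational map \<open>g\<close> conjugated \<open>sg\<close> into an
  automorphism, that is, into a linear map of the plane, then \<open>g\<close> would map the curve into an eigenspace of this
  linear map, hence into a line. Splitting this condition by characters of the Heisenberg group and specialising it to
  points of \<open>K\<close> yields singular nonzero elements of the division algebra.
\<close>

text \<open>\<open>K\<close> is taken maximal so that all complex numbers, with their type class
  arithmetic, form its algebraic closure. The constants come from the prime 2, which is inert in the
  Eisenstein integers: in the residue field with four elements the only nonzero cube is 1, so
  \<open>w\<close> is not a cube there and \<open>(2, w)\<close> is a division algebra already over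
  the field generated by \<open>w\<close>. The nine cubics \<open>u_i * u_j ^ 2\<close> form a
  matrix of rank one whose columns are multiples of \<open>u\<close>. This places the plane in the
  projective space of the algebra, where a \<open>K\<close>-point would be a zero divisor. Omitting
  \<open>x * y * z\<close> leaves each character of the Heisenberg group exactly once among the
  cubics, so that descent to \<open>K\<close> is a splitting into characters. The main obstacle: the
  conjugating map has unknown degree, its matrix may vanish along the curve, and the linear form
  that kills the matrix on the curve has complex coefficients. Hence a power of the equation of the
  curve is divided out, and remainders modulo the curve are computed over \<open>K\<close>; a
  complex linear relation between them can then be tested at points of \<open>K\<close>.\<close>

definition CC :: "complex ring" where
  "CC = \<lparr>carrier = UNIV, monoid.mult = (*), one = 1, ring.zero = 0, ring.add = (+)\<rparr>"

lemma CC_simps [simp]: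
  "carrier CC = UNIV" "x \<otimes>\<^bsub>CC\<^esub> y = x * y" "x \<oplus>\<^bsub>CC\<^esub> y = x + y" "\<one>\<^bsub>CC\<^esub> = 1" "\<zero>\<^bsub>CC\<^esub> = 0"
  by (simp_all add: CC_def)

lemma field_CC: "field CC"
proof -
  have "\<exists>y. x + y = 0 \<and> y + x = 0" for x :: complex
    by (rule exI[of _ "- x"]) simp
  moreover have "\<exists>y. x * y = 1 \<and> y * x = 1" if "x \<noteq> 0" for x :: complex
    using that by (intro exI[of _ "inverse x"]) simp
  ultimately show ?thesis
    by unfold_locales (auto simp: Units_def algebra_simps)
qed

lemma CC_pow [simp]: "x [^]\<^bsub>CC\<^esub> (n::nat) = x ^ n"
  by (induction n) (simp_all add: mult.commute)

lemma CC_neg [simp]: "\<ominus>\<^bsub>CC\<^esub> x = - x"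
proof -
  interpret CC: ring CC using field_CC by (simp add: field.is_ring)
  show ?thesis by (rule CC.minus_equality) simp_all
qed

lemma CC_finsum [simp]: "finite A \<Longrightarrow> finsum CC f A = sum f A"
proof (induction A rule: finite_induct)
  interpret CC: ring CC using field_CC by (simp add: field.is_ring)
  case empty show ?case by simp
  case (insert x F) then show ?case by (subst CC.finsum_insert) auto
qed

lemma CC_finprod [simp]: "finite A \<Longrightarrow> finprod CC f A = prod f A"
proof (induction A rule: finite_induct)
  interpret CC: field CC by (rule field_CC)
  case empty show ?case by simp
  case (insert x F) then show ?case by (subst CC.finprod_insert) auto
qed

lemma CC_inv [simp]: "x \<noteq> 0 \<Longrightarrow> inv\<^bsub>CC\<^esub> x = inverse x"
proof -
  interpret CC: field CC by (rule field_CC)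
  show "x \<noteq> 0 \<Longrightarrow> ?thesis" by (rule CC.inv_char) simp_all
qed

lemma CC_add_pow [simp]: "[n] \<cdot>\<^bsub>CC\<^esub> x = of_nat n * x"
  by (induction n) (simp_all add: add_pow_def nat_pow_def algebra_simps)


section \<open>Forms as functions on coordinate vectors\<close>

lemma finite_hexps [simp]: "finite (hexps n d)"
proof (rule finite_subset)
  show "hexps n d \<subseteq> {xs. set xs \<subseteq> {..d} \<and> length xs = Suc n}"
    by (auto simp: hexps_def intro: member_le_sum_list)
qed (simp add: finite_lists_length_eq)

definition mon :: "nat \<Rightarrow> nat list \<Rightarrow> complex list \<Rightarrow> complex" where
  "mon n e v = (\<Prod>i\<le>n. v ! i ^ (e ! i))"

lemma form_eval_CC: "form_eval CC n d F v = (\<Sum>e\<in>hexps n d. F e * mon n e v)"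
  by (simp add: form_eval_def mon_def)

lemma mon_scale:
  assumes "e \<in> hexps n d" "length v = Suc n"
  shows "mon n e (map ((*) c) v) = c ^ d * mon n e v"
proof -
  have "mon n e (map ((*) c) v) = (\<Prod>i\<le>n. c ^ (e ! i) * v ! i ^ (e ! i))"
    unfolding mon_def by (rule prod.cong) (use assms in \<open>auto simp: power_mult_distrib\<close>)
  also have "\<dots> = c ^ (\<Sum>i\<le>n. e ! i) * mon n e v"
    by (simp add: prod.distrib mon_def power_sum)
  also have "(\<Sum>i\<le>n. e ! i) = d"
    using assms(1) by (auto simp: hexps_def sum_list_sum_nth lessThan_Suc_atMost atLeast0LessThan)
  finally show ?thesis .
qed

text \<open>A form is represented by its values, and only the existence of coefficients in
  \<open>k\<close> is recorded. Sums, products and composites of forms can then be treated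
  pointwise, without a coefficient formula for the result.\<close>

definition ffun :: "complex set \<Rightarrow> nat \<Rightarrow> nat \<Rightarrow> (complex list \<Rightarrow> complex) set" where
  "ffun k n d = {h. \<exists>F\<in>forms k n d. \<forall>v. length v = Suc n \<longrightarrow> h v = form_eval CC n d F v}"

lemma ffunI:
  assumes "\<And>e. e \<in> hexps n d \<Longrightarrow> F e \<in> k"
    and "\<And>v. length v = Suc n \<Longrightarrow> h v = (\<Sum>e\<in>hexps n d. F e * mon n e v)"
  shows "h \<in> ffun k n d"
  unfolding ffun_def by (rule CollectI, rule bexI[of _ F]) (use assms in \<open>auto simp: form_eval_CC forms_def\<close>)

lemma ffunE:
  assumes "h \<in> ffun k n d"
  shows "\<exists>F. (\<forall>e\<in>hexps n d. F e \<in> k) \<and>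
    (\<forall>v. length v = Suc n \<longrightarrow> h v = (\<Sum>e\<in>hexps n d. F e * mon n e v))"
  using assms by (auto simp: ffun_def form_eval_CC forms_def image_subset_iff)

lemma form_eval_ffun: "F \<in> forms k n d \<Longrightarrow> form_eval CC n d F \<in> ffun k n d"
  by (auto simp: ffun_def)

lemma ffun_cong:
  "h \<in> ffun k n d \<Longrightarrow> (\<And>v. length v = Suc n \<Longrightarrow> h' v = h v) \<Longrightarrow> h' \<in> ffun k n d"
  by (auto simp: ffun_def)

lemma ffun_mono: "k \<subseteq> k' \<Longrightarrow> h \<in> ffun k n d \<Longrightarrow> h \<in> ffun k' n d"
  by (force simp: ffun_def forms_def)

lemma ffun_scale:
  assumes "h \<in> ffun k n d" "length v = Suc n"
  shows "h (map ((*) c) v) = c ^ d * h v"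
proof -
  obtain F where F: "\<forall>v. length v = Suc n \<longrightarrow> h v = (\<Sum>e\<in>hexps n d. F e * mon n e v)"
    using ffunE[OF assms(1)] by blast
  show ?thesis
    using assms(2) by (simp add: F mon_scale[OF _ assms(2)] sum_distrib_left mult_ac cong: sum.cong)
qed

locale subring_C =
  fixes k :: "complex set"
  assumes k0 [simp]: "0 \<in> k" and k1 [simp]: "1 \<in> k"
    and kadd [simp]: "x \<in> k \<Longrightarrow> y \<in> k \<Longrightarrow> x + y \<in> k"
    and kmult [simp]: "x \<in> k \<Longrightarrow> y \<in> k \<Longrightarrow> x * y \<in> k"
    and kneg [simp]: "x \<in> k \<Longrightarrow> - x \<in> k"
begin

lemma kdiff [simp]: "x \<in> k \<Longrightarrow> y \<in> k \<Longrightarrow> x - y \<in> k"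
  using kadd[of x "- y"] by simp

lemma kpow [simp]: "x \<in> k \<Longrightarrow> x ^ n \<in> k"
  by (induction n) auto

lemma knat [simp]: "of_nat n \<in> k"
  by (induction n) auto

lemma knum [simp]: "numeral n \<in> k"
  using knat[of "numeral n"] by simp

lemma ksum [simp]: "(\<And>i. i \<in> A \<Longrightarrow> f i \<in> k) \<Longrightarrow> sum f A \<in> k"
  by (induction A rule: infinite_finite_induct) auto

lemma kprod [simp]: "(\<And>i. i \<in> A \<Longrightarrow> f i \<in> k) \<Longrightarrow> prod f A \<in> k"
  by (induction A rule: infinite_finite_induct) auto

lemma ffun_add:
  assumes "f \<in> ffun k n d" "g \<in> ffun k n d"
  shows "(\<lambda>v. f v + g v) \<in> ffun k n d"
proof -
  obtain F where F: "\<forall>e\<in>hexps n d. F e \<in> k"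
    "\<forall>v. length v = Suc n \<longrightarrow> f v = (\<Sum>e\<in>hexps n d. F e * mon n e v)"
    using ffunE[OF assms(1)] by blast
  obtain G where G: "\<forall>e\<in>hexps n d. G e \<in> k"
    "\<forall>v. length v = Suc n \<longrightarrow> g v = (\<Sum>e\<in>hexps n d. G e * mon n e v)"
    using ffunE[OF assms(2)] by blast
  show ?thesis
    by (rule ffunI[where F = "\<lambda>e. F e + G e"]) (simp_all add: F G distrib_right sum.distrib)
qed

lemma ffun_smult:
  assumes "c \<in> k" "f \<in> ffun k n d"
  shows "(\<lambda>v. c * f v) \<in> ffun k n d"
proof -
  obtain F where F: "\<forall>e\<in>hexps n d. F e \<in> k"
    "\<forall>v. length v = Suc n \<longrightarrow> f v = (\<Sum>e\<in>hexps n d. F e * mon n e v)"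
    using ffunE[OF assms(2)] by blast
  show ?thesis
    by (rule ffunI[where F = "\<lambda>e. c * F e"]) (simp_all add: F assms sum_distrib_left mult_ac)
qed

lemma ffun_zero: "(\<lambda>v. 0) \<in> ffun k n d"
  by (rule ffunI[where F = "\<lambda>e. 0"]) simp_all

lemma ffun_neg: "f \<in> ffun k n d \<Longrightarrow> (\<lambda>v. - f v) \<in> ffun k n d"
  using ffun_smult[of "-1"] by simp

lemma ffun_diff: "f \<in> ffun k n d \<Longrightarrow> g \<in> ffun k n d \<Longrightarrow> (\<lambda>v. f v - g v) \<in> ffun k n d"
  using ffun_add[OF _ ffun_neg] by simp

lemma ffun_sum: "(\<And>i. i \<in> A \<Longrightarrow> f i \<in> ffun k n d) \<Longrightarrow> (\<lambda>v. \<Sum>i\<in>A. f i v) \<in> ffun k n d"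
  by (induction A rule: infinite_finite_induct) (auto simp: ffun_zero intro: ffun_add)

lemma ffun_mon:
  assumes "e \<in> hexps n d"
  shows "mon n e \<in> ffun k n d"
  by (rule ffunI[where F = "\<lambda>e'. if e' = e then 1 else 0"])
     (use assms in \<open>auto simp: if_distrib[of "\<lambda>x. x * _"] cong: if_cong\<close>)

lemma mon_mult:
  assumes "e \<in> hexps n d" "e' \<in> hexps n d'"
  shows "map2 (+) e e' \<in> hexps n (d + d')"
    and "mon n e v * mon n e' v = mon n (map2 (+) e e') v"
proof -
  have "sum_list (map2 (+) e e') = sum_list e + sum_list e'"
    using assms by (auto simp: hexps_def sum_list_sum_nth sum.distrib)
  then show "map2 (+) e e' \<in> hexps n (d + d')"
    using assms by (simp add: hexps_def)
  show "mon n e v * mon n e' v = mon n (map2 (+) e e') v"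
    unfolding mon_def prod.distrib[symmetric]
    by (rule prod.cong) (use assms in \<open>auto simp: hexps_def power_add\<close>)
qed

lemma ffun_mult:
  assumes "f \<in> ffun k n d" "g \<in> ffun k n d'"
  shows "(\<lambda>v. f v * g v) \<in> ffun k n (d + d')"
proof -
  obtain F where F: "\<forall>e\<in>hexps n d. F e \<in> k"
    "\<forall>v. length v = Suc n \<longrightarrow> f v = (\<Sum>e\<in>hexps n d. F e * mon n e v)"
    using ffunE[OF assms(1)] by blast
  obtain G where G: "\<forall>e\<in>hexps n d'. G e \<in> k"
    "\<forall>v. length v = Suc n \<longrightarrow> g v = (\<Sum>e\<in>hexps n d'. G e * mon n e v)"
    using ffunE[OF assms(2)] by blast
  have "(\<lambda>v. \<Sum>e\<in>hexps n d. \<Sum>e'\<in>hexps n d'. (F e * G e') * mon n (map2 (+) e e') v) \<in> ffun k n (d + d')"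
    by (intro ffun_sum ffun_smult ffun_mon mon_mult(1)) (auto simp: F G)
  then show ?thesis
  proof (rule ffun_cong)
    fix v :: "complex list" assume v: "length v = Suc n"
    show "f v * g v = (\<Sum>e\<in>hexps n d. \<Sum>e'\<in>hexps n d'. (F e * G e') * mon n (map2 (+) e e') v)"
      by (simp add: F G v sum_product mon_mult(2)[symmetric] mult_ac cong: sum.cong)
  qed
qed

lemma ffun_const: "c \<in> k \<Longrightarrow> (\<lambda>v. c) \<in> ffun k n 0"
proof -
  assume c: "c \<in> k"
  have *: "hexps n 0 = {replicate (Suc n) 0}"
    by (auto simp: hexps_def intro!: replicate_eqI simp del: replicate_Suc)
  show ?thesis
    by (rule ffunI[where F = "\<lambda>e. c"]) (use c in \<open>simp_all add: * mon_def del: replicate_Suc\<close>)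
qed

lemma ffun_coord:
  assumes "i \<le> n"
  shows "(\<lambda>v. v ! i) \<in> ffun k n 1"
proof -
  let ?e = "(replicate (Suc n) 0)[i := 1 :: nat]"
  have "sum_list ?e = 1"
    using assms by (subst sum_list_update) (auto simp del: replicate_Suc)
  then have "mon n ?e \<in> ffun k n 1"
    by (intro ffun_mon) (simp add: hexps_def del: replicate_Suc)
  then show ?thesis
  proof (rule ffun_cong)
    fix v :: "complex list"
    have "mon n ?e v = (\<Prod>j\<le>n. if i = j then v ! j else 1)"
      unfolding mon_def by (rule prod.cong) (auto simp: nth_list_update simp del: replicate_Suc)
    then show "v ! i = mon n ?e v"
      using assms by simp
  qed
qed

lemma ffun_power: "f \<in> ffun k n d \<Longrightarrow> (\<lambda>v. f v ^ j) \<in> ffun k n (d * j)"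
  by (induction j) (auto intro: ffun_mult ffun_const)

lemma ffun_prod:
  "finite A \<Longrightarrow> (\<And>i. i \<in> A \<Longrightarrow> f i \<in> ffun k n (d i)) \<Longrightarrow> (\<lambda>v. \<Prod>i\<in>A. f i v) \<in> ffun k n (sum d A)"
  by (induction A rule: finite_induct) (auto intro: ffun_mult ffun_const)

text \<open>This is what makes a composite of regular maps regular over the same
  \<open>k\<close>.\<close>

lemma ffun_comp:
  assumes "h \<in> ffun k m e" "\<And>j. j \<le> m \<Longrightarrow> G j \<in> ffun k n d"
  shows "(\<lambda>v. h (map (\<lambda>j. G j v) [0..<Suc m])) \<in> ffun k n (d * e)"
proof -
  obtain F where F: "\<forall>e'\<in>hexps m e. F e' \<in> k"
    "\<forall>v. length v = Suc m \<longrightarrow> h v = (\<Sum>e'\<in>hexps m e. F e' * mon m e' v)"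
    using ffunE[OF assms(1)] by blast
  have deg: "d * e = (\<Sum>i\<le>m. d * (e' ! i))" if "e' \<in> hexps m e" for e'
    using that by (auto simp: hexps_def sum_list_sum_nth lessThan_Suc_atMost atLeast0LessThan sum_distrib_left)
  have "(\<lambda>v. \<Sum>e'\<in>hexps m e. F e' * (\<Prod>i\<le>m. G i v ^ (e' ! i))) \<in> ffun k n (d * e)"
  proof (intro ffun_sum ffun_smult)
    fix e' assume e': "e' \<in> hexps m e"
    show "(\<lambda>v. \<Prod>i\<le>m. G i v ^ (e' ! i)) \<in> ffun k n (d * e)"
      unfolding deg[OF e'] by (intro ffun_prod ffun_power assms(2)) auto
  qed (simp add: F)
  then show ?thesis
    by (rule ffun_cong) (simp add: F mon_def nth_map_upt less_Suc_eq_le del: upt_Suc cong: prod.cong_simp)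
qed

end

lemma subring_C_UNIV: "subring_C UNIV"
  by unfold_locales auto


section \<open>Points, closed sets and regular maps in terms of forms\<close>

definition vecs :: "nat \<Rightarrow> complex list set" where
  "vecs n = {v. length v = Suc n \<and> (\<exists>i\<le>n. v ! i \<noteq> 0)}"

lemma hvec_CC: "hvec CC n = vecs n"
proof -
  have "v = replicate (Suc n) 0 \<longleftrightarrow> (\<forall>i\<le>n. v ! i = 0)" if "length v = Suc n" for v :: "complex list"
    using that by (auto simp: list_eq_iff_nth_eq less_Suc_eq_le simp del: replicate_Suc)
  then show ?thesis by (auto simp: hvec_def vecs_def simp del: replicate_Suc)
qed

abbreviation pt :: "complex list \<Rightarrow> complex list set" where
  "pt v \<equiv> hpt CC v"

lemma pt_def': "pt v = {map ((*) c) v | c. c \<noteq> 0}"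
  by (auto simp: hpt_def)

lemma pt_self [simp]: "v \<in> pt v"
  unfolding pt_def' by (rule CollectI, rule exI[of _ 1]) (simp add: map_idI)

lemma pt_eqI:
  assumes c: "c \<noteq> 0"
  shows "pt (map ((*) c) v) = pt v"
proof -
  have "map ((*) d) v = map ((*) (d / c)) (map ((*) c) v)" for d
    using c by simp
  moreover have "map ((*) d) (map ((*) c) v) = map ((*) (d * c)) v" for d
    by simp
  ultimately show ?thesis
    unfolding pt_def' set_eq_iff mem_Collect_eq by (metis c divide_eq_0_iff mult_eq_0_iff)
qed

lemma pt_eqD: "v \<in> pt u \<Longrightarrow> pt v = pt u"
proof -
  assume "v \<in> pt u"
  then obtain c where "c \<noteq> 0" "v = map ((*) c) u"
    unfolding pt_def' by blast
  then show ?thesis using pt_eqI by blast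
qed

lemma pt_eq_iff: "pt v = pt u \<longleftrightarrow> (\<exists>c. c \<noteq> 0 \<and> v = map ((*) c) u)"
proof
  assume "pt v = pt u"
  then have "v \<in> pt u" by (metis pt_self)
  then show "\<exists>c. c \<noteq> 0 \<and> v = map ((*) c) u" by (auto simp: pt_def')
qed (auto simp: pt_eqI)

text \<open>Proportionality is turned into the vanishing of 2x2 minors. These are forms, so equality
  of two image points becomes accessible to density arguments.\<close>

lemma pt_eq_minors:
  assumes "v \<in> vecs n" "u \<in> vecs n" "\<And>i j. i \<le> n \<Longrightarrow> j \<le> n \<Longrightarrow> v ! i * u ! j = v ! j * u ! i"
  shows "pt v = pt u"
proof -
  obtain i where i: "i \<le> n" "v ! i \<noteq> 0"
    using assms(1) by (auto simp: vecs_def)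
  obtain j where j: "j \<le> n" "u ! j \<noteq> 0"
    using assms(2) by (auto simp: vecs_def)
  have ui: "u ! i \<noteq> 0"
    using assms(3)[OF i(1) j(1)] i j by auto
  have "v = map ((*) (v ! i / u ! i)) u"
  proof (rule nth_equalityI)
    show "length v = length (map ((*) (v ! i / u ! i)) u)"
      using assms by (simp add: vecs_def)
    fix l assume "l < length v"
    then have l: "l \<le> n" "l < length u"
      using assms by (auto simp: vecs_def)
    show "v ! l = map ((*) (v ! i / u ! i)) u ! l"
      using assms(3)[OF i(1) l(1)] l ui by (simp add: field_simps)
  qed
  then show ?thesis
    using pt_eq_iff ui i(2) by (metis divide_eq_0_iff)
qed

lemma pt_minors:
  assumes "pt v = pt u" "i < length u" "j < length u"
  shows "v ! i * u ! j = v ! j * u ! i"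
  using assms by (auto simp: pt_eq_iff)

lemma proj_space_CC: "proj_space CC n = pt ` vecs n"
  by (simp add: proj_space_def hvec_CC)

lemma vecs_scale [simp]: "c \<noteq> 0 \<Longrightarrow> v \<in> vecs n \<Longrightarrow> map ((*) c) v \<in> vecs n"
  by (force simp: vecs_def)

lemma proj_space_mem: "p \<in> proj_space CC n \<Longrightarrow> v \<in> p \<Longrightarrow> v \<in> vecs n \<and> p = pt v"
  by (auto simp: proj_space_CC dest: pt_eqD) (auto simp: pt_def')

lemma proj_space_ex: "p \<in> proj_space CC n \<Longrightarrow> \<exists>v. v \<in> p"
  by (auto simp: proj_space_CC intro: pt_self)

lemma vanishes_at_pt:
  assumes "length v = Suc n"
  shows "vanishes_at CC n d F (pt v) \<longleftrightarrow> form_eval CC n d F v = 0"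
proof -
  have "form_eval CC n d F (map ((*) c) v) = c ^ d * form_eval CC n d F v" for c
    by (rule ffun_scale[OF form_eval_ffun[of F UNIV] assms]) (simp add: forms_def)
  moreover have "v \<in> pt v" by simp
  ultimately show ?thesis
    unfolding vanishes_at_def by (auto simp: pt_def')
qed

text \<open>The principal open set of a form. By homogeneity the quantifier over all coordinate
  vectors amounts to a condition on a single one (\<open>nz_ffun\<close>).\<close>

definition nz :: "complex list set set \<Rightarrow> (complex list \<Rightarrow> complex) \<Rightarrow> complex list set set" where
  "nz S h = {p \<in> S. \<forall>v\<in>p. h v \<noteq> 0}"

lemma nz_ffun:
  assumes "S \<subseteq> proj_space CC n" "h \<in> ffun k n d" "p \<in> S" "v \<in> p"
  shows "p \<in> nz S h \<longleftrightarrow> h v \<noteq> 0"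
proof -
  have v: "v \<in> vecs n" "p = pt v"
    using proj_space_mem[of p n v] assms by auto
  then have "h (map ((*) c) v) = c ^ d * h v" for c
    by (intro ffun_scale[OF assms(2)]) (simp add: vecs_def)
  then show ?thesis
    using assms v unfolding nz_def by (auto simp: pt_def')
qed

lemma closed_over_ffun:
  "closed_over CC k n S \<longleftrightarrow>
    (\<exists>E. (\<forall>(d, h)\<in>E. h \<in> ffun k n d) \<and> S = {p \<in> proj_space CC n. \<forall>(d, h)\<in>E. \<forall>v\<in>p. h v = 0})"
proof
  assume "closed_over CC k n S"
  then obtain E where E: "\<forall>(d, F)\<in>E. F \<in> forms k n d"
    "S = {p \<in> proj_space CC n. \<forall>(d, F)\<in>E. vanishes_at CC n d F p}"
    unfolding closed_over_def by blast
  show "\<exists>E. (\<forall>(d, h)\<in>E. h \<in> ffun k n d) \<and> S = {p \<in> proj_space CC n. \<forall>(d, h)\<in>E. \<forall>v\<in>p. h v = 0}"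
    by (rule exI[of _ "(\<lambda>(d, F). (d, form_eval CC n d F)) ` E"])
       (use E in \<open>auto simp: vanishes_at_def intro: form_eval_ffun\<close>)
next
  assume "\<exists>E. (\<forall>(d, h)\<in>E. h \<in> ffun k n d) \<and> S = {p \<in> proj_space CC n. \<forall>(d, h)\<in>E. \<forall>v\<in>p. h v = 0}"
  then obtain E where E: "\<forall>(d, h)\<in>E. h \<in> ffun k n d"
    "S = {p \<in> proj_space CC n. \<forall>(d, h)\<in>E. \<forall>v\<in>p. h v = 0}" by blast
  have "\<forall>x\<in>E. \<exists>F. F \<in> forms k n (fst x) \<and> (\<forall>v. length v = Suc n \<longrightarrow> snd x v = form_eval CC n (fst x) F v)"
    using E(1) by (force simp: ffun_def)
  then obtain F where F: "\<And>x. x \<in> E \<Longrightarrow> F x \<in> forms k n (fst x)"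
    "\<And>x v. x \<in> E \<Longrightarrow> length v = Suc n \<Longrightarrow> snd x v = form_eval CC n (fst x) (F x) v"
    by metis
  have "S = {p \<in> proj_space CC n. \<forall>(d, G)\<in>(\<lambda>x. (fst x, F x)) ` E. vanishes_at CC n d G p}"
  proof -
    have "(\<forall>x\<in>E. \<forall>v\<in>p. snd x v = 0) \<longleftrightarrow> (\<forall>x\<in>E. vanishes_at CC n (fst x) (F x) p)" if p: "p \<in> proj_space CC n" for p
      unfolding vanishes_at_def using F(2) proj_space_mem[OF p] by (simp add: vecs_def)
    then show ?thesis
      unfolding E(2) by (auto simp: case_prod_unfold)
  qed
  then show "closed_over CC k n S"
    unfolding closed_over_def using F(1) by (intro exI[of _ "(\<lambda>x. (fst x, F x)) ` E"]) auto
qed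

text \<open>Nonvanishing is tested at the vector \<open>v\<close> itself instead of at the point.
  Homogeneity makes both the same, and the local formula can then be applied to any chosen
  vector.\<close>

lemma regular_over_ffun:
  assumes "U \<subseteq> proj_space CC n"
  shows "regular_over CC k n U m Y f \<longleftrightarrow> f ` U \<subseteq> Y \<and>
     (\<forall>x\<in>U. \<exists>d G. (\<forall>j\<le>m. G j \<in> ffun k n d) \<and> (\<exists>j\<le>m. \<exists>v\<in>x. G j v \<noteq> 0) \<and>
        (\<forall>y\<in>U. \<forall>v\<in>y. (\<exists>j\<le>m. G j v \<noteq> 0) \<longrightarrow> f y = pt (map (\<lambda>j. G j v) [0..<Suc m])))"
    (is "?L \<longleftrightarrow> ?R")
proof
  assume L: ?L
  show ?R
  proof (intro conjI ballI)
    show "f ` U \<subseteq> Y" using L by (simp add: regular_over_def)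
    fix x assume x: "x \<in> U"
    obtain d F where F: "(\<forall>j\<le>m. F j \<in> forms k n d) \<and> (\<exists>j\<le>m. \<not> vanishes_at CC n d (F j) x) \<and>
      (\<forall>y\<in>U. (\<exists>j\<le>m. \<not> vanishes_at CC n d (F j) y) \<longrightarrow>
           (\<forall>v\<in>y. f y = pt (map (\<lambda>j. form_eval CC n d (F j) v) [0..<Suc m])))"
      using bspec[OF conjunct2[OF L[unfolded regular_over_def]] x] by (elim exE) (rule that)
    note F = F[THEN conjunct1] F[THEN conjunct2, THEN conjunct1] F[THEN conjunct2, THEN conjunct2]
    show "\<exists>d G. (\<forall>j\<le>m. G j \<in> ffun k n d) \<and> (\<exists>j\<le>m. \<exists>v\<in>x. G j v \<noteq> 0) \<and>
        (\<forall>y\<in>U. \<forall>v\<in>y. (\<exists>j\<le>m. G j v \<noteq> 0) \<longrightarrow> f y = pt (map (\<lambda>j. G j v) [0..<Suc m]))"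
      by (rule exI[of _ d], rule exI[of _ "\<lambda>j. form_eval CC n d (F j)"])
         (use F in \<open>auto simp: vanishes_at_def form_eval_ffun simp del: upt_Suc\<close>)
  qed
next
  assume R: ?R
  show ?L
    unfolding regular_over_def
  proof (intro conjI ballI)
    show "f ` U \<subseteq> Y" using R by simp
    fix x assume x: "x \<in> U"
    obtain d G where G: "(\<forall>j\<le>m. G j \<in> ffun k n d) \<and> (\<exists>j\<le>m. \<exists>v\<in>x. G j v \<noteq> 0) \<and>
        (\<forall>y\<in>U. \<forall>v\<in>y. (\<exists>j\<le>m. G j v \<noteq> 0) \<longrightarrow> f y = pt (map (\<lambda>j. G j v) [0..<Suc m]))"
      using bspec[OF conjunct2[OF R] x] by (elim exE) (rule that)
    note G = G[THEN conjunct1] G[THEN conjunct2, THEN conjunct1] G[THEN conjunct2, THEN conjunct2]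
    from G(1) have "\<forall>j. \<exists>F. j \<le> m \<longrightarrow> F \<in> forms k n d \<and> (\<forall>v. length v = Suc n \<longrightarrow> G j v = form_eval CC n d F v)"
      by (auto simp: ffun_def)
    then obtain F where F: "\<And>j. j \<le> m \<Longrightarrow> F j \<in> forms k n d"
      "\<And>j v. j \<le> m \<Longrightarrow> length v = Suc n \<Longrightarrow> G j v = form_eval CC n d (F j) v"
      by metis
    have len: "length v = Suc n" if "y \<in> U" "v \<in> y" for y v
      using that assms proj_space_mem[of y n v] by (auto simp: vecs_def)
    show "\<exists>d F. (\<forall>j\<le>m. F j \<in> forms k n d) \<and> (\<exists>j\<le>m. \<not> vanishes_at CC n d (F j) x) \<and>
        (\<forall>y\<in>U. (\<exists>j\<le>m. \<not> vanishes_at CC n d (F j) y) \<longrightarrow>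
           (\<forall>v\<in>y. f y = pt (map (\<lambda>j. form_eval CC n d (F j) v) [0..<Suc m])))"
    proof (rule exI[of _ d], rule exI[of _ F], intro conjI allI impI ballI)
      show "F j \<in> forms k n d" if "j \<le> m" for j using F that by simp
      show "\<exists>j\<le>m. \<not> vanishes_at CC n d (F j) x"
      proof -
        obtain j v where "j \<le> m" "v \<in> x" "G j v \<noteq> 0" using G(2) by blast
        then show ?thesis
          using F(2)[of j v] len[OF x] by (intro exI[of _ j]) (auto simp: vanishes_at_def)
      qed
      fix y v assume y: "y \<in> U" "\<exists>j\<le>m. \<not> vanishes_at CC n d (F j) y" "v \<in> y"
      then obtain j where j: "j \<le> m" "\<not> vanishes_at CC n d (F j) y" by blast
      have "y = pt v" using y assms proj_space_mem[of y n v] by auto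
      then have "form_eval CC n d (F j) v \<noteq> 0"
        using j vanishes_at_pt[of v n d "F j"] len[OF y(1,3)] by auto
      then have "f y = pt (map (\<lambda>j. G j v) [0..<Suc m])"
        using G(3) y F(2)[OF j(1) len[OF y(1,3)]] j(1) by metis
      also have "map (\<lambda>j. G j v) [0..<Suc m] = map (\<lambda>j. form_eval CC n d (F j) v) [0..<Suc m]"
        using F(2) len[OF y(1,3)] by (auto simp del: upt_Suc)
      finally show "f y = pt (map (\<lambda>j. form_eval CC n d (F j) v) [0..<Suc m])" .
    qed
  qed
qed

section \<open>Rational self-maps of an irreducible variety and the group they form\<close>

locale irreducible_variety = subring_C K for K +
  fixes n :: nat and S :: "complex list set set"
  assumes S_proj: "S \<subseteq> proj_space CC n"
    and S_ne: "S \<noteq> {}"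
    and irred: "\<And>d e g h. g \<in> ffun K n d \<Longrightarrow> h \<in> ffun K n e \<Longrightarrow> nz S g \<noteq> {} \<Longrightarrow> nz S h \<noteq> {} \<Longrightarrow>
      nz S g \<inter> nz S h \<noteq> {}"
begin

lemma S_mem: "p \<in> S \<Longrightarrow> v \<in> p \<Longrightarrow> v \<in> vecs n \<and> p = pt v"
  using S_proj proj_space_mem[of p n v] by blast

lemma S_ex: "p \<in> S \<Longrightarrow> \<exists>v. v \<in> p"
  using S_proj proj_space_ex by blast

lemma nzS: "h \<in> ffun K n d \<Longrightarrow> p \<in> S \<Longrightarrow> v \<in> p \<Longrightarrow> p \<in> nz S h \<longleftrightarrow> h v \<noteq> 0"
  using nz_ffun[OF S_proj] by blast

lemma nz_mult:
  assumes "g \<in> ffun K n d" "h \<in> ffun K n e"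
  shows "nz S (\<lambda>v. g v * h v) = nz S g \<inter> nz S h"
  by (auto simp: nz_def)

text \<open>Principal open sets of forms over \<open>K\<close> are a basis of the topology. For the
  converse the complement is cut out by all forms whose principal open set lies in
  \<open>U\<close>.\<close>

lemma open_iff:
  "open_over CC K n S U \<longleftrightarrow> U \<subseteq> S \<and> (\<forall>p\<in>U. \<exists>d. \<exists>h\<in>ffun K n d. p \<in> nz S h \<and> nz S h \<subseteq> U)"
  (is "?L \<longleftrightarrow> ?R")
proof
  assume ?L
  then obtain E where E: "\<forall>(d, h)\<in>E. h \<in> ffun K n d"
    "U = S - {p \<in> proj_space CC n. \<forall>(d, h)\<in>E. \<forall>v\<in>p. h v = 0}"
    unfolding open_over_def closed_over_ffun by blast
  show ?R
  proof (intro conjI ballI)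
    show "U \<subseteq> S" using E(2) by blast
    fix p assume p: "p \<in> U"
    then have pS: "p \<in> S" "p \<in> proj_space CC n" using E(2) S_proj by auto
    with p E(2) obtain d h v where h: "(d, h) \<in> E" "v \<in> p" "h v \<noteq> 0"
      by auto
    then have hf: "h \<in> ffun K n d" using E(1) by blast
    have "nz S h \<subseteq> U"
    proof
      fix q assume q: "q \<in> nz S h"
      then have "q \<in> S" by (simp add: nz_def)
      moreover obtain w where "w \<in> q" using S_ex[OF \<open>q \<in> S\<close>] by blast
      moreover have "h w \<noteq> 0" using q \<open>w \<in> q\<close> by (simp add: nz_def)
      ultimately show "q \<in> U" unfolding E(2) using h(1) by auto
    qed
    moreover have "p \<in> nz S h" using nzS[OF hf pS(1) h(2)] h(3) by simp
    ultimately show "\<exists>d. \<exists>h\<in>ffun K n d. p \<in> nz S h \<and> nz S h \<subseteq> U" using hf by blast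
  qed
next
  assume R: ?R
  let ?E = "{(d, h). h \<in> ffun K n d \<and> nz S h \<subseteq> U}"
  let ?C = "{p \<in> proj_space CC n. \<forall>(d, h)\<in>?E. \<forall>v\<in>p. h v = 0}"
  have "closed_over CC K n ?C"
    unfolding closed_over_ffun by (rule exI[of _ ?E]) auto
  moreover have "U = S - ?C"
  proof (intro equalityI subsetI)
    fix p assume p: "p \<in> U"
    then obtain d h where h: "h \<in> ffun K n d" "p \<in> nz S h" "nz S h \<subseteq> U"
      using R by blast
    obtain v where v: "v \<in> p" using S_ex p R by blast
    have "h v \<noteq> 0" using h v by (auto simp: nz_def)
    then have "p \<notin> ?C" using h v by auto
    then show "p \<in> S - ?C" using p R by blast
  next
    fix p assume p: "p \<in> S - ?C"
    then have "p \<in> proj_space CC n" using S_proj by blast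
    then obtain d h v where h: "h \<in> ffun K n d" "nz S h \<subseteq> U" "v \<in> p" "h v \<noteq> 0"
      using p by auto
    then show "p \<in> U" using nzS[OF h(1) _ h(3)] p by auto
  qed
  ultimately show ?L unfolding open_over_def by blast
qed

lemma open_S: "open_over CC K n S S"
proof -
  have "\<exists>d. \<exists>h\<in>ffun K n d. p \<in> nz S h \<and> nz S h \<subseteq> S" if "p \<in> S" for p
    by (rule exI[of _ 0], rule bexI[of _ "\<lambda>v. 1"]) (use that ffun_const in \<open>auto simp: nz_def\<close>)
  then show ?thesis unfolding open_iff by blast
qed

lemma open_nz: "h \<in> ffun K n d \<Longrightarrow> open_over CC K n S (nz S h)"
  unfolding open_iff by (intro conjI ballI exI bexI) (auto simp: nz_def)

lemma dense:
  assumes "open_over CC K n S U" "open_over CC K n S V" "U \<noteq> {}" "V \<noteq> {}"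
  shows "U \<inter> V \<noteq> {}"
proof -
  obtain d g where g: "g \<in> ffun K n d" "nz S g \<noteq> {}" "nz S g \<subseteq> U"
    using assms unfolding open_iff by blast
  obtain e h where h: "h \<in> ffun K n e" "nz S h \<noteq> {}" "nz S h \<subseteq> V"
    using assms unfolding open_iff by blast
  show ?thesis using irred[OF g(1) h(1)] g h by blast
qed

lemma open_Int:
  assumes "open_over CC K n S U" "open_over CC K n S V"
  shows "open_over CC K n S (U \<inter> V)"
  unfolding open_iff
proof (intro conjI ballI)
  show "U \<inter> V \<subseteq> S" using assms by (auto simp: open_iff)
  fix p assume p: "p \<in> U \<inter> V"
  obtain d g where g: "g \<in> ffun K n d" "p \<in> nz S g" "nz S g \<subseteq> U"
    using assms p unfolding open_iff by blast
  obtain e h where h: "h \<in> ffun K n e" "p \<in> nz S h" "nz S h \<subseteq> V"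
    using assms p unfolding open_iff by blast
  show "\<exists>d. \<exists>h\<in>ffun K n d. p \<in> nz S h \<and> nz S h \<subseteq> U \<inter> V"
    using nz_mult[OF g(1) h(1)] g(2,3) h(2,3)
    by (intro exI[of _ "d + e"] bexI[OF _ ffun_mult[OF g(1) h(1)]]) auto
qed

definition regS :: "complex list set set \<Rightarrow> (complex list set \<Rightarrow> complex list set) \<Rightarrow> bool" where
  "regS U f \<longleftrightarrow> open_over CC K n S U \<and> U \<noteq> {} \<and> regular_over CC K n U n S f"

lemma rat_reps_iff: "(U, f) \<in> rat_reps CC K n S \<longleftrightarrow> regS U f"
  by (simp add: rat_reps_def regS_def)

lemma regS_sub: "regS U f \<Longrightarrow> U \<subseteq> S"
  by (simp add: regS_def open_iff)

lemma regS_maps: "regS U f \<Longrightarrow> x \<in> U \<Longrightarrow> f x \<in> S"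
  by (auto simp: regS_def regular_over_def)

text \<open>The index \<open>a\<close> singles out a coordinate form that is nonzero at
  \<open>x\<close>. Multiplying other forms by \<open>G a\<close> confines them to points where the
  local formula is meaningful.\<close>

definition loc :: "complex list set set \<Rightarrow> (complex list set \<Rightarrow> complex list set) \<Rightarrow> complex list set \<Rightarrow>
    nat \<Rightarrow> (nat \<Rightarrow> complex list \<Rightarrow> complex) \<Rightarrow> nat \<Rightarrow> bool" where
  "loc U f x d G a \<longleftrightarrow> (\<forall>j\<le>n. G j \<in> ffun K n d) \<and> a \<le> n \<and> x \<in> nz S (G a) \<and>
    (\<forall>y\<in>U. \<forall>v\<in>y. \<forall>j\<le>n. G j v \<noteq> 0 \<longrightarrow> f y = pt (map (\<lambda>j. G j v) [0..<Suc n]))"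

lemma locD:
  assumes "loc U f x d G a"
  shows "\<And>j. j \<le> n \<Longrightarrow> G j \<in> ffun K n d" "a \<le> n" "x \<in> nz S (G a)"
    "\<And>y v j. y \<in> U \<Longrightarrow> v \<in> y \<Longrightarrow> j \<le> n \<Longrightarrow> G j v \<noteq> 0 \<Longrightarrow> f y = pt (map (\<lambda>j. G j v) [0..<Suc n])"
  using assms unfolding loc_def by blast+

lemma regS_local:
  assumes "regS U f" "x \<in> U"
  shows "\<exists>d G a. loc U f x d G a"
proof -
  have U: "U \<subseteq> proj_space CC n" using regS_sub[OF assms(1)] S_proj by blast
  have xS: "x \<in> S" using regS_sub assms by blast
  have "regular_over CC K n U n S f" using assms by (simp add: regS_def)
  from bspec[OF conjunct2[OF this[unfolded regular_over_ffun[OF U]]] assms(2)]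
  obtain d G where G: "(\<forall>j\<le>n. G j \<in> ffun K n d) \<and> (\<exists>j\<le>n. \<exists>v\<in>x. G j v \<noteq> 0) \<and>
        (\<forall>y\<in>U. \<forall>v\<in>y. (\<exists>j\<le>n. G j v \<noteq> 0) \<longrightarrow> f y = pt (map (\<lambda>j. G j v) [0..<Suc n]))"
    by (elim exE) (rule that)
  note G = G[THEN conjunct1] G[THEN conjunct2, THEN conjunct1] G[THEN conjunct2, THEN conjunct2]
  obtain a v where a: "a \<le> n" "v \<in> x" "G a v \<noteq> 0" using G(2) by blast
  have "x \<in> nz S (G a)" using nzS[of "G a" d x v] G(1) a xS by blast
  then have "loc U f x d G a" using G a unfolding loc_def by blast
  then show ?thesis by blast
qed

lemma regS_I:
  assumes "open_over CC K n S U" "U \<noteq> {}" "\<And>x. x \<in> U \<Longrightarrow> f x \<in> S"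
    and "\<And>x. x \<in> U \<Longrightarrow> \<exists>d G. (\<forall>j\<le>n. G j \<in> ffun K n d) \<and> (\<exists>j\<le>n. x \<in> nz S (G j)) \<and>
      (\<forall>y\<in>U. \<forall>v\<in>y. (\<exists>j\<le>n. G j v \<noteq> 0) \<longrightarrow> f y = pt (map (\<lambda>j. G j v) [0..<Suc n]))"
  shows "regS U f"
proof -
  have US: "U \<subseteq> S" using assms(1) by (simp add: open_iff)
  then have U: "U \<subseteq> proj_space CC n" using S_proj by blast
  have "\<exists>d G. (\<forall>j\<le>n. G j \<in> ffun K n d) \<and> (\<exists>j\<le>n. \<exists>v\<in>x. G j v \<noteq> 0) \<and>
        (\<forall>y\<in>U. \<forall>v\<in>y. (\<exists>j\<le>n. G j v \<noteq> 0) \<longrightarrow> f y = pt (map (\<lambda>j. G j v) [0..<Suc n]))" if x: "x \<in> U" for x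
  proof -
    from assms(4)[OF x] obtain d G where G: "(\<forall>j\<le>n. G j \<in> ffun K n d) \<and> (\<exists>j\<le>n. x \<in> nz S (G j)) \<and>
      (\<forall>y\<in>U. \<forall>v\<in>y. (\<exists>j\<le>n. G j v \<noteq> 0) \<longrightarrow> f y = pt (map (\<lambda>j. G j v) [0..<Suc n]))"
      by (elim exE) (rule that)
    obtain v where v: "v \<in> x" using S_ex US x by blast
    have "\<exists>j\<le>n. \<exists>v\<in>x. G j v \<noteq> 0" using G[THEN conjunct2, THEN conjunct1] v by (auto simp: nz_def)
    then show ?thesis using G by blast
  qed
  then have "regular_over CC K n U n S f"
    unfolding regular_over_ffun[OF U] using assms(3) by blast
  then show ?thesis using assms(1,2) by (simp add: regS_def)
qed

lemma regS_restrict: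
  assumes "regS U f" "open_over CC K n S W" "W \<noteq> {}" "W \<subseteq> U"
  shows "regS W f"
proof (rule regS_I[OF assms(2,3)])
  fix x assume x: "x \<in> W"
  then show "f x \<in> S" using regS_maps assms by blast
  obtain d G a where "loc U f x d G a" using regS_local assms x by blast
  note G = locD[OF this]
  have "\<forall>y\<in>W. \<forall>v\<in>y. (\<exists>j\<le>n. G j v \<noteq> 0) \<longrightarrow> f y = pt (map (\<lambda>j. G j v) [0..<Suc n])"
    using G(4) assms(4) by blast
  then show "\<exists>d G. (\<forall>j\<le>n. G j \<in> ffun K n d) \<and> (\<exists>j\<le>n. x \<in> nz S (G j)) \<and>
      (\<forall>y\<in>W. \<forall>v\<in>y. (\<exists>j\<le>n. G j v \<noteq> 0) \<longrightarrow> f y = pt (map (\<lambda>j. G j v) [0..<Suc n]))"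
    using G(1-3) by (intro exI[of _ d] exI[of _ G]) blast
qed

lemma map_vecs: "a \<le> n \<Longrightarrow> G a \<noteq> 0 \<Longrightarrow> map G [0..<Suc n] \<in> vecs n"
  unfolding vecs_def by (rule CollectI, intro conjI exI[of _ a]) (simp_all del: upt_Suc add: nth_map_upt)

text \<open>The identity theorem for rational maps. If a minor of the two local formulas were
  nonzero at \<open>x\<close>, it would be nonzero on a nonempty open set, which meets
  \<open>W\<close> by irreducibility; but on \<open>W\<close> all minors vanish.\<close>

lemma regS_agree:
  assumes f: "regS U f" and g: "regS V g" and W: "open_over CC K n S W" "W \<noteq> {}" "W \<subseteq> U \<inter> V"
    and eq: "\<And>x. x \<in> W \<Longrightarrow> f x = g x" and x: "x \<in> U" "x \<in> V"
  shows "f x = g x"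
proof -
  obtain d F a where locF: "loc U f x d F a" using regS_local[OF f x(1)] x by blast
    note F = locD[OF locF]
  obtain e G b where locG: "loc V g x e G b" using regS_local[OF g x(2)] x by blast
    note G = locD[OF locG]
  have xS: "x \<in> S" using regS_sub f x by blast
  obtain v where v: "v \<in> x" using S_ex xS by blast
  have nza: "F a v \<noteq> 0" "G b v \<noteq> 0" using F(3) G(3) v by (auto simp: nz_def)
  have "F i v * G j v = F j v * G i v" if ij: "i \<le> n" "j \<le> n" for i j
  proof (rule ccontr)
    assume neq: "F i v * G j v \<noteq> F j v * G i v"
    let ?h = "\<lambda>v. F i v * G j v - F j v * G i v"
    have h: "?h \<in> ffun K n (d + e)" by (intro ffun_diff ffun_mult F(1) G(1) ij)
    have xh: "x \<in> nz S ?h" using nzS[OF h xS v] neq by simp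
    \<comment> \<open>This second form guarantees that both local formulas are valid at the point
      \<open>y\<close> found below.\<close>
    have ab: "(\<lambda>v. F a v * G b v) \<in> ffun K n (d + e)" by (intro ffun_mult F G)
    have "x \<in> nz S (\<lambda>v. F a v * G b v)" using nzS[OF ab xS v] nza by simp
    then have "nz S ?h \<inter> nz S (\<lambda>v. F a v * G b v) \<noteq> {}" using irred[OF h ab] xh by blast
    then have "nz S (\<lambda>v. ?h v * (F a v * G b v)) \<noteq> {}" using nz_mult[OF h ab] by simp
    moreover have "open_over CC K n S (nz S (\<lambda>v. ?h v * (F a v * G b v)))"
      by (rule open_nz[OF ffun_mult[OF h ab]])
    ultimately obtain y where y: "y \<in> W" "y \<in> nz S (\<lambda>v. ?h v * (F a v * G b v))"
      using dense[OF W(1) _ W(2)] by blast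
    obtain w where w: "w \<in> y" using S_ex y by (auto simp: nz_def)
    have wnz: "?h w \<noteq> 0" "F a w \<noteq> 0" "G b w \<noteq> 0" using y w by (auto simp: nz_def)
    have "pt (map (\<lambda>j. F j w) [0..<Suc n]) = pt (map (\<lambda>j. G j w) [0..<Suc n])"
      using F(4)[of y w a] G(4)[of y w b] w wnz y(1) W(3) F(2) G(2) eq[OF y(1)] by auto
    from pt_minors[OF this, of i j] have "?h w = 0"
      using ij by (simp add: nth_map_upt less_Suc_eq_le del: upt_Suc)
    then show False using wnz by simp
  qed
  then have "pt (map (\<lambda>j. F j v) [0..<Suc n]) = pt (map (\<lambda>j. G j v) [0..<Suc n])"
    by (intro pt_eq_minors[of _ n] map_vecs[of a "\<lambda>j. F j v"] map_vecs[of b "\<lambda>j. G j v"])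
       (use nza F(2) G(2) in \<open>simp_all add: nth_map_upt del: upt_Suc\<close>)
  then show ?thesis using F(4)[OF x(1) v F(2) nza(1)] G(4)[OF x(2) v G(2) nza(2)] by simp
qed

lemma regS_comp:
  assumes f: "regS U f" and g: "regS V g"
  shows "open_over CC K n S {x \<in> U. f x \<in> V}"
    and "{x \<in> U. f x \<in> V} \<noteq> {} \<Longrightarrow> regS {x \<in> U. f x \<in> V} (g \<circ> f)"
proof -
  let ?W = "{x \<in> U. f x \<in> V}"
  show op: "open_over CC K n S ?W"
    unfolding open_iff
  proof (intro conjI ballI)
    show "?W \<subseteq> S" using regS_sub f by blast
    fix x assume x: "x \<in> ?W"
    obtain d F a where locF: "loc U f x d F a" using regS_local[OF f] x by blast
    note F = locD[OF locF]
    have oU: "open_over CC K n S U" and oV: "open_over CC K n S V" using f g by (simp_all add: regS_def)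
    obtain e1 h1 where h1: "h1 \<in> ffun K n e1" "x \<in> nz S h1" "nz S h1 \<subseteq> U"
      using oU x unfolding open_iff by blast
    obtain e2 h2 where h2: "h2 \<in> ffun K n e2" "f x \<in> nz S h2" "nz S h2 \<subseteq> V"
      using oV x unfolding open_iff by blast
    let ?c = "\<lambda>v. h2 (map (\<lambda>j. F j v) [0..<Suc n])"
    have c: "?c \<in> ffun K n (d * e2)" by (intro ffun_comp h2(1) F(1))
    \<comment> \<open>The three factors keep the point in \<open>U\<close>, make the local formula
      for \<open>f\<close> valid, and put the image into \<open>V\<close>.\<close>
    let ?h = "\<lambda>v. h1 v * (F a v * ?c v)"
    have h: "?h \<in> ffun K n (e1 + (d + d * e2))" by (intro ffun_mult h1 F c)
    have key: "h2 (map (\<lambda>j. F j w) [0..<Suc n]) \<noteq> 0 \<longleftrightarrow> f y \<in> nz S h2"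
      if "y \<in> U" "w \<in> y" "F a w \<noteq> 0" for y w
    proof -
      have e: "f y = pt (map (\<lambda>j. F j w) [0..<Suc n])" using F(4)[OF that(1,2) F(2) that(3)] .
      have "map (\<lambda>j. F j w) [0..<Suc n] \<in> f y" unfolding e by (rule pt_self)
      then show ?thesis using nzS[OF h2(1) regS_maps[OF f that(1)]] by blast
    qed
    have "x \<in> nz S ?h"
    proof -
      obtain v where v: "v \<in> x" using S_ex regS_sub f x by blast
      have "h1 v \<noteq> 0" "F a v \<noteq> 0" using h1 F v by (auto simp: nz_def)
      then show ?thesis using nzS[OF h _ v] key[of x v] h2(2) v x regS_sub[OF f] by auto
    qed
    moreover have "nz S ?h \<subseteq> ?W"
    proof
      fix y assume y: "y \<in> nz S ?h"
      then have yU: "y \<in> U" using h1(3) by (auto simp: nz_def)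
      then obtain w where w: "w \<in> y" using S_ex regS_sub f by blast
      then have "F a w \<noteq> 0" "?c w \<noteq> 0" using y by (auto simp: nz_def simp del: upt_Suc)
      then show "y \<in> ?W" using key[OF yU w] h2(3) yU by blast
    qed
    ultimately show "\<exists>d. \<exists>h\<in>ffun K n d. x \<in> nz S h \<and> nz S h \<subseteq> ?W" using h by blast
  qed
  assume ne: "?W \<noteq> {}"
  show "regS ?W (g \<circ> f)"
  proof (rule regS_I[OF op ne])
    fix x assume x: "x \<in> ?W"
    show "(g \<circ> f) x \<in> S" using x regS_maps[OF g] by simp
    obtain d F a where locF: "loc U f x d F a" using regS_local[OF f] x by blast
    note F = locD[OF locF]
    obtain e G b where locG: "loc V g (f x) e G b" using regS_local[OF g] x by blast
    note G = locD[OF locG]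
    \<comment> \<open>The factor \<open>F a v\<close> forces the new forms to vanish wherever the
      formula for \<open>f\<close> gives no information. On the class of the point it is only a
      nonzero scalar.\<close>
    let ?G = "\<lambda>j v. F a v * G j (map (\<lambda>j. F j v) [0..<Suc n])"
    have xS: "x \<in> S" using regS_sub f x by blast
    have GG: "?G j \<in> ffun K n (d + d * e)" if "j \<le> n" for j
      using that by (intro ffun_mult ffun_comp F G)
    have val: "F a v \<noteq> 0 \<Longrightarrow> y \<in> U \<Longrightarrow> v \<in> y \<Longrightarrow> map (\<lambda>j. F j v) [0..<Suc n] \<in> f y" for y v
      using F(4)[OF _ _ F(2)] pt_self by metis
    have "x \<in> nz S (?G b)"
    proof -
      obtain v where v: "v \<in> x" using S_ex xS by blast
      have "F a v \<noteq> 0" using F v by (auto simp: nz_def)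
      moreover have "G b (map (\<lambda>j. F j v) [0..<Suc n]) \<noteq> 0"
        using val[OF calculation _ v] G(3) x by (auto simp: nz_def)
      ultimately show ?thesis using nzS[OF GG[OF G(2)] xS v] by simp
    qed
    moreover have "(g \<circ> f) y = pt (map (\<lambda>j. ?G j v) [0..<Suc n])"
      if y: "y \<in> ?W" "v \<in> y" "j \<le> n" "?G j v \<noteq> 0" for y v j
    proof -
      have nza: "F a v \<noteq> 0" "G j (map (\<lambda>j. F j v) [0..<Suc n]) \<noteq> 0" using y by auto
      have "g (f y) = pt (map (\<lambda>j. G j (map (\<lambda>j. F j v) [0..<Suc n])) [0..<Suc n])"
        using G(4)[OF _ val[OF nza(1) _ y(2)] y(3) nza(2)] y(1) by simp
      also have "\<dots> = pt (map ((*) (F a v)) (map (\<lambda>j. G j (map (\<lambda>j. F j v) [0..<Suc n])) [0..<Suc n]))"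
        by (rule pt_eqI[OF nza(1), symmetric])
      finally show ?thesis by (simp add: o_def del: upt_Suc)
    qed
    ultimately show "\<exists>d G. (\<forall>j\<le>n. G j \<in> ffun K n d) \<and> (\<exists>j\<le>n. x \<in> nz S (G j)) \<and>
      (\<forall>y\<in>?W. \<forall>v\<in>y. (\<exists>j\<le>n. G j v \<noteq> 0) \<longrightarrow> (g \<circ> f) y = pt (map (\<lambda>j. G j v) [0..<Suc n]))"
      using GG G(2) by (intro exI[of _ "d + d * e"] exI[of _ ?G]) blast
  qed
qed

lemma regS_id: "regS S id"
proof (rule regS_I[OF open_S S_ne])
  fix x assume x: "x \<in> S"
  then show "id x \<in> S" by simp
  obtain v where "v \<in> x" using S_ex[OF x] by blast
  moreover from S_mem[OF x this] obtain i where "i \<le> n" "v ! i \<noteq> 0" by (auto simp: vecs_def)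
  ultimately have v: "v \<in> x" "i \<le> n" "v ! i \<noteq> 0" by auto
  have "x \<in> nz S (\<lambda>v. v ! i)" using nzS[OF ffun_coord[OF v(2)] x v(1)] v(3) by simp
  moreover have "id y = pt (map (\<lambda>j. w ! j) [0..<Suc n])" if "y \<in> S" "w \<in> y" for y w
  proof -
    have "length w = Suc n" "y = pt w" using S_mem[OF that] by (auto simp: vecs_def)
    then show ?thesis by (metis id_apply map_nth)
  qed
  ultimately show "\<exists>d G. (\<forall>j\<le>n. G j \<in> ffun K n d) \<and> (\<exists>j\<le>n. x \<in> nz S (G j)) \<and>
      (\<forall>y\<in>S. \<forall>v\<in>y. (\<exists>j\<le>n. G j v \<noteq> 0) \<longrightarrow> id y = pt (map (\<lambda>j. G j v) [0..<Suc n]))"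
    using v(2) ffun_coord by (intro exI[of _ 1] exI[of _ "\<lambda>j v. v ! j"]) blast
qed

definition eqr :: "complex list set set \<times> (complex list set \<Rightarrow> complex list set) \<Rightarrow>
    complex list set set \<times> (complex list set \<Rightarrow> complex list set) \<Rightarrow> bool" where
  "eqr r s \<longleftrightarrow> regS (fst r) (snd r) \<and> regS (fst s) (snd s) \<and> (\<forall>x\<in>fst r \<inter> fst s. snd r x = snd s x)"

lemma rat_rel_eqr: "(r, s) \<in> rat_rel CC K n S \<longleftrightarrow> eqr r s"
  by (cases r; cases s) (simp add: rat_rel_def eqr_def rat_reps_iff)

lemma eqr_refl: "regS (fst r) (snd r) \<Longrightarrow> eqr r r"
  by (simp add: eqr_def)

lemma eqr_sym: "eqr r s \<Longrightarrow> eqr s r"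
  by (auto simp: eqr_def)

text \<open>The outer maps are known to agree only on the triple intersection of the domains. This
  is dense, so \<open>regS_agree\<close> extends the equality to their common domain.\<close>

lemma eqr_trans:
  assumes "eqr r s" "eqr s t"
  shows "eqr r t"
  unfolding eqr_def
proof (intro conjI ballI)
  show "regS (fst r) (snd r)" "regS (fst t) (snd t)" using assms by (auto simp: eqr_def)
  fix x assume x: "x \<in> fst r \<inter> fst t"
  have op: "open_over CC K n S (fst u)" "fst u \<noteq> {}" if "u \<in> {r, s, t}" for u
    using assms that by (auto simp: eqr_def regS_def)
  show "snd r x = snd t x"
  proof (rule regS_agree[of "fst r" "snd r" "fst t" "snd t" "fst r \<inter> fst s \<inter> fst t" x])
    show "regS (fst r) (snd r)" "regS (fst t) (snd t)" by fact+
    show "open_over CC K n S (fst r \<inter> fst s \<inter> fst t)" by (intro open_Int op) auto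
    show "fst r \<inter> fst s \<inter> fst t \<noteq> {}" by (intro dense open_Int op) auto
  qed (use assms x in \<open>auto simp: eqr_def\<close>)
qed

abbreviation "cl r \<equiv> rat_class CC K n S r"

lemma cl_mem: "s \<in> cl r \<longleftrightarrow> eqr r s"
  by (simp add: rat_class_def rat_rel_eqr)

lemma cl_eq: "regS (fst r) (snd r) \<Longrightarrow> cl r = cl s \<longleftrightarrow> eqr r s"
  (is "?R \<Longrightarrow> _")
proof -
  assume ?R
  then have "eqr r r" by (rule eqr_refl)
  show ?thesis
  proof
    assume "cl r = cl s"
    then have "r \<in> cl s" using \<open>eqr r r\<close> cl_mem by blast
    then show "eqr r s" using cl_mem eqr_sym by blast
  next
    assume "eqr r s"
    then show "cl r = cl s" unfolding set_eq_iff cl_mem using eqr_sym eqr_trans by blast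
  qed
qed

definition cmp :: "complex list set set \<times> (complex list set \<Rightarrow> complex list set) \<Rightarrow>
    complex list set set \<times> (complex list set \<Rightarrow> complex list set) \<Rightarrow>
    complex list set set \<times> (complex list set \<Rightarrow> complex list set)" where
  "cmp s r = ({x \<in> fst r. snd r x \<in> fst s}, snd s \<circ> snd r)"

lemma cmp_assoc: "cmp t (cmp s r) = cmp (cmp t s) r"
  by (auto simp: cmp_def)

definition bir :: "complex list set set \<times> (complex list set \<Rightarrow> complex list set) \<Rightarrow> bool" where
  "bir r \<longleftrightarrow> r \<in> bir_reps CC K n S"

definition invs :: "complex list set set \<times> (complex list set \<Rightarrow> complex list set) \<Rightarrow>
    complex list set set \<times> (complex list set \<Rightarrow> complex list set) \<Rightarrow> bool" where
  "invs r s \<longleftrightarrow> regS (fst r) (snd r) \<and> regS (fst s) (snd s) \<and> inverse_rat_reps r s"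

lemma bir_iff: "bir r \<longleftrightarrow> (\<exists>s. invs r s)"
  by (cases r) (force simp: bir_def bir_reps_def invs_def rat_reps_iff)

lemma invs_sym: "invs r s \<Longrightarrow> invs s r"
  by (auto simp: invs_def inverse_rat_reps_def)

lemma bir_reg: "bir r \<Longrightarrow> regS (fst r) (snd r)"
  by (auto simp: bir_iff invs_def)

text \<open>Birational maps are dominant: the open set on which the inverse can be followed by
  \<open>r\<close> meets \<open>W\<close>, and such a point is the image of its inverse
  image.\<close>

lemma bir_preimage:
  assumes "bir r" "open_over CC K n S W" "W \<noteq> {}"
  shows "{x \<in> fst r. snd r x \<in> W} \<noteq> {}"
proof -
  obtain s where s: "invs r s" using assms by (auto simp: bir_iff)
  then have reg: "regS (fst r) (snd r)" "regS (fst s) (snd s)" by (auto simp: invs_def)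
  let ?V = "{y \<in> fst s. snd s y \<in> fst r}"
  have "open_over CC K n S ?V" by (rule regS_comp(1)[OF reg(2,1)])
  moreover have "?V \<noteq> {}" using s by (auto simp: invs_def inverse_rat_reps_def case_prod_unfold)
  ultimately obtain y where y: "y \<in> ?V" "y \<in> W" using dense[OF _ assms(2) _ assms(3)] by blast
  then have "snd r (snd s y) = y" using s by (auto simp: invs_def inverse_rat_reps_def case_prod_unfold)
  then show ?thesis using y by auto
qed

lemma cmp_reg:
  assumes "bir r" "regS (fst s) (snd s)"
  shows "regS (fst (cmp s r)) (snd (cmp s r))"
proof -
  have "{x \<in> fst r. snd r x \<in> fst s} \<noteq> {}"
    using bir_preimage[OF assms(1)] assms(2) by (simp add: regS_def)
  then show ?thesis using regS_comp(2)[OF bir_reg[OF assms(1)] assms(2)] by (simp add: cmp_def)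
qed

lemma invs_cmp:
  assumes "invs r r'" "invs s s'"
  shows "invs (cmp s r) (cmp r' s')"
proof -
  have b: "bir r" "bir r'" "bir s" "bir s'" using assms invs_sym bir_iff by blast+
  have R: "regS (fst (cmp s r)) (snd (cmp s r))" "regS (fst (cmp r' s')) (snd (cmp r' s'))"
    using b by (auto intro: cmp_reg bir_reg)
  have d: "\<And>x. x \<in> fst r \<Longrightarrow> snd r x \<in> fst r' \<Longrightarrow> snd r' (snd r x) = x"
    "\<And>x. x \<in> fst r' \<Longrightarrow> snd r' x \<in> fst r \<Longrightarrow> snd r (snd r' x) = x"
    "\<And>x. x \<in> fst s \<Longrightarrow> snd s x \<in> fst s' \<Longrightarrow> snd s' (snd s x) = x"
    "\<And>x. x \<in> fst s' \<Longrightarrow> snd s' x \<in> fst s \<Longrightarrow> snd s (snd s' x) = x"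
    using assms by (auto simp: invs_def inverse_rat_reps_def case_prod_unfold)
  have sub: "fst r \<subseteq> S" "fst r' \<subseteq> S" "fst s \<subseteq> S" "fst s' \<subseteq> S"
    using b bir_reg regS_sub by blast+
  \<comment> \<open>The domain of the reversed composite is pulled back first along \<open>v\<close>
    and then along \<open>u\<close>; it stays nonempty by dominance.\<close>
  have bc: "\<exists>x. x \<in> fst (cmp v u) \<and> snd (cmp v u) x \<in> fst (cmp u' v')"
    if uv: "invs u u'" "invs v v'" for u u' v v'
  proof -
    have b: "bir u" "bir u'" "bir v" "bir v'" using uv invs_sym bir_iff by blast+
    have R: "regS (fst (cmp u' v')) (snd (cmp u' v'))"
      using b by (auto intro: cmp_reg bir_reg)
    have o1: "open_over CC K n S (fst (cmp u' v'))" "fst (cmp u' v') \<noteq> {}" using R by (auto simp: regS_def)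
    have o2: "{y \<in> fst v. snd v y \<in> fst (cmp u' v')} \<noteq> {}" by (rule bir_preimage[OF b(3) o1])
    have o3: "open_over CC K n S {y \<in> fst v. snd v y \<in> fst (cmp u' v')}"
      by (rule regS_comp(1)[OF bir_reg[OF b(3)] R])
    have "{x \<in> fst u. snd u x \<in> {y \<in> fst v. snd v y \<in> fst (cmp u' v')}} \<noteq> {}"
      by (rule bir_preimage[OF b(1) o3 o2])
    then show ?thesis by (auto simp: cmp_def)
  qed
  have "inverse_rat_reps (cmp s r) (cmp r' s')"
    using bc[OF assms] bc[OF invs_sym[OF assms(2)] invs_sym[OF assms(1)]] d
    by (auto simp: inverse_rat_reps_def cmp_def)
  then show ?thesis using R by (simp add: invs_def)
qed

lemma bir_cmp: "bir r \<Longrightarrow> bir s \<Longrightarrow> bir (cmp s r)"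
  using invs_cmp by (meson bir_iff)

text \<open>The inverse of \<open>r\<close> also serves for \<open>r'\<close>. The two identities
  hold where \<open>r\<close> and \<open>r'\<close> overlap and spread to the full domains of the
  composites by \<open>regS_agree\<close>.\<close>

lemma bir_eqr:
  assumes "bir r" "eqr r r'"
  shows "bir r'"
proof -
  obtain s where s: "invs r s" using assms by (auto simp: bir_iff)
  have reg: "regS (fst r) (snd r)" "regS (fst r') (snd r')" "regS (fst s) (snd s)"
    using s assms by (auto simp: invs_def eqr_def)
  have bs: "bir s" using s invs_sym bir_iff by blast
  have op: "open_over CC K n S (fst r)" "fst r \<noteq> {}" "open_over CC K n S (fst r')" "fst r' \<noteq> {}"
     "open_over CC K n S (fst s)" "fst s \<noteq> {}"
    using reg by (auto simp: regS_def)
  have rr: "open_over CC K n S (fst r \<inter> fst r')" "fst r \<inter> fst r' \<noteq> {}"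
    using open_Int dense op by blast+
  have A: "{x \<in> fst s. snd s x \<in> fst r \<inter> fst r'} \<noteq> {}" by (rule bir_preimage[OF bs rr])
  have regI: "regS (fst r \<inter> fst r') (snd r)"
    by (rule regS_restrict[OF reg(1) rr]) auto
  have W1: "open_over CC K n S {x \<in> fst s. snd s x \<in> fst r \<inter> fst r'}"
    by (rule regS_comp(1)[OF reg(3) regI])
  have eq: "snd r x = snd r' x" if "x \<in> fst r" "x \<in> fst r'" for x using assms that by (auto simp: eqr_def)
  have ir: "\<And>x. x \<in> fst r \<Longrightarrow> snd r x \<in> fst s \<Longrightarrow> snd s (snd r x) = x"
    "\<And>x. x \<in> fst s \<Longrightarrow> snd s x \<in> fst r \<Longrightarrow> snd r (snd s x) = x"
    using s by (auto simp: invs_def inverse_rat_reps_def case_prod_unfold)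
  let ?B = "{x \<in> fst r \<inter> fst r'. snd r x \<in> fst s}"
  have oB: "open_over CC K n S ?B" by (rule regS_comp(1)[OF regI reg(3)])
  have neB: "?B \<noteq> {}"
  proof -
    have "{x \<in> fst r. snd r x \<in> fst s} \<noteq> {}" "open_over CC K n S {x \<in> fst r. snd r x \<in> fst s}"
      using bir_preimage[OF assms(1) op(5,6)] regS_comp(1)[OF reg(1,3)] by auto
    then have "{x \<in> fst r. snd r x \<in> fst s} \<inter> (fst r \<inter> fst r') \<noteq> {}"
      by (intro dense rr)
    then show ?thesis by auto
  qed
  have c1: "regS {x \<in> fst r'. snd r' x \<in> fst s} (snd s \<circ> snd r')"
    using neB eq by (intro regS_comp(2) reg) auto
  have c2: "regS {x \<in> fst s. snd s x \<in> fst r'} (snd r' \<circ> snd s)"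
    using A by (intro regS_comp(2) reg) auto
  have "(snd s \<circ> snd r') x = id x" if "x \<in> {x \<in> fst r'. snd r' x \<in> fst s}" for x
  proof (rule regS_agree[OF c1 regS_id oB neB])
    show "?B \<subseteq> {x \<in> fst r'. snd r' x \<in> fst s} \<inter> S" using eq regS_sub[OF reg(1)] by auto
    show "(snd s \<circ> snd r') y = id y" if "y \<in> ?B" for y using that eq[of y] ir(1)[of y] by auto
    show "x \<in> S" using that regS_sub[OF reg(2)] by auto
  qed fact
  moreover have "(snd r' \<circ> snd s) x = id x" if "x \<in> {x \<in> fst s. snd s x \<in> fst r'}" for x
  proof (rule regS_agree[OF c2 regS_id W1 A])
    show "{x \<in> fst s. snd s x \<in> fst r \<inter> fst r'} \<subseteq> {x \<in> fst s. snd s x \<in> fst r'} \<inter> S"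
      using regS_sub[OF reg(3)] by auto
    show "(snd r' \<circ> snd s) y = id y" if "y \<in> {x \<in> fst s. snd s x \<in> fst r \<inter> fst r'}" for y
      using that eq[of "snd s y"] ir(2)[of y] by auto
    show "x \<in> S" using that regS_sub[OF reg(3)] by auto
  qed fact
  ultimately have "invs r' s"
    unfolding invs_def inverse_rat_reps_def case_prod_unfold
  proof (intro conjI reg)
    show "\<exists>x\<in>fst r'. snd r' x \<in> fst s" using neB eq by auto
    show "\<exists>y\<in>fst s. snd s y \<in> fst r'" using A by auto
  qed auto
  then show ?thesis using bir_iff by blast
qed

lemma eqr_cmp:
  assumes "bir r" "bir s" "eqr r r'" "eqr s s'"
  shows "eqr (cmp s r) (cmp s' r')"
proof -
  have b: "bir r'" "bir s'" using assms bir_eqr by blast+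
  have reg: "regS (fst (cmp s r)) (snd (cmp s r))" "regS (fst (cmp s' r')) (snd (cmp s' r'))"
    using assms b by (auto intro: cmp_reg bir_reg)
  show ?thesis
    unfolding eqr_def
  proof (intro conjI reg ballI)
    fix x assume "x \<in> fst (cmp s r) \<inter> fst (cmp s' r')"
    then show "snd (cmp s r) x = snd (cmp s' r') x"
      using assms by (auto simp: cmp_def eqr_def)
  qed
qed

lemma Bir_carrier: "carrier (Bir CC K n S) = cl ` {r. bir r}"
  by (simp add: Bir_def bir_def)

lemma Bir_one: "\<one>\<^bsub>Bir CC K n S\<^esub> = cl (S, id)"
  by (simp add: Bir_def)

lemma Bir_mult:
  assumes "bir r" "bir s"
  shows "cl s \<otimes>\<^bsub>Bir CC K n S\<^esub> cl r = cl (cmp s r)"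
proof -
  have "cl s \<otimes>\<^bsub>Bir CC K n S\<^esub> cl r = (\<Union>s'\<in>cl s. \<Union>r'\<in>cl r. cl (cmp s' r'))"
    by (simp add: Bir_def cmp_def case_prod_unfold)
  also have "\<dots> = cl (cmp s r)"
  proof -
    have "cl (cmp s' r') = cl (cmp s r)" if "s' \<in> cl s" "r' \<in> cl r" for s' r'
      using that eqr_cmp[OF assms] cl_eq[OF cmp_reg[OF assms(1) bir_reg[OF assms(2)]]]
      by (metis cl_mem)
    moreover have "s \<in> cl s" "r \<in> cl r" using assms bir_reg eqr_refl cl_mem by auto
    ultimately show ?thesis by blast
  qed
  finally show ?thesis .
qed

lemma bir_id: "bir (S, id)"
proof -
  have "\<exists>x. x \<in> S" using S_ne by blast
  then have "invs (S, id) (S, id)" using regS_id by (simp add: invs_def inverse_rat_reps_def)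
  then show ?thesis using bir_iff by blast
qed

lemma invs_cl:
  assumes i: "invs r s"
  shows "cl (cmp s r) = cl (S, id)"
proof -
  have b: "bir r" "bir s" using i invs_sym bir_iff by blast+
  have reg: "regS (fst (cmp s r)) (snd (cmp s r))" using b by (auto intro: cmp_reg bir_reg)
  have "snd s (snd r x) = x" if "x \<in> fst r" "snd r x \<in> fst s" for x
    using i that by (auto simp: invs_def inverse_rat_reps_def case_prod_unfold)
  then have "eqr (cmp s r) (S, id)"
    unfolding eqr_def using reg regS_id by (simp add: cmp_def)
  then show ?thesis using cl_eq[OF reg] by blast
qed

lemma group_Bir: "group (Bir CC K n S)"
proof (rule groupI)
  let ?G = "Bir CC K n S"
  show "\<one>\<^bsub>?G\<^esub> \<in> carrier ?G" using bir_id by (auto simp: Bir_carrier Bir_one)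
  show "x \<otimes>\<^bsub>?G\<^esub> y \<in> carrier ?G" if xy: "x \<in> carrier ?G" "y \<in> carrier ?G" for x y
    using xy Bir_mult bir_cmp by (auto simp: Bir_carrier)
  show "x \<otimes>\<^bsub>?G\<^esub> y \<otimes>\<^bsub>?G\<^esub> z = x \<otimes>\<^bsub>?G\<^esub> (y \<otimes>\<^bsub>?G\<^esub> z)"
    if xy: "x \<in> carrier ?G" "y \<in> carrier ?G" "z \<in> carrier ?G" for x y z
    using xy by (auto simp: Bir_carrier Bir_mult bir_cmp cmp_assoc)
  show "\<one>\<^bsub>?G\<^esub> \<otimes>\<^bsub>?G\<^esub> x = x" if x: "x \<in> carrier ?G" for x
  proof -
    obtain r where r: "x = cl r" "bir r" using x by (auto simp: Bir_carrier)
    have "cmp (S, id) r = r" using regS_maps[OF bir_reg[OF r(2)]] by (cases r) (auto simp: cmp_def)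
    then show ?thesis using r Bir_mult[OF r(2) bir_id] by (simp add: Bir_one)
  qed
  show "\<exists>y\<in>carrier ?G. y \<otimes>\<^bsub>?G\<^esub> x = \<one>\<^bsub>?G\<^esub>" if x: "x \<in> carrier ?G" for x
  proof -
    obtain r where r: "x = cl r" "bir r" using x by (auto simp: Bir_carrier)
    then obtain s where s: "invs r s" by (auto simp: bir_iff)
    then have "bir s" using invs_sym bir_iff by blast
    then have "cl s \<in> carrier ?G" "cl s \<otimes>\<^bsub>?G\<^esub> x = \<one>\<^bsub>?G\<^esub>"
      using r s Bir_mult[OF r(2) \<open>bir s\<close>] invs_cl[OF s] by (simp_all add: Bir_carrier Bir_one)
    then show ?thesis by blast
  qed
qed

end

section \<open>The reduced norm and its anisotropy at the prime 2\<close>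

hide_const (open) Divisibility.prime UnivPoly.monom UnivPoly.coeff

lemma less_3: "i < 3 \<Longrightarrow> i = 0 \<or> i = 1 \<or> i = (2::nat)"
  by auto

text \<open>Reduced norm of the sum of the \<open>u i j * X ^ i * Y ^ j\<close> in the cyclic
  algebra with \<open>X ^ 3 = 2\<close> and \<open>Y ^ 3 = w\<close>; see \<open>Nr_det\<close>. The
  ring is left general because norms of polynomial entries occur as well.\<close>

definition Nr :: "'a \<Rightarrow> (nat \<Rightarrow> nat \<Rightarrow> 'a::comm_ring_1) \<Rightarrow> 'a" where
  "Nr w u = (u 0 0 ^ 3 + 2 * u 1 0 ^ 3 + 4 * u 2 0 ^ 3 - 6 * u 0 0 * u 1 0 * u 2 0)
     + w * (u 0 1 ^ 3 + 2 * u 1 1 ^ 3 + 4 * u 2 1 ^ 3 - 6 * u 0 1 * u 1 1 * u 2 1)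
     + w\<^sup>2 * (u 0 2 ^ 3 + 2 * u 1 2 ^ 3 + 4 * u 2 2 ^ 3 - 6 * u 0 2 * u 1 2 * u 2 2)
     - 3 * w * (u 0 0 * u 0 1 * u 0 2 + 2 * (u 1 0 * u 1 1 * u 1 2) + 4 * (u 2 0 * u 2 1 * u 2 2)
        + 2 * (w\<^sup>2 * (u 0 0 * u 1 1 * u 2 2 + u 1 0 * u 2 1 * u 0 2 + u 2 0 * u 0 1 * u 1 2)
             + w * (u 0 0 * u 2 1 * u 1 2 + u 1 0 * u 0 1 * u 2 2 + u 2 0 * u 1 1 * u 0 2)))"

lemma Nr_cong: "(\<And>i j. i < 3 \<Longrightarrow> j < 3 \<Longrightarrow> u i j = v i j) \<Longrightarrow> Nr w u = Nr w v"
  by (simp add: Nr_def)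

lemma Nr_smult: "Nr w (\<lambda>i j. c * u i j) = c ^ 3 * Nr w u"
  unfolding Nr_def by (simp add: algebra_simps power2_eq_square power3_eq_cube)

text \<open>The new entries are the coordinates of the product with the generator \<open>X\<close>,
  where \<open>X ^ 3 = 2\<close>, and \<open>X\<close> has reduced norm 2.\<close>

lemma Nr_shift:
  assumes "w\<^sup>2 + w + 1 = 0"
  shows "Nr w (\<lambda>i j. if i = 0 then 2 * u 2 j else u (i - 1) j) = 2 * Nr w u"
proof -
  have ww: "w * w = - 1 - w" using assms by (simp add: power2_eq_square eq_neg_iff_add_eq_0 algebra_simps)
  have ww': "w * (w * x) = - x - w * x" for x
    unfolding mult.assoc[symmetric] ww by (simp add: algebra_simps)
  show ?thesis
    unfolding Nr_def by (simp add: ww ww' algebra_simps power2_eq_square power3_eq_cube)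
qed

locale cube_root_1 =
  fixes w :: complex
  assumes w_eq: "w\<^sup>2 + w + 1 = 0"
begin

lemma w2: "w\<^sup>2 = - 1 - w"
  using w_eq by (simp add: algebra_simps eq_neg_iff_add_eq_0)

lemma ww: "w * w = - 1 - w"
  using w2 by (simp add: power2_eq_square)

lemma ww': "w * (w * x) = - x - w * x"
  unfolding mult.assoc[symmetric] ww by (simp add: algebra_simps)

text \<open>Multiplication by the conjugate yields the norm \<open>p * p - p * q + q * q\<close>,
  which is positive definite.\<close>

lemma w_irrational: "of_int p + of_int q * w = 0 \<Longrightarrow> p = 0 \<and> q = 0"
proof -
  assume a: "of_int p + of_int q * w = (0 :: complex)"
  have "(of_int (p * p - p * q + q * q) :: complex) = (of_int p + of_int q * w) * (of_int (p - q) - of_int q * w)"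
    by (simp add: ww ww' algebra_simps)
  then have "(of_int (p * p - p * q + q * q) :: complex) = 0" unfolding a by simp
  then have "p * p - p * q + q * q = 0" using of_int_eq_0_iff by blast
  then have "(2 * p - q)\<^sup>2 + 3 * q\<^sup>2 = 0" by (simp add: power2_eq_square algebra_simps)
  then have "q\<^sup>2 = 0" "(2 * p - q)\<^sup>2 = 0" using zero_le_power2[of q] zero_le_power2[of "2 * p - q"] by linarith+
  then show ?thesis by simp
qed

text \<open>The \<open>2\<close>-adic descent: modulo \<open>2\<close> the reduced norm becomes the norm form of the unramified cubic
  extension \<open>F\<^sub>6\<^sub>4 / F\<^sub>4\<close> obtained by adjoining a cube root of \<open>w\<close>.\<close>

lemma norm_mod2:
  fixes p0 q0 p1 q1 p2 q2 r s :: int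
  assumes "u0 = of_int p0 + of_int q0 * w" "u1 = of_int p1 + of_int q1 * w" "u2 = of_int p2 + of_int q2 * w"
    and "u0 ^ 3 + w * u1 ^ 3 + w\<^sup>2 * u2 ^ 3 - 3 * w * (u0 * u1 * u2) = 2 * (of_int r + of_int s * w)"
  shows "even p0 \<and> even q0 \<and> even p1 \<and> even q1 \<and> even p2 \<and> even q2"
proof -
  note wsimps = ww ww' algebra_simps power2_eq_square power3_eq_cube
  have cube: "(of_int p + of_int q * w) ^ 3 =
      of_int (p ^ 3 + q ^ 3 - 3 * p * q\<^sup>2) + of_int (3 * p\<^sup>2 * q - 3 * p * q\<^sup>2) * w" for p q
    by (simp add: wsimps)
  have wm: "w * (of_int p + of_int q * w) = of_int (- q) + of_int (p - q) * w" for p q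
    by (simp add: wsimps)
  have w2m: "w\<^sup>2 * (of_int p + of_int q * w) = of_int (q - p) + of_int (- p) * w" for p q
    by (simp add: wsimps)
  have mm: "(of_int p + of_int q * w) * (of_int p' + of_int q' * w) =
      of_int (p * p' - q * q') + of_int (p * q' + q * p' - q * q') * w" for p q p' q'
    by (simp add: wsimps)
  \<comment> \<open>\<open>A\<close> and \<open>B\<close> are the coefficients of 1 and
    \<open>w\<close> in the norm form.\<close>
  define A where "A = p0 ^ 3 + q0 ^ 3 - 3 * p0 * q0\<^sup>2 - (3 * p1\<^sup>2 * q1 - 3 * p1 * q1\<^sup>2)
      + ((3 * p2\<^sup>2 * q2 - 3 * p2 * q2\<^sup>2) - (p2 ^ 3 + q2 ^ 3 - 3 * p2 * q2\<^sup>2))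
      + 3 * ((p0 * p1 - q0 * q1) * q2 + (p0 * q1 + q0 * p1 - q0 * q1) * p2 - (p0 * q1 + q0 * p1 - q0 * q1) * q2)"
  define B where "B = (3 * p0\<^sup>2 * q0 - 3 * p0 * q0\<^sup>2) + (p1 ^ 3 + q1 ^ 3 - 3 * p1 * q1\<^sup>2) - (3 * p1\<^sup>2 * q1 - 3 * p1 * q1\<^sup>2)
      - (p2 ^ 3 + q2 ^ 3 - 3 * p2 * q2\<^sup>2)
      - 3 * (((p0 * p1 - q0 * q1) * p2 - (p0 * q1 + q0 * p1 - q0 * q1) * q2)
         - ((p0 * p1 - q0 * q1) * q2 + (p0 * q1 + q0 * p1 - q0 * q1) * p2 - (p0 * q1 + q0 * p1 - q0 * q1) * q2))"
  have "u0 ^ 3 + w * u1 ^ 3 + w\<^sup>2 * u2 ^ 3 - 3 * w * (u0 * u1 * u2) = of_int A + of_int B * w"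
    unfolding assms(1-3) cube wm w2m mm mult.assoc A_def B_def
    by (simp add: wsimps)
  then have "of_int (A - 2 * r) + of_int (B - 2 * s) * w = 0"
    using assms(4) by (simp add: algebra_simps)
  from w_irrational[OF this] have "A = 2 * r" "B = 2 * s" by simp_all
  then have "even A" "even B" by simp_all
  \<comment> \<open>Evenness of \<open>A\<close> and \<open>B\<close> depends only on the parities
    of the six integers, so 64 cases decide.\<close>
  then show ?thesis
    unfolding A_def B_def
    by (simp only: even_add even_diff even_mult_iff even_power even_minus even_numeral odd_numeral
        simp_thms zero_less_numeral)
       (cases "even p0"; cases "even q0"; cases "even p1"; cases "even q1"; cases "even p2"; cases "even q2";
        simp only: simp_thms)
qed

definition Ew :: "complex set" where
  "Ew = {of_int p + of_int q * w | p q. True}"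

lemma Ew_I: "of_int p + of_int q * w \<in> Ew"
  unfolding Ew_def by blast

lemma subring_Ew: "subring_C Ew"
proof
  show "0 \<in> Ew" using Ew_I[of 0 0] by simp
  show "1 \<in> Ew" using Ew_I[of 1 0] by simp
  fix x assume "x \<in> Ew"
  then obtain p q where x: "x = of_int p + of_int q * w" by (auto simp: Ew_def)
  show "- x \<in> Ew" using Ew_I[of "- p" "- q"] x by simp
  fix y assume "y \<in> Ew"
  then obtain p' q' where y: "y = of_int p' + of_int q' * w" by (auto simp: Ew_def)
  show "x + y \<in> Ew" using Ew_I[of "p + p'" "q + q'"] x y by (simp add: algebra_simps)
  have "x * y = of_int (p * p' - q * q') + of_int (p * q' + q * p' - q * q') * w"
    unfolding x y by (simp add: ww ww' algebra_simps)
  then show "x * y \<in> Ew" by (simp only: Ew_I)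
qed

lemma w_Ew: "w \<in> Ew"
  using Ew_I[of 0 1] by simp

text \<open>Infinite descent by division by \<open>X\<close>, where \<open>X ^ 3 = 2\<close>. By
  \<open>norm_mod2\<close> the row with index 0 is even, so division sends the rows
  \<open>u0, u1, u2\<close> to \<open>u1, u2, u0 / 2\<close>. The weights 4, 5, 6 of the old rows
  become 3, 4, 5, so the measure drops unless everything is zero.\<close>

lemma Nr_int_descent:
  fixes P Q :: "nat \<Rightarrow> nat \<Rightarrow> int"
  assumes "Nr w (\<lambda>i j. of_int (P i j) + of_int (Q i j) * w) = 0"
  shows "\<forall>i<3. \<forall>j<3. P i j = 0 \<and> Q i j = 0"
  using assms
proof (induction "\<Sum>j<3. 4 * nat (\<bar>P 0 j\<bar> + \<bar>Q 0 j\<bar>) + 5 * nat (\<bar>P 1 j\<bar> + \<bar>Q 1 j\<bar>) + 6 * nat (\<bar>P 2 j\<bar> + \<bar>Q 2 j\<bar>)"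
    arbitrary: P Q rule: less_induct)
  case less
  interpret E: subring_C Ew by (rule subring_Ew)
  let ?u = "\<lambda>i j. of_int (P i j) + of_int (Q i j) * w"
  have uE: "?u i j \<in> Ew" for i j by (rule Ew_I)
  define v where "v = ?u"
  have vE [simp]: "v i j \<in> Ew" for i j unfolding v_def by (rule uE)
  note [simp] = w_Ew
  \<comment> \<open>Outside the norm of row 0 every term of \<open>Nr\<close> has an even
    coefficient; \<open>R\<close> is minus one half of these terms.\<close>
  define R where "R = - (v 1 0 ^ 3 + 2 * v 2 0 ^ 3 - 3 * v 0 0 * v 1 0 * v 2 0)
     - w * (v 1 1 ^ 3 + 2 * v 2 1 ^ 3 - 3 * v 0 1 * v 1 1 * v 2 1)
     - w\<^sup>2 * (v 1 2 ^ 3 + 2 * v 2 2 ^ 3 - 3 * v 0 2 * v 1 2 * v 2 2)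
     + 3 * w * ((v 1 0 * v 1 1 * v 1 2) + 2 * (v 2 0 * v 2 1 * v 2 2)
        + (w\<^sup>2 * (v 0 0 * v 1 1 * v 2 2 + v 1 0 * v 2 1 * v 0 2 + v 2 0 * v 0 1 * v 1 2)
             + w * (v 0 0 * v 2 1 * v 1 2 + v 1 0 * v 0 1 * v 2 2 + v 2 0 * v 1 1 * v 0 2)))"
  have "R \<in> Ew" unfolding R_def by simp
  then obtain r s where rs: "R = of_int r + of_int s * w" by (auto simp: Ew_def)
  have "Nr w v = 0" using less.prems by (simp add: v_def)
  moreover have "v 0 0 ^ 3 + w * v 0 1 ^ 3 + w\<^sup>2 * v 0 2 ^ 3 - 3 * w * (v 0 0 * v 0 1 * v 0 2) - 2 * R = Nr w v"
    unfolding Nr_def R_def by (simp add: algebra_simps)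
  ultimately have "v 0 0 ^ 3 + w * v 0 1 ^ 3 + w\<^sup>2 * v 0 2 ^ 3 - 3 * w * (v 0 0 * v 0 1 * v 0 2) = 2 * R"
    by simp
  from norm_mod2[OF _ _ _ this[unfolded rs], of "P 0 0" "Q 0 0" "P 0 1" "Q 0 1" "P 0 2" "Q 0 2"]
  have ev: "even (P 0 j) \<and> even (Q 0 j)" if "j < 3" for j
    using that by (auto simp: v_def less_Suc_eq numeral_3_eq_3 numeral_2_eq_2)
  show ?case
  proof (cases "\<forall>i<3. \<forall>j<3. P i j = 0 \<and> Q i j = 0")
    case False
    define P' where "P' = (\<lambda>i j. if i = 2 then P 0 j div 2 else P (i + 1) j)"
    define Q' where "Q' = (\<lambda>i j. if i = 2 then Q 0 j div 2 else Q (i + 1) j)"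
    have nz: "\<exists>j<3. P 0 j \<noteq> 0 \<or> Q 0 j \<noteq> 0 \<or> P 1 j \<noteq> 0 \<or> Q 1 j \<noteq> 0 \<or> P 2 j \<noteq> 0 \<or> Q 2 j \<noteq> 0"
    proof -
      obtain i j where "i < 3" "j < 3" "P i j \<noteq> 0 \<or> Q i j \<noteq> 0" using False by blast
      then show ?thesis using less_3[of i] by blast
    qed
    have le: "4 * nat (\<bar>P' 0 j\<bar> + \<bar>Q' 0 j\<bar>) + 5 * nat (\<bar>P' 1 j\<bar> + \<bar>Q' 1 j\<bar>) + 6 * nat (\<bar>P' 2 j\<bar> + \<bar>Q' 2 j\<bar>)
        \<le> 4 * nat (\<bar>P 0 j\<bar> + \<bar>Q 0 j\<bar>) + 5 * nat (\<bar>P 1 j\<bar> + \<bar>Q 1 j\<bar>) + 6 * nat (\<bar>P 2 j\<bar> + \<bar>Q 2 j\<bar>)"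
      "P 0 j \<noteq> 0 \<or> Q 0 j \<noteq> 0 \<or> P 1 j \<noteq> 0 \<or> Q 1 j \<noteq> 0 \<or> P 2 j \<noteq> 0 \<or> Q 2 j \<noteq> 0 \<Longrightarrow>
        4 * nat (\<bar>P' 0 j\<bar> + \<bar>Q' 0 j\<bar>) + 5 * nat (\<bar>P' 1 j\<bar> + \<bar>Q' 1 j\<bar>) + 6 * nat (\<bar>P' 2 j\<bar> + \<bar>Q' 2 j\<bar>)
        < 4 * nat (\<bar>P 0 j\<bar> + \<bar>Q 0 j\<bar>) + 5 * nat (\<bar>P 1 j\<bar> + \<bar>Q 1 j\<bar>) + 6 * nat (\<bar>P 2 j\<bar> + \<bar>Q 2 j\<bar>)"
      if j: "j < 3" for j
    proof -
      obtain a b where ab: "P 0 j = 2 * a" "Q 0 j = 2 * b" using ev[OF j] by (auto elim!: evenE)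
      have e: "P' 0 j = P 1 j" "Q' 0 j = Q 1 j" "P' 1 j = P 2 j" "Q' 1 j = Q 2 j" "P' 2 j = a" "Q' 2 j = b"
        using ab by (simp_all add: P'_def Q'_def numeral_2_eq_2)
      have n2: "nat (\<bar>2 * a\<bar> + \<bar>2 * b\<bar>) = 2 * nat (\<bar>a\<bar> + \<bar>b\<bar>)"
      proof -
        have "\<bar>2 * a\<bar> + \<bar>2 * b\<bar> = 2 * (\<bar>a\<bar> + \<bar>b\<bar>)" by (simp only: abs_mult abs_numeral distrib_left)
        then show ?thesis by (simp only: nat_mult_distrib) simp
      qed
      have n0: "nat (\<bar>x\<bar> + \<bar>y\<bar>) = 0 \<longleftrightarrow> x = 0 \<and> y = 0" for x y :: int by auto
      have "0 < nat (\<bar>a\<bar> + \<bar>b\<bar>) \<or> 0 < nat (\<bar>P 1 j\<bar> + \<bar>Q 1 j\<bar>) \<or> 0 < nat (\<bar>P 2 j\<bar> + \<bar>Q 2 j\<bar>)"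
        if "P 0 j \<noteq> 0 \<or> Q 0 j \<noteq> 0 \<or> P 1 j \<noteq> 0 \<or> Q 1 j \<noteq> 0 \<or> P 2 j \<noteq> 0 \<or> Q 2 j \<noteq> 0"
        using that n0[of a b] n0[of "P 1 j" "Q 1 j"] n0[of "P 2 j" "Q 2 j"] unfolding ab by (metis gr0I mult_zero_right)
      moreover have "4 * B + 5 * C + 6 * A \<le> 4 * (2 * A) + 5 * B + 6 * C"
        "0 < A \<or> 0 < B \<or> 0 < C \<Longrightarrow> 4 * B + 5 * C + 6 * A < 4 * (2 * A) + 5 * B + 6 * C" for A B C :: nat
        by linarith+
      ultimately show "4 * nat (\<bar>P' 0 j\<bar> + \<bar>Q' 0 j\<bar>) + 5 * nat (\<bar>P' 1 j\<bar> + \<bar>Q' 1 j\<bar>) + 6 * nat (\<bar>P' 2 j\<bar> + \<bar>Q' 2 j\<bar>)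
        \<le> 4 * nat (\<bar>P 0 j\<bar> + \<bar>Q 0 j\<bar>) + 5 * nat (\<bar>P 1 j\<bar> + \<bar>Q 1 j\<bar>) + 6 * nat (\<bar>P 2 j\<bar> + \<bar>Q 2 j\<bar>)"
        "P 0 j \<noteq> 0 \<or> Q 0 j \<noteq> 0 \<or> P 1 j \<noteq> 0 \<or> Q 1 j \<noteq> 0 \<or> P 2 j \<noteq> 0 \<or> Q 2 j \<noteq> 0 \<Longrightarrow>
        4 * nat (\<bar>P' 0 j\<bar> + \<bar>Q' 0 j\<bar>) + 5 * nat (\<bar>P' 1 j\<bar> + \<bar>Q' 1 j\<bar>) + 6 * nat (\<bar>P' 2 j\<bar> + \<bar>Q' 2 j\<bar>)
        < 4 * nat (\<bar>P 0 j\<bar> + \<bar>Q 0 j\<bar>) + 5 * nat (\<bar>P 1 j\<bar> + \<bar>Q 1 j\<bar>) + 6 * nat (\<bar>P 2 j\<bar> + \<bar>Q 2 j\<bar>)"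
        unfolding e ab n2 by blast+
    qed
    let ?u' = "\<lambda>i j. of_int (P' i j) + of_int (Q' i j) * w"
    have two: "2 * complex_of_int (a div 2) = of_int a" if "even a" for a :: int
      using that by (metis dvd_mult_div_cancel of_int_mult of_int_numeral)
    have sh: "(if i = 0 then 2 * ?u' 2 j else ?u' (i - 1) j) = ?u i j" if "j < 3" "i < 3" for i j
      using ev[OF that(1)] two[of "P 0 j"] two[of "Q 0 j"] that
      by (auto simp: P'_def Q'_def algebra_simps)
    have "2 * Nr w ?u' = Nr w (\<lambda>i j. if i = 0 then 2 * ?u' 2 j else ?u' (i - 1) j)"
      by (rule Nr_shift[OF w_eq, symmetric])
    also have "\<dots> = Nr w ?u" by (rule Nr_cong) (rule sh)
    finally have N': "Nr w ?u' = 0" using less.prems by simp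
    have "(\<Sum>j<3. 4 * nat (\<bar>P' 0 j\<bar> + \<bar>Q' 0 j\<bar>) + 5 * nat (\<bar>P' 1 j\<bar> + \<bar>Q' 1 j\<bar>) + 6 * nat (\<bar>P' 2 j\<bar> + \<bar>Q' 2 j\<bar>))
        < (\<Sum>j<3. 4 * nat (\<bar>P 0 j\<bar> + \<bar>Q 0 j\<bar>) + 5 * nat (\<bar>P 1 j\<bar> + \<bar>Q 1 j\<bar>) + 6 * nat (\<bar>P 2 j\<bar> + \<bar>Q 2 j\<bar>))"
      by (rule sum_strict_mono_ex1) (use le nz in auto)
    from less.hyps[OF this N'] have z: "\<forall>i<3. \<forall>j<3. P' i j = 0 \<and> Q' i j = 0" .
    have "P i j = 0 \<and> Q i j = 0" if ij: "i < 3" "j < 3" for i j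
    proof (cases "i = 0")
      case True
      have "P 0 j div 2 = 0" "Q 0 j div 2 = 0" using z ij(2) by (auto simp: P'_def Q'_def dest: spec[of _ 2])
      then show ?thesis using ev[OF ij(2)] True by auto
    next
      case F: False
      then have "P' (i - 1) j = P i j" "Q' (i - 1) j = Q i j" using ij by (auto simp: P'_def Q'_def)
      then show ?thesis using z ij by (metis less_imp_diff_less)
    qed
    then show ?thesis by blast
  qed blast
qed

text \<open>The last clause says that the cyclic algebra \<open>(2, w)\<close> over \<open>K\<close>
  has no nonzero element of reduced norm zero, so that it is a division algebra.\<close>

definition good_field :: "complex set \<Rightarrow> bool" where
  "good_field K \<longleftrightarrow> subring_C K \<and> (\<forall>x\<in>K. inverse x \<in> K) \<and> w \<in> K \<and>
     (\<forall>u. (\<forall>i<3. \<forall>j<3. u i j \<in> K) \<longrightarrow> Nr w u = 0 \<longrightarrow> (\<forall>i<3. \<forall>j<3. u i j = 0))"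

definition Qw :: "complex set" where
  "Qw = {x. \<exists>m::int. m \<noteq> 0 \<and> of_int m * x \<in> Ew}"

text \<open>The starting point for Zorn's lemma. Anisotropy follows from the integral case after
  clearing denominators.\<close>

lemma good_Qw: "good_field Qw"
  unfolding good_field_def
proof (intro conjI allI impI ballI)
  interpret E: subring_C Ew by (rule subring_Ew)
  have intE: "of_int m \<in> Ew" for m using Ew_I[of m 0] by simp
  show "subring_C Qw"
  proof
    show "0 \<in> Qw" "1 \<in> Qw" unfolding Qw_def by (auto intro!: exI[of _ 1])
    fix x assume "x \<in> Qw"
    then obtain m :: int where m: "m \<noteq> 0" "of_int m * x \<in> Ew" by (auto simp: Qw_def)
    show "- x \<in> Qw" unfolding Qw_def using m E.kneg[OF m(2)] by (auto intro!: exI[of _ m])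
    fix y assume "y \<in> Qw"
    then obtain l :: int where l: "l \<noteq> 0" "of_int l * y \<in> Ew" by (auto simp: Qw_def)
    have e: "of_int (m * l) * (x + y) = of_int l * (of_int m * x) + of_int m * (of_int l * y)"
      "of_int (m * l) * (x * y) = (of_int m * x) * (of_int l * y)"
      by (simp_all add: algebra_simps)
    have "of_int (m * l) * (x + y) \<in> Ew" "of_int (m * l) * (x * y) \<in> Ew"
      unfolding e using E.kadd[OF E.kmult[OF intE[of l] m(2)] E.kmult[OF intE[of m] l(2)]] E.kmult[OF m(2) l(2)]
      by simp_all
    then show "x + y \<in> Qw" "x * y \<in> Qw"
      unfolding Qw_def using m(1) l(1) by (auto intro!: exI[of _ "m * l"] simp del: of_int_mult)
  qed
  show "w \<in> Qw" unfolding Qw_def using w_Ew by (auto intro!: exI[of _ 1])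
  fix x assume "x \<in> Qw"
  then obtain m :: int where m: "m \<noteq> 0" "of_int m * x \<in> Ew" by (auto simp: Qw_def)
  then obtain p q where pq: "of_int m * x = of_int p + of_int q * w" by (auto simp: Ew_def)
  show "inverse x \<in> Qw"
  proof (cases "x = 0")
    case True
    then show ?thesis using \<open>x \<in> Qw\<close> by simp
  next
    case False
    \<comment> \<open>The inverse is the conjugate divided by the norm, and the norm is the integer
      \<open>?N\<close>.\<close>
    let ?N = "p * p - p * q + q * q"
    have N: "of_int ?N = (of_int p + of_int q * w) * (of_int (p - q) - of_int q * w)"
      by (simp add: ww ww' algebra_simps)
    have "?N \<noteq> 0"
    proof
      assume "?N = 0"
      then have "(2 * p - q)\<^sup>2 + 3 * q\<^sup>2 = 0" by (simp add: power2_eq_square algebra_simps)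
      then have "q\<^sup>2 = 0" "(2 * p - q)\<^sup>2 = 0" using zero_le_power2[of q] zero_le_power2[of "2 * p - q"] by linarith+
      then have "p = 0" "q = 0" by auto
      then show False using pq False m by simp
    qed
    moreover have "of_int ?N * inverse x = of_int m * (of_int (p - q) - of_int q * w)"
      unfolding N pq[symmetric] using False by (simp add: field_simps)
    moreover have "of_int m * (of_int (p - q) - of_int q * w) \<in> Ew"
      using intE w_Ew by (intro E.kmult E.kdiff)
    ultimately show ?thesis unfolding Qw_def by (intro CollectI exI[of _ ?N]) simp
  qed
next
  fix u i j assume u: "\<forall>i<3. \<forall>j<3. u i j \<in> Qw" "Nr w u = 0" and ij: "i < (3::nat)" "j < (3::nat)"
  interpret E: subring_C Ew by (rule subring_Ew)
  have "\<forall>i j. \<exists>m::int. i < 3 \<longrightarrow> j < 3 \<longrightarrow> m \<noteq> 0 \<and> of_int m * u i j \<in> Ew"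
    using u(1) by (auto simp: Qw_def)
  then obtain m :: "nat \<Rightarrow> nat \<Rightarrow> int" where m: "\<And>i j. i < 3 \<Longrightarrow> j < 3 \<Longrightarrow> m i j \<noteq> 0 \<and> of_int (m i j) * u i j \<in> Ew"
    by metis
  define M where "M = (\<Prod>(i, j)\<in>{..<3::nat} \<times> {..<3::nat}. m i j)"
  have M0: "M \<noteq> 0" unfolding M_def using m by auto
  have ME: "of_int M * u i j \<in> Ew" if "i < 3" "j < 3" for i j
  proof -
    have "M = (\<Prod>(i, j)\<in>{..<3} \<times> {..<3} - {(i, j)}. m i j) * m i j"
      unfolding M_def using that by (subst prod.remove[of _ "(i, j)"]) (auto simp: mult.commute)
    then have "of_int M * u i j = of_int (\<Prod>(i, j)\<in>{..<3} \<times> {..<3} - {(i, j)}. m i j) * (of_int (m i j) * u i j)"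
      by simp
    moreover have "of_int a \<in> Ew" for a :: int using Ew_I[of a 0] by simp
    ultimately show ?thesis using m[OF that] by (simp only: E.kmult)
  qed
  have "\<forall>i j. \<exists>p q. i < 3 \<longrightarrow> j < 3 \<longrightarrow> of_int M * u i j = of_int p + of_int q * w"
    using ME unfolding Ew_def by blast
  then obtain P Q :: "nat \<Rightarrow> nat \<Rightarrow> int"
    where PQ: "\<And>i j. i < 3 \<Longrightarrow> j < 3 \<Longrightarrow> of_int M * u i j = of_int (P i j) + of_int (Q i j) * w"
    by metis
  have "Nr w (\<lambda>i j. of_int (P i j) + of_int (Q i j) * w) = Nr w (\<lambda>i j. of_int M * u i j)"
    unfolding Nr_def by (simp add: PQ)
  also have "\<dots> = 0" by (simp add: Nr_smult u(2))
  finally have "P i j = 0 \<and> Q i j = 0" using Nr_int_descent ij by blast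
  then show "u i j = 0" using PQ[OF ij] M0 by simp
qed

end

section \<open>A maximal field over which the algebra stays a division algebra\<close>

definition sring :: "'a::comm_ring_1 set \<Rightarrow> bool" where
  "sring R \<longleftrightarrow> 0 \<in> R \<and> 1 \<in> R \<and> (\<forall>x\<in>R. \<forall>y\<in>R. x + y \<in> R) \<and> (\<forall>x\<in>R. \<forall>y\<in>R. x * y \<in> R) \<and> (\<forall>x\<in>R. - x \<in> R)"

lemma sringD:
  assumes "sring R"
  shows "0 \<in> R" "1 \<in> R" "x \<in> R \<Longrightarrow> y \<in> R \<Longrightarrow> x + y \<in> R" "x \<in> R \<Longrightarrow> y \<in> R \<Longrightarrow> x * y \<in> R" "x \<in> R \<Longrightarrow> - x \<in> R"
    "x \<in> R \<Longrightarrow> y \<in> R \<Longrightarrow> x - y \<in> R"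
  using assms unfolding sring_def by (auto simp: diff_conv_add_uminus simp del: add_uminus_conv_diff)

lemma sring_sum: "sring R \<Longrightarrow> (\<And>i. i \<in> A \<Longrightarrow> f i \<in> R) \<Longrightarrow> sum f A \<in> R"
  by (induction A rule: infinite_finite_induct) (auto simp: sringD)

lemma sring_prod: "sring R \<Longrightarrow> (\<And>i. i \<in> A \<Longrightarrow> f i \<in> R) \<Longrightarrow> prod f A \<in> R"
  by (induction A rule: infinite_finite_induct) (auto simp: sringD)

lemma sring_power: "sring R \<Longrightarrow> x \<in> R \<Longrightarrow> x ^ n \<in> R"
  by (induction n) (auto simp: sringD)

lemma sring_numeral: "sring R \<Longrightarrow> numeral n \<in> R"
proof -
  assume R: "sring R"
  have "of_nat m \<in> R" for m by (induction m) (auto simp: sringD[OF R])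
  from this[of "numeral n"] show ?thesis by simp
qed

lemma sring_subring_C: "sring K \<longleftrightarrow> subring_C K"
  by (auto simp: sring_def subring_C_def)

definition polyset :: "'a::comm_ring_1 set \<Rightarrow> 'a poly set" where
  "polyset R = {p. \<forall>i. Polynomial.coeff p i \<in> R}"

lemma sring_polyset:
  assumes R: "sring R"
  shows "sring (polyset R)"
  unfolding sring_def
proof (intro conjI ballI)
  show "0 \<in> polyset R" "1 \<in> polyset R" by (auto simp: polyset_def sringD[OF R])
  fix p assume p: "p \<in> polyset R"
  then show "- p \<in> polyset R" by (auto simp: polyset_def sringD[OF R])
  fix q assume "q \<in> polyset R"
  with p show "p + q \<in> polyset R" "p * q \<in> polyset R"
    by (auto simp: polyset_def sringD[OF R] coeff_mult intro!: sring_sum[OF R])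
qed

lemma polyset_pCons: "pCons a p \<in> polyset R \<longleftrightarrow> a \<in> R \<and> p \<in> polyset R"
  by (auto simp: polyset_def coeff_pCons split: nat.splits)

lemma polyset_0: "sring R \<Longrightarrow> 0 \<in> polyset R"
  using sring_polyset sringD by blast

lemma polyset_poly: "sring R \<Longrightarrow> p \<in> polyset R \<Longrightarrow> x \<in> R \<Longrightarrow> poly p x \<in> R"
  by (simp add: poly_altdef polyset_def sring_sum sringD sring_power)

text \<open>An exact quotient in the large ring of two elements of \<open>R\<close> stays in
  \<open>R\<close>. This later keeps coefficients in \<open>K\<close> when a power of the equation
  of the curve is divided out.\<close>

definition divclosed :: "'a::idom set \<Rightarrow> bool" where
  "divclosed R \<longleftrightarrow> (\<forall>p q. q \<in> R \<longrightarrow> q \<noteq> 0 \<longrightarrow> p * q \<in> R \<longrightarrow> p \<in> R)"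

text \<open>The leading coefficient of \<open>p\<close> is the exact quotient of two elements of
  \<open>R\<close>. Removing the leading term of \<open>p\<close> lowers the degree.\<close>

lemma divclosed_polyset:
  assumes R: "sring R" and d: "divclosed R"
  shows "divclosed (polyset R)"
  unfolding divclosed_def
proof (intro allI impI)
  fix p q :: "'a poly"
  assume q: "q \<in> polyset R" "q \<noteq> 0" and pq: "p * q \<in> polyset R"
  from pq show "p \<in> polyset R"
  proof (induction "Polynomial.degree p" arbitrary: p rule: less_induct)
    case less
    note S = sringD[OF sring_polyset[OF R]]
    let ?a = "Polynomial.lead_coeff p" and ?n = "Polynomial.degree p"
    have "Polynomial.lead_coeff (p * q) \<in> R" using less.prems by (simp add: polyset_def)
    then have "?a * Polynomial.lead_coeff q \<in> R" by (simp only: Polynomial.lead_coeff_mult)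
    moreover have "Polynomial.lead_coeff q \<in> R" "Polynomial.lead_coeff q \<noteq> 0" using q by (auto simp: polyset_def)
    ultimately have a: "?a \<in> R" using d unfolding divclosed_def by blast
    define m where "m = Polynomial.monom ?a ?n"
    have m: "m \<in> polyset R" using a R by (auto simp: m_def polyset_def sringD)
    show ?case
    proof (cases "?n = 0")
      case True
      then obtain c where "p = [:c:]" by (rule degree_eq_zeroE)
      then have "p = m" by (simp add: m_def monom_0)
      then show ?thesis using m by simp
    next
      case False
      have "Polynomial.degree (p - m) < ?n"
      proof (rule degree_lessI)
        show "p - m \<noteq> 0 \<or> 0 < ?n" using False by simp
        show "\<forall>k\<ge>?n. Polynomial.coeff (p - m) k = 0"
          by (auto simp: m_def coeff_eq_0)
      qed
      moreover have "(p - m) * q \<in> polyset R"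
        using less.prems S m q by (simp add: left_diff_distrib)
      ultimately have "p - m \<in> polyset R" using less.hyps by blast
      then have "(p - m) + m \<in> polyset R" using m S by blast
      then show ?thesis by simp
    qed
  qed
qed

context cube_root_1
begin

lemma good_fieldD:
  assumes "good_field K"
  shows "sring K" "x \<in> K \<Longrightarrow> inverse x \<in> K" "w \<in> K"
    "(\<And>i j. i < 3 \<Longrightarrow> j < 3 \<Longrightarrow> u i j \<in> K) \<Longrightarrow> Nr w u = 0 \<Longrightarrow> i < 3 \<Longrightarrow> j < 3 \<Longrightarrow> u i j = 0"
  using assms unfolding good_field_def sring_subring_C by blast+

text \<open>At 0 the norm specialises to a norm over \<open>K\<close>, so all constant terms vanish.
  Then the variable can be cancelled from every entry, and induction on the degree finishes.\<close>

lemma Nr_polynomial: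
  fixes p :: "nat \<Rightarrow> nat \<Rightarrow> complex poly"
  assumes K: "good_field K" and p: "\<And>i j. i < 3 \<Longrightarrow> j < 3 \<Longrightarrow> p i j \<in> polyset K" and N: "Nr [:w:] p = 0"
    and ij: "i < 3" "j < 3"
  shows "p i j = 0"
proof -
    have c0: "Polynomial.coeff (p i j) 0 = 0" if ij: "i < 3" "j < 3"
      and p: "\<And>i j. i < 3 \<Longrightarrow> j < 3 \<Longrightarrow> p i j \<in> polyset K" and N: "Nr [:w:] p = 0"
      for p :: "nat \<Rightarrow> nat \<Rightarrow> complex poly" and i j
    proof -
      have "poly (Nr [:w:] p) 0 = Nr w (\<lambda>i j. poly (p i j) 0)"
        by (simp add: Nr_def)
      then have "Nr w (\<lambda>i j. poly (p i j) 0) = 0" using N by simp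
      moreover have "poly (p i j) 0 \<in> K" if "i < 3" "j < 3" for i j
        using p[OF that] by (simp add: polyset_def poly_0_coeff_0)
      ultimately have "poly (p i j) 0 = 0" using good_fieldD(4)[OF K, of "\<lambda>i j. poly (p i j) 0"] ij by blast
      then show ?thesis by (simp add: poly_0_coeff_0)
    qed
  have *: "\<forall>i<3. \<forall>j<3. p i j = 0"
    if "\<And>i j. i < 3 \<Longrightarrow> j < 3 \<Longrightarrow> p i j \<in> polyset K" "Nr [:w:] p = 0"
      "\<And>i j. i < 3 \<Longrightarrow> j < 3 \<Longrightarrow> Polynomial.degree (p i j) \<le> n" for n and p :: "nat \<Rightarrow> nat \<Rightarrow> complex poly"
    using that
  proof (induction n arbitrary: p)
      case 0
      show ?case
      proof (intro allI impI)
        fix i j :: nat assume ij: "i < 3" "j < 3"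
        have "Polynomial.degree (p i j) = 0" using 0(3)[OF ij] by simp
        then show "p i j = 0" using c0[OF ij 0(1,2)] by (metis leading_coeff_0_iff)
      qed
    next
      case (Suc n)
      have "\<exists>q. p i j = pCons 0 q" if "i < 3" "j < 3" for i j
      proof -
        obtain a q where "p i j = pCons a q" by (rule pCons_cases)
        then show ?thesis using c0[OF that Suc.prems(1,2)] by auto
      qed
      then obtain q where q: "\<And>i j. i < 3 \<Longrightarrow> j < 3 \<Longrightarrow> p i j = pCons 0 (q i j)"
        by metis
      have "Nr [:w:] p = Nr [:w:] (\<lambda>i j. [:0, 1:] * q i j)" unfolding Nr_def by (simp add: q)
      then have "[:0, 1:] ^ 3 * Nr [:w:] q = 0" using Suc.prems(2) by (simp only: Nr_smult)
      then have "Nr [:w:] q = 0" by simp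
      moreover have "q i j \<in> polyset K" if "i < 3" "j < 3" for i j
        using Suc.prems(1)[OF that] q[OF that] by (simp add: polyset_pCons)
      moreover have "Polynomial.degree (q i j) \<le> n" if "i < 3" "j < 3" for i j
        using Suc.prems(3)[OF that] q[OF that] by (auto split: if_splits)
      ultimately have "\<forall>i<3. \<forall>j<3. q i j = 0" using Suc.IH by blast
      then show ?case using q by simp
  qed
  define n where "n = (\<Sum>i<3::nat. \<Sum>j<3::nat. Polynomial.degree (p i j))"
  have "Polynomial.degree (p i j) \<le> n" if "i < 3" "j < 3" for i j
  proof -
    have "Polynomial.degree (p i j) \<le> (\<Sum>j<3. Polynomial.degree (p i j))"
      by (rule member_le_sum) (use that in auto)
    also have "\<dots> \<le> n" unfolding n_def
      by (rule member_le_sum[of i _ "\<lambda>i. \<Sum>j<3. Polynomial.degree (p i j)"]) (use that in auto)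
    finally show ?thesis .
  qed
  from *[OF p N this] ij show ?thesis by blast
qed

text \<open>Anisotropy passes to unions of chains since a zero of the norm involves only nine
  elements, all of which lie in one member of the chain.\<close>

lemma ex_max_good: "\<exists>K. good_field K \<and> (\<forall>K'. good_field K' \<longrightarrow> K \<subseteq> K' \<longrightarrow> K' = K)"
proof -
  have "\<exists>M\<in>Collect good_field. \<forall>Y\<in>Collect good_field. M \<subseteq> Y \<longrightarrow> Y = M"
  proof (rule subset_Zorn_nonempty, goal_cases)
    case 1
    show "Collect good_field \<noteq> {}" using good_Qw by blast
  next
    case C: (2 Ch)
    have mem: "\<exists>B\<in>Ch. A \<subseteq> B" if "finite A" "A \<subseteq> \<Union>Ch" for A
      using finite_subset_Union_chain[OF that C] by blast
    have gd: "good_field B" if "B \<in> Ch" for B using C(2) that by (auto simp: subset_chain_def)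
    then have sr: "sring B" if "B \<in> Ch" for B using that by (simp add: good_field_def sring_subring_C)
    have "sring (\<Union>Ch)"
      unfolding sring_def
    proof (intro conjI ballI)
      show "0 \<in> \<Union>Ch" "1 \<in> \<Union>Ch" using C(1) sr sringD by blast+
      fix x assume x: "x \<in> \<Union>Ch"
      then show "- x \<in> \<Union>Ch" using sr sringD by blast
      fix y assume "y \<in> \<Union>Ch"
      then obtain B where "B \<in> Ch" "x \<in> B" "y \<in> B" using mem[of "{x, y}"] x by auto
      then show "x + y \<in> \<Union>Ch" "x * y \<in> \<Union>Ch" using sringD[OF sr[of B]] by blast+
    qed
    moreover have "\<forall>x\<in>\<Union>Ch. inverse x \<in> \<Union>Ch" "w \<in> \<Union>Ch" using good_fieldD(2,3)[OF gd] C(1) by blast+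
    moreover have "\<forall>i<3. \<forall>j<3. u i j = 0" if u: "\<forall>i<3. \<forall>j<3. u i j \<in> \<Union>Ch" "Nr w u = 0" for u
    proof -
      have "(\<lambda>(i, j). u i j) ` ({..<3} \<times> {..<3}) \<subseteq> \<Union>Ch"
        using u(1) by (intro image_subsetI) (simp only: case_prod_unfold mem_Times_iff lessThan_iff)
      moreover have "finite ((\<lambda>(i, j). u i j) ` ({..<3} \<times> {..<3}))" by simp
      ultimately obtain B where B: "B \<in> Ch" "(\<lambda>(i, j). u i j) ` ({..<3} \<times> {..<3}) \<subseteq> B"
        using mem by meson
      have "u i j \<in> B" if "i < 3" "j < 3" for i j
        using subsetD[OF B(2) imageI[of "(i, j)"]] that by simp
      then show ?thesis by (intro allI impI good_fieldD(4)[OF gd[OF B(1)] _ u(2)]) auto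
    qed
    ultimately show "\<Union>Ch \<in> Collect good_field"
      unfolding good_field_def sring_subring_C[symmetric] mem_Collect_eq by (intro conjI) simp_all
  qed
  then show ?thesis by blast
qed

text \<open>If \<open>t\<close> were transcendental, \<open>K'\<close>, the field of rational
  functions in \<open>t\<close>, would still be good by \<open>Nr_polynomial\<close>; maximality
  would then put \<open>t\<close> into \<open>K\<close>.\<close>

lemma max_good_algebraic:
  assumes K: "good_field K" and max: "\<And>K'. good_field K' \<Longrightarrow> K \<subseteq> K' \<Longrightarrow> K' = K"
  shows "\<exists>p\<in>polyset K. p \<noteq> 0 \<and> poly p t = 0"
proof (rule ccontr)
  assume "\<not> ?thesis"
  then have tr: "p \<in> polyset K \<Longrightarrow> poly p t = 0 \<Longrightarrow> p = 0" for p by blast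
  have sK: "sring K" using K by (simp add: good_field_def sring_subring_C)
  note P = sringD[OF sring_polyset[OF sK]]
  define K' where "K' = {poly p t / poly q t | p q. p \<in> polyset K \<and> q \<in> polyset K \<and> q \<noteq> 0}"
  have K'I: "poly p t / poly q t \<in> K'" if "p \<in> polyset K" "q \<in> polyset K" "q \<noteq> 0" for p q
    unfolding K'_def using that by blast
  have K'E: "\<exists>p q. p \<in> polyset K \<and> q \<in> polyset K \<and> poly q t \<noteq> 0 \<and> x = poly p t / poly q t" if "x \<in> K'" for x
    using that tr unfolding K'_def by blast
  have pin: "poly p t \<in> K'" if "p \<in> polyset K" for p
    using K'I[OF that P(2)] by simp
  have KK': "K \<subseteq> K'"
  proof
    fix x assume "x \<in> K"
    then have "[:x:] \<in> polyset K" using polyset_0[OF sK] by (simp add: polyset_pCons)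
    from pin[OF this] show "x \<in> K'" by simp
  qed
  have "good_field K'"
    unfolding good_field_def sring_subring_C[symmetric]
  proof (intro conjI allI ballI impI)
    show "sring K'"
      unfolding sring_def
    proof (intro conjI ballI)
      show "0 \<in> K'" "1 \<in> K'" using KK' sringD[OF sK] by blast+
      fix x assume "x \<in> K'"
      then obtain p q where x: "p \<in> polyset K" "q \<in> polyset K" "poly q t \<noteq> 0" "x = poly p t / poly q t"
        using K'E by blast
      have "q \<noteq> 0" using x by auto
      then show "- x \<in> K'" using K'I[OF P(5)[OF x(1)] x(2)] x(4) by simp
      fix y assume "y \<in> K'"
      then obtain p' q' where y: "p' \<in> polyset K" "q' \<in> polyset K" "poly q' t \<noteq> 0" "y = poly p' t / poly q' t"
        using K'E by blast
      have nz: "q * q' \<noteq> 0" using x(3) y(3) by auto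
      show "x + y \<in> K'"
        using K'I[OF P(3)[OF P(4)[OF x(1) y(2)] P(4)[OF y(1) x(2)]] P(4)[OF x(2) y(2)] nz] x y
        by (simp add: add_frac_eq)
      show "x * y \<in> K'"
        using K'I[OF P(4)[OF x(1) y(1)] P(4)[OF x(2) y(2)] nz] x y by simp
    qed
    show "w \<in> K'" using KK' K by (auto simp: good_field_def)
    fix x assume "x \<in> K'"
    then obtain p q where x: "p \<in> polyset K" "q \<in> polyset K" "poly q t \<noteq> 0" "x = poly p t / poly q t"
      using K'E by blast
    show "inverse x \<in> K'"
    proof (cases "p = 0")
      case True
      then show ?thesis using x \<open>x \<in> K'\<close> by simp
    next
      case False
      then show ?thesis using K'I[OF x(2,1)] x(4) by simp
    qed
  next
    fix u i j assume u: "\<forall>i<3. \<forall>j<3. u i j \<in> K'" "Nr w u = 0" and ij: "i < (3::nat)" "j < (3::nat)"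
    have "\<exists>p q. p \<in> polyset K \<and> q \<in> polyset K \<and> poly q t \<noteq> 0 \<and> u i j = poly p t / poly q t"
      if "i < 3" "j < 3" for i j using K'E u that by blast
    then obtain p q where pq: "\<And>i j. i < 3 \<Longrightarrow> j < 3 \<Longrightarrow> p i j \<in> polyset K \<and> q i j \<in> polyset K \<and>
        poly (q i j) t \<noteq> 0 \<and> u i j = poly (p i j) t / poly (q i j) t"
      by metis
    define I where "I = {..<3::nat} \<times> {..<3::nat}"
    define Q where "Q = (\<Prod>(i, j)\<in>I. q i j)"
    \<comment> \<open>Numerators over the common denominator \<open>Q\<close>.\<close>
    define r where "r i j = p i j * (\<Prod>(i, j)\<in>I - {(i, j)}. q i j)" for i j
    have r: "r i j \<in> polyset K" if "i < 3" "j < 3" for i j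
      unfolding r_def using pq that
      by (intro P(4) sring_prod[OF sring_polyset[OF sK]]) (auto simp: I_def)
    have Q0: "poly Q t \<noteq> 0" unfolding Q_def poly_prod using pq by (auto simp: I_def)
    have ru: "poly (r i j) t = poly Q t * u i j" if "i < 3" "j < 3" for i j
    proof -
      have "Q = q i j * (\<Prod>(i, j)\<in>I - {(i, j)}. q i j)"
        unfolding Q_def using that by (subst prod.remove[of _ "(i, j)"]) (auto simp: I_def)
      then show ?thesis using pq[OF that] by (simp add: r_def)
    qed
    have "poly (Nr [:w:] r) t = Nr w (\<lambda>i j. poly Q t * u i j)"
      unfolding Nr_def by (simp add: ru)
    then have "poly (Nr [:w:] r) t = 0" by (simp add: Nr_smult u(2))
    moreover have "Nr [:w:] r \<in> polyset K"
    proof -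
      have "w \<in> K" using K by (simp add: good_field_def)
      then have "[:w:] \<in> polyset K" using polyset_0[OF sK] by (simp add: polyset_pCons)
      then show ?thesis unfolding Nr_def
        by (intro P sring_power[OF sring_polyset[OF sK]] sring_numeral[OF sring_polyset[OF sK]] r) auto
    qed
    ultimately have "Nr [:w:] r = 0" using tr by blast
    from Nr_polynomial[OF K r this ij] have "r i j = 0" .
    then show "u i j = 0" using ru[OF ij] Q0 by simp
  qed
  then have "K' = K" using max KK' by blast
  moreover have "t \<in> K'" using pin[of "[:0, 1:]"] sringD[OF sK] polyset_0[OF sK] by (simp add: polyset_pCons)
  ultimately have "t \<in> K" by simp
  then have "[:- t, 1:] \<in> polyset K" using sringD[OF sK] polyset_0[OF sK] by (simp add: polyset_pCons)
  from tr[OF this] show False by simp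
qed

end

section \<open>The complex numbers as an algebraic closure of the subfield\<close>

lemma CC_eval: "ring.eval CC (rev cs) x = (\<Sum>i<length cs. cs ! i * x ^ i)"
proof (induction cs rule: rev_induct)
  interpret C: field CC by (rule field_CC)
  case Nil show ?case by simp
  case (snoc a cs)
  then show ?case by (simp add: nth_append)
qed

text \<open>HOL-Algebra lists coefficients from the leading one down and \<open>coeffs\<close> lists
  them upwards, hence the reversal.\<close>

lemma CC_eval_coeffs: "ring.eval CC (rev (coeffs p)) x = poly p x"
  unfolding CC_eval poly_altdef by (cases "p = 0") (auto simp: length_coeffs coeffs_nth lessThan_Suc_atMost intro: sum.cong)

lemma CC_algebraically_closed: "algebraically_closed CC"
proof -
  interpret C: field CC by (rule field_CC)
  show ?thesis
  proof (rule C.algebraically_closedI)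
    fix P assume P: "P \<in> carrier (poly_ring CC)" "length P - 1 > 1"
    define p where "p = Poly (rev P)"
    have "P \<noteq> []" using P(2) by auto
    moreover have "hd P \<noteq> 0" using P(1) \<open>P \<noteq> []\<close> by (simp add: univ_poly_carrier[symmetric] polynomial_def)
    ultimately have c: "coeffs p = rev P" unfolding p_def by (cases P) auto
    have "\<exists>x. poly p x = 0"
    proof -
      have "Polynomial.degree p \<noteq> 0" using c P(2) by (simp add: degree_eq_length_coeffs)
      then show ?thesis using alg_closed_imp_poly_has_root[of p] by auto
    qed
    then obtain x where "poly p x = 0" by blast
    then have "C.eval P x = 0" using CC_eval_coeffs[of p x] c by simp
    then show "\<exists>x\<in>carrier CC. C.eval P x = \<zero>\<^bsub>CC\<^esub>" by auto
  qed
qed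

lemma algebraic_closure_CC:
  assumes K: "subring_C K" "\<And>x. x \<in> K \<Longrightarrow> inverse x \<in> K"
    and alg: "\<And>t. \<exists>p\<in>polyset K. p \<noteq> 0 \<and> poly p t = 0"
  shows "algebraic_closure CC K"
proof -
  interpret C: algebraically_closed CC by (rule CC_algebraically_closed)
  interpret K: subring_C K by fact
  have sf: "subfield K CC"
  proof (rule C.subfieldI'[OF C.subringI])
    show "inv\<^bsub>CC\<^esub> k \<in> K" if "k \<in> K - {\<zero>\<^bsub>CC\<^esub>}" for k
      using that K(2) by (simp add: CC_inv)
  qed auto
  have "algebraic_closure_axioms CC K"
  proof
    show "(C.algebraic over K) x" for x
    proof -
      obtain p where p: "p \<in> polyset K" "p \<noteq> 0" "poly p x = 0" using alg by blast
      show ?thesis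
      proof (rule C.algebraicI[of "rev (coeffs p)"])
        have "set (coeffs p) \<subseteq> K" using p(1) by (auto simp: polyset_def set_conv_nth coeffs_nth length_coeffs p(2))
        moreover have "hd (rev (coeffs p)) \<noteq> 0" using p(2) by (simp add: hd_rev last_coeffs_eq_coeff_degree)
        ultimately show "rev (coeffs p) \<in> carrier (K[X]\<^bsub>CC\<^esub>)"
          by (simp add: univ_poly_carrier[symmetric] polynomial_def)
        show "rev (coeffs p) \<noteq> []" using p(2) by simp
        show "C.eval (rev (coeffs p)) x = \<zero>\<^bsub>CC\<^esub>" using p(3) by (simp add: CC_eval_coeffs)
      qed
    qed
    show "C.splitted P" if "P \<in> carrier (K[X]\<^bsub>CC\<^esub>)" for P
      using C.roots_over_carrier C.carrier_polynomial_shell[OF subfieldE(1)[OF sf] that] .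
  qed
  then show ?thesis
    using sf by (intro algebraic_closure.intro C.field_axioms)
qed

lemma has_char_zero_CC: "1 \<in> K \<Longrightarrow> has_char_zero (CC\<lparr>carrier := K\<rparr>)"
proof -
  have "[m] \<cdot>\<^bsub>CC\<lparr>carrier := K\<rparr>\<^esub> 1 = of_nat m" for m :: nat
    by (induction m) (simp_all add: add_pow_def nat_pow_def CC_def)
  then show ?thesis by (simp add: has_char_zero_def CC_def)
qed

section \<open>Polynomials in three variables\<close>

type_synonym p3 = "complex poly poly poly"

text \<open>The innermost variable is \<open>z\<close>, then \<open>y\<close>, and in
  \<open>p3\<close> the outermost is \<open>x\<close>. With \<open>x\<close> outside, reduction
  modulo the curve, which is quadratic in \<open>x\<close>, is an induction over
  \<open>pCons\<close>.\<close>

definition ev2 :: "complex poly poly \<Rightarrow> complex \<Rightarrow> complex \<Rightarrow> complex" where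
  "ev2 a y z = poly (poly a [:y:]) z"

definition ev3 :: "p3 \<Rightarrow> complex \<Rightarrow> complex \<Rightarrow> complex \<Rightarrow> complex" where
  "ev3 p x y z = ev2 (poly p [:[:x:]:]) y z"

definition px :: p3 where "px = [:0, 1:]"
definition py :: p3 where "py = [:[:0, 1:]:]"
definition pz :: p3 where "pz = [:[:[:0, 1:]:]:]"
definition pc :: "complex \<Rightarrow> p3" where "pc c = [:[:[:c:]:]:]"

lemma ev2_simps [simp]:
  "ev2 (p + q) y z = ev2 p y z + ev2 q y z" "ev2 (p * q) y z = ev2 p y z * ev2 q y z"
  "ev2 (p - q) y z = ev2 p y z - ev2 q y z" "ev2 (- p) y z = - ev2 p y z" "ev2 0 y z = 0" "ev2 1 y z = 1"
  "ev2 (p ^ n) y z = ev2 p y z ^ n" "ev2 (numeral k) y z = numeral k"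
  by (simp_all add: ev2_def poly_numeral)

lemma ev3_simps [simp]:
  "ev3 (p + q) x y z = ev3 p x y z + ev3 q x y z" "ev3 (p * q) x y z = ev3 p x y z * ev3 q x y z"
  "ev3 (p - q) x y z = ev3 p x y z - ev3 q x y z" "ev3 (- p) x y z = - ev3 p x y z" "ev3 0 x y z = 0" "ev3 1 x y z = 1"
  "ev3 (p ^ n) x y z = ev3 p x y z ^ n" "ev3 (numeral k) x y z = numeral k"
  "ev3 px x y z = x" "ev3 py x y z = y" "ev3 pz x y z = z" "ev3 (pc c) x y z = c"
  by (simp_all add: ev3_def poly_numeral px_def py_def pz_def pc_def) (simp_all add: ev2_def)

lemma ev3_sum [simp]: "ev3 (sum f A) x y z = (\<Sum>i\<in>A. ev3 (f i) x y z)"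
  by (induction A rule: infinite_finite_induct) auto

lemma ev3_prod [simp]: "ev3 (prod f A) x y z = (\<Prod>i\<in>A. ev3 (f i) x y z)"
  by (induction A rule: infinite_finite_induct) auto

lemma ev3_const: "ev3 [:a:] x y z = ev2 a y z"
  by (simp add: ev3_def)

lemma infinite_roots_0:
  fixes p :: "'a::idom poly"
  assumes "infinite A" "\<And>a. a \<in> A \<Longrightarrow> poly p a = 0"
  shows "p = 0"
proof (rule ccontr)
  assume "p \<noteq> 0"
  then have "finite {x. poly p x = 0}" by (rule poly_roots_finite)
  then show False using assms by (meson finite_subset mem_Collect_eq subsetI)
qed

text \<open>The infinite set is arbitrary so that vanishing can be tested at points with coordinates
  in \<open>K\<close> only.\<close>

lemma ev2_zero:
  assumes "infinite A" "\<And>y z. y \<in> A \<Longrightarrow> z \<in> A \<Longrightarrow> ev2 p y z = 0"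
  shows "p = 0"
proof -
  have "poly p [:y:] = 0" if "y \<in> A" for y
    by (rule infinite_roots_0[OF assms(1)]) (use assms(2)[OF that] in \<open>simp add: ev2_def\<close>)
  moreover have "infinite ((\<lambda>y. [:y:]) ` A)"
    using assms(1) by (subst finite_image_iff) (auto simp: inj_on_def)
  ultimately show ?thesis by (intro infinite_roots_0[of "(\<lambda>y. [:y:]) ` A"]) auto
qed

lemma ev3_zero:
  assumes "\<And>x y z. ev3 p x y z = 0"
  shows "p = 0"
proof -
  have "poly p [:[:x:]:] = 0" for x
    by (rule ev2_zero[of UNIV]) (use assms in \<open>auto simp: ev3_def infinite_UNIV_char_0\<close>)
  moreover have "infinite ((\<lambda>x. [:[:x:]:] :: complex poly poly) ` UNIV)"
    by (subst finite_image_iff) (auto simp: inj_on_def infinite_UNIV_char_0)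
  ultimately show ?thesis by (intro infinite_roots_0[of "(\<lambda>x. [:[:x:]:]) ` UNIV"]) auto
qed

lemma ev3_eq: "(\<And>x y z. ev3 p x y z = ev3 q x y z) \<Longrightarrow> p = q"
  using ev3_zero[of "p - q"] by simp

lemma ev3_nonzero: "p \<noteq> 0 \<Longrightarrow> \<exists>x y z. ev3 p x y z \<noteq> 0"
  using ev3_zero by blast

text \<open>An identity valid off a hypersurface holds everywhere, because \<open>g * h\<close> is
  zero in an integral domain.\<close>

lemma ev3_dense:
  assumes "g \<noteq> 0" "\<And>x y z. ev3 g x y z \<noteq> 0 \<Longrightarrow> ev3 h x y z = 0"
  shows "h = 0"
proof -
  have "g * h = 0" by (rule ev3_zero) (use assms(2) in auto)
  then show ?thesis using assms(1) by simp
qed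

definition K2 :: "complex set \<Rightarrow> complex poly poly set" where "K2 K = polyset (polyset K)"
definition K3 :: "complex set \<Rightarrow> p3 set" where "K3 K = polyset (K2 K)"

lemma sring_K2: "sring K \<Longrightarrow> sring (K2 K)"
  unfolding K2_def by (intro sring_polyset)

lemma sring_K3: "sring K \<Longrightarrow> sring (K3 K)"
  unfolding K3_def by (intro sring_polyset sring_K2)

lemma K3_vars: "sring K \<Longrightarrow> px \<in> K3 K" "sring K \<Longrightarrow> py \<in> K3 K" "sring K \<Longrightarrow> pz \<in> K3 K"
  "sring K \<Longrightarrow> c \<in> K \<Longrightarrow> pc c \<in> K3 K"
  using sring_K2[of K] sring_polyset[of K]
  by (auto simp: px_def py_def pz_def pc_def K3_def K2_def polyset_pCons polyset_0 sringD)

lemma K2_ev2: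
  assumes "sring K" "a \<in> K2 K" "y \<in> K" "z \<in> K"
  shows "ev2 a y z \<in> K"
proof -
  have "[:y:] \<in> polyset K" using assms by (simp add: polyset_pCons polyset_0)
  then show ?thesis unfolding ev2_def
    using assms by (intro polyset_poly sring_polyset) (auto simp: K2_def)
qed

lemma divclosed_K3:
  assumes "sring K" "\<And>x. x \<in> K \<Longrightarrow> inverse x \<in> K"
  shows "divclosed (K3 K)"
proof -
  have "divclosed K"
    unfolding divclosed_def
  proof (intro allI impI)
    fix p q :: complex assume "q \<in> K" "q \<noteq> 0" "p * q \<in> K"
    then have "(p * q) * inverse q \<in> K" using assms sringD(4) by blast
    then show "p \<in> K" using \<open>q \<noteq> 0\<close> by (simp add: field_simps)
  qed
  then show ?thesis unfolding K3_def K2_def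
    by (intro divclosed_polyset sring_polyset assms)
qed

section \<open>The plane cubic fixed by the Cremona transformation\<close>

context cube_root_1
begin

lemma w_nz [simp]: "w \<noteq> 0"
  using w_eq by auto

text \<open>This is \<open>w * fkl 1 2\<close>, hence an eigenvector of the Heisenberg group; its
  zero set is the curve fixed pointwise by \<open>sg\<close>, as \<open>sg_curve\<close>
  shows.\<close>

definition cv :: "complex \<Rightarrow> complex \<Rightarrow> complex \<Rightarrow> complex" where
  "cv x y z = x\<^sup>2 * y + w\<^sup>2 * y\<^sup>2 * z + w * z\<^sup>2 * x"

definition fC :: p3 where
  "fC = px\<^sup>2 * py + pc (w\<^sup>2) * py\<^sup>2 * pz + pc w * pz\<^sup>2 * px"

lemma ev3_fC [simp]: "ev3 fC x y z = cv x y z"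
  by (simp add: fC_def cv_def)

definition vy :: "complex poly poly" where "vy = [:0, 1:]"
definition vz :: "complex poly poly" where "vz = [:[:0, 1:]:]"
definition vc :: "complex \<Rightarrow> complex poly poly" where "vc c = [:[:c:]:]"

lemma ev2_vars [simp]: "ev2 vy y z = y" "ev2 vz y z = z" "ev2 (vc c) y z = c"
  by (simp_all add: vy_def vz_def vc_def ev2_def)

lemma const_embed: "[:a * b:] = [:a:] * [:b:]" "[:a + b:] = [:a:] + [:b:]" "[:a - b:] = [:a:] - [:b:]"
  "[:a ^ n:] = [:a:] ^ n" for a b :: "complex poly poly"
  by (simp_all add: poly_const_pow)

text \<open>Pseudo-division by \<open>fC\<close>, which has degree 2 in \<open>x\<close> and leading
  coefficient \<open>y\<close>. Only powers of \<open>y\<close> have to be multiplied in, and all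
  coefficients of the remainder stay in \<open>K\<close>.\<close>

lemma curve_reduction:
  assumes K: "sring K" "w \<in> K" and h: "h \<in> K3 K"
  shows "\<exists>n A B q. A \<in> K2 K \<and> B \<in> K2 K \<and> py ^ n * h = q * fC + [:A:] + px * [:B:]"
  using h
proof (induction h rule: pCons_induct)
  case 0
  show ?case
    by (rule exI[of _ 0], rule exI[of _ 0], rule exI[of _ 0], rule exI[of _ 0])
       (use sringD[OF sring_K2[OF K(1)]] in simp)
next
  case (pCons a h)
  then have a: "a \<in> K2 K" and "h \<in> K3 K" by (auto simp: K3_def polyset_pCons)
  with pCons.IH obtain n A B q where IH: "A \<in> K2 K" "B \<in> K2 K" "py ^ n * h = q * fC + [:A:] + px * [:B:]"
    by blast
  \<comment> \<open>The remainder after multiplication by \<open>x * y\<close>, with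
    \<open>x ^ 2 * y\<close> replaced by means of the equation of the curve.\<close>
  let ?A = "vy ^ (Suc n) * a - vc (w\<^sup>2) * vy\<^sup>2 * vz * B" and ?B = "vy * A - vc w * vz\<^sup>2 * B"
  let ?q = "px * py * q + [:B:]"
  note S = sringD[OF sring_K2[OF K(1)]]
  have v: "vy \<in> K2 K" "vz \<in> K2 K" "vc w \<in> K2 K" "vc (w\<^sup>2) \<in> K2 K"
    using K sring_polyset[OF K(1)] sring_power[OF K]
    by (auto simp: vy_def vz_def vc_def K2_def polyset_pCons polyset_0 sringD)
  have "?A \<in> K2 K" "?B \<in> K2 K"
    using v a IH by (auto intro!: S sring_power[OF sring_K2[OF K(1)]])
  moreover have "py ^ Suc n * pCons a h = ?q * fC + [:?A:] + px * [:?B:]"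
  proof -
    have 1: "pCons a h = [:a:] + px * h" by (simp add: px_def)
    have e: "[:vy:] = py" "[:vz:] = pz" "[:vc c:] = pc c" for c
      by (simp_all add: vy_def vz_def vc_def py_def pz_def pc_def)
    have fc: "px * (px * py) = fC - pc (w\<^sup>2) * py\<^sup>2 * pz - pc w * pz\<^sup>2 * px"
      by (simp add: fC_def power2_eq_square algebra_simps)
    have "py ^ Suc n * pCons a h = py ^ Suc n * [:a:] + px * py * (py ^ n * h)"
      unfolding 1 by (simp add: algebra_simps)
    also have "\<dots> = py ^ Suc n * [:a:] + px * py * q * fC + px * py * [:A:] + (px * (px * py)) * [:B:]"
      unfolding IH(3) by (simp add: algebra_simps)
    also have "\<dots> = ?q * fC + [:?A:] + px * [:?B:]"
      unfolding fc const_embed e by (simp add: algebra_simps)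
    finally show ?thesis .
  qed
  ultimately show ?case by blast
qed

text \<open>At points without zero coordinates the factors \<open>y ^ n\<close> from pseudo-division
  can be cancelled. By \<open>vanC_dvd\<close> the condition is still equivalent to divisibility by
  \<open>fC\<close>.\<close>

definition vanC :: "p3 \<Rightarrow> bool" where
  "vanC h \<longleftrightarrow> (\<forall>x y z. cv x y z = 0 \<longrightarrow> x \<noteq> 0 \<longrightarrow> y \<noteq> 0 \<longrightarrow> z \<noteq> 0 \<longrightarrow> ev3 h x y z = 0)"

text \<open>For fixed \<open>y\<close> and \<open>z\<close> the equation is quadratic in
  \<open>x\<close> with discriminant \<open>w ^ 2 * z * (z ^ 3 - 4 * y ^ 3)\<close>. The last two
  conclusions are Vieta's formulas.\<close>

lemma cv_roots:
  assumes "y \<noteq> 0" "z \<noteq> 0" "z ^ 3 - 4 * y ^ 3 \<noteq> 0"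
  obtains x x' where "x \<noteq> x'" "x \<noteq> 0" "x' \<noteq> 0" "cv x y z = 0" "cv x' y z = 0"
    "y * (x + x') = - w * z\<^sup>2" "x * x' = w\<^sup>2 * y * z"
proof -
  define s where "s = csqrt (w\<^sup>2 * z * (z ^ 3 - 4 * y ^ 3))"
  have s2: "s * s = w\<^sup>2 * z * (z ^ 3 - 4 * y ^ 3)" unfolding s_def by (simp flip: power2_eq_square)
  have s0: "s \<noteq> 0" using assms by (simp add: s_def)
  define x where "x = (- w * z\<^sup>2 + s) / (2 * y)"
  define x' where "x' = (- w * z\<^sup>2 - s) / (2 * y)"
  have sum: "y * (x + x') = - w * z\<^sup>2" using assms(1) by (simp add: x_def x'_def field_simps)
  have "4 * y\<^sup>2 * (x * x') = (- w * z\<^sup>2 + s) * (- w * z\<^sup>2 - s)"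
    using assms(1) by (simp add: x_def x'_def field_simps power2_eq_square)
  also have "\<dots> = w\<^sup>2 * z ^ 4 - s * s" by (simp add: algebra_simps power2_eq_square power4_eq_xxxx)
  also have "\<dots> = 4 * y\<^sup>2 * (w\<^sup>2 * y * z)"
    unfolding s2 by (simp add: algebra_simps power2_eq_square power3_eq_cube power4_eq_xxxx)
  finally have prod: "x * x' = w\<^sup>2 * y * z" using assms(1) by simp
  have nz: "x \<noteq> 0" "x' \<noteq> 0" using prod assms by auto
  have ne: "x \<noteq> x'"
  proof
    assume "x = x'"
    then have "s = - s" using assms(1) by (simp add: x_def x'_def)
    then show False using s0 by simp
  qed
  have "cv x y z = x * (y * (x + x')) - y * (x * x') + w\<^sup>2 * y\<^sup>2 * z + w * z\<^sup>2 * x"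
    by (simp add: cv_def algebra_simps power2_eq_square)
  then have c1: "cv x y z = 0" unfolding sum prod by (simp add: algebra_simps power2_eq_square)
  have "cv x' y z = x' * (y * (x + x')) - y * (x * x') + w\<^sup>2 * y\<^sup>2 * z + w * z\<^sup>2 * x'"
    by (simp add: cv_def algebra_simps power2_eq_square)
  then have c2: "cv x' y z = 0" unfolding sum prod by (simp add: algebra_simps power2_eq_square)
  show ?thesis by (rule that[OF ne nz c1 c2 sum prod])
qed

definition gen :: "complex poly poly" where "gen = vy * vz * (vz ^ 3 - 4 * vy ^ 3)"

lemma gen_nz: "gen \<noteq> 0"
proof
  assume "gen = 0"
  then have "ev2 gen 1 1 = 0" by simp
  then show False by (simp add: gen_def)
qed

lemma ev2_gen: "ev2 gen y z \<noteq> 0 \<longleftrightarrow> y \<noteq> 0 \<and> z \<noteq> 0 \<and> z ^ 3 - 4 * y ^ 3 \<noteq> 0"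
  by (simp add: gen_def)

lemma ev2_dense:
  assumes "\<And>y z. y \<noteq> 0 \<Longrightarrow> z \<noteq> 0 \<Longrightarrow> z ^ 3 - 4 * y ^ 3 \<noteq> 0 \<Longrightarrow> ev2 p y z = 0"
  shows "p = 0"
proof -
  have "gen * p = 0"
  proof (rule ev2_zero[of UNIV])
    show "ev2 (gen * p) y z = 0" for y z using assms[of y z] ev2_gen[of y z] by auto
  qed (simp add: infinite_UNIV_char_0)
  then show ?thesis using gen_nz by simp
qed

text \<open>Over general \<open>y\<close> and \<open>z\<close> the linear polynomial
  \<open>A + x * B\<close> vanishes at two distinct values of \<open>x\<close>. This also yields
  uniqueness of remainders.\<close>

lemma vanC_reduced:
  assumes "py ^ n * h = q * fC + [:A:] + px * [:B:]" "vanC h"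
  shows "A = 0" "B = 0"
proof -
  have *: "ev2 A y z + x * ev2 B y z = 0" if "cv x y z = 0" "x \<noteq> 0" "y \<noteq> 0" "z \<noteq> 0" for x y z
  proof -
    have "ev3 (py ^ n * h) x y z = ev2 A y z + x * ev2 B y z"
      unfolding assms(1) ev3_simps ev3_const ev3_fC that(1) by simp
    moreover have "ev3 h x y z = 0" using assms(2) that by (simp add: vanC_def)
    ultimately show ?thesis by simp
  qed
  have **: "ev2 A y z = 0 \<and> ev2 B y z = 0" if yz: "y \<noteq> 0" "z \<noteq> 0" "z ^ 3 - 4 * y ^ 3 \<noteq> 0" for y z
  proof -
    obtain x x' where x: "x \<noteq> x'" "x \<noteq> 0" "x' \<noteq> 0" "cv x y z = 0" "cv x' y z = 0"
      by (rule cv_roots[OF yz])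
    have "ev2 A y z + x * ev2 B y z = 0" "ev2 A y z + x' * ev2 B y z = 0"
      using * x yz by blast+
    then have "(x - x') * ev2 B y z = 0" by (simp add: algebra_simps add_eq_0_iff)
    then have "ev2 B y z = 0" using x(1) by simp
    then show ?thesis using \<open>ev2 A y z + x * ev2 B y z = 0\<close> by simp
  qed
  show "A = 0" "B = 0" by (rule ev2_dense; use ** in blast)+
qed

lemma reduced_vanC:
  assumes "py ^ n * h = q * fC"
  shows "vanC h"
  unfolding vanC_def
proof (intro allI impI)
  fix x y z assume c: "cv x y z = 0" "x \<noteq> 0" "y \<noteq> 0" "z \<noteq> 0"
  have "ev3 (py ^ n * h) x y z = 0" unfolding assms using c by simp
  then show "ev3 h x y z = 0" using c by simp
qed

lemma sring_UNIV: "sring UNIV" by (simp add: sring_def)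

lemma K3_UNIV: "h \<in> K3 UNIV" by (simp add: K3_def K2_def polyset_def)

lemma prime_py: "prime_elem py"
proof -
  have "prime_elem (vy :: complex poly poly)"
    unfolding prime_elem_def
  proof (intro conjI allI impI)
    have d: "vy dvd p \<longleftrightarrow> poly p 0 = 0" for p :: "complex poly poly"
      using poly_eq_0_iff_dvd[of p 0] by (simp add: vy_def)
    show "vy \<noteq> 0" by (simp add: vy_def)
    show "\<not> is_unit vy" unfolding d by simp
    show "vy dvd a \<or> vy dvd b" if "vy dvd a * b" for a b using that unfolding d by simp
  qed
  then show ?thesis by (simp add: py_def vy_def prime_elem_const_poly_iff)
qed

lemma py_ndvd_fC: "\<not> py dvd fC"
proof
  assume "py dvd fC"
  then obtain q where "fC = py * q" ..
  then have "ev3 fC 1 0 1 = 0" by simp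
  then show False by (simp add: cv_def)
qed

text \<open>The Nullstellensatz for this curve. The remainder vanishes, so \<open>fC\<close> divides
  \<open>y ^ n * h\<close>, and the prime \<open>y\<close> can be cancelled since it does not divide
  \<open>fC\<close>.\<close>

lemma vanC_dvd: "vanC h \<longleftrightarrow> fC dvd h"
proof
  assume v: "vanC h"
  obtain n A B q where r: "py ^ n * h = q * fC + [:A:] + px * [:B:]"
    using curve_reduction[OF sring_UNIV _ K3_UNIV, of h] by auto
  have "A = 0" "B = 0" using vanC_reduced[OF r v] by auto
  then have "py ^ n * h = q * fC" using r by simp
  then show "fC dvd h"
  proof (induction n arbitrary: q)
    case 0
    then show ?case by simp
  next
    case (Suc n)
    have "py dvd q * fC" using Suc.prems by (metis dvd_mult2 dvd_refl power_Suc)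
    then have "py dvd q" using prime_elem_dvd_multD[OF prime_py] py_ndvd_fC by blast
    then obtain q' where "q = py * q'" ..
    then have "py * (py ^ n * h) = py * (q' * fC)" using Suc.prems by (simp add: mult.assoc)
    then have "py ^ n * h = q' * fC" using prime_py by (metis mult_cancel_left prime_elem_def)
    then show ?case by (rule Suc.IH)
  qed
next
  assume "fC dvd h"
  then show "vanC h" by (auto simp: vanC_def elim!: dvdE)
qed

text \<open>The expression is \<open>y\<close> times the product of \<open>A + x * B\<close> over
  both roots \<open>x\<close> of the curve equation, so the lemma expresses its
  irreducibility.\<close>

lemma norm_zero:
  fixes A B :: "complex poly poly"
  assumes "A\<^sup>2 * vy - A * B * vc w * vz\<^sup>2 + B\<^sup>2 * vc (w\<^sup>2) * vy\<^sup>2 * vz = 0"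
  shows "A = 0 \<and> B = 0"
proof -
  have B: "B = 0"
  proof (rule ccontr)
    assume B: "B \<noteq> 0"
    have vc2: "vc (w\<^sup>2) = vc w * vc w" by (simp add: vc_def power2_eq_square)
    \<comment> \<open>Completing the square makes \<open>B ^ 2\<close> times the discriminant a
      square. That is impossible for nonzero \<open>B\<close>, as the discriminant has odd degree 3
      in \<open>y\<close>.\<close>
    have "(2 * vy * A - vc w * vz\<^sup>2 * B)\<^sup>2 =
        4 * vy * (A\<^sup>2 * vy - A * B * vc w * vz\<^sup>2 + B\<^sup>2 * vc (w\<^sup>2) * vy\<^sup>2 * vz) + B\<^sup>2 * (vc (w\<^sup>2) * vz * (vz ^ 3 - 4 * vy ^ 3))"
      unfolding vc2 by (simp add: algebra_simps power2_eq_square power3_eq_cube)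
    then have e: "(2 * vy * A - vc w * vz\<^sup>2 * B)\<^sup>2 = B\<^sup>2 * (vc (w\<^sup>2) * vz * (vz ^ 3 - 4 * vy ^ 3))"
      unfolding assms by simp
    have d3: "Polynomial.degree (vc (w\<^sup>2) * vz * (vz ^ 3 - 4 * vy ^ 3)) = 3"
    proof -
      have "vc (w\<^sup>2) * vz * (vz ^ 3 - 4 * vy ^ 3) =
          Polynomial.smult ([:w\<^sup>2:] * [:0, 1:]) [:[:0, 1:] ^ 3, 0, 0, - 4:]"
        by (simp add: vc_def vz_def vy_def numeral_poly power3_eq_cube)
      moreover have "[:w\<^sup>2:] * [:0, 1:] \<noteq> (0 :: complex poly)" by simp
      ultimately show ?thesis by (simp del: mult_pCons_left mult_pCons_right)
    qed
    have nz: "vc (w\<^sup>2) * vz * (vz ^ 3 - 4 * vy ^ 3) \<noteq> 0" using d3 by auto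
    have "2 * Polynomial.degree (2 * vy * A - vc w * vz\<^sup>2 * B) = 2 * Polynomial.degree B + 3"
      using arg_cong[OF e, of Polynomial.degree] B nz d3
      by (simp add: Polynomial.degree_mult_eq degree_power_eq del: mult_eq_0_iff) (metis degree_0 mult_0_right power_0_left zero_neq_numeral degree_power_eq mult.commute)
    then show False by presburger
  qed
  then have "A\<^sup>2 * vy = 0" using assms by simp
  then show ?thesis using B by (simp add: vy_def)
qed

text \<open>Irreducibility of the curve. At each of the two roots one of the reduced factors
  vanishes, so the product of the two norms vanishes identically and one norm is zero.\<close>

lemma vanC_mult:
  assumes "vanC (g * h)"
  shows "vanC g \<or> vanC h"
proof -
  obtain n A B q where r: "py ^ n * g = q * fC + [:A:] + px * [:B:]"
    using curve_reduction[OF sring_UNIV _ K3_UNIV, of g] by auto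
  obtain n' A' B' q' where r': "py ^ n' * h = q' * fC + [:A':] + px * [:B':]"
    using curve_reduction[OF sring_UNIV _ K3_UNIV, of h] by auto
  let ?N = "\<lambda>A B. A\<^sup>2 * vy - A * B * vc w * vz\<^sup>2 + B\<^sup>2 * vc (w\<^sup>2) * vy\<^sup>2 * vz"
  have ev: "ev2 (?N A B) y z = y * ((ev2 A y z + x * ev2 B y z) * (ev2 A y z + x' * ev2 B y z))"
    if "y * (x + x') = - w * z\<^sup>2" "x * x' = w\<^sup>2 * y * z" for A B x x' y z
  proof -
    have "y * ((ev2 A y z + x * ev2 B y z) * (ev2 A y z + x' * ev2 B y z)) =
       (ev2 A y z)\<^sup>2 * y + ev2 A y z * ev2 B y z * (y * (x + x')) + (ev2 B y z)\<^sup>2 * y * (x * x')"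
      by (simp add: algebra_simps power2_eq_square)
    also have "\<dots> = ev2 (?N A B) y z" unfolding that by (simp add: algebra_simps power2_eq_square)
    finally show ?thesis by simp
  qed
  have "?N A B * ?N A' B' = 0"
  proof (rule ev2_dense)
    fix y z :: complex assume yz: "y \<noteq> 0" "z \<noteq> 0" "z ^ 3 - 4 * y ^ 3 \<noteq> 0"
    obtain x x' where x: "x \<noteq> x'" "x \<noteq> 0" "x' \<noteq> 0" "cv x y z = 0" "cv x' y z = 0"
      "y * (x + x') = - w * z\<^sup>2" "x * x' = w\<^sup>2 * y * z"
      by (rule cv_roots[OF yz])
    have G: "ev2 A y z + t * ev2 B y z = y ^ n * ev3 g t y z" if "cv t y z = 0" for t
      using arg_cong[OF r, of "\<lambda>p. ev3 p t y z"] unfolding ev3_simps ev3_const ev3_fC that by simp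
    have H: "ev2 A' y z + t * ev2 B' y z = y ^ n' * ev3 h t y z" if "cv t y z = 0" for t
      using arg_cong[OF r', of "\<lambda>p. ev3 p t y z"] unfolding ev3_simps ev3_const ev3_fC that by simp
    have "ev3 g x y z * ev3 h x y z = 0"
      using assms x yz unfolding vanC_def ev3_simps by blast
    then show "ev2 (?N A B * ?N A' B') y z = 0"
      unfolding ev2_simps(2)[of "?N A B"] ev[OF x(6,7)] G[OF x(4)] G[OF x(5)] H[OF x(4)] H[OF x(5)]
      by auto
  qed
  then have "?N A B = 0 \<or> ?N A' B' = 0" by (simp only: mult_eq_0_iff)
  then show ?thesis
  proof
    assume "?N A B = 0"
    then have "A = 0" "B = 0" using norm_zero by blast+
    then show ?thesis using r reduced_vanC[of n g q] by simp
  next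
    assume "?N A' B' = 0"
    then have "A' = 0" "B' = 0" using norm_zero by blast+
    then show ?thesis using r' reduced_vanC[of n' h q'] by simp
  qed
qed

lemma fC_nz [simp]: "fC \<noteq> 0"
proof
  assume "fC = 0"
  then have "ev3 fC 1 0 1 = 0" by simp
  then show False by (simp add: cv_def)
qed

lemma degree_fC: "Polynomial.degree fC = 2"
proof -
  show ?thesis by (simp add: fC_def px_def py_def pz_def pc_def power2_eq_square)
qed

text \<open>The largest common power of \<open>fC\<close> exists because the degree in
  \<open>x\<close> of the nonzero entry \<open>V i0\<close> bounds the exponent.\<close>

lemma fC_order:
  assumes "finite I" "i0 \<in> I" "V i0 \<noteq> 0"
  shows "\<exists>m V'. (\<forall>i\<in>I. V i = fC ^ m * V' i) \<and> (\<exists>i\<in>I. \<not> vanC (V' i))"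
proof -
  let ?P = "\<lambda>m. \<forall>i\<in>I. fC ^ m dvd V i"
  have bd: "m \<le> Polynomial.degree (V i0)" if "?P m" for m
  proof -
    have "Polynomial.degree (fC ^ m) \<le> Polynomial.degree (V i0)"
      using that assms by (intro dvd_imp_degree_le) auto
    then show ?thesis by (simp add: degree_power_eq degree_fC)
  qed
  have "?P 0" by simp
  then obtain m where m: "?P m" "\<And>m'. ?P m' \<Longrightarrow> m' \<le> m"
    using GreatestI_nat[of ?P 0 "Polynomial.degree (V i0)"] Greatest_le_nat[of ?P _ "Polynomial.degree (V i0)"] bd by blast
  then have "\<forall>i\<in>I. \<exists>v. V i = fC ^ m * v" by (auto simp: dvd_def)
  then obtain V' where V': "\<forall>i\<in>I. V i = fC ^ m * V' i" by metis
  have "\<exists>i\<in>I. \<not> vanC (V' i)"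
  proof (rule ccontr)
    assume "\<not> ?thesis"
    then have "\<forall>i\<in>I. fC dvd V' i" by (simp add: vanC_dvd)
    then have "?P (Suc m)" using V' by (auto intro: mult_dvd_mono simp: mult.commute[of fC])
    then show False using m(2) by fastforce
  qed
  then show ?thesis using V' by blast
qed

end

section \<open>Splitting forms in nine coordinates by characters\<close>

lemma list3: "length u = 3 \<Longrightarrow> u = [u ! 0, u ! 1, u ! 2]"
  by (auto simp: length_Suc_conv eval_nat_numeral)

lemma sum3: "(\<Sum>i<3. g i) = g 0 + g 1 + g (2::nat)"
  by (simp add: eval_nat_numeral)

lemma ffun_in:
  assumes "subring_C k" "h \<in> ffun k n d" "length v = Suc n" "set v \<subseteq> k"
  shows "h v \<in> k"
proof -
  interpret subring_C k by fact
  obtain F where F: "\<forall>e\<in>hexps n d. F e \<in> k" "\<forall>v. length v = Suc n \<longrightarrow> h v = (\<Sum>e\<in>hexps n d. F e * mon n e v)"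
    using ffunE[OF assms(2)] by blast
  have "v ! i \<in> k" if "i \<le> n" for i using assms(3,4) that by (auto simp: subset_iff)
  then have "(\<Sum>e\<in>hexps n d. F e * mon n e v) \<in> k"
    using F(1) unfolding mon_def by (intro ksum kmult kprod kpow) auto
  then show ?thesis using F(2) assms(3) by simp
qed

lemma ffun_pull:
  assumes k: "subring_C k" and h: "h \<in> ffun k n d" and G: "\<And>j. j \<le> n \<Longrightarrow> G j \<in> K3 k"
  shows "\<exists>P\<in>K3 k. \<forall>x y z. ev3 P x y z = h (map (\<lambda>j. ev3 (G j) x y z) [0..<Suc n])"
proof -
  have sk: "sring (K3 k)" using k sring_K3 sring_subring_C by blast
  obtain F where F: "\<forall>e\<in>hexps n d. F e \<in> k" "\<forall>v. length v = Suc n \<longrightarrow> h v = (\<Sum>e\<in>hexps n d. F e * mon n e v)"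
    using ffunE[OF h] by blast
  let ?P = "\<Sum>e\<in>hexps n d. pc (F e) * (\<Prod>i\<le>n. G i ^ (e ! i))"
  show ?thesis
  proof (rule bexI[of _ ?P])
    show "?P \<in> K3 k"
      by (intro sring_sum sring_prod sring_power sringD(4) sk K3_vars(4)) (use F G k sring_subring_C in auto)
    show "\<forall>x y z. ev3 ?P x y z = h (map (\<lambda>j. ev3 (G j) x y z) [0..<Suc n])"
      by (simp add: F mon_def nth_map_upt less_Suc_eq_le del: upt_Suc cong: prod.cong_simp)
  qed
qed

text \<open>Coordinates are numbered \<open>3 * k + l\<close>, where \<open>k\<close> and
  \<open>l\<close> index a character. Cube roots of unity give the Heisenberg action, and
  \<open>al\<close>, \<open>be\<close> undo the twist.\<close>

definition sc :: "complex \<Rightarrow> complex \<Rightarrow> complex list \<Rightarrow> complex list" where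
  "sc g d v = map (\<lambda>m. g ^ (m div 3) * d ^ (m mod 3) * v ! m) [0..<Suc 8]"

lemma sc_len [simp]: "length (sc g d v) = 9"
  by (simp add: sc_def)

lemma sc_nth [simp]: "m < 9 \<Longrightarrow> sc g d v ! m = g ^ (m div 3) * d ^ (m mod 3) * v ! m"
  unfolding sc_def by (subst nth_map_upt) simp_all

lemma sc_sc: "sc g d (sc g' d' v) = sc (g * g') (d * d') v"
  by (rule nth_equalityI) (simp_all add: power_mult_distrib)

lemma sc_1: "length v = 9 \<Longrightarrow> sc 1 1 v = v"
  by (rule nth_equalityI) simp_all

text \<open>A form in the nine coordinates decomposes into components on which the scalings \<open>sc\<close> by cube
  roots of unity act through characters; each component absorbs scalings by cube roots of elements of \<open>k\<close>
  up to a scalar factor.\<close>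

lemma character_split:
  assumes k: "subring_C k" and h: "h \<in> ffun k 8 d"
  shows "\<exists>H. (\<forall>i<3. \<forall>j<3. H i j \<in> ffun k 8 d) \<and>
    (\<forall>v. length v = 9 \<longrightarrow> h v = (\<Sum>i<3. \<Sum>j<3. H i j v)) \<and>
    (\<forall>g e v i j. g ^ 3 = 1 \<longrightarrow> e ^ 3 = 1 \<longrightarrow> length v = 9 \<longrightarrow> i < 3 \<longrightarrow> j < 3 \<longrightarrow>
       H i j (sc g e v) = g ^ i * e ^ j * H i j v) \<and>
    (\<forall>g e i j. g ^ 3 \<in> k \<longrightarrow> e ^ 3 \<in> k \<longrightarrow> i < 3 \<longrightarrow> j < 3 \<longrightarrow>
       (\<exists>H'\<in>ffun k 8 d. \<forall>v. length v = 9 \<longrightarrow> H i j (sc g e v) = g ^ i * e ^ j * H' v))"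
proof -
  interpret subring_C k by fact
  obtain F where F: "\<forall>e\<in>hexps 8 d. F e \<in> k" "\<forall>v. length v = Suc 8 \<longrightarrow> h v = (\<Sum>e\<in>hexps 8 d. F e * mon 8 e v)"
    using ffunE[OF h] by blast
  define a where "a e = (\<Sum>m\<le>8. (m div 3) * e ! m)" for e :: "nat list"
  define b where "b e = (\<Sum>m\<le>8. (m mod 3) * e ! m)" for e :: "nat list"
  have ms: "mon 8 e (sc g t v) = g ^ a e * t ^ b e * mon 8 e v" for e g t v
  proof -
    have "mon 8 e (sc g t v) = (\<Prod>m\<le>8. g ^ ((m div 3) * e ! m) * t ^ ((m mod 3) * e ! m) * (v ! m) ^ (e ! m))"
      unfolding mon_def by (rule prod.cong) (auto simp: power_mult_distrib power_mult)
    then show ?thesis by (simp only: prod.distrib power_sum a_def b_def mon_def)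
  qed
  define I where "I i j = {e \<in> hexps 8 d. a e mod 3 = i \<and> b e mod 3 = j}" for i j
  define H where "H i j v = (\<Sum>e\<in>I i j. F e * mon 8 e v)" for i j v
  have Iff: "(\<lambda>v. \<Sum>e\<in>I i j. C e * mon 8 e v) \<in> ffun k 8 d" if "\<And>e. e \<in> I i j \<Longrightarrow> C e \<in> k" for C i j
    by (intro ffun_sum ffun_smult ffun_mon that) (auto simp: I_def)
  \<comment> \<open>On a component the residue of the exponent is constant and can be taken out;
    what remains is a power of \<open>g ^ 3\<close>, which lies in \<open>k\<close>.\<close>
  have red: "g ^ n = g ^ (n mod 3) * (g ^ 3) ^ (n div 3)" for g :: complex and n
    by (simp flip: power_mult power_add)
  have Hs: "H i j (sc g t v) = g ^ i * t ^ j * (\<Sum>e\<in>I i j. (F e * (g ^ 3) ^ (a e div 3) * (t ^ 3) ^ (b e div 3)) * mon 8 e v)"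
    for g t v i j
    unfolding H_def sum_distrib_left
  proof (rule sum.cong[OF refl])
    fix e assume e: "e \<in> I i j"
    show "F e * mon 8 e (sc g t v) = g ^ i * t ^ j * (F e * (g ^ 3) ^ (a e div 3) * (t ^ 3) ^ (b e div 3) * mon 8 e v)"
      unfolding ms red[of g "a e"] red[of t "b e"] using e by (simp add: I_def mult_ac)
  qed
  have 1: "H i j \<in> ffun k 8 d" for i j
    unfolding H_def by (rule Iff) (use F in \<open>auto simp: I_def\<close>)
  have 2: "h v = (\<Sum>i<3. \<Sum>j<3. H i j v)" if "length v = 9" for v
  proof -
    have "h v = (\<Sum>e\<in>hexps 8 d. F e * mon 8 e v)" using F that by simp
    also have "hexps 8 d = (\<Union>x\<in>{..<3} \<times> {..<3}. I (fst x) (snd x))" by (auto simp: I_def)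
    also have "(\<Sum>e\<in>\<dots>. F e * mon 8 e v) = (\<Sum>x\<in>{..<3} \<times> {..<3}. H (fst x) (snd x) v)"
      unfolding H_def by (rule sum.UNION_disjoint) (auto simp: I_def)
    also have "\<dots> = (\<Sum>i<3. \<Sum>j<3. H i j v)" by (simp add: sum.cartesian_product case_prod_unfold)
    finally show ?thesis .
  qed
  have 3: "H i j (sc g e v) = g ^ i * e ^ j * H i j v" if "g ^ 3 = 1" "e ^ 3 = 1" for g e v i j
    unfolding Hs that by (simp add: H_def)
  have 4: "\<exists>H'\<in>ffun k 8 d. \<forall>v. length v = 9 \<longrightarrow> H i j (sc g e v) = g ^ i * e ^ j * H' v"
    if "g ^ 3 \<in> k" "e ^ 3 \<in> k" for g e i j
    by (rule bexI[OF _ Iff[of i j "\<lambda>e'. F e' * (g ^ 3) ^ (a e' div 3) * (e ^ 3) ^ (b e' div 3)"]])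
       (use F that in \<open>auto simp: Hs I_def\<close>)
  show ?thesis by (rule exI[of _ H]) (use 1 2 3 4 in blast)
qed

section \<open>The twisted embedding of the plane and its equations over the base field\<close>

locale severi_brauer = cube_root_1 w for w +
  fixes al be :: complex and K :: "complex set"
  assumes al3: "al ^ 3 = 2" and be3: "be ^ 3 = w" and good: "good_field K"
begin

lemma sK: "sring K" and Kinv: "x \<in> K \<Longrightarrow> inverse x \<in> K" and wK [simp]: "w \<in> K"
  using good_fieldD[OF good] by blast+

sublocale K: subring_C K
  using sK sring_subring_C by blast

lemma nz [simp]: "al \<noteq> 0" "be \<noteq> 0"
  using al3 be3 by auto

lemma w3: "w ^ 3 = 1"
  by (simp add: power3_eq_cube ww algebra_simps)

lemma w_pow_num: "w ^ 2 = - 1 - w" "w ^ 4 = w" "w ^ 6 = 1" "w ^ 8 = - 1 - w"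
proof -
  show 2: "w ^ 2 = - 1 - w" by (rule w2)
  have "w ^ 4 = w ^ 3 * w" "w ^ 6 = w ^ 3 * w ^ 3" "w ^ 8 = w ^ 3 * (w ^ 3 * w ^ 2)"
    by (simp_all flip: power_add power_Suc2)
  then show "w ^ 4 = w" "w ^ 6 = 1" "w ^ 8 = - 1 - w" by (simp_all add: w3 2)
qed

lemma w_pow_mod: "w ^ n = w ^ (n mod 3)"
proof -
  have "w ^ n = w ^ (n mod 3) * (w ^ 3) ^ (n div 3)" by (simp flip: power_mult power_add)
  then show ?thesis by (simp add: w3)
qed

text \<open>For fixed \<open>l\<close> this is a discrete Fourier transform of the monomials
  \<open>u_i * u_(i+l) ^ 2\<close>, since \<open>2 * i * k\<close> stands for \<open>- i * k\<close>
  modulo 3. The result is a simultaneous eigenvector of the Heisenberg group, with a different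
  character for each pair \<open>k, l\<close>.\<close>

definition fkl :: "nat \<Rightarrow> nat \<Rightarrow> complex list \<Rightarrow> complex" where
  "fkl k l u = (\<Sum>i<3. w ^ (2 * i * k) * (u ! i * (u ! ((i + l) mod 3))\<^sup>2))"

definition fvec :: "complex list \<Rightarrow> complex list" where
  "fvec u = map (\<lambda>m. fkl (m div 3) (m mod 3) u) [0..<Suc 8]"

text \<open>The twist: a field automorphism that moves \<open>al\<close> or \<open>be\<close> by
  cube roots of unity changes \<open>phi\<close> by a scaling \<open>sc\<close>, which an element of
  the Heisenberg group compensates. Therefore the image is a variety over \<open>K\<close>.\<close>

definition phi :: "complex list \<Rightarrow> complex list" where
  "phi u = sc (inverse al) (inverse be) (fvec u)"

definition S :: "complex list set set" where
  "S = (\<lambda>u. pt (phi u)) ` vecs 2"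

text \<open>The inverse transform; \<open>j + 2 * i\<close> is the difference \<open>j - i\<close>
  modulo 3. It yields the matrix of rank one in \<open>rm_fvec\<close>, and for coordinates in
  \<open>K\<close> the matrix \<open>Rm v\<close> represents an element of the cyclic
  algebra.\<close>

definition rm :: "complex list \<Rightarrow> nat \<Rightarrow> nat \<Rightarrow> complex" where
  "rm t i j = (\<Sum>k<3. w ^ (i * k) * t ! (3 * k + (j + 2 * i) mod 3))"

abbreviation Rm :: "complex list \<Rightarrow> nat \<Rightarrow> nat \<Rightarrow> complex" where
  "Rm v \<equiv> rm (sc al be v)"

lemma idx_less: "k < 3 \<Longrightarrow> 3 * k + x mod 3 < (9::nat)"
proof -
  assume "k < 3"
  moreover have "x mod 3 < 3" by simp
  ultimately show ?thesis by linarith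
qed

lemma fvec_len [simp]: "length (fvec u) = 9" by (simp add: fvec_def)
lemma phi_len [simp]: "length (phi u) = 9" by (simp add: phi_def)

lemma fvec_nth [simp]: "m < 9 \<Longrightarrow> fvec u ! m = fkl (m div 3) (m mod 3) u"
  unfolding fvec_def by (subst nth_map_upt) simp_all

lemma sc_phi: "sc al be (phi u) = fvec u"
  by (simp add: phi_def sc_sc sc_1)

lemma rm_fvec: "i < 3 \<Longrightarrow> j < 3 \<Longrightarrow> rm (fvec u) i j = 3 * (u ! i * (u ! j)\<^sup>2)"
proof -
  assume "i < 3" "j < 3"
  then show ?thesis
    by (elim less_3[THEN disjE] disjE; simp add: rm_def fkl_def sum3 w_pow_num; simp add: ww ww' algebra_simps flip: numeral_2_eq_2)
qed

lemma rm_inv: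
  assumes "length t = 9" "\<And>i j. i < 3 \<Longrightarrow> j < 3 \<Longrightarrow> rm t i j = 0" "m < 9"
  shows "t ! m = 0"
proof -
  have m: "m = 3 * (m div 3) + m mod 3" "m div 3 < 3" "m mod 3 < 3" using assms(3) by auto
  have "3 * t ! (3 * k + l) = (\<Sum>i<3. w ^ (2 * i * k) * rm t i ((i + l) mod 3))" if kl: "k < 3" "l < 3" for k l
  proof -
    consider "l = 0" | "l = 1" | "l = 2" using less_3[OF kl(2)] by blast
    then show ?thesis
      using less_3[OF kl(1)]
      by cases (elim disjE; simp add: rm_def sum3 w_pow_num; simp add: ww ww' algebra_simps flip: numeral_2_eq_2)+
  qed
  from this[OF m(2,3)] have "3 * t ! (3 * (m div 3) + m mod 3) = 0"
    using assms(2) by (simp add: sum3)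
  then show ?thesis using m(1) by simp
qed

lemma phi_vecs: "u \<in> vecs 2 \<Longrightarrow> phi u \<in> vecs 8"
proof -
  assume u: "u \<in> vecs 2"
  then obtain i where i: "i \<le> 2" "u ! i \<noteq> 0" by (auto simp: vecs_def)
  have "\<exists>m<9. phi u ! m \<noteq> 0"
  proof (rule ccontr)
    assume "\<not> ?thesis"
    then have "sc al be (phi u) ! m = 0" if "m < 9" for m using that by simp
    then have z: "fvec u ! m = 0" if "m < 9" for m using that unfolding sc_phi by simp
    have "rm (fvec u) i i = 0"
      unfolding rm_def using z i(1) by (auto intro!: sum.neutral simp del: fvec_nth)
    then show False using rm_fvec[of i i u] i by simp
  qed
  then obtain m where "m < 9" "phi u ! m \<noteq> 0" by blast
  then show ?thesis unfolding vecs_def by (intro CollectI conjI exI[of _ m]) simp_all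
qed

lemma fkl_scale: "length u = 3 \<Longrightarrow> fkl k l (map ((*) c) u) = c ^ 3 * fkl k l u"
  by (simp add: fkl_def sum3 algebra_simps power2_eq_square power3_eq_cube)

lemma phi_scale: "length u = 3 \<Longrightarrow> phi (map ((*) c) u) = map ((*) (c ^ 3)) (phi u)"
  by (rule nth_equalityI) (simp_all add: phi_def fkl_scale mult_ac)

lemma pt_phi_cong: "length u = 3 \<Longrightarrow> pt u = pt u' \<Longrightarrow> pt (phi u) = pt (phi u')"
proof -
  assume u: "length u = 3" "pt u = pt u'"
  then obtain c where c: "c \<noteq> 0" "u = map ((*) c) u'" by (auto simp: pt_eq_iff)
  then have "phi u = map ((*) (c ^ 3)) (phi u')" using u by (simp add: phi_scale)
  then show ?thesis using c pt_eqI[of "c ^ 3"] by simp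
qed

lemma Rm_scale: "length v = 9 \<Longrightarrow> i < 3 \<Longrightarrow> Rm (map ((*) c) v) i j = c * Rm v i j"
  by (auto simp: rm_def sum3 algebra_simps)

lemma Rm_phi: "i < 3 \<Longrightarrow> j < 3 \<Longrightarrow> Rm (phi u) i j = 3 * (u ! i * (u ! j)\<^sup>2)"
  by (simp add: sc_phi rm_fvec)

text \<open>At \<open>phi u\<close> every nonzero column is a multiple of \<open>u\<close>. Columns
  thus provide local inverses of the embedding.\<close>

definition col :: "nat \<Rightarrow> complex list \<Rightarrow> complex list" where
  "col j v = map (\<lambda>i. Rm v i j) [0..<Suc 2]"

lemma col_nth: "i < 3 \<Longrightarrow> col j v ! i = Rm v i j"
  unfolding col_def by (subst nth_map_upt) simp_all

lemma col_len [simp]: "length (col j v) = 3" by (simp add: col_def)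

lemma col_phi: "length u = 3 \<Longrightarrow> j < 3 \<Longrightarrow> col j (map ((*) c) (phi u)) = map ((*) (c * 3 * (u ! j)\<^sup>2)) u"
  by (rule nth_equalityI) (simp_all add: col_nth Rm_scale Rm_phi)

lemma pt_phi_inj:
  assumes "u \<in> vecs 2" "u' \<in> vecs 2" "pt (phi u) = pt (phi u')"
  shows "pt u = pt u'"
proof -
  obtain c where c: "c \<noteq> 0" "phi u = map ((*) c) (phi u')" using assms by (auto simp: pt_eq_iff)
  have len: "length u = 3" "length u' = 3" using assms by (auto simp: vecs_def)
  obtain j where j: "j < 3" "u ! j \<noteq> 0" using assms by (auto simp: vecs_def less_Suc_eq_le numeral_3_eq_3 numeral_2_eq_2)
  have e: "map ((*) (1 * 3 * (u ! j)\<^sup>2)) u = map ((*) (c * 3 * (u' ! j)\<^sup>2)) u'"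
  proof -
    have "map ((*) 1) (phi u) = map ((*) c) (phi u')" using c by (simp add: map_idI)
    then show ?thesis
      unfolding col_phi[OF len(1) j(1), symmetric] col_phi[OF len(2) j(1), symmetric] by (rule arg_cong)
  qed
  have "u' ! j \<noteq> 0"
    using arg_cong[OF e, of "\<lambda>l. l ! j"] j len by auto
  then show ?thesis
    using e pt_eqI[of "1 * 3 * (u ! j)\<^sup>2" u] pt_eqI[of "c * 3 * (u' ! j)\<^sup>2" u'] j c by simp
qed

lemma S_proj: "S \<subseteq> proj_space CC 8"
  using phi_vecs by (auto simp: S_def proj_space_CC)

lemma rm_ffun: "i < 3 \<Longrightarrow> (\<lambda>t. rm t i j) \<in> ffun K 8 1"
  unfolding rm_def by (intro K.ffun_sum K.ffun_smult K.ffun_coord) (auto dest: idx_less[of _ "j + 2 * i"])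

text \<open>The Heisenberg group; \<open>Mt p q\<close> acts on the coordinates \<open>fkl\<close> through characters.\<close>

definition Mt :: "nat \<Rightarrow> nat \<Rightarrow> complex list \<Rightarrow> complex list" where
  "Mt p q u = map (\<lambda>i. w ^ (i * q) * u ! ((i + p) mod 3)) [0..<Suc 2]"

lemma Mt_nth: "i < 3 \<Longrightarrow> Mt p q u ! i = w ^ (i * q) * u ! ((i + p) mod 3)"
  unfolding Mt_def by (subst nth_map_upt) simp_all

lemma Mt_len [simp]: "length (Mt p q u) = 3" by (simp add: Mt_def)

text \<open>After the shift of \<open>i\<close> by \<open>p\<close> the exponents of
  \<open>w\<close> are compared modulo 3. Their difference is independent of \<open>i\<close>
  because a cubic monomial collects \<open>3 * (i * q)\<close>.\<close>

lemma fkl_Mt: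
  assumes "l < 3"
  shows "fkl k l (Mt p q u) = (w ^ p) ^ k * (w ^ (2 * q)) ^ l * fkl k l u"
proof -
  have "w ^ (2 * i * k) * (Mt p q u ! i * (Mt p q u ! ((i + l) mod 3))\<^sup>2)
     = (w ^ p) ^ k * (w ^ (2 * q)) ^ l * (w ^ (2 * ((i + p) mod 3) * k) * (u ! ((i + p) mod 3) * (u ! (((i + p) mod 3 + l) mod 3))\<^sup>2))"
    if i: "i < 3" for i
  proof -
    have j: "((i + l) mod 3 + p) mod 3 = ((i + p) mod 3 + l) mod 3"
      by (simp add: mod_add_left_eq mod_add_right_eq ac_simps)
    have "w ^ (2 * i * k) * (Mt p q u ! i * (Mt p q u ! ((i + l) mod 3))\<^sup>2)
      = w ^ (2 * i * k + i * q + 2 * ((i + l) mod 3 * q)) * (u ! ((i + p) mod 3) * (u ! (((i + p) mod 3 + l) mod 3))\<^sup>2)"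
      using i by (simp add: Mt_nth j power_mult_distrib power_add mult_ac flip: power_mult)
    also have "w ^ (2 * i * k + i * q + 2 * ((i + l) mod 3 * q)) = w ^ (p * k + 2 * q * l + 2 * ((i + p) mod 3) * k)"
    proof -
      have "(2 * i * k + i * q + 2 * ((i + l) mod 3 * q)) mod 3 = (2 * i * k + i * q + 2 * ((i + l) * q)) mod 3"
        by (intro mod_add_cong[OF refl] mod_mult_cong[OF refl] mod_mult_left_eq)
      also have "2 * i * k + i * q + 2 * ((i + l) * q) = 2 * i * k + 2 * q * l + 3 * (i * q)"
        by (simp add: algebra_simps)
      finally have 1: "(2 * i * k + i * q + 2 * ((i + l) mod 3 * q)) mod 3 = (2 * i * k + 2 * q * l) mod 3" by simp
      have "(p * k + 2 * q * l + 2 * ((i + p) mod 3) * k) mod 3 = (p * k + 2 * q * l + 2 * (i + p) * k) mod 3"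
        by (intro mod_add_cong[OF refl] mod_mult_cong[OF _ refl] mod_mult_right_eq)
      also have "p * k + 2 * q * l + 2 * (i + p) * k = 2 * i * k + 2 * q * l + 3 * (p * k)"
        by (simp add: algebra_simps)
      finally have 2: "(p * k + 2 * q * l + 2 * ((i + p) mod 3) * k) mod 3 = (2 * i * k + 2 * q * l) mod 3" by simp
      show ?thesis
        by (subst w_pow_mod, subst (2) w_pow_mod) (simp only: 1 2)
    qed
    also have "w ^ (p * k + 2 * q * l + 2 * ((i + p) mod 3) * k) = (w ^ p) ^ k * (w ^ (2 * q)) ^ l * w ^ (2 * ((i + p) mod 3) * k)"
      by (simp add: power_add power_mult)
    finally show ?thesis by (simp add: mult_ac)
  qed
  then have "fkl k l (Mt p q u) = (w ^ p) ^ k * (w ^ (2 * q)) ^ l *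
     (\<Sum>i<3. (\<lambda>i. w ^ (2 * i * k) * (u ! i * (u ! ((i + l) mod 3))\<^sup>2)) ((i + p) mod 3))"
    unfolding fkl_def sum_distrib_left by (intro sum.cong) auto
  also have "(\<Sum>i<3. (\<lambda>i. w ^ (2 * i * k) * (u ! i * (u ! ((i + l) mod 3))\<^sup>2)) ((i + p) mod 3)) = fkl k l u"
    unfolding fkl_def
  proof (rule sum.reindex_bij_betw)
    have "p mod 3 = 0 \<or> p mod 3 = 1 \<or> p mod 3 = 2" by auto
    moreover have "(i + p) mod 3 = (i + p mod 3) mod 3" for i by (simp add: mod_add_right_eq)
    moreover have "{..<3} = {0, 1, 2::nat}" by auto
    ultimately show "bij_betw (\<lambda>i. (i + p) mod 3) {..<3} {..<3}"
      by (auto simp: bij_betw_def inj_on_def)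
  qed
  finally show ?thesis .
qed

lemma fvec_Mt: "fvec (Mt p q u) = sc (w ^ p) (w ^ (2 * q)) (fvec u)"
  by (rule nth_equalityI) (simp_all add: fkl_Mt)

lemma w_pow3: "(w ^ p) ^ 3 = 1"
proof -
  have "(w ^ p) ^ 3 = (w ^ 3) ^ p" by (simp only: mult.commute flip: power_mult)
  then show ?thesis by (simp add: w3)
qed

text \<open>Invertibility of the Fourier transform on pairs of residues modulo 3, one variable at a
  time.\<close>

lemma fourier9:
  assumes "\<And>p q. p < 3 \<Longrightarrow> q < 3 \<Longrightarrow> (\<Sum>i<3. \<Sum>j<3. (w ^ p) ^ i * (w ^ q) ^ j * c i j) = 0" "i < 3" "j < 3"
  shows "c i j = 0"
proof -
  have one: "d i = 0" if "\<And>p. p < 3 \<Longrightarrow> (\<Sum>i<3. (w ^ p) ^ i * d i) = 0" "i < 3" for d :: "nat \<Rightarrow> complex" and i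
  proof -
    have "(\<Sum>p<3. w ^ (2 * p * i) * (\<Sum>i<3. (w ^ p) ^ i * d i)) = 3 * d i"
      using less_3[OF that(2)]
      by (elim disjE; simp add: sum3 w_pow_num power2_eq_square; simp add: ww ww' algebra_simps flip: numeral_2_eq_2)
    moreover have "(\<Sum>p<3. w ^ (2 * p * i) * (\<Sum>i<3. (w ^ p) ^ i * d i)) = 0"
      by (rule sum.neutral) (use that(1) in auto)
    ultimately show ?thesis by simp
  qed
  have "(\<Sum>j<3. (w ^ q) ^ j * c i j) = 0" if "q < 3" "i < 3" for q i
  proof (rule one[of "\<lambda>i. \<Sum>j<3. (w ^ q) ^ j * c i j"])
    show "(\<Sum>i<3. (w ^ p) ^ i * (\<Sum>j<3. (w ^ q) ^ j * c i j)) = 0" if "p < 3" for p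
      using assms(1)[OF that \<open>q < 3\<close>] by (simp add: sum_distrib_left mult.assoc)
  qed fact
  then show ?thesis using one[of "c i" j] assms(2,3) by blast
qed

text \<open>The image of \<open>fvec\<close> is stable under scalings by cube roots of unity, which
  come from the Heisenberg group. Hence each character component vanishes on it separately.\<close>

lemma split_fvec_zero:
  assumes Q: "\<And>u. length u = 3 \<Longrightarrow> Q (fvec u) = 0"
    and H: "\<And>v. length v = 9 \<Longrightarrow> Q v = (\<Sum>i<3. \<Sum>j<3. H i j v)"
    "\<And>g e v i j. g ^ 3 = 1 \<Longrightarrow> e ^ 3 = 1 \<Longrightarrow> length v = 9 \<Longrightarrow> i < 3 \<Longrightarrow> j < 3 \<Longrightarrow>
       H i j (sc g e v) = g ^ i * e ^ j * H i j v"
    and ij: "i < 3" "j < 3" and u: "length u = 3"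
  shows "H i j (fvec u) = 0"
proof (rule fourier9[OF _ ij])
  fix p q :: nat
  \<comment> \<open>\<open>Mt\<close> turns its second argument into \<open>w ^ (2 * q)\<close>, so
    \<open>2 * q\<close> is inserted to obtain the character \<open>w ^ q\<close>.\<close>
  have "w ^ (2 * (2 * q)) = w ^ q"
  proof -
    have "2 * (2 * q) mod 3 = q mod 3" by presburger
    then show ?thesis using w_pow_mod[of "2 * (2 * q)"] w_pow_mod[of q] by simp
  qed
  then have "fvec (Mt p (2 * q) u) = sc (w ^ p) (w ^ q) (fvec u)"
    by (simp add: fvec_Mt)
  then have "Q (sc (w ^ p) (w ^ q) (fvec u)) = 0" using Q[of "Mt p (2 * q) u"] by simp
  then show "(\<Sum>i<3. \<Sum>j<3. (w ^ p) ^ i * (w ^ q) ^ j * H i j (fvec u)) = 0"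
    using H w_pow3 by (simp cong: sum.cong_simp)
qed

text \<open>Descent through characters. Each component of \<open>Q\<close> vanishes on the image of
  \<open>fvec\<close>; after scaling by \<open>al\<close> and \<open>be\<close> it is a scalar times
  a form over \<open>K\<close>, which therefore vanishes on the surface and hence at
  \<open>v\<close>.\<close>

lemma form_descent:
  assumes Q: "Q \<in> ffun K 8 d" "\<And>u. length u = 3 \<Longrightarrow> Q (fvec u) = 0"
    and v: "length v = 9" "\<And>d h. h \<in> ffun K 8 d \<Longrightarrow> (\<And>u. length u = 3 \<Longrightarrow> h (phi u) = 0) \<Longrightarrow> h v = 0"
  shows "Q (sc al be v) = 0"
proof -
  obtain H where H: "\<forall>i<3. \<forall>j<3. H i j \<in> ffun K 8 d"
    "\<forall>v. length v = 9 \<longrightarrow> Q v = (\<Sum>i<3. \<Sum>j<3. H i j v)"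
    "\<forall>g e v i j. g ^ 3 = 1 \<longrightarrow> e ^ 3 = 1 \<longrightarrow> length v = 9 \<longrightarrow> i < 3 \<longrightarrow> j < 3 \<longrightarrow>
       H i j (sc g e v) = g ^ i * e ^ j * H i j v"
    "\<forall>g e i j. g ^ 3 \<in> K \<longrightarrow> e ^ 3 \<in> K \<longrightarrow> i < 3 \<longrightarrow> j < 3 \<longrightarrow>
       (\<exists>H'\<in>ffun K 8 d. \<forall>v. length v = 9 \<longrightarrow> H i j (sc g e v) = g ^ i * e ^ j * H' v)"
    using character_split[OF K.subring_C_axioms Q(1)] by blast
  have "H i j (sc al be v) = 0" if ij: "i < 3" "j < 3" for i j
  proof -
    obtain H' where H': "H' \<in> ffun K 8 d" "\<forall>v. length v = 9 \<longrightarrow> H i j (sc al be v) = al ^ i * be ^ j * H' v"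
      using H(4)[rule_format, of al be i j] ij al3 be3 by auto
    have "H' (phi u) = 0" if "length u = 3" for u
    proof -
      have "H i j (fvec u) = 0"
        by (rule split_fvec_zero[of Q]) (use Q(2) H ij that in auto)
      then show ?thesis using H'(2)[rule_format, of "phi u"] by (simp add: sc_phi)
    qed
    then have "H' v = 0" using v(2)[OF H'(1)] by blast
    then show ?thesis using H'(2) v(1) by simp
  qed
  then show ?thesis using H(2) by simp
qed

text \<open>All forms over \<open>K\<close> vanishing on the image are taken as equations. That they
  suffice is checked after untwisting, where \<open>form_descent\<close> makes two explicit families
  of relations available.\<close>

lemma S_closed: "closed_over CC K 8 S"
  unfolding closed_over_ffun
proof (intro exI conjI)
  let ?E = "{(d, h). h \<in> ffun K 8 d \<and> (\<forall>u. length u = 3 \<longrightarrow> h (phi u) = 0)}"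
  show "\<forall>(d, h)\<in>?E. h \<in> ffun K 8 d" by auto
  show "S = {p \<in> proj_space CC 8. \<forall>(d, h)\<in>?E. \<forall>v\<in>p. h v = 0}"
  proof (intro equalityI subsetI)
    fix p assume p: "p \<in> S"
    then obtain u where u: "u \<in> vecs 2" "p = pt (phi u)" by (auto simp: S_def)
    have "h v = 0" if h: "h \<in> ffun K 8 d" "\<forall>u. length u = 3 \<longrightarrow> h (phi u) = 0" "v \<in> p" for d h v
    proof -
      obtain c where "v = map ((*) c) (phi u)" using h(3) u(2) unfolding pt_def' by blast
      then have "h v = c ^ d * h (phi u)" using ffun_scale[OF h(1), of "phi u" c] by simp
      then show ?thesis using h(2) u by (simp add: vecs_def)
    qed
    then show "p \<in> {p \<in> proj_space CC 8. \<forall>(d, h)\<in>?E. \<forall>v\<in>p. h v = 0}" using p S_proj by auto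
  next
    fix p assume p: "p \<in> {p \<in> proj_space CC 8. \<forall>(d, h)\<in>?E. \<forall>v\<in>p. h v = 0}"
    then obtain v where v: "v \<in> vecs 8" "p = pt v" by (auto simp: proj_space_CC)
    have len: "length v = 9" using v by (simp add: vecs_def)
    have van: "h v = 0" if "h \<in> ffun K 8 d" "\<And>u. length u = 3 \<Longrightarrow> h (phi u) = 0" for d h
      using p v(2) that pt_self[of v] by blast
    have D: "Q (sc al be v) = 0" if "Q \<in> ffun K 8 d" "\<And>u. length u = 3 \<Longrightarrow> Q (fvec u) = 0" for Q d
    proof (rule form_descent[OF that(1) _ len])
      show "h v = 0" if "h \<in> ffun K 8 d" "\<And>u. length u = 3 \<Longrightarrow> h (phi u) = 0" for d h
        using van that by blast
    qed (rule that(2))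
    \<comment> \<open>With \<open>Rm\<close> replaced by the matrix of \<open>u\<close>, both sides
      are \<open>27 * u_i * u_k ^ 2 * u_j ^ 6\<close>.\<close>
    have r1: "Rm v i j * (Rm v k j)\<^sup>2 = Rm v i k * (Rm v j j)\<^sup>2" if "i < 3" "j < 3" "k < 3" for i j k
    proof -
      have "(\<lambda>t. rm t i j * (rm t k j)\<^sup>2 - rm t i k * (rm t j j)\<^sup>2) \<in> ffun K 8 (1 + 1 * 2)"
        by (intro K.ffun_diff K.ffun_mult K.ffun_power rm_ffun that)
      from D[OF this] show ?thesis
        using that by (simp add: rm_fvec power2_eq_square)
    qed
    \<comment> \<open>Both sides are \<open>27 * u_i ^ 3 * u_k ^ 6\<close> on the plane. Hence a
      matrix with zero diagonal is zero.\<close>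
    have r2: "(Rm v i k) ^ 3 = Rm v i i * (Rm v k k)\<^sup>2" if "i < 3" "k < 3" for i k
    proof -
      have a: "(\<lambda>t. (rm t i k) ^ 3) \<in> ffun K 8 3"
        using K.ffun_power[OF rm_ffun[OF that(1), of k], of 3] by simp
      have b: "(\<lambda>t. rm t i i * (rm t k k)\<^sup>2) \<in> ffun K 8 3"
        using K.ffun_mult[OF rm_ffun[OF that(1), of i] K.ffun_power[OF rm_ffun[OF that(2), of k], of 2]]
        by (simp add: numeral_3_eq_3)
      from D[OF K.ffun_diff[OF a b]] show ?thesis
        using that by (simp add: rm_fvec power2_eq_square power3_eq_cube)
    qed
    have "\<exists>j<3. Rm v j j \<noteq> 0"
    proof (rule ccontr)
      assume "\<not> ?thesis"
      then have "Rm v i k = 0" if "i < 3" "k < 3" for i k using r2[OF that] that by simp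
      then have "sc al be v ! m = 0" if "m < 9" for m using rm_inv[of "sc al be v" m] that by simp
      then have "v ! m = 0" if "m < 9" for m
        using that sc_nth[OF that, of al be v] by simp
      then show False using v(1) by (auto simp: vecs_def)
    qed
    then obtain j where j: "j < 3" "Rm v j j \<noteq> 0" by blast
    \<comment> \<open>The preimage is read off from a column with nonzero diagonal entry.\<close>
    define u where "u = col j v"
    have ui: "u ! i = Rm v i j" if "i < 3" for i unfolding u_def using that by (rule col_nth)
    have u: "u \<in> vecs 2" using j ui[of j] by (auto simp: vecs_def u_def intro!: exI[of _ j])
    \<comment> \<open>The factor of proportionality dictated by \<open>r1\<close>.\<close>
    define cc where "cc = 3 * (Rm v j j)\<^sup>2"
    have "Rm (phi u) i k = Rm (map ((*) cc) v) i k" if "i < 3" "k < 3" for i k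
      using that r1[OF that(1) j(1) that(2)] len by (simp add: Rm_phi ui Rm_scale cc_def)
    then have z: "rm (fvec u) i k - Rm (map ((*) cc) v) i k = 0" if "i < 3" "k < 3" for i k
      using that by (simp add: sc_phi)
    define t where "t = map (\<lambda>m. fvec u ! m - sc al be (map ((*) cc) v) ! m) [0..<Suc 8]"
    have tn: "t ! m = fvec u ! m - sc al be (map ((*) cc) v) ! m" if "m < 9" for m
      unfolding t_def using that by (subst nth_map_upt) simp_all
    have "rm t i k = rm (fvec u) i k - Rm (map ((*) cc) v) i k" if "i < 3" "k < 3" for i k
    proof -
      note idx_less[of _ "k + 2 * i"]
      then show ?thesis unfolding rm_def sum_subtractf[symmetric] right_diff_distrib[symmetric]
        by (intro sum.cong) (simp_all add: tn del: fvec_nth sc_nth)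
    qed
    then have "t ! m = 0" if "m < 9" for m
      using rm_inv[of t m] z that by (simp add: t_def)
    then have "fvec u = sc al be (map ((*) cc) v)"
      by (intro nth_equalityI) (simp_all add: tn del: fvec_nth sc_nth)
    then have "phi u = sc (inverse al) (inverse be) (sc al be (map ((*) cc) v))"
      by (simp add: phi_def)
    also have "\<dots> = map ((*) cc) v" using len by (simp add: sc_sc sc_1)
    finally have "pt (phi u) = pt v" using pt_eqI[of cc v] j by (simp add: cc_def)
    then show "p \<in> S" using u v unfolding S_def by blast
  qed
qed

end

section \<open>Absence of rational points, and irreducibility\<close>

lemma vecs2: "[x, y, z] \<in> vecs 2 \<longleftrightarrow> x \<noteq> 0 \<or> y \<noteq> 0 \<or> z \<noteq> 0"
  by (auto simp: vecs_def le_Suc_eq numeral_2_eq_2)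

lemma vecs2_E:
  assumes "u \<in> vecs 2"
  obtains x y z where "u = [x, y, z]"
  using assms list3[of u] by (auto simp: vecs_def)

lemma kernel_det:
  fixes B :: "nat \<Rightarrow> nat \<Rightarrow> complex"
  assumes "\<And>j. j < 3 \<Longrightarrow> xi 0 * B 0 j + xi 1 * B 1 j + xi 2 * B 2 j = 0"
    and "i < (3::nat)" "xi i \<noteq> 0"
  shows "B 0 0 * (B 1 1 * B 2 2 - B 1 2 * B 2 1) - B 0 1 * (B 1 0 * B 2 2 - B 1 2 * B 2 0)
    + B 0 2 * (B 1 0 * B 2 1 - B 1 1 * B 2 0) = 0" (is "?d = 0")
proof -
  have e: "xi 0 * B 0 0 + xi 1 * B 1 0 + xi 2 * B 2 0 = 0" "xi 0 * B 0 1 + xi 1 * B 1 1 + xi 2 * B 2 1 = 0"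
    "xi 0 * B 0 2 + xi 1 * B 1 2 + xi 2 * B 2 2 = 0"
    using assms(1)[of 0] assms(1)[of 1] assms(1)[of 2] by auto
  have "xi 0 * ?d = (xi 0 * B 0 0 + xi 1 * B 1 0 + xi 2 * B 2 0) * (B 1 1 * B 2 2 - B 1 2 * B 2 1)
     - (xi 0 * B 0 1 + xi 1 * B 1 1 + xi 2 * B 2 1) * (B 1 0 * B 2 2 - B 1 2 * B 2 0)
     + (xi 0 * B 0 2 + xi 1 * B 1 2 + xi 2 * B 2 2) * (B 1 0 * B 2 1 - B 1 1 * B 2 0)"
    by (simp add: algebra_simps)
  then have 0: "xi 0 * ?d = 0" unfolding e by simp
  have "xi 1 * ?d = (xi 0 * B 0 0 + xi 1 * B 1 0 + xi 2 * B 2 0) * (B 0 2 * B 2 1 - B 0 1 * B 2 2)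
     - (xi 0 * B 0 1 + xi 1 * B 1 1 + xi 2 * B 2 1) * (B 0 2 * B 2 0 - B 0 0 * B 2 2)
     + (xi 0 * B 0 2 + xi 1 * B 1 2 + xi 2 * B 2 2) * (B 0 1 * B 2 0 - B 0 0 * B 2 1)"
    by (simp add: algebra_simps)
  then have 1: "xi 1 * ?d = 0" unfolding e by simp
  have "xi 2 * ?d = (xi 0 * B 0 0 + xi 1 * B 1 0 + xi 2 * B 2 0) * (B 0 1 * B 1 2 - B 0 2 * B 1 1)
     - (xi 0 * B 0 1 + xi 1 * B 1 1 + xi 2 * B 2 1) * (B 0 0 * B 1 2 - B 0 2 * B 1 0)
     + (xi 0 * B 0 2 + xi 1 * B 1 2 + xi 2 * B 2 2) * (B 0 0 * B 1 1 - B 0 1 * B 1 0)"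
    by (simp add: algebra_simps)
  then have 2: "xi 2 * ?d = 0" unfolding e by simp
  show ?thesis using less_3[OF assms(2)] assms(3) 0 1 2 by auto
qed

context severi_brauer
begin

lemma al_simps: "al * (al * al) = 2" "al * (al * (al * x)) = 2 * x"
proof -
  show "al * (al * al) = 2" using al3 by (simp add: power3_eq_cube mult.assoc)
  then show "al * (al * (al * x)) = 2 * x" by (simp flip: mult.assoc)
qed

lemma be_simps: "be * (be * be) = w" "be * (be * (be * x)) = w * x"
proof -
  show "be * (be * be) = w" using be3 by (simp add: power3_eq_cube mult.assoc)
  then show "be * (be * (be * x)) = w * x" by (simp flip: mult.assoc)
qed

text \<open>The conjugate under \<open>al -> w ^ i * al\<close> of the element with coordinates
  \<open>u 0 l, u 1 l, u 2 l\<close> in powers of \<open>al\<close>.\<close>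

definition sl :: "(nat \<Rightarrow> nat \<Rightarrow> complex) \<Rightarrow> nat \<Rightarrow> nat \<Rightarrow> complex" where
  "sl u l i = u 0 l + al * w ^ i * u 1 l + al\<^sup>2 * w ^ (2 * i) * u 2 l"

lemma sl_norm: "sl u l 0 * sl u l 1 * sl u l 2 = u 0 l ^ 3 + 2 * u 1 l ^ 3 + 4 * u 2 l ^ 3 - 6 * u 0 l * u 1 l * u 2 l"
  unfolding sl_def by (simp add: w_pow_num; simp add: ww ww' al_simps algebra_simps power2_eq_square power3_eq_cube)

lemma sl_mixed: "sl u 0 0 * sl u 1 1 * sl u 2 2 + sl u 0 1 * sl u 1 2 * sl u 2 0 + sl u 0 2 * sl u 1 0 * sl u 2 1 =
   3 * (u 0 0 * u 0 1 * u 0 2 + 2 * (u 1 0 * u 1 1 * u 1 2) + 4 * (u 2 0 * u 2 1 * u 2 2)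
        + 2 * (w\<^sup>2 * (u 0 0 * u 1 1 * u 2 2 + u 1 0 * u 2 1 * u 0 2 + u 2 0 * u 0 1 * u 1 2)
             + w * (u 0 0 * u 2 1 * u 1 2 + u 1 0 * u 0 1 * u 2 2 + u 2 0 * u 1 1 * u 0 2)))"
  unfolding sl_def by (simp add: w_pow_num; simp add: ww ww' al_simps algebra_simps power2_eq_square power3_eq_cube)

text \<open>\<open>A\<close> is the matrix of an element of the cyclic algebra and \<open>Nr\<close> its reduced norm.\<close>

lemma Nr_det:
  defines "A \<equiv> \<lambda>u i j. be ^ ((j + 2 * i) mod 3) * sl u ((j + 2 * i) mod 3) i"
  shows "A u 0 0 * (A u 1 1 * A u 2 2 - A u 1 2 * A u 2 1) - A u 0 1 * (A u 1 0 * A u 2 2 - A u 1 2 * A u 2 0)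
    + A u 0 2 * (A u 1 0 * A u 2 1 - A u 1 1 * A u 2 0) = Nr w u"
proof -
  have "A u 0 0 * (A u 1 1 * A u 2 2 - A u 1 2 * A u 2 1) - A u 0 1 * (A u 1 0 * A u 2 2 - A u 1 2 * A u 2 0)
    + A u 0 2 * (A u 1 0 * A u 2 1 - A u 1 1 * A u 2 0)
    = sl u 0 0 * sl u 0 1 * sl u 0 2 + w * (sl u 1 0 * sl u 1 1 * sl u 1 2) + w\<^sup>2 * (sl u 2 0 * sl u 2 1 * sl u 2 2)
     - w * (sl u 0 0 * sl u 1 1 * sl u 2 2 + sl u 0 1 * sl u 1 2 * sl u 2 0 + sl u 0 2 * sl u 1 0 * sl u 2 1)"
    unfolding A_def by (simp; simp add: be_simps algebra_simps power2_eq_square flip: numeral_2_eq_2)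
  also have "\<dots> = Nr w u"
    unfolding sl_norm sl_mixed Nr_def by (simp add: algebra_simps)
  finally show ?thesis .
qed

text \<open>This is where the division algebra acts: \<open>Rm v\<close> is the matrix of an element
  over \<open>K\<close>, a left kernel vector makes its reduced norm zero, and then the element is
  zero. The kernel vector may have arbitrary complex entries.\<close>

lemma no_singular:
  assumes K: "\<And>m. m < 9 \<Longrightarrow> v ! m \<in> K" and len: "length v = 9" and xi: "i < 3" "xi i \<noteq> 0"
    and ker: "\<And>j. j < 3 \<Longrightarrow> (\<Sum>i<3. xi i * Rm v i j) = 0" and m: "m < 9"
  shows "v ! m = 0"
proof -
  define u where "u k l = v ! (3 * k + l)" for k l
  have R: "Rm v i j = be ^ ((j + 2 * i) mod 3) * sl u ((j + 2 * i) mod 3) i" if "i < 3" for i j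
  proof -
    have l: "(j + 2 * i) mod 3 < 3" by simp
    have *: "sc al be v ! (3 * k + l) = al ^ k * be ^ l * u k l" if "k < 3" "l < 3" for k l
    proof -
      have "3 * k + l < 9" using that by linarith
      then show ?thesis using that by (simp add: u_def)
    qed
    show ?thesis
      unfolding rm_def sum3 sl_def using *[OF _ l, of 0] *[OF _ l, of 1] *[OF _ l, of 2]
      by (simp add: algebra_simps del: sc_nth)
  qed
  define B where "B i j = be ^ ((j + 2 * i) mod 3) * sl u ((j + 2 * i) mod 3) i" for i j
  have lt: "(0::nat) < 3" "(1::nat) < 3" "(2::nat) < 3" by auto
  have "xi 0 * B 0 j + xi 1 * B 1 j + xi 2 * B 2 j = 0" if "j < 3" for j
    using ker[OF that] unfolding sum3 R[OF lt(1)] R[OF lt(2)] R[OF lt(3)] B_def .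
  from kernel_det[of xi B, OF this xi] have "Nr w u = 0"
    unfolding B_def Nr_det .
  moreover have "u k l \<in> K" if "k < 3" "l < 3" for k l
  proof -
    have "3 * k + l < 9" using that by linarith
    then show ?thesis using K by (simp add: u_def)
  qed
  ultimately have "u (m div 3) (m mod 3) = 0"
    using good_fieldD(4)[OF good, of u "m div 3" "m mod 3"] m by auto
  then show ?thesis by (simp add: u_def)
qed

text \<open>The matrix of a point of \<open>S\<close> has rank one and is thus singular.\<close>

lemma no_rational_points:
  assumes "pt v \<in> S" "length v = 9" "set v \<subseteq> K"
  shows False
proof -
  obtain u where u: "u \<in> vecs 2" "pt v = pt (phi u)" using assms(1) by (auto simp: S_def)
  then obtain c where c: "c \<noteq> 0" "v = map ((*) c) (phi u)" by (auto simp: pt_eq_iff)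
  obtain x y z where xyz: "u = [x, y, z]" using vecs2_E[OF u(1)] by blast
  have nz: "x \<noteq> 0 \<or> y \<noteq> 0 \<or> z \<noteq> 0" using u(1) xyz vecs2 by simp
  \<comment> \<open>Any nonzero vector orthogonal to \<open>u\<close> is a left kernel vector, since
    all columns are multiples of \<open>u\<close>.\<close>
  obtain xi :: "nat \<Rightarrow> complex" and i where xi: "xi 0 * x + xi 1 * y + xi 2 * z = 0" "i < 3" "xi i \<noteq> 0"
  proof (cases "x = 0")
    case True
    then show ?thesis using that[of "\<lambda>i. if i = 0 then 1 else 0" 0] by simp
  next
    case False
    then show ?thesis using that[of "\<lambda>i. if i = 0 then - y else if i = 1 then x else 0" 1] by simp
  qed
  have "v ! m = 0" if "m < 9" for m
  proof (rule no_singular[where v = v and xi = xi and i = i and m = m, OF _ assms(2) xi(2,3) _ that])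
    show "v ! m \<in> K" if "m < 9" for m using assms that by (auto simp: subset_iff)
    fix j :: nat assume j: "j < 3"
    have "(\<Sum>i<3. xi i * Rm v i j) = c * 3 * (u ! j)\<^sup>2 * (xi 0 * x + xi 1 * y + xi 2 * z)"
      unfolding c(2) using j by (simp add: sum3 Rm_scale Rm_phi xyz algebra_simps)
    then show "(\<Sum>i<3. xi i * Rm v i j) = 0" using xi(1) by simp
  qed
  moreover have "v \<in> vecs 8" using c phi_vecs[OF u(1)] by simp
  ultimately show False by (auto simp: vecs_def)
qed

text \<open>A morphism over \<open>K\<close> from the plane would send the rational point
  \<open>[1, 0, 0]\<close> to a rational point of \<open>S\<close>.\<close>

lemma S_not_rational: "\<not> isomorphic_over CC K 8 S 2 (proj_space CC 2)"
proof
  assume "isomorphic_over CC K 8 S 2 (proj_space CC 2)"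
  then obtain g where "regular_over CC K 2 (proj_space CC 2) 8 S g"
    by (auto simp: isomorphic_over_def inverse_morphisms_def)
  note g = this[unfolded regular_over_ffun[OF subset_refl]]
  define x where "x = pt [1, 0, 0 :: complex]"
  have x: "x \<in> proj_space CC 2" unfolding x_def proj_space_CC by (rule imageI) (simp add: vecs2)
  obtain d G where G: "(\<forall>j\<le>8. G j \<in> ffun K 2 d) \<and> (\<exists>j\<le>8. \<exists>v\<in>x. G j v \<noteq> 0) \<and>
     (\<forall>y\<in>proj_space CC 2. \<forall>v\<in>y. (\<exists>j\<le>8. G j v \<noteq> 0) \<longrightarrow> g y = pt (map (\<lambda>j. G j v) [0..<Suc 8]))"
    using bspec[OF conjunct2[OF g] x] by (elim exE) (rule that)
  then obtain j v where j: "j \<le> 8" "v \<in> x" "G j v \<noteq> 0" by blast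
  obtain c where "v = map ((*) c) [1, 0, 0]" using j(2) unfolding x_def pt_def' by blast
  then have "G j v = c ^ d * G j [1, 0, 0]"
    using ffun_scale[of "G j" K 2 d "[1, 0, 0]" c] G j(1) by simp
  then have nz: "G j [1, 0, 0] \<noteq> 0" using j(3) by auto
  have "[1, 0, 0] \<in> x" unfolding x_def by (rule pt_self)
  then have gx: "g x = pt (map (\<lambda>j. G j [1, 0, 0]) [0..<Suc 8])"
    using G[THEN conjunct2, THEN conjunct2] x j(1) nz by blast
  have "g x \<in> S" using conjunct1[OF g] x by blast
  then show False
  proof (rule no_rational_points[of "map (\<lambda>j. G j [1, 0, 0]) [0..<Suc 8]", unfolded gx[symmetric]])
    show "set (map (\<lambda>j. G j [1, 0, 0]) [0..<Suc 8]) \<subseteq> K"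
    proof -
      have "G j [1, 0, 0] \<in> K" if "j \<le> 8" for j
        using ffun_in[OF K.subring_C_axioms, of "G j" 2 d "[1, 0, 0]"] G that by simp
      then show ?thesis by (auto simp del: upt_Suc)
    qed
  qed simp
qed

lemma fkl_ffun: "fkl k l \<in> ffun K 2 3"
proof -
  have "(\<lambda>u. u ! i * (u ! ((i + l) mod 3))\<^sup>2) \<in> ffun K 2 (1 + 1 * 2)" if "i < 3" for i
  proof -
    have "(i + l) mod 3 < 3" by simp
    then have "(i + l) mod 3 \<le> 2" by linarith
    then show ?thesis using that by (intro K.ffun_mult K.ffun_power K.ffun_coord) auto
  qed
  then have "(\<lambda>u. \<Sum>i<3. w ^ (2 * i * k) * (u ! i * (u ! ((i + l) mod 3))\<^sup>2)) \<in> ffun K 2 (1 + 1 * 2)"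
    by (intro K.ffun_sum K.ffun_smult) auto
  moreover have "(1::nat) + 1 * 2 = 3" by simp
  ultimately show ?thesis unfolding fkl_def[abs_def] by (simp only:)
qed

interpretation L: subring_C UNIV by (rule subring_C_UNIV)

lemma phi_ffun: "(\<lambda>u. phi u ! m) \<in> ffun UNIV 2 3" if "m < 9"
proof -
  have "(\<lambda>u. (inverse al ^ (m div 3) * inverse be ^ (m mod 3)) * fkl (m div 3) (m mod 3) u) \<in> ffun UNIV 2 3"
    by (rule L.ffun_smult[OF UNIV_I ffun_mono[OF subset_UNIV fkl_ffun]])
  then show ?thesis using that by (simp add: phi_def)
qed

lemma map_phi: "map (\<lambda>j. phi u ! j) [0..<Suc 8] = phi u"
  by (rule nth_equalityI) (auto simp: nth_map_upt simp del: upt_Suc)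

lemma S_severi_brauer: "severi_brauer_surface CC K 8 S"
  unfolding severi_brauer_surface_def
proof
  show "closed_over CC K 8 S" by (rule S_closed)
  define f where "f p = pt (SOME u. u \<in> vecs 2 \<and> p = pt (phi u))" for p
  define g where "g q = pt (phi (SOME u. u \<in> vecs 2 \<and> q = pt u))" for q
  have f: "f (pt (phi u)) = pt u" if "u \<in> vecs 2" for u
  proof -
    have "\<exists>u'. u' \<in> vecs 2 \<and> pt (phi u) = pt (phi u')" using that by blast
    from someI_ex[OF this] show ?thesis unfolding f_def using pt_phi_inj[OF that] by blast
  qed
  have g: "g (pt u) = pt (phi u)" if "u \<in> vecs 2" for u
  proof -
    have "\<exists>u'. u' \<in> vecs 2 \<and> pt u = pt u'" using that by blast
    from someI_ex[OF this] have "pt u = pt (SOME u'. u' \<in> vecs 2 \<and> pt u = pt u')" by blast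
    from pt_phi_cong[OF _ this] show ?thesis unfolding g_def using that by (simp add: vecs_def)
  qed
  have "inverse_morphisms CC UNIV 8 S 2 (proj_space CC 2) f g"
    unfolding inverse_morphisms_def
  proof (intro conjI ballI)
    show "g (f x) = x" if "x \<in> S" for x using that f g by (auto simp: S_def)
    show "f (g y) = y" if "y \<in> proj_space CC 2" for y using that f g by (auto simp: proj_space_CC)
    show "regular_over CC UNIV 8 S 2 (proj_space CC 2) f"
      unfolding regular_over_ffun[OF S_proj]
    proof (intro conjI ballI)
      show "f ` S \<subseteq> proj_space CC 2" using f by (auto simp: S_def proj_space_CC)
      fix x assume x: "x \<in> S"
      then obtain u where u: "u \<in> vecs 2" "x = pt (phi u)" by (auto simp: S_def)
      then obtain j where j: "j \<le> 2" "u ! j \<noteq> 0" by (auto simp: vecs_def)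
      have j3: "j < 3" using j by simp
      \<comment> \<open>Near \<open>x\<close> the inverse is given by column \<open>j\<close>,
        chosen so that the coordinate \<open>u ! j\<close> is nonzero.\<close>
      let ?G = "\<lambda>i v. Rm v i j"
      have scff: "(\<lambda>v. sc al be v ! m) \<in> ffun UNIV 8 1" if "m < 9" for m
        using L.ffun_smult[OF _ L.ffun_coord[of m 8], of "al ^ (m div 3) * be ^ (m mod 3)"] that by simp
      have 1: "?G i \<in> ffun UNIV 8 1" if "i \<le> 2" for i
        unfolding rm_def by (intro L.ffun_sum L.ffun_smult scff idx_less) auto
      have 2: "\<exists>i\<le>2. \<exists>v\<in>x. ?G i v \<noteq> 0"
        using u j j3 by (intro exI[of _ j] conjI bexI[of _ "phi u"]) (auto simp: Rm_phi)
      have 3: "f y = pt (map (\<lambda>i. ?G i v) [0..<Suc 2])" if y: "y \<in> S" "v \<in> y" "i \<le> 2" "?G i v \<noteq> 0" for y v i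
      proof -
        obtain u' where u': "u' \<in> vecs 2" "y = pt (phi u')" using y(1) by (auto simp: S_def)
        obtain c where c: "v = map ((*) c) (phi u')" using y(2) u'(2) unfolding pt_def' by blast
        have len: "length u' = 3" using u' by (simp add: vecs_def)
        have e: "map (\<lambda>i. ?G i v) [0..<Suc 2] = map ((*) (c * 3 * (u' ! j)\<^sup>2)) u'"
          unfolding col_def[symmetric] c by (rule col_phi[OF len j3])
        have "?G i v = c * (3 * (u' ! i * (u' ! j)\<^sup>2))" using y(3) j3 by (simp add: c Rm_scale Rm_phi)
        then have "c * 3 * (u' ! j)\<^sup>2 \<noteq> 0" using y(4) by auto
        then show ?thesis unfolding e u'(2) f[OF u'(1)] by (rule pt_eqI[symmetric])
      qed
      show "\<exists>d G. (\<forall>j\<le>2. G j \<in> ffun UNIV 8 d) \<and> (\<exists>j\<le>2. \<exists>v\<in>x. G j v \<noteq> 0) \<and>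
        (\<forall>y\<in>S. \<forall>v\<in>y. (\<exists>j\<le>2. G j v \<noteq> 0) \<longrightarrow> f y = pt (map (\<lambda>j. G j v) [0..<Suc 2]))"
        using 1 2 3 by (intro exI[of _ 1] exI[of _ ?G]) blast
    qed
    show "regular_over CC UNIV 2 (proj_space CC 2) 8 S g"
      unfolding regular_over_ffun[OF subset_refl]
    proof (intro conjI ballI)
      show "g ` proj_space CC 2 \<subseteq> S" using g by (auto simp: S_def proj_space_CC)
      fix x assume x: "x \<in> proj_space CC 2"
      then obtain u where u: "u \<in> vecs 2" "x = pt u" by (auto simp: proj_space_CC)
      let ?G = "\<lambda>j u. phi u ! j"
      have 1: "?G j \<in> ffun UNIV 2 3" if "j \<le> 8" for j using that by (intro phi_ffun) simp
      have 2: "\<exists>j\<le>8. \<exists>v\<in>x. ?G j v \<noteq> 0"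
      proof -
        obtain j where "j \<le> 8" "phi u ! j \<noteq> 0" using phi_vecs[OF u(1)] by (auto simp: vecs_def)
        then show ?thesis using u(2) pt_self by blast
      qed
      have 3: "g y = pt (map (\<lambda>j. ?G j v) [0..<Suc 8])" if y: "y \<in> proj_space CC 2" "v \<in> y" for y v
        unfolding map_phi using proj_space_mem[OF y] g by simp
      show "\<exists>d G. (\<forall>j\<le>8. G j \<in> ffun UNIV 2 d) \<and> (\<exists>j\<le>8. \<exists>v\<in>x. G j v \<noteq> 0) \<and>
        (\<forall>y\<in>proj_space CC 2. \<forall>v\<in>y. (\<exists>j\<le>8. G j v \<noteq> 0) \<longrightarrow> g y = pt (map (\<lambda>j. G j v) [0..<Suc 8]))"
        using 1 2 3 by (intro exI[of _ 3] exI[of _ ?G]) blast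
    qed
  qed
  then show "isomorphic_over CC (carrier CC) 8 S 2 (proj_space CC 2)"
    by (auto simp: isomorphic_over_def)
qed

definition pv :: "nat \<Rightarrow> p3" where
  "pv i = (if i = 0 then px else if i = 1 then py else pz)"

lemma ev3_pv: "i < 3 \<Longrightarrow> ev3 (pv i) x y z = [x, y, z] ! i"
  using less_3[of i] by (auto simp: pv_def)

definition phiP :: "nat \<Rightarrow> p3" where
  "phiP m = pc (inverse al ^ (m div 3) * inverse be ^ (m mod 3)) *
     (\<Sum>i<3. pc (w ^ (2 * i * (m div 3))) * (pv i * (pv ((i + m mod 3) mod 3))\<^sup>2))"

lemma phiP: "m < 9 \<Longrightarrow> ev3 (phiP m) x y z = phi [x, y, z] ! m"
  by (simp add: phiP_def phi_def fkl_def ev3_pv cong: sum.cong_simp)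

text \<open>Pulling forms back to the plane reduces questions on \<open>S\<close> to the integral
  domain \<open>p3\<close>.\<close>

lemma pull_S:
  assumes "h \<in> ffun UNIV 8 d"
  shows "\<exists>P. \<forall>x y z. ev3 P x y z = h (phi [x, y, z])"
proof -
  have "map (\<lambda>j. ev3 (phiP j) x y z) [0..<Suc 8] = phi [x, y, z]" for x y z
    by (rule nth_equalityI) (auto simp: nth_map_upt phiP simp del: upt_Suc)
  then show ?thesis
    using ffun_pull[OF subring_C_UNIV assms, of phiP] K3_UNIV by metis
qed

lemma nz_S_iff:
  assumes "h \<in> ffun UNIV 8 d" "u \<in> vecs 2"
  shows "pt (phi u) \<in> nz S h \<longleftrightarrow> h (phi u) \<noteq> 0"
  by (rule nz_ffun[OF S_proj assms(1)]) (use assms(2) in \<open>auto simp: S_def\<close>)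

lemma S_irreducible: "irreducible_variety K 8 S"
proof (intro irreducible_variety.intro K.subring_C_axioms irreducible_variety_axioms.intro)
  show "S \<subseteq> proj_space CC 8" by (rule S_proj)
  show "S \<noteq> {}" unfolding S_def using vecs2[of 1 0 0] by auto
  fix d e g h assume gh: "g \<in> ffun K 8 d" "h \<in> ffun K 8 e" "nz S g \<noteq> {}" "nz S h \<noteq> {}"
  have ghU: "g \<in> ffun UNIV 8 d" "h \<in> ffun UNIV 8 e" using gh ffun_mono by blast+
  obtain Pg where Pg: "\<And>x y z. ev3 Pg x y z = g (phi [x, y, z])" using pull_S[OF ghU(1)] by blast
  obtain Ph where Ph: "\<And>x y z. ev3 Ph x y z = h (phi [x, y, z])" using pull_S[OF ghU(2)] by blast
  have nzP: "P \<noteq> 0" if hne: "nz S h \<noteq> {}" "h \<in> ffun UNIV 8 d" "\<And>x y z. ev3 P x y z = h (phi [x, y, z])" for P h d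
  proof -
    obtain p where p: "p \<in> nz S h" using hne by blast
    then obtain u where u: "u \<in> vecs 2" "p = pt (phi u)" by (auto simp: nz_def S_def)
    obtain x y z where xyz: "u = [x, y, z]" using vecs2_E[OF u(1)] by blast
    have "h (phi u) \<noteq> 0" using p u by (auto simp: nz_def)
    then have "ev3 P x y z \<noteq> 0" using that(3) xyz by simp
    then show ?thesis by auto
  qed
  \<comment> \<open>The factor \<open>px\<close> ensures that the vector found below is nonzero and
    so represents a point.\<close>
  have "px * (Pg * Ph) \<noteq> 0" using nzP[OF gh(3) ghU(1) Pg] nzP[OF gh(4) ghU(2) Ph] by (simp add: px_def)
  then obtain x y z where "ev3 (px * (Pg * Ph)) x y z \<noteq> 0" using ev3_nonzero by blast
  then have xyz: "x \<noteq> 0" "g (phi [x, y, z]) \<noteq> 0" "h (phi [x, y, z]) \<noteq> 0" by (auto simp: Pg Ph)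
  then have "[x, y, z] \<in> vecs 2" by (simp add: vecs2)
  then have "pt (phi [x, y, z]) \<in> nz S g \<inter> nz S h"
    using nz_S_iff[OF ghU(1)] nz_S_iff[OF ghU(2)] xyz by blast
  then show "nz S g \<inter> nz S h \<noteq> {}" by blast
qed

end

section \<open>Homomorphisms from powers of the cyclic group of order three\<close>

lemma (in group) hom_image_iso:
  assumes "group A" "f \<in> hom A G" "inj_on f (carrier A)"
  shows "subgroup (f ` carrier A) G" "G\<lparr>carrier := f ` carrier A\<rparr> \<cong> A"
proof -
  interpret A: group A by fact
  interpret h: group_hom A G f
    using assms group_axioms by (simp add: group_hom_def group_hom_axioms_def A.group_axioms)
  show "subgroup (f ` carrier A) G" by (rule h.img_is_subgroup)
  have "f \<in> iso A (G\<lparr>carrier := f ` carrier A\<rparr>)"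
    using assms(2,3) by (auto simp: iso_def hom_def bij_betw_def)
  then have "A \<cong> G\<lparr>carrier := f ` carrier A\<rparr>" by (auto simp: is_iso_def)
  then show "G\<lparr>carrier := f ` carrier A\<rparr> \<cong> A" by (rule A.iso_sym)
qed

lemma (in group) pow_mod3:
  assumes "g \<in> carrier G" "g [^] (3::nat) = \<one>"
  shows "g [^] (i::int) = g [^] (i mod 3)"
proof -
  have "g [^] (3::int) = \<one>" using assms(2) by (metis int_pow_int of_nat_numeral)
  then have "g [^] (3 * (i div 3)) = \<one>" using assms(1) by (simp add: int_pow_pow[symmetric])
  moreover have "g [^] i = g [^] (3 * (i div 3)) \<otimes> g [^] (i mod 3)"
    using assms(1) by (simp add: int_pow_mult[symmetric])
  ultimately show ?thesis using assms(1) by simp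
qed

lemma (in group) cube_homs:
  assumes g: "g1 \<in> carrier G" "g2 \<in> carrier G" "g3 \<in> carrier G"
    and c: "g1 \<otimes> g2 = g2 \<otimes> g1" "g1 \<otimes> g3 = g3 \<otimes> g1" "g2 \<otimes> g3 = g3 \<otimes> g2"
    and p: "g1 [^] (3::nat) = \<one>" "g2 [^] (3::nat) = \<one>" "g3 [^] (3::nat) = \<one>"
    and ind: "\<And>(i::int) (j::int) (k::int). i \<in> {0..<3} \<Longrightarrow> j \<in> {0..<3} \<Longrightarrow> k \<in> {0..<3} \<Longrightarrow>
      g1 [^] i \<otimes> (g2 [^] j \<otimes> g3 [^] k) = \<one> \<Longrightarrow> i = 0 \<and> j = 0 \<and> k = 0"
  shows "(\<lambda>(i, j, k). g1 [^] i \<otimes> (g2 [^] j \<otimes> g3 [^] k)) \<in>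
      hom (integer_mod_group 3 \<times>\<times> integer_mod_group 3 \<times>\<times> integer_mod_group 3) G" (is "?f \<in> _")
    and "inj_on (\<lambda>(i, j, k). g1 [^] i \<otimes> (g2 [^] j \<otimes> g3 [^] k))
      (carrier (integer_mod_group 3 \<times>\<times> integer_mod_group 3 \<times>\<times> integer_mod_group 3))"
proof -
  let ?A = "integer_mod_group 3 \<times>\<times> integer_mod_group 3 \<times>\<times> integer_mod_group 3"
  have cc: "g [^] i \<otimes> h [^] j = h [^] j \<otimes> g [^] i"
    if "g \<in> carrier G" "h \<in> carrier G" "g \<otimes> h = h \<otimes> g" for g h and i j :: int
  proof -
    have 1: "g \<otimes> h [^] j = h [^] j \<otimes> g" if "g \<in> carrier G" "h \<in> carrier G" "g \<otimes> h = h \<otimes> g" for g h and j :: int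
    proof -
      have n: "g \<otimes> h [^] n = h [^] n \<otimes> g" for n :: nat
      proof (induction n)
        case (Suc n)
        have "g \<otimes> h [^] Suc n = (g \<otimes> h [^] n) \<otimes> h" using that by (simp add: m_assoc)
        also have "\<dots> = h [^] n \<otimes> (g \<otimes> h)" using that Suc by (simp add: m_assoc)
        also have "\<dots> = h [^] Suc n \<otimes> g" using that by (simp add: m_assoc)
        finally show ?case .
      qed (use that in simp)
      show ?thesis
      proof (cases j)
        case (nonneg n)
        then show ?thesis using n by (simp add: int_pow_int)
      next
        case (neg n)
        define x where "x = h [^] Suc n"
        have x: "x \<in> carrier G" "g \<otimes> x = x \<otimes> g" using that n[of "Suc n"] by (simp_all add: x_def)
        have "g \<otimes> inv x = inv x \<otimes> (x \<otimes> g) \<otimes> inv x" using that x(1) by (simp add: m_assoc[symmetric])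
        also have "\<dots> = inv x \<otimes> (g \<otimes> x) \<otimes> inv x" using x(2) by simp
        also have "\<dots> = inv x \<otimes> g" using that x(1) by (simp add: m_assoc)
        finally show ?thesis using neg that by (simp add: int_pow_neg int_pow_int x_def del: nat_pow_Suc of_nat_Suc)
      qed
    qed
    have "g [^] i \<otimes> h = h \<otimes> g [^] i" using 1[of h g i] that by simp
    then show ?thesis using 1[of "g [^] i" h j] that by simp
  qed
  have mult: "?f (i, j, k) \<otimes> ?f (i', j', k') = g1 [^] (i + i') \<otimes> (g2 [^] (j + j') \<otimes> g3 [^] (k + k'))"
    for i j k i' j' k' :: int
  proof -
    have lc: "h [^] m \<otimes> (g [^] n \<otimes> r) = g [^] n \<otimes> (h [^] m \<otimes> r)"
      if "g \<in> carrier G" "h \<in> carrier G" "r \<in> carrier G" "g \<otimes> h = h \<otimes> g" for g h r and m n :: int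
      using cc[of g h n m] that by (simp add: m_assoc[symmetric])
    show ?thesis
      using g by (simp add: m_assoc int_pow_mult lc[of g1 g2] lc[of g1 g3] lc[of g2 g3] c)
  qed
  have car: "carrier (integer_mod_group 3) = {0..<3}" by (simp add: carrier_integer_mod_group)
  have mo: "x \<otimes>\<^bsub>integer_mod_group 3\<^esub> y = (x + y) mod 3" for x y by (simp add: mult_integer_mod_group)
  show hom: "?f \<in> hom ?A G"
    unfolding hom_def
  proof (intro CollectI conjI Pi_I ballI)
    show "?f x \<in> carrier G" for x :: "int \<times> int \<times> int" using g by (auto simp: case_prod_unfold)
    fix x y :: "int \<times> int \<times> int"
    obtain i j k i' j' k' where xy: "x = (i, j, k)" "y = (i', j', k')" by (metis surj_pair)
    show "?f (x \<otimes>\<^bsub>?A\<^esub> y) = ?f x \<otimes> ?f y"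
      unfolding xy mult
      using pow_mod3[OF g(1) p(1), of "i + i'"] pow_mod3[OF g(2) p(2), of "j + j'"] pow_mod3[OF g(3) p(3), of "k + k'"]
      by (simp add: mo)
  qed
  have grpA: "group ?A" by (intro DirProd_group group_integer_mod_group)
  interpret h: group_hom ?A G ?f
    using hom grpA group_axioms by (simp add: group_hom_def group_hom_axioms_def)
  show "inj_on ?f (carrier ?A)"
  proof (rule h.inj_iff_trivial_ker[THEN iffD2], intro equalityI subsetI)
    fix x assume "x \<in> kernel ?A G ?f"
    then have x: "x \<in> carrier ?A" "?f x = \<one>" unfolding kernel_def by (simp_all only: mem_Collect_eq)
    obtain i j k where ijk: "x = (i, j, k)" by (rule prod_cases3)
    have m: "i \<in> {0..<3}" "j \<in> {0..<3}" "k \<in> {0..<3}"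
      using x(1) unfolding ijk carrier_DirProd car mem_Times_iff fst_conv snd_conv by blast+
    have "i = 0 \<and> j = 0 \<and> k = 0" by (rule ind[OF m]) (use x(2) in \<open>simp only: ijk prod.case\<close>)
    then show "x \<in> {\<one>\<^bsub>?A\<^esub>}" unfolding ijk by simp
  next
    fix x assume "x \<in> {\<one>\<^bsub>?A\<^esub>}"
    then have "x = \<one>\<^bsub>?A\<^esub>" by (rule singletonD)
    then show "x \<in> kernel ?A G ?f" unfolding kernel_def by (simp only: mem_Collect_eq h.hom_one monoid.one_closed[OF group.is_monoid[OF grpA]] simp_thms)
  qed
qed

section \<open>The quartic Cremona transformation\<close>

context severi_brauer
begin

sublocale V: irreducible_variety K 8 S
  by (rule S_irreducible)

definition mo :: "nat \<Rightarrow> nat \<Rightarrow> complex list \<Rightarrow> complex" where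
  "mo i j u = u ! i * (u ! j)\<^sup>2"

text \<open>A plane form of degree 12 written as a quartic in the nine cubics with coefficients in
  \<open>K\<close>. The cubics in the components of \<open>sg\<close> are of this kind.\<close>

definition quart :: "(complex list \<Rightarrow> complex) \<Rightarrow> bool" where
  "quart h \<longleftrightarrow> (\<exists>Q\<in>ffun K 8 4. \<forall>u. length u = 3 \<longrightarrow> h u = Q (fvec u))"

lemma quart_add: "quart f \<Longrightarrow> quart g \<Longrightarrow> quart (\<lambda>u. f u + g u)"
  unfolding quart_def by (metis (no_types, lifting) K.ffun_add)

lemma quart_smult: "c \<in> K \<Longrightarrow> quart f \<Longrightarrow> quart (\<lambda>u. c * f u)"
  unfolding quart_def by (metis (no_types, lifting) K.ffun_smult)

lemma quart_mo:
  assumes "a < 3" "b < 3" "c < 3" "d < 3" "e < 3" "f < 3" "g < 3" "h < 3"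
  shows "quart (\<lambda>u. mo a b u * mo c d u * mo e f u * mo g h u)"
proof -
  have m: "(\<lambda>t. inverse 3 * rm t i j) \<in> ffun K 8 1" if "i < 3" for i j
    using Kinv[of 3] by (intro K.ffun_smult rm_ffun that) simp
  have v: "inverse 3 * rm (fvec u) i j = mo i j u" if "i < 3" "j < 3" for u i j
    using that by (simp add: rm_fvec mo_def)
  have "(\<lambda>t. inverse 3 * rm t a b * (inverse 3 * rm t c d) * (inverse 3 * rm t e f) * (inverse 3 * rm t g h)) \<in> ffun K 8 (1 + 1 + 1 + 1)"
    by (intro K.ffun_mult m assms)
  moreover have "(1::nat) + 1 + 1 + 1 = 4" by simp
  ultimately have Q: "(\<lambda>t. inverse 3 * rm t a b * (inverse 3 * rm t c d) * (inverse 3 * rm t e f) * (inverse 3 * rm t g h)) \<in> ffun K 8 4"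
    by (simp only:)
  show ?thesis unfolding quart_def by (rule bexI[OF _ Q]) (simp only: v assms simp_thms)
qed

text \<open>The quartic Cremona transformation of order three that corresponds to multiplying one coordinate of the
  diagonal cubic surface (with coordinates \<open>fkl k l\<close>, \<open>k, l > 0\<close>) by a cube root of unity.\<close>

definition sg :: "complex list \<Rightarrow> complex list" where
  "sg u = (let x = u ! 0; y = u ! 1; z = u ! 2 in
     [x * z * (x * z - y\<^sup>2), w * (x * y * (x * y - z\<^sup>2)), w\<^sup>2 * (y * z * (y * z - x\<^sup>2))])"

text \<open>The square of \<open>sg\<close> with its common factor removed, which is also its
  inverse; see \<open>sg_sg\<close> and \<open>sg_sg2\<close>.\<close>

definition sg2 :: "complex list \<Rightarrow> complex list" where
  "sg2 u = (let x = u ! 0; y = u ! 1; z = u ! 2; a = x * z - y\<^sup>2; b = x * y - z\<^sup>2; c = y * z - x\<^sup>2 in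
     [w * (a * c), a * b, w\<^sup>2 * (b * c)])"

lemma sg_len [simp]: "length (sg u) = 3" by (simp add: sg_def Let_def)

text \<open>Each of the nine products of degree 12 is written out as a combination of fourfold
  products of \<open>mo\<close>. All coefficients lie in the ring generated by
  \<open>w\<close>.\<close>

lemma sg_quart: "i < 3 \<Longrightarrow> j < 3 \<Longrightarrow> quart (\<lambda>u. sg u ! i * (sg u ! j)\<^sup>2)"
proof -
  have KK: "w ^ n \<in> K" "numeral m * w ^ n \<in> K" "- numeral m * w ^ n \<in> K" "- 1 * w ^ n \<in> K" "1 * w ^ n \<in> K"
    "numeral m * w \<in> K" "- numeral m * w \<in> K" "- 1 * w \<in> K" "1 * w \<in> K" "- numeral m \<in> K" "- 1 \<in> K" for n m
    by (intro K.kmult K.kneg K.kpow K.knum K.k1 wK)+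
  note I = quart_add quart_smult quart_mo KK K.knum K.k1
  \<comment> \<open>The grouping into factors \<open>mo\<close> is not unique, because the
    \<open>mo\<close> satisfy relations; one choice is fixed for each monomial.\<close>
  have e00: "(\<lambda>u. sg u ! 0 * (sg u ! 0)\<^sup>2) = (\<lambda>u. ((((- 1) * (mo 0 0 u * mo 1 1 u * mo 1 1 u * mo 2 2 u)) + 3 * (mo 0 0 u * mo 0 1 u * mo 1 2 u * mo 1 2 u)) + (- 3) * (mo 0 0 u * mo 0 1 u * mo 0 2 u * mo 2 2 u)) + 1 * (mo 0 0 u * mo 0 0 u * mo 2 2 u * mo 2 2 u))"
    by (rule ext) (simp add: sg_def Let_def mo_def w_pow_num; simp add: ww ww' algebra_simps power2_eq_square)
  have q00: "quart (\<lambda>u. sg u ! 0 * (sg u ! 0)\<^sup>2)"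
    unfolding e00 by (intro I) simp_all
  have e01: "(\<lambda>u. sg u ! 0 * (sg u ! 1)\<^sup>2) = (\<lambda>u. (((((((- 1) * w ^ 2) * (mo 0 0 u * mo 1 1 u * mo 1 2 u * mo 2 2 u)) + (1 * w ^ 2) * (mo 0 0 u * mo 0 1 u * mo 2 2 u * mo 2 2 u)) + (2 * w ^ 2) * (mo 0 0 u * mo 0 1 u * mo 1 1 u * mo 2 2 u)) + ((- 2) * w ^ 2) * (mo 0 0 u * mo 0 1 u * mo 0 2 u * mo 1 2 u)) + ((- 1) * w ^ 2) * (mo 0 0 u * mo 0 1 u * mo 0 1 u * mo 2 1 u)) + (1 * w ^ 2) * (mo 0 0 u * mo 0 0 u * mo 1 1 u * mo 1 2 u))"
    by (rule ext) (simp add: sg_def Let_def mo_def w_pow_num; simp add: ww ww' algebra_simps power2_eq_square)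
  have q01: "quart (\<lambda>u. sg u ! 0 * (sg u ! 1)\<^sup>2)"
    unfolding e01 by (intro I) simp_all
  have e02: "(\<lambda>u. sg u ! 0 * (sg u ! 2)\<^sup>2) = (\<lambda>u. (((((((- 1) * w) * (mo 0 1 u * mo 1 1 u * mo 1 2 u * mo 2 2 u)) + (1 * w) * (mo 0 1 u * mo 0 1 u * mo 2 2 u * mo 2 2 u)) + (2 * w) * (mo 0 0 u * mo 1 1 u * mo 1 2 u * mo 1 2 u)) + ((- 2) * w) * (mo 0 0 u * mo 0 1 u * mo 1 2 u * mo 2 2 u)) + ((- 1) * w) * (mo 0 0 u * mo 0 1 u * mo 0 1 u * mo 2 2 u)) + (1 * w) * (mo 0 0 u * mo 0 0 u * mo 1 2 u * mo 1 2 u))"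
    by (rule ext) (simp add: sg_def Let_def mo_def w_pow_num; simp add: ww ww' algebra_simps power2_eq_square)
  have q02: "quart (\<lambda>u. sg u ! 0 * (sg u ! 2)\<^sup>2)"
    unfolding e02 by (intro I) simp_all
  have e10: "(\<lambda>u. sg u ! 1 * (sg u ! 0)\<^sup>2) = (\<lambda>u. (((((((- 1) * w) * (mo 0 0 u * mo 1 1 u * mo 1 2 u * mo 1 2 u)) + (2 * w) * (mo 0 0 u * mo 0 1 u * mo 1 2 u * mo 2 2 u)) + (1 * w) * (mo 0 0 u * mo 0 1 u * mo 1 1 u * mo 1 2 u)) + ((- 1) * w) * (mo 0 0 u * mo 0 2 u * mo 0 2 u * mo 1 2 u)) + ((- 2) * w) * (mo 0 0 u * mo 0 1 u * mo 0 1 u * mo 2 2 u)) + (1 * w) * (mo 0 0 u * mo 0 0 u * mo 1 2 u * mo 1 2 u))"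
    by (rule ext) (simp add: sg_def Let_def mo_def w_pow_num; simp add: ww ww' algebra_simps power2_eq_square)
  have q10: "quart (\<lambda>u. sg u ! 1 * (sg u ! 0)\<^sup>2)"
    unfolding e10 by (intro I) simp_all
  have e11: "(\<lambda>u. sg u ! 1 * (sg u ! 1)\<^sup>2) = (\<lambda>u. ((((- 1) * (mo 0 0 u * mo 1 1 u * mo 2 2 u * mo 2 2 u)) + 3 * (mo 0 0 u * mo 0 1 u * mo 1 2 u * mo 1 2 u)) + (- 3) * (mo 0 0 u * mo 0 1 u * mo 0 1 u * mo 1 2 u)) + 1 * (mo 0 0 u * mo 0 0 u * mo 1 1 u * mo 1 1 u))"
    by (rule ext) (simp add: sg_def Let_def mo_def w_pow_num; simp add: ww ww' algebra_simps power2_eq_square)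
  have q11: "quart (\<lambda>u. sg u ! 1 * (sg u ! 1)\<^sup>2)"
    unfolding e11 by (intro I) simp_all
  have e12: "(\<lambda>u. sg u ! 1 * (sg u ! 2)\<^sup>2) = (\<lambda>u. (((((((- 1) * w ^ 2) * (mo 0 1 u * mo 1 1 u * mo 2 2 u * mo 2 2 u)) + (1 * w ^ 2) * (mo 0 1 u * mo 0 1 u * mo 1 2 u * mo 1 2 u)) + (2 * w ^ 2) * (mo 0 0 u * mo 1 1 u * mo 1 2 u * mo 2 2 u)) + ((- 2) * w ^ 2) * (mo 0 0 u * mo 0 1 u * mo 1 1 u * mo 2 2 u)) + ((- 1) * w ^ 2) * (mo 0 0 u * mo 0 1 u * mo 0 2 u * mo 1 2 u)) + (1 * w ^ 2) * (mo 0 0 u * mo 0 0 u * mo 1 1 u * mo 1 2 u))"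
    by (rule ext) (simp add: sg_def Let_def mo_def w_pow_num; simp add: ww ww' algebra_simps power2_eq_square)
  have q12: "quart (\<lambda>u. sg u ! 1 * (sg u ! 2)\<^sup>2)"
    unfolding e12 by (intro I) simp_all
  have e20: "(\<lambda>u. sg u ! 2 * (sg u ! 0)\<^sup>2) = (\<lambda>u. ((((((1 * w ^ 2) * (mo 0 1 u * mo 0 1 u * mo 1 2 u * mo 1 2 u)) + ((- 2) * w ^ 2) * (mo 0 0 u * mo 1 1 u * mo 1 2 u * mo 2 2 u)) + (1 * w ^ 2) * (mo 0 0 u * mo 0 1 u * mo 2 2 u * mo 2 2 u)) + ((- 1) * w ^ 2) * (mo 0 0 u * mo 0 1 u * mo 1 1 u * mo 2 2 u)) + (2 * w ^ 2) * (mo 0 0 u * mo 0 1 u * mo 0 2 u * mo 1 2 u)) + ((- 1) * w ^ 2) * (mo 0 0 u * mo 0 0 u * mo 1 2 u * mo 2 2 u))"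
    by (rule ext) (simp add: sg_def Let_def mo_def w_pow_num; simp add: ww ww' algebra_simps power2_eq_square)
  have q20: "quart (\<lambda>u. sg u ! 2 * (sg u ! 0)\<^sup>2)"
    unfolding e20 by (intro I) simp_all
  have e21: "(\<lambda>u. sg u ! 2 * (sg u ! 1)\<^sup>2) = (\<lambda>u. ((((((1 * w) * (mo 0 1 u * mo 0 1 u * mo 2 2 u * mo 2 2 u)) + ((- 2) * w) * (mo 0 0 u * mo 1 1 u * mo 1 2 u * mo 1 2 u)) + ((- 1) * w) * (mo 0 0 u * mo 0 1 u * mo 1 2 u * mo 2 2 u)) + (1 * w) * (mo 0 0 u * mo 0 1 u * mo 1 1 u * mo 1 2 u)) + (2 * w) * (mo 0 0 u * mo 0 1 u * mo 0 1 u * mo 2 2 u)) + ((- 1) * w) * (mo 0 0 u * mo 0 0 u * mo 1 1 u * mo 2 1 u))"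
    by (rule ext) (simp add: sg_def Let_def mo_def w_pow_num; simp add: ww ww' algebra_simps power2_eq_square)
  have q21: "quart (\<lambda>u. sg u ! 2 * (sg u ! 1)\<^sup>2)"
    unfolding e21 by (intro I) simp_all
  have e22: "(\<lambda>u. sg u ! 2 * (sg u ! 2)\<^sup>2) = (\<lambda>u. (((1 * (mo 1 1 u * mo 1 1 u * mo 2 2 u * mo 2 2 u)) + (- 3) * (mo 0 1 u * mo 0 1 u * mo 1 2 u * mo 2 2 u)) + 3 * (mo 0 0 u * mo 0 1 u * mo 1 2 u * mo 1 2 u)) + (- 1) * (mo 0 0 u * mo 0 0 u * mo 1 1 u * mo 2 2 u))"
    by (rule ext) (simp add: sg_def Let_def mo_def w_pow_num; simp add: ww ww' algebra_simps power2_eq_square)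
  have q22: "quart (\<lambda>u. sg u ! 2 * (sg u ! 2)\<^sup>2)"
    unfolding e22 by (intro I) simp_all
  assume "i < 3" "j < 3"
  then show ?thesis using q00 q01 q02 q10 q11 q12 q20 q21 q22 by (auto dest!: less_3)
qed

end

section \<open>Descent of equivariant plane maps to the surface\<close>

context severi_brauer
begin

lemma fkl_quart: "quart (\<lambda>u. fkl k l (sg u))"
proof -
  have "quart (\<lambda>u. w ^ (2 * i * k) * (sg u ! i * (sg u ! ((i + l) mod 3))\<^sup>2))" if "i < 3" for i
    by (intro quart_smult sg_quart that) auto
  from quart_add[OF quart_add[OF this[of 0] this[of 1]] this[of 2]] show ?thesis
    unfolding fkl_def sum3 by simp
qed

definition hmg :: "(complex list \<Rightarrow> complex list) \<Rightarrow> nat \<Rightarrow> bool" where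
  "hmg s d \<longleftrightarrow> (\<forall>u. length u = 3 \<longrightarrow> length (s u) = 3 \<and> (\<forall>c. s (map ((*) c) u) = map ((*) (c ^ d)) (s u)))"

text \<open>A homogeneous map \<open>s\<close> of the plane that commutes with the Heisenberg group up to scalars descends to a
  rational map of \<open>S\<close> over \<open>K\<close>.\<close>

definition defined_over_K :: "(complex list \<Rightarrow> complex list) \<Rightarrow> bool" where
  "defined_over_K s \<longleftrightarrow> (\<exists>e E. \<forall>m<9. E m \<in> ffun K 8 e \<and> (\<forall>u. length u = 3 \<longrightarrow> phi (s u) ! m = E m (phi u)))"

text \<open>Coordinate \<open>m\<close> of \<open>s\<close> has the character belonging to
  \<open>m\<close>, so only that component of \<open>Q m\<close> contributes to it. After scaling by
  \<open>al\<close> and \<open>be\<close> this component is a form over \<open>K\<close>, up to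
  precisely the factor contained in \<open>phi\<close>.\<close>

lemma equivariant_defined_over_K:
  assumes Q: "\<And>m. m < 9 \<Longrightarrow> Q m \<in> ffun K 8 e"
    "\<And>m u. m < 9 \<Longrightarrow> length u = 3 \<Longrightarrow> fvec (s u) ! m = Q m (fvec u)"
    and eq: "\<And>p q u. length u = 3 \<Longrightarrow> fvec (s (Mt p q u)) = sc (w ^ p) (w ^ (2 * q)) (fvec (s u))"
  shows "defined_over_K s"
proof -
  have "\<exists>E\<in>ffun K 8 e. \<forall>u. length u = 3 \<longrightarrow> phi (s u) ! m = E (phi u)" if m: "m < 9" for m
  proof -
    obtain H where H: "\<forall>i<3. \<forall>j<3. H i j \<in> ffun K 8 e"
      "\<forall>v. length v = 9 \<longrightarrow> Q m v = (\<Sum>i<3. \<Sum>j<3. H i j v)"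
      "\<forall>g e v i j. g ^ 3 = 1 \<longrightarrow> e ^ 3 = 1 \<longrightarrow> length v = 9 \<longrightarrow> i < 3 \<longrightarrow> j < 3 \<longrightarrow>
         H i j (sc g e v) = g ^ i * e ^ j * H i j v"
      "\<forall>g t i j. g ^ 3 \<in> K \<longrightarrow> t ^ 3 \<in> K \<longrightarrow> i < 3 \<longrightarrow> j < 3 \<longrightarrow>
         (\<exists>H'\<in>ffun K 8 e. \<forall>v. length v = 9 \<longrightarrow> H i j (sc g t v) = g ^ i * t ^ j * H' v)"
      using character_split[OF K.subring_C_axioms Q(1)[OF m]] by blast
    let ?k = "m div 3" and ?l = "m mod 3"
    have kl: "?k < 3" "?l < 3" using m by auto
    have comp: "fvec (s u) ! m = H ?k ?l (fvec u)" if u: "length u = 3" for u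
    proof -
      \<comment> \<open>The deviation from what is claimed. All its character sums vanish by
        equivariance, hence so does every entry.\<close>
      define c where "c i j = H i j (fvec u) - (if i = ?k \<and> j = ?l then fvec (s u) ! m else 0)" for i j
      have "c ?k ?l = 0"
      proof (rule fourier9[OF _ kl])
        fix p q :: nat
        have "2 * (2 * q) mod 3 = q mod 3" by presburger
        then have w4: "w ^ (2 * (2 * q)) = w ^ q" using w_pow_mod[of "2 * (2 * q)"] w_pow_mod[of q] by simp
        have "(\<Sum>i<3. \<Sum>j<3. (w ^ p) ^ i * (w ^ q) ^ j * H i j (fvec u)) = Q m (sc (w ^ p) (w ^ q) (fvec u))"
          using H w_pow3 by (simp cong: sum.cong_simp)
        also have "\<dots> = Q m (fvec (Mt p (2 * q) u))" by (simp only: fvec_Mt w4)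
        also have "\<dots> = fvec (s (Mt p (2 * q) u)) ! m" using Q(2)[OF m] by simp
        also have "\<dots> = (w ^ p) ^ ?k * (w ^ q) ^ ?l * fvec (s u) ! m"
          unfolding eq[OF u] w4 using m by (simp del: fvec_nth)
        finally have "(\<Sum>i<3. \<Sum>j<3. (w ^ p) ^ i * (w ^ q) ^ j * H i j (fvec u)) = (w ^ p) ^ ?k * (w ^ q) ^ ?l * fvec (s u) ! m" .
        moreover have "(\<Sum>i<3. \<Sum>j<3. (w ^ p) ^ i * (w ^ q) ^ j * (if i = ?k \<and> j = ?l then fvec (s u) ! m else 0))
            = (w ^ p) ^ ?k * (w ^ q) ^ ?l * fvec (s u) ! m"
        proof -
          have "(\<Sum>j<3. (w ^ p) ^ i * (w ^ q) ^ j * (if i = ?k \<and> j = ?l then fvec (s u) ! m else 0))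
            = (if i = ?k then (w ^ p) ^ ?k * (w ^ q) ^ ?l * fvec (s u) ! m else 0)" for i
          proof -
            have "(\<Sum>j<3. (w ^ p) ^ i * (w ^ q) ^ j * (if i = ?k \<and> j = ?l then fvec (s u) ! m else 0))
               = (\<Sum>j<3. if j = ?l then (if i = ?k then (w ^ p) ^ ?k * (w ^ q) ^ ?l * fvec (s u) ! m else 0) else 0)"
              by (rule sum.cong) auto
            then show ?thesis using kl by simp
          qed
          then show ?thesis using kl by simp
        qed
        ultimately show "(\<Sum>i<3. \<Sum>j<3. (w ^ p) ^ i * (w ^ q) ^ j * c i j) = 0"
          by (simp only: c_def right_diff_distrib sum_subtractf) simp
      qed
      then show ?thesis by (simp add: c_def)
    qed
    obtain H' where H': "H' \<in> ffun K 8 e" "\<forall>v. length v = 9 \<longrightarrow> H ?k ?l (sc al be v) = al ^ ?k * be ^ ?l * H' v"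
      using H(4)[rule_format, of al be ?k ?l] kl al3 be3 by auto
    have "phi (s u) ! m = H' (phi u)" if u: "length u = 3" for u
    proof -
      have "phi (s u) ! m = inverse al ^ ?k * inverse be ^ ?l * H ?k ?l (sc al be (phi u))"
        unfolding sc_phi comp[OF u, symmetric] phi_def[of "s u"] using m by (simp del: fvec_nth)
      also have "\<dots> = (inverse al * al) ^ ?k * (inverse be * be) ^ ?l * H' (phi u)"
        using H'(2) by (simp only: phi_len power_mult_distrib mult_ac)
      finally show ?thesis by simp
    qed
    then show ?thesis using H'(1) by blast
  qed
  then obtain E where "\<And>m. m < 9 \<Longrightarrow> E m \<in> ffun K 8 e \<and> (\<forall>u. length u = 3 \<longrightarrow> phi (s u) ! m = E m (phi u))"
    by metis
  then show ?thesis unfolding defined_over_K_def by blast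
qed

text \<open>The matrices multiply only up to cube roots of unity. These scalars disappear on points,
  so the images in \<open>Bir\<close> commute.\<close>

lemma Mt_Mt: "Mt p q (Mt a b u) = map ((*) (w ^ (p * b))) (Mt (p + a) (q + b) u)"
proof (rule nth_equalityI)
  fix i assume "i < length (Mt p q (Mt a b u))"
  then have i: "i < 3" by simp
  have "w ^ ((i + p) mod 3 * b) = w ^ ((i + p) * b)"
    by (metis mod_mult_left_eq w_pow_mod)
  moreover have "((i + p) mod 3 + a) mod 3 = (i + (p + a)) mod 3"
    by (simp add: mod_add_left_eq add.assoc)
  ultimately show "Mt p q (Mt a b u) ! i = map ((*) (w ^ (p * b))) (Mt (p + a) (q + b) u) ! i"
    using i by (simp add: Mt_nth power_add algebra_simps)
qed simp

lemma Mt_mod: "length u = 3 \<Longrightarrow> p mod 3 = p' mod 3 \<Longrightarrow> q mod 3 = q' mod 3 \<Longrightarrow> Mt p q u = Mt p' q' u"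
proof (rule nth_equalityI)
  fix i assume a: "p mod 3 = p' mod 3" "q mod 3 = q' mod 3" "i < length (Mt p q u)"
  have "w ^ (i * q) = w ^ (i * q')" by (metis a(2) mod_mult_right_eq w_pow_mod)
  moreover have "(i + p) mod 3 = (i + p') mod 3" using a(1) by (metis mod_add_right_eq)
  ultimately show "Mt p q u ! i = Mt p' q' u ! i" using a(3) by (simp add: Mt_nth)
qed simp

lemma Mt_0: "length u = 3 \<Longrightarrow> Mt 0 0 u = u"
  by (rule nth_equalityI) (simp_all add: Mt_nth)

lemma hmg_Mt: "hmg (Mt a b) 1"
  unfolding hmg_def
proof (intro allI impI conjI)
  fix u :: "complex list" and c assume "length u = 3"
  then show "Mt a b (map ((*) c) u) = map ((*) (c ^ 1)) (Mt a b u)"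
    by (intro nth_equalityI) (simp_all add: Mt_nth)
qed simp

lemma hmg_sg: "hmg sg 4"
  unfolding hmg_def
  by (simp add: sg_def Let_def power2_eq_square power4_eq_xxxx algebra_simps)

lemma fvec_scale: "length u = 3 \<Longrightarrow> fvec (map ((*) c) u) = map ((*) (c ^ 3)) (fvec u)"
  by (rule nth_equalityI) (simp_all add: fkl_scale)

text \<open>Checked for the two generators of the Heisenberg group and then extended to all
  exponents by induction.\<close>

lemma sg_Mt: "length u = 3 \<Longrightarrow> sg (Mt p q u) = map ((*) (w ^ q * (w ^ 2) ^ p)) (Mt p q (sg u))"
proof -
  assume u: "length u = 3"
  then obtain x y z where xyz: "u = [x, y, z]" using list3 by blast
  have Mt3: "Mt p q v = [w ^ 0 * v ! (p mod 3), w ^ q * v ! ((1 + p) mod 3), w ^ (2 * q) * v ! ((2 + p) mod 3)]" for p q v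
  proof (rule nth_equalityI)
    fix i assume "i < length (Mt p q v)"
    then have "i = 0 \<or> i = 1 \<or> i = 2" by auto
    then show "Mt p q v ! i = [w ^ 0 * v ! (p mod 3), w ^ q * v ! ((1 + p) mod 3), w ^ (2 * q) * v ! ((2 + p) mod 3)] ! i"
      by (elim disjE) (simp_all add: Mt_nth)
  qed simp
  have 1: "sg (Mt 1 0 v) = map ((*) (w ^ 2)) (Mt 1 0 (sg v))" if "length v = 3" for v
    unfolding Mt3 using list3[OF that]
    by (simp add: sg_def Let_def w_pow_num; simp add: ww ww' algebra_simps power2_eq_square flip: numeral_2_eq_2)
  have 2: "sg (Mt 0 1 v) = map ((*) w) (Mt 0 1 (sg v))" if "length v = 3" for v
    unfolding Mt3 using list3[OF that]
    by (simp add: sg_def Let_def w_pow_num; simp add: ww ww' algebra_simps power2_eq_square flip: numeral_2_eq_2)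
  have m1: "Mt a b (map ((*) c) v) = map ((*) c) (Mt a b v)" if "length v = 3" for a b c v
    using hmg_Mt[of a b] that by (simp add: hmg_def)
  have 3: "sg (Mt p 0 v) = map ((*) ((w ^ 2) ^ p)) (Mt p 0 (sg v))" if "length v = 3" for v
  proof (induction p)
    case 0
    then show ?case using that by (simp add: Mt_0 map_idI)
  next
    case (Suc p)
    have e: "Mt (Suc p) 0 v = Mt 1 0 (Mt p 0 v)" for v by (simp add: Mt_Mt map_idI)
    have "sg (Mt 1 0 (Mt p 0 v)) = map ((*) (w ^ 2)) (Mt 1 0 (map ((*) ((w ^ 2) ^ p)) (Mt p 0 (sg v))))"
      by (subst 1) (simp_all only: Mt_len Suc)
    also have "\<dots> = map ((*) (w ^ 2)) (map ((*) ((w ^ 2) ^ p)) (Mt 1 0 (Mt p 0 (sg v))))"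
      by (subst m1) simp_all
    finally show ?case unfolding e by (simp add: o_def mult_ac)
  qed
  have 4: "sg (Mt 0 q v) = map ((*) (w ^ q)) (Mt 0 q (sg v))" if "length v = 3" for v
  proof (induction q)
    case 0
    then show ?case using that by (simp add: Mt_0 map_idI)
  next
    case (Suc q)
    have e: "Mt 0 (Suc q) v = Mt 0 1 (Mt 0 q v)" for v by (simp add: Mt_Mt map_idI)
    have "sg (Mt 0 1 (Mt 0 q v)) = map ((*) w) (Mt 0 1 (map ((*) (w ^ q)) (Mt 0 q (sg v))))"
      by (subst 2) (simp_all only: Mt_len Suc)
    also have "\<dots> = map ((*) w) (map ((*) (w ^ q)) (Mt 0 1 (Mt 0 q (sg v))))"
      by (subst m1) simp_all
    finally show ?case unfolding e by (simp add: o_def mult_ac)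
  qed
  have e: "Mt p q v = Mt 0 q (Mt p 0 v)" for v by (simp add: Mt_Mt map_idI)
  have "sg (Mt 0 q (Mt p 0 u)) = map ((*) (w ^ q)) (Mt 0 q (map ((*) ((w ^ 2) ^ p)) (Mt p 0 (sg u))))"
    by (subst 4) (simp_all only: Mt_len 3[OF u])
  also have "\<dots> = map ((*) (w ^ q)) (map ((*) ((w ^ 2) ^ p)) (Mt 0 q (Mt p 0 (sg u))))"
    by (subst m1) simp_all
  finally show ?thesis unfolding e by (simp add: o_def mult_ac)
qed

lemma sg_defined: "defined_over_K sg"
proof -
  have "\<exists>Q\<in>ffun K 8 4. \<forall>u. length u = 3 \<longrightarrow> fkl k l (sg u) = Q (fvec u)" for k l
    using fkl_quart[of k l] by (auto simp: quart_def)
  then have ex: "\<exists>Q. Q \<in> ffun K 8 4 \<and> (\<forall>u. length u = 3 \<longrightarrow> fkl k l (sg u) = Q (fvec u))" for k l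
    by (simp only: Bex_def)
  define Q where "Q k l = (SOME Q. Q \<in> ffun K 8 4 \<and> (\<forall>u. length u = 3 \<longrightarrow> fkl k l (sg u) = Q (fvec u)))" for k l
  have Q: "Q k l \<in> ffun K 8 4 \<and> (\<forall>u. length u = 3 \<longrightarrow> fkl k l (sg u) = Q k l (fvec u))" for k l
    unfolding Q_def by (rule someI_ex[OF ex])
  show ?thesis
  proof (rule equivariant_defined_over_K[of "\<lambda>m. Q (m div 3) (m mod 3)" 4])
    fix p q and u :: "complex list" assume u: "length u = 3"
    \<comment> \<open>The scalar in \<open>sg_Mt\<close> is a cube root of unity and is cancelled by
      the cubic homogeneity of \<open>fvec\<close>.\<close>
    have "w ^ q * (w ^ 2) ^ p = w ^ (q + 2 * p)" by (simp add: power_add power_mult)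
    then have 1: "(w ^ q * (w ^ 2) ^ p) ^ 3 = 1" by (simp only: w_pow3)
    have "fvec (sg (Mt p q u)) = map ((*) ((w ^ q * (w ^ 2) ^ p) ^ 3)) (fvec (Mt p q (sg u)))"
      unfolding sg_Mt[OF u] by (rule fvec_scale[OF Mt_len])
    then show "fvec (sg (Mt p q u)) = sc (w ^ p) (w ^ (2 * q)) (fvec (sg u))"
      unfolding 1 fvec_Mt by (simp add: map_idI)
  next
    show "Q (m div 3) (m mod 3) \<in> ffun K 8 4" for m using Q by blast
    show "fvec (sg u) ! m = Q (m div 3) (m mod 3) (fvec u)" if "m < 9" "length u = 3" for m u
      using Q[of "m div 3" "m mod 3"] that by simp
  qed
qed

lemma Mt_defined: "defined_over_K (Mt a b)"
proof (rule equivariant_defined_over_K[of "\<lambda>m t. ((w ^ a) ^ (m div 3) * (w ^ (2 * b)) ^ (m mod 3)) * t ! m" 1])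
  show "(\<lambda>t. ((w ^ a) ^ (m div 3) * (w ^ (2 * b)) ^ (m mod 3)) * t ! m) \<in> ffun K 8 1" if "m < 9" for m
    using that by (intro K.ffun_smult K.ffun_coord) auto
  show "fvec (Mt a b u) ! m = (w ^ a) ^ (m div 3) * (w ^ (2 * b)) ^ (m mod 3) * fvec u ! m" if "m < 9" "length u = 3" for m u
    unfolding fvec_Mt using that by (simp del: fvec_nth)
  show "fvec (Mt a b (Mt p q u)) = sc (w ^ p) (w ^ (2 * q)) (fvec (Mt a b u))" for p q u
    by (simp add: fvec_Mt sc_sc mult.commute)
qed

definition dom :: "(complex list \<Rightarrow> complex list) \<Rightarrow> complex list set set" where
  "dom s = {pt (phi u) | u. u \<in> vecs 2 \<and> s u \<in> vecs 2}"

text \<open>The chosen representative does not matter for homogeneous \<open>s\<close>, by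
  \<open>hmg_pt\<close>.\<close>

definition lft :: "(complex list \<Rightarrow> complex list) \<Rightarrow> complex list set \<Rightarrow> complex list set" where
  "lft s p = pt (phi (s (SOME u. u \<in> vecs 2 \<and> p = pt (phi u))))"

lemma len_vecs: "u \<in> vecs 2 \<Longrightarrow> length u = 3"
  by (simp add: vecs_def)

lemma vecs_scale_iff: "c \<noteq> 0 \<Longrightarrow> map ((*) c) u \<in> vecs 2 \<longleftrightarrow> u \<in> vecs 2"
  by (auto simp: vecs_def)

lemma hmg_pt:
  assumes "hmg s d" "u \<in> vecs 2" "u' \<in> vecs 2" "pt (phi u) = pt (phi u')"
  shows "pt (phi (s u)) = pt (phi (s u'))" "s u \<in> vecs 2 \<longleftrightarrow> s u' \<in> vecs 2"
proof -
  have "pt u = pt u'" by (rule pt_phi_inj[OF assms(2-4)])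
  then obtain c where c: "c \<noteq> 0" "u = map ((*) c) u'" by (auto simp: pt_eq_iff)
  then have s: "s u = map ((*) (c ^ d)) (s u')" using assms by (simp add: hmg_def len_vecs)
  have "length (s u') = 3" using assms by (simp add: hmg_def len_vecs)
  then show "pt (phi (s u)) = pt (phi (s u'))"
    unfolding s using pt_eqI[of "c ^ d" "s u'"] c by (intro pt_phi_cong) auto
  show "s u \<in> vecs 2 \<longleftrightarrow> s u' \<in> vecs 2" unfolding s using c by (simp add: vecs_scale_iff)
qed

lemma lft_pt:
  assumes "hmg s d" "u \<in> vecs 2"
  shows "lft s (pt (phi u)) = pt (phi (s u))"
proof -
  define u' where "u' = (SOME u'. u' \<in> vecs 2 \<and> pt (phi u) = pt (phi u'))"
  have "\<exists>u'. u' \<in> vecs 2 \<and> pt (phi u) = pt (phi u')" using assms(2) by (intro exI[of _ u]) simp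
  from someI_ex[OF this] have "u' \<in> vecs 2" "pt (phi u) = pt (phi u')" by (simp_all only: u'_def)
  from hmg_pt(1)[OF assms this] show ?thesis unfolding lft_def u'_def by (rule sym)
qed

lemma dom_pt:
  assumes "hmg s d" "u \<in> vecs 2"
  shows "pt (phi u) \<in> dom s \<longleftrightarrow> s u \<in> vecs 2"
proof
  assume "pt (phi u) \<in> dom s"
  then obtain u' where u': "u' \<in> vecs 2" "pt (phi u) = pt (phi u')" "s u' \<in> vecs 2"
    unfolding dom_def mem_Collect_eq by (elim exE conjE)
  then show "s u \<in> vecs 2" using hmg_pt(2)[OF assms u'(1,2)] by simp
next
  assume "s u \<in> vecs 2"
  then show "pt (phi u) \<in> dom s" unfolding dom_def mem_Collect_eq by (intro exI[of _ u] conjI refl assms(2))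
qed

lemma phi_vecs_iff: "length u = 3 \<Longrightarrow> phi u \<in> vecs 8 \<longleftrightarrow> u \<in> vecs 2"
proof
  assume u: "length u = 3" "phi u \<in> vecs 8"
  show "u \<in> vecs 2"
  proof (rule ccontr)
    assume "u \<notin> vecs 2"
    then have "u ! i = 0" if "i < 3" for i using u that by (auto simp: vecs_def)
    then have "fkl k l u = 0" for k l by (simp add: fkl_def)
    then show False using u(2) by (auto simp: vecs_def phi_def)
  qed
qed (rule phi_vecs)

text \<open>A single family of forms \<open>E\<close> describes the map on its whole domain, which
  is the union of the principal open sets of the \<open>E m\<close>.\<close>

lemma regS_lft:
  assumes h: "hmg s d" and K: "defined_over_K s" and ne: "u0 \<in> vecs 2" "s u0 \<in> vecs 2"
  shows "V.regS (dom s) (lft s)"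
proof -
  obtain e E where E: "\<And>m. m < 9 \<Longrightarrow> E m \<in> ffun K 8 e"
    "\<And>m u. m < 9 \<Longrightarrow> length u = 3 \<Longrightarrow> phi (s u) ! m = E m (phi u)"
    using K unfolding defined_over_K_def by blast
  have Emem: "E m v = c ^ e * E m (phi u)" if "v = map ((*) c) (phi u)" "m < 9" for m v c u
    using ffun_scale[OF E(1)[OF that(2)], of "phi u" c] that(1) by simp
  have dS: "dom s \<subseteq> S" by (auto simp: dom_def S_def)
  have key: "s u \<in> vecs 2 \<longleftrightarrow> (\<exists>m<9. E m (phi u) \<noteq> 0)" if "u \<in> vecs 2" for u
  proof -
    have "length (s u) = 3" using h that by (simp add: hmg_def len_vecs)
    then have "s u \<in> vecs 2 \<longleftrightarrow> phi (s u) \<in> vecs 8" by (simp add: phi_vecs_iff)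
    also have "\<dots> \<longleftrightarrow> (\<exists>m<9. phi (s u) ! m \<noteq> 0)" by (auto simp: vecs_def less_Suc_eq_le[of _ 8, simplified])
    also have "\<dots> \<longleftrightarrow> (\<exists>m<9. E m (phi u) \<noteq> 0)" using E(2) that by (auto simp: len_vecs)
    finally show ?thesis .
  qed
  have nzE: "pt (phi u) \<in> nz S (E m) \<longleftrightarrow> E m (phi u) \<noteq> 0" if "u \<in> vecs 2" "m < 9" for u m
    by (rule nz_S_iff[OF ffun_mono[OF subset_UNIV E(1)] that(1)]) (rule that(2))
  have sub: "nz S (E m) \<subseteq> dom s" if "m < 9" for m
  proof
    fix p assume p: "p \<in> nz S (E m)"
    then obtain u where u: "u \<in> vecs 2" "p = pt (phi u)" by (auto simp: nz_def S_def)
    then show "p \<in> dom s" using nzE[OF u(1) that] key[OF u(1)] p dom_pt[OF h u(1)] that by blast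
  qed
  have op: "open_over CC K 8 S (dom s)"
    unfolding V.open_iff
  proof (intro conjI ballI dS)
    fix p assume "p \<in> dom s"
    then obtain u where u: "u \<in> vecs 2" "p = pt (phi u)" "s u \<in> vecs 2" unfolding dom_def mem_Collect_eq by (elim exE conjE)
    then obtain m where m: "m < 9" "E m (phi u) \<noteq> 0" using key by blast
    then show "\<exists>d. \<exists>h\<in>ffun K 8 d. p \<in> nz S h \<and> nz S h \<subseteq> dom s"
      using nzE[OF u(1) m(1)] u(2) E(1)[OF m(1)] sub[OF m(1)] by blast
  qed
  show ?thesis
  proof (rule V.regS_I[OF op])
    show "dom s \<noteq> {}" using ne by (auto simp: dom_def)
    fix x assume "x \<in> dom s"
    then obtain u where u: "u \<in> vecs 2" "x = pt (phi u)" "s u \<in> vecs 2" unfolding dom_def mem_Collect_eq by (elim exE conjE)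
    show "lft s x \<in> S" using lft_pt[OF h u(1)] u by (auto simp: S_def)
    obtain m where m: "m < 9" "E m (phi u) \<noteq> 0" using key u by blast
    have 1: "\<forall>j\<le>8. E j \<in> ffun K 8 e" using E(1) by simp
    have 2: "\<exists>j\<le>8. x \<in> nz S (E j)" using nzE[OF u(1) m(1)] m u(2) by (intro exI[of _ m]) simp
    have 3: "lft s y = pt (map (\<lambda>j. E j v) [0..<Suc 8])" if y: "y \<in> dom s" "v \<in> y" "j \<le> 8" "E j v \<noteq> 0" for y v j
    proof -
      obtain u' where u': "u' \<in> vecs 2" "y = pt (phi u')" "s u' \<in> vecs 2" using y(1) unfolding dom_def mem_Collect_eq by (elim exE conjE)
      obtain c where c: "c \<noteq> 0" "v = map ((*) c) (phi u')" using y(2) unfolding u'(2) pt_def' by blast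
      have "map (\<lambda>j. E j v) [0..<Suc 8] = map ((*) (c ^ e)) (phi (s u'))"
        by (rule nth_equalityI) (simp_all add: nth_map_upt Emem[OF c(2)] E(2) len_vecs[OF u'(1)] del: upt_Suc)
      then show ?thesis using lft_pt[OF h u'(1)] u'(2) pt_eqI[of "c ^ e"] c(1) by simp
    qed
    show "\<exists>d G. (\<forall>j\<le>8. G j \<in> ffun K 8 d) \<and> (\<exists>j\<le>8. x \<in> nz S (G j)) \<and>
      (\<forall>y\<in>dom s. \<forall>v\<in>y. (\<exists>j\<le>8. G j v \<noteq> 0) \<longrightarrow> lft s y = pt (map (\<lambda>j. G j v) [0..<Suc 8]))"
      using 1 2 3 by (intro exI[of _ e] exI[of _ E]) blast
  qed
qed

abbreviation "rp s \<equiv> (dom s, lft s)"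
abbreviation "G \<equiv> Bir CC K 8 S"

text \<open>A map whose cube is scalar has its own square as inverse. The orbit of \<open>u0\<close>
  shows that the domains of the composites are nonempty.\<close>

lemma cyc3_bir:
  assumes h: "hmg s d" and K: "defined_over_K s" and u0: "u0 \<in> vecs 2" "s u0 \<in> vecs 2" "s (s u0) \<in> vecs 2" "s (s (s u0)) \<in> vecs 2"
    and c3: "\<And>u. u \<in> vecs 2 \<Longrightarrow> \<exists>c. s (s (s u)) = map ((*) c) u"
  shows "V.bir (rp s)" "V.cl (V.cmp (rp s) (V.cmp (rp s) (rp s))) = V.cl (S, id)"
proof -
  have r: "V.regS (dom s) (lft s)" by (rule regS_lft[OF h K u0(1,2)])
  have ptd: "pt (phi u) \<in> dom s \<longleftrightarrow> s u \<in> vecs 2" "lft s (pt (phi u)) = pt (phi (s u))" if "u \<in> vecs 2" for u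
    using dom_pt[OF h that] lft_pt[OF h that] by auto
  have "V.regS {x \<in> dom s. lft s x \<in> dom s} (lft s \<circ> lft s)"
  proof (rule V.regS_comp(2)[OF r r])
    have "pt (phi u0) \<in> {x \<in> dom s. lft s x \<in> dom s}" using ptd u0 by simp
    then show "{x \<in> dom s. lft s x \<in> dom s} \<noteq> {}" by blast
  qed
  then have r2: "V.regS (fst (V.cmp (rp s) (rp s))) (snd (V.cmp (rp s) (rp s)))" by (simp add: V.cmp_def)
  have id3: "lft s (lft s (lft s x)) = x" if d: "x \<in> dom s" "lft s x \<in> dom s" "lft s (lft s x) \<in> dom s" for x
  proof -
    obtain u where u: "u \<in> vecs 2" "x = pt (phi u)" using d(1) unfolding dom_def mem_Collect_eq by (elim exE conjE)
    have 1: "s u \<in> vecs 2" using d(1) ptd u by simp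
    have 2: "s (s u) \<in> vecs 2" using d(2) ptd u 1 by simp
    have 3: "s (s (s u)) \<in> vecs 2" using d(3) ptd u 1 2 by simp
    obtain c where c: "s (s (s u)) = map ((*) c) u" using c3 u by blast
    have "c \<noteq> 0" using 3 unfolding c by (auto simp: vecs_def)
    then have "pt (s (s (s u))) = pt u" unfolding c by (rule pt_eqI)
    then have "pt (phi (s (s (s u)))) = pt (phi u)" using 3 by (intro pt_phi_cong) (simp_all add: len_vecs)
    then show ?thesis using u 1 2 ptd by simp
  qed
  have "inverse_rat_reps (rp s) (V.cmp (rp s) (rp s))"
  proof -
    have x0: "pt (phi u0) \<in> dom s" "lft s (pt (phi u0)) \<in> dom s" "lft s (lft s (pt (phi u0))) \<in> dom s"
      using ptd u0 by simp_all
    show ?thesis using x0 id3 by (auto simp: inverse_rat_reps_def V.cmp_def)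
  qed
  then have i: "V.invs (rp s) (V.cmp (rp s) (rp s))" using r r2 by (simp add: V.invs_def)
  then show "V.bir (rp s)" using V.bir_iff by blast
  have "V.cl (V.cmp (V.cmp (rp s) (rp s)) (rp s)) = V.cl (S, id)" by (rule V.invs_cl[OF i])
  then show "V.cl (V.cmp (rp s) (V.cmp (rp s) (rp s))) = V.cl (S, id)" by (simp add: V.cmp_assoc)
qed

lemma cl_eqI:
  assumes "V.regS (fst r) (snd r)" "V.regS (fst s) (snd s)"
    "\<And>u. u \<in> vecs 2 \<Longrightarrow> pt (phi u) \<in> fst r \<Longrightarrow> pt (phi u) \<in> fst s \<Longrightarrow> snd r (pt (phi u)) = snd s (pt (phi u))"
  shows "V.cl r = V.cl s"
proof -
  have "V.eqr r s"
    unfolding V.eqr_def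
  proof (intro conjI assms(1,2) ballI)
    fix x assume x: "x \<in> fst r \<inter> fst s"
    then have "x \<in> S" using V.regS_sub[OF assms(1)] by blast
    then obtain u where "u \<in> vecs 2" "x = pt (phi u)" by (auto simp: S_def)
    then show "snd r x = snd s x" using assms(3) x by simp
  qed
  then show ?thesis using V.cl_eq[OF assms(1)] by blast
qed

lemma Mt_vecs: "u \<in> vecs 2 \<Longrightarrow> Mt a b u \<in> vecs 2"
proof -
  assume u: "u \<in> vecs 2"
  then obtain i where i: "i < 3" "u ! i \<noteq> 0" by (auto simp: vecs_def less_Suc_eq_le numeral_3_eq_3 numeral_2_eq_2)
  define j where "j = (i + 2 * a) mod 3"
  have j: "j < 3" by (simp add: j_def)
  have "(j + a) mod 3 = (i + 3 * a) mod 3" unfolding j_def by presburger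
  then have "(j + a) mod 3 = i" using i(1) by simp
  then have "Mt a b u ! j \<noteq> 0" using j i(2) by (simp add: Mt_nth)
  then show ?thesis using j by (auto simp: vecs_def intro!: exI[of _ j])
qed

text \<open>A test point at which the maps involved are defined and which tells them apart.\<close>

lemma u123: "[1, 2, 3] \<in> vecs 2"
  by (simp add: vecs2)

lemma bir_Mt: "V.bir (rp (Mt a b))" "V.cl (V.cmp (rp (Mt a b)) (V.cmp (rp (Mt a b)) (rp (Mt a b)))) = V.cl (S, id)"
proof -
  have "\<exists>c. Mt a b (Mt a b (Mt a b u)) = map ((*) c) u" if "u \<in> vecs 2" for u
  proof -
    have "Mt a b (Mt a b (Mt a b u)) = map ((*) (w ^ (a * b) * w ^ (a * (b + b)))) (Mt (a + (a + a)) (b + (b + b)) u)"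
      using hmg_Mt[of a b] by (simp add: Mt_Mt hmg_def mult_ac add_ac)
    also have "Mt (a + (a + a)) (b + (b + b)) u = Mt 0 0 u"
      by (rule Mt_mod) (use that in \<open>auto simp: len_vecs\<close>, presburger+)
    finally show ?thesis using that by (auto simp: Mt_0 len_vecs)
  qed
  then show "V.bir (rp (Mt a b))" "V.cl (V.cmp (rp (Mt a b)) (V.cmp (rp (Mt a b)) (rp (Mt a b)))) = V.cl (S, id)"
    by (intro cyc3_bir[OF hmg_Mt Mt_defined u123] Mt_vecs u123; blast)+
qed

lemma sg_sg: "length u = 3 \<Longrightarrow> \<exists>c. sg (sg u) = map ((*) c) (sg2 u)"
proof -
  assume "length u = 3"
  then obtain x y z where xyz: "u = [x, y, z]" using list3 by blast
  \<comment> \<open>The common factor of the three coordinates of \<open>sg (sg u)\<close> is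
    \<open>N * (x * y * z) ^ 2\<close> up to sign.\<close>
  define N where "N = (y * z) ^ 3 + (x * z) ^ 3 + (x * y) ^ 3 - 3 * (x * y * z)\<^sup>2"
  have "sg (sg u) = map ((*) (- N * (x * y * z)\<^sup>2)) (sg2 u)"
    unfolding xyz N_def sg_def sg2_def Let_def
    by (simp add: w_pow_num; simp add: ww ww' algebra_simps power2_eq_square power3_eq_cube)
  then show ?thesis by blast
qed

lemma sg_sg2: "length u = 3 \<Longrightarrow> \<exists>c. sg (sg2 u) = map ((*) c) u"
proof -
  assume "length u = 3"
  then obtain x y z where xyz: "u = [x, y, z]" using list3 by blast
  define a where "a = x * z - y\<^sup>2"
  define b where "b = x * y - z\<^sup>2"
  define c where "c = y * z - x\<^sup>2"
  define n where "n = x ^ 3 + y ^ 3 + z ^ 3 - 3 * x * y * z"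
  \<comment> \<open>Up to sign \<open>a\<close>, \<open>b\<close>, \<open>c\<close> are the
    cofactors of the circulant matrix of \<open>x, y, z\<close> with determinant \<open>n\<close>.
    The identities say that the adjugate of the adjugate is the determinant times the
    matrix.\<close>
  have id: "c\<^sup>2 - a * b = x * n" "a\<^sup>2 - b * c = y * n" "b\<^sup>2 - a * c = z * n"
    unfolding a_def b_def c_def n_def by (simp_all add: algebra_simps power2_eq_square power3_eq_cube)
  have "sg (sg2 u) = [a\<^sup>2 * b\<^sup>2 * c\<^sup>2 * ((c\<^sup>2 - a * b)) / 1 * 1, a\<^sup>2 * b\<^sup>2 * c\<^sup>2 * (a\<^sup>2 - b * c), a\<^sup>2 * b\<^sup>2 * c\<^sup>2 * (b\<^sup>2 - a * c)]"
    unfolding xyz sg_def sg2_def Let_def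
    by (simp flip: a_def b_def c_def add: w_pow_num; simp add: ww ww' algebra_simps power2_eq_square)
  then have "sg (sg2 u) = map ((*) (a\<^sup>2 * b\<^sup>2 * c\<^sup>2 * n)) u"
    unfolding id xyz by simp
  then show ?thesis by blast
qed

lemma bir_sg: "V.bir (rp sg)" "V.cl (V.cmp (rp sg) (V.cmp (rp sg) (rp sg))) = V.cl (S, id)"
proof -
  have c3: "\<exists>c. sg (sg (sg u)) = map ((*) c) u" if "u \<in> vecs 2" for u
  proof -
    have len: "length u = 3" "length (sg2 u) = 3" using that by (auto simp: len_vecs sg2_def Let_def)
    obtain c where c: "sg (sg u) = map ((*) c) (sg2 u)" using sg_sg len by blast
    obtain c' where c': "sg (sg2 u) = map ((*) c') u" using sg_sg2 len by blast
    have "sg (sg (sg u)) = map ((*) (c ^ 4)) (sg (sg2 u))"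
      unfolding c using hmg_sg len by (simp add: hmg_def)
    then show ?thesis unfolding c' by auto
  qed
  have e1: "sg [1, 2, 3] = [- 3, - (14 * w), 30 * w\<^sup>2]" by (simp add: sg_def Let_def)
  have v1: "sg [1, 2, 3] \<in> vecs 2" unfolding e1 by (simp add: vecs2)
  have "sg (sg [1, 2, 3]) ! 1 \<noteq> 0"
  proof -
    have "sg (sg [1, 2, 3]) ! 1 = w * ((- 3) * (- (14 * w)) * ((- 3) * (- (14 * w)) - (30 * w\<^sup>2)\<^sup>2))"
      unfolding e1 by (simp add: sg_def Let_def)
    also have "(30 * w\<^sup>2)\<^sup>2 = 900 * w" by (simp add: power2_eq_square ww ww' algebra_simps)
    also have "w * ((- 3) * (- (14 * w)) * ((- 3) * (- (14 * w)) - 900 * w)) = - 36036 * w ^ 3"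
      by (simp add: power3_eq_cube)
    finally show ?thesis by (simp add: w3)
  qed
  then have v2: "sg (sg [1, 2, 3]) \<in> vecs 2"
    by (auto simp: vecs_def intro!: exI[of _ 1])
  have v3: "sg (sg (sg [1, 2, 3])) \<in> vecs 2"
  proof -
    obtain c where c: "sg (sg [1, 2, 3]) = map ((*) c) (sg2 [1, 2, 3])" using sg_sg[of "[1, 2, 3]"] by auto
    have "c \<noteq> 0" using v2 unfolding c by (auto simp: vecs2 sg2_def Let_def)
    have "w \<noteq> - 1" using w_eq by auto
    then have "35 * (1 + w) \<noteq> 0" by (metis add.commute eq_neg_iff_add_eq_0 mult_eq_0_iff zero_neq_numeral)
    then have "35 + w * 35 \<noteq> 0" by (simp add: algebra_simps)
    then have "sg (sg2 [1, 2, 3]) ! 0 \<noteq> 0"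
      by (simp add: sg_def sg2_def Let_def w_pow_num; simp add: ww ww' algebra_simps power2_eq_square)
    moreover have "sg (map ((*) c) (sg2 [1, 2, 3])) = map ((*) (c ^ 4)) (sg (sg2 [1, 2, 3]))"
      by (rule hmg_sg[unfolded hmg_def, rule_format, THEN conjunct2, rule_format]) (simp add: sg2_def Let_def)
    ultimately have "sg (map ((*) c) (sg2 [1, 2, 3])) ! 0 \<noteq> 0" using \<open>c \<noteq> 0\<close> by simp
    then show ?thesis unfolding c by (auto simp: vecs_def intro!: exI[of _ 0])
  qed
  show "V.bir (rp sg)" "V.cl (V.cmp (rp sg) (V.cmp (rp sg) (rp sg))) = V.cl (S, id)"
    using cyc3_bir[OF hmg_sg sg_defined u123 v1 v2 v3] c3 by blast+
qed

end

text \<open>The smaller groups are embedded through the first coordinates, so that the subgroup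
  contains the image of \<open>(1, 0, 0)\<close> in all three cases. That element will be the
  Cremona transformation.\<close>

lemma (in group) cube_subgroup:
  fixes A :: "('c, 'm) monoid_scheme"
  assumes f: "f \<in> hom (integer_mod_group 3 \<times>\<times> integer_mod_group 3 \<times>\<times> integer_mod_group 3) G"
    and inj: "inj_on f (carrier (integer_mod_group 3 \<times>\<times> integer_mod_group 3 \<times>\<times> integer_mod_group 3))"
    and A: "group A"
    and cases: "A \<cong> integer_mod_group 3 \<or> A \<cong> integer_mod_group 3 \<times>\<times> integer_mod_group 3 \<or> A \<cong> integer_mod_group 3 \<times>\<times> integer_mod_group 3 \<times>\<times> integer_mod_group 3"
  shows "\<exists>H. subgroup H G \<and> G\<lparr>carrier := H\<rparr> \<cong> A \<and> f (1, 0, 0) \<in> H"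
proof -
  let ?P = "integer_mod_group 3 \<times>\<times> integer_mod_group 3 \<times>\<times> integer_mod_group 3"
  have car: "carrier (integer_mod_group 3) = {0..<3}" by (simp add: carrier_integer_mod_group)
  have C: "group (integer_mod_group 3)" by (rule group_integer_mod_group)
  have gen: ?thesis
    if B: "group B" "A \<cong> B" and i: "i \<in> hom B ?P" "inj_on i (carrier B)" and x: "x \<in> carrier B" "i x = (1, 0, 0)"
    for B :: "('d, 'n) monoid_scheme" and i x
  proof -
    have "i ` carrier B \<subseteq> carrier ?P" using i(1) unfolding hom_def by (simp add: image_subset_iff Pi_iff del: carrier_DirProd)
    then have j: "inj_on (f \<circ> i) (carrier B)" using comp_inj_on[OF i(2) inj_on_subset[OF inj]] by blast
    have h: "f \<circ> i \<in> hom B G" by (rule Group.hom_compose[OF i(1) f])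
    have "B \<cong> A" by (rule group.iso_sym[OF A B(2)])
    then have "G\<lparr>carrier := (f \<circ> i) ` carrier B\<rparr> \<cong> A"
      using iso_trans[OF hom_image_iso(2)[OF B(1) h j]] by simp
    moreover have "f (1, 0, 0) \<in> (f \<circ> i) ` carrier B" using x by (intro image_eqI[of _ _ x]) simp_all
    ultimately show ?thesis using hom_image_iso(1)[OF B(1) h j] by blast
  qed
  show ?thesis using cases
  proof (elim disjE)
    assume A1: "A \<cong> integer_mod_group 3"
    show ?thesis
      by (rule gen[OF C A1, of "\<lambda>i. (i, 0, 0)" 1]) (auto simp: hom_def car inj_on_def mult_integer_mod_group)
  next
    assume A2: "A \<cong> integer_mod_group 3 \<times>\<times> integer_mod_group 3"
    show ?thesis
      by (rule gen[OF DirProd_group[OF C C] A2, of "\<lambda>x. (fst x, snd x, 0)" "(1, 0)"])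
        (auto simp: hom_def car inj_on_def mult_integer_mod_group)
  next
    assume A3: "A \<cong> ?P"
    show ?thesis
      by (rule gen[OF DirProd_group[OF C DirProd_group[OF C C]] A3, of "\<lambda>x. x" "(1, 0, 0)"])
        (auto simp: hom_def car inj_on_def)
  qed
qed

section \<open>The subgroup generated by the Heisenberg group and the Cremona transformation\<close>

context severi_brauer
begin

sublocale G: group G
  by (rule V.group_Bir)

lemma cmp_rp:
  assumes "hmg s d" "hmg t e" "u \<in> vecs 2"
  shows "pt (phi u) \<in> fst (V.cmp (rp s) (rp t)) \<longleftrightarrow> t u \<in> vecs 2 \<and> s (t u) \<in> vecs 2"
    and "t u \<in> vecs 2 \<Longrightarrow> snd (V.cmp (rp s) (rp t)) (pt (phi u)) = pt (phi (s (t u)))"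
proof -
  have t: "pt (phi u) \<in> dom t \<longleftrightarrow> t u \<in> vecs 2" "lft t (pt (phi u)) = pt (phi (t u))"
    by (rule dom_pt[OF assms(2,3)], rule lft_pt[OF assms(2,3)])
  show "pt (phi u) \<in> fst (V.cmp (rp s) (rp t)) \<longleftrightarrow> t u \<in> vecs 2 \<and> s (t u) \<in> vecs 2"
    using t dom_pt[OF assms(1), of "t u"] by (auto simp: V.cmp_def)
  show "snd (V.cmp (rp s) (rp t)) (pt (phi u)) = pt (phi (s (t u)))" if "t u \<in> vecs 2"
    using t lft_pt[OF assms(1) that] by (simp add: V.cmp_def)
qed

lemma pt_phi_scaled: "v \<in> vecs 2 \<Longrightarrow> v = map ((*) c) u \<Longrightarrow> pt (phi v) = pt (phi u)"
proof -
  assume v: "v \<in> vecs 2" "v = map ((*) c) u"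
  then have "c \<noteq> 0" by (auto simp: vecs_def)
  then have "pt v = pt u" unfolding v(2) by (rule pt_eqI)
  then show ?thesis using v(1) by (intro pt_phi_cong) (simp_all add: len_vecs)
qed

definition gM :: "nat \<Rightarrow> nat \<Rightarrow> _" where
  "gM a b = V.cl (rp (Mt a b))"

definition gS where
  "gS = V.cl (rp sg)"

lemma gM_carrier [simp]: "gM a b \<in> carrier G"
  using bir_Mt by (auto simp: gM_def V.Bir_carrier)

lemma gS_carrier [simp]: "gS \<in> carrier G"
  using bir_sg by (auto simp: gS_def V.Bir_carrier)

lemma gM_0: "gM 0 0 = \<one>\<^bsub>G\<^esub>"
  unfolding gM_def V.Bir_one
proof (rule cl_eqI)
  show "V.regS (fst (rp (Mt 0 0))) (snd (rp (Mt 0 0)))" by (rule V.bir_reg[OF bir_Mt(1)])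
  show "V.regS (fst (S, id)) (snd (S, id))" by (simp only: fst_conv snd_conv V.regS_id)
  fix u :: "complex list" assume "u \<in> vecs 2"
  then show "snd (rp (Mt 0 0)) (pt (phi u)) = snd (S, id) (pt (phi u))"
    by (simp add: lft_pt[OF hmg_Mt] Mt_0 len_vecs)
qed

lemma gM_mult: "gM a b \<otimes>\<^bsub>G\<^esub> gM p q = gM (a + p) (b + q)"
  unfolding gM_def V.Bir_mult[OF bir_Mt(1) bir_Mt(1)]
proof (rule cl_eqI)
  show "V.regS (fst (V.cmp (rp (Mt a b)) (rp (Mt p q)))) (snd (V.cmp (rp (Mt a b)) (rp (Mt p q))))"
    by (intro V.bir_reg V.bir_cmp bir_Mt)
  show "V.regS (fst (rp (Mt (a + p) (b + q)))) (snd (rp (Mt (a + p) (b + q))))" by (rule V.bir_reg[OF bir_Mt(1)])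
  fix u :: "complex list" assume u: "u \<in> vecs 2"
  have "pt (phi (Mt a b (Mt p q u))) = pt (phi (Mt (a + p) (b + q) u))"
    by (rule pt_phi_scaled[OF _ Mt_Mt]) (intro Mt_vecs u)
  then show "snd (V.cmp (rp (Mt a b)) (rp (Mt p q))) (pt (phi u)) = snd (rp (Mt (a + p) (b + q))) (pt (phi u))"
    using cmp_rp(2)[OF hmg_Mt hmg_Mt u Mt_vecs[OF u]] by (simp add: lft_pt[OF hmg_Mt u])
qed

lemma gS_gM: "gS \<otimes>\<^bsub>G\<^esub> gM p q = gM p q \<otimes>\<^bsub>G\<^esub> gS"
  unfolding gM_def gS_def V.Bir_mult[OF bir_Mt(1) bir_sg(1)] V.Bir_mult[OF bir_sg(1) bir_Mt(1)]
proof (rule cl_eqI)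
  show "V.regS (fst (V.cmp (rp sg) (rp (Mt p q)))) (snd (V.cmp (rp sg) (rp (Mt p q))))"
    by (intro V.bir_reg V.bir_cmp bir_Mt bir_sg)
  show "V.regS (fst (V.cmp (rp (Mt p q)) (rp sg))) (snd (V.cmp (rp (Mt p q)) (rp sg)))"
    by (intro V.bir_reg V.bir_cmp bir_Mt bir_sg)
  fix u :: "complex list" assume u: "u \<in> vecs 2"
    and d: "pt (phi u) \<in> fst (V.cmp (rp sg) (rp (Mt p q)))" "pt (phi u) \<in> fst (V.cmp (rp (Mt p q)) (rp sg))"
  have v: "sg (Mt p q u) \<in> vecs 2" "sg u \<in> vecs 2"
    using d cmp_rp(1)[OF hmg_sg hmg_Mt u] cmp_rp(1)[OF hmg_Mt hmg_sg u] by blast+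
  have "pt (phi (sg (Mt p q u))) = pt (phi (Mt p q (sg u)))"
    by (rule pt_phi_scaled[OF v(1) sg_Mt]) (rule len_vecs[OF u])
  then show "snd (V.cmp (rp sg) (rp (Mt p q))) (pt (phi u)) = snd (V.cmp (rp (Mt p q)) (rp sg)) (pt (phi u))"
    using cmp_rp(2)[OF hmg_sg hmg_Mt u Mt_vecs[OF u]] cmp_rp(2)[OF hmg_Mt hmg_sg u v(2)] by simp
qed

lemma gM_mod: "a mod 3 = a' mod 3 \<Longrightarrow> b mod 3 = b' mod 3 \<Longrightarrow> gM a b = gM a' b'"
  unfolding gM_def
proof (rule cl_eqI)
  assume ab: "a mod 3 = a' mod 3" "b mod 3 = b' mod 3"
  show "V.regS (fst (rp (Mt a b))) (snd (rp (Mt a b)))" "V.regS (fst (rp (Mt a' b'))) (snd (rp (Mt a' b')))"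
    by (rule V.bir_reg[OF bir_Mt(1)])+
  fix u :: "complex list" assume u: "u \<in> vecs 2"
  show "snd (rp (Mt a b)) (pt (phi u)) = snd (rp (Mt a' b')) (pt (phi u))"
    using Mt_mod[OF len_vecs[OF u] ab] by (simp add: lft_pt[OF hmg_Mt u])
qed

lemma gS3: "gS [^]\<^bsub>G\<^esub> (3::nat) = \<one>\<^bsub>G\<^esub>"
proof -
  have "gS [^]\<^bsub>G\<^esub> (3::nat) = gS \<otimes>\<^bsub>G\<^esub> (gS \<otimes>\<^bsub>G\<^esub> gS)"
    by (simp add: numeral_3_eq_3 G.m_assoc)
  also have "\<dots> = V.cl (V.cmp (rp sg) (V.cmp (rp sg) (rp sg)))"
    unfolding gS_def by (simp add: V.Bir_mult bir_sg(1) V.bir_cmp)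
  finally show ?thesis unfolding bir_sg(2) V.Bir_one .
qed

lemma gM_pow: "gM a b [^]\<^bsub>G\<^esub> (n::nat) = gM (n * a) (n * b)"
  by (induction n) (simp_all add: gM_0 gM_mult add.commute)

lemma gM3: "gM a b [^]\<^bsub>G\<^esub> (3::nat) = \<one>\<^bsub>G\<^esub>"
  unfolding gM_pow gM_0[symmetric] by (rule gM_mod) simp_all

text \<open>The test point is compared with its image. For a nontrivial shift the first two
  coordinates would force the root of unity \<open>t\<close> to be \<open>4 / 3\<close> or 6,
  contradicting \<open>t ^ 3 = 1\<close>.\<close>

lemma gM_1: "gM a b = \<one>\<^bsub>G\<^esub> \<Longrightarrow> a mod 3 = 0 \<and> b mod 3 = 0"
proof -
  assume "gM a b = \<one>\<^bsub>G\<^esub>"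
  then have "V.cl (rp (Mt a b)) = V.cl (S, id)" by (simp only: gM_def V.Bir_one)
  then have e: "V.eqr (rp (Mt a b)) (S, id)" using V.cl_eq[OF V.bir_reg[OF bir_Mt(1)]] by blast
  have d: "pt (phi [1, 2, 3]) \<in> dom (Mt a b)" using dom_pt[OF hmg_Mt u123] Mt_vecs[OF u123] by simp
  moreover have "pt (phi [1, 2, 3]) \<in> S" using u123 by (auto simp: S_def)
  ultimately have "lft (Mt a b) (pt (phi [1, 2, 3])) = pt (phi [1, 2, 3])"
    using e by (auto simp: V.eqr_def)
  then have "pt (phi (Mt a b [1, 2, 3])) = pt (phi [1, 2, 3])" by (simp add: lft_pt[OF hmg_Mt u123])
  from pt_phi_inj[OF Mt_vecs[OF u123] u123 this]
  obtain c where c: "Mt a b [1, 2, 3] = map ((*) c) [1, 2, 3]" by (auto simp: pt_eq_iff)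
  define t where "t = w ^ b"
  have t3: "t ^ 3 = 1" by (simp only: t_def w_pow3)
  have n0: "[1, 2, 3] ! (a mod 3) = c" using arg_cong[OF c, of "\<lambda>v. v ! 0"] by (simp add: Mt_nth)
  have n1: "t * [1, 2, 3] ! ((1 + a) mod 3) = c * 2" using arg_cong[OF c, of "\<lambda>v. v ! 1"] by (simp add: Mt_nth t_def)
  have "a mod 3 = 0 \<or> a mod 3 = 1 \<or> a mod 3 = 2" by presburger
  then have "a mod 3 = 0 \<and> t = 1"
  proof (elim disjE)
    assume a: "a mod 3 = 0"
    then have "(1 + a) mod 3 = 1" by presburger
    then show ?thesis using n0 n1 a by simp
  next
    assume a: "a mod 3 = 1"
    then have "(1 + a) mod 3 = 2" by presburger
    then have "t * 3 = 4" using n0 n1 a by simp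
    then have "(t * 3) ^ 3 = 4 ^ 3" by simp
    then have "t ^ 3 * 27 = 64" by (simp add: power_mult_distrib)
    then show ?thesis using t3 by simp
  next
    assume a: "a mod 3 = 2"
    then have "(1 + a) mod 3 = 0" by presburger
    then have "t = 6" using n0 n1 a by simp
    then show ?thesis using t3 by simp
  qed
  moreover have "b mod 3 = 0" if "w ^ b = 1"
  proof -
    have "w ^ (b mod 3) = 1" using that w_pow_mod[of b] by simp
    moreover have "b mod 3 = 0 \<or> b mod 3 = 1 \<or> b mod 3 = 2" by presburger
    moreover have w1: "w \<noteq> 1" using w_eq by auto
    moreover have "w\<^sup>2 \<noteq> 1"
    proof
      assume "w\<^sup>2 = 1"
      moreover have "w ^ 3 = w\<^sup>2 * w" by (simp add: power3_eq_cube power2_eq_square)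
      ultimately show False using w3 w1 by simp
    qed
    ultimately show ?thesis by (elim disjE) simp_all
  qed
  ultimately show ?thesis unfolding t_def by blast
qed

text \<open>Both images of the test point are known. Cubing the coordinates removes every power of
  \<open>w\<close> and leaves incompatible integers.\<close>

lemma gS_neq_gM: "gS \<noteq> gM a b"
proof
  assume "gS = gM a b"
  then have "V.cl (rp sg) = V.cl (rp (Mt a b))" by (simp only: gM_def gS_def)
  then have e: "V.eqr (rp sg) (rp (Mt a b))" using V.cl_eq[OF V.bir_reg[OF bir_sg(1)]] by blast
  have e1: "sg [1, 2, 3] = [- 3, - (14 * w), 30 * w\<^sup>2]" by (simp add: sg_def Let_def)
  have v1: "sg [1, 2, 3] \<in> vecs 2" unfolding e1 by (simp add: vecs2)
  have "pt (phi [1, 2, 3]) \<in> dom (Mt a b)" using dom_pt[OF hmg_Mt u123] Mt_vecs[OF u123] by simp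
  moreover have "pt (phi [1, 2, 3]) \<in> dom sg" using dom_pt[OF hmg_sg u123] v1 by simp
  ultimately have "lft sg (pt (phi [1, 2, 3])) = lft (Mt a b) (pt (phi [1, 2, 3]))"
    using e by (auto simp: V.eqr_def)
  then have "pt (phi (sg [1, 2, 3])) = pt (phi (Mt a b [1, 2, 3]))"
    by (simp add: lft_pt[OF hmg_Mt u123] lft_pt[OF hmg_sg u123])
  from pt_phi_inj[OF v1 Mt_vecs[OF u123] this]
  obtain c where c: "sg [1, 2, 3] = map ((*) c) (Mt a b [1, 2, 3])" by (auto simp: pt_eq_iff)
  have n0: "- 3 = c * [1, 2, 3] ! (a mod 3)"
    using arg_cong[OF c, of "\<lambda>v. v ! 0"] unfolding e1 by (simp add: Mt_nth)
  have n1: "- (14 * w) = c * (w ^ b * [1, 2, 3] ! ((1 + a) mod 3))"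
    using arg_cong[OF c, of "\<lambda>v. v ! 1"] unfolding e1 by (simp add: Mt_nth)
  have c0: "- 27 = c ^ 3 * ([1, 2, 3] ! (a mod 3)) ^ 3"
    using arg_cong[OF n0, of "\<lambda>x. x ^ 3"] by (simp add: power_mult_distrib)
  have c1: "- 2744 = c ^ 3 * ([1, 2, 3] ! ((1 + a) mod 3)) ^ 3"
    using arg_cong[OF n1, of "\<lambda>x. x ^ 3"] by (simp add: power_mult_distrib w_pow3 w3)
  have "a mod 3 = 0 \<or> a mod 3 = 1 \<or> a mod 3 = 2" by presburger
  then show False
  proof (elim disjE)
    assume a: "a mod 3 = 0"
    then have "(1 + a) mod 3 = 1" by presburger
    then have "c ^ 3 = - 27" "c ^ 3 * 8 = - 2744" using c0 c1 a by simp_all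
    then show ?thesis by simp
  next
    assume a: "a mod 3 = 1"
    then have "(1 + a) mod 3 = 2" by presburger
    then have e: "c ^ 3 * 8 = - 27" "c ^ 3 * 27 = - 2744" using c0 c1 a by simp_all
    have "(c ^ 3 * 8) * 27 = (c ^ 3 * 27) * 8" by simp
    then show ?thesis unfolding e by simp
  next
    assume a: "a mod 3 = 2"
    then have "(1 + a) mod 3 = 0" by presburger
    then have "c ^ 3 * 27 = - 27" "c ^ 3 = - 2744" using c0 c1 a by simp_all
    then show ?thesis by simp
  qed
qed

text \<open>Independence of the three generators: a relation that involves \<open>gS\<close> would
  make \<open>gS\<close> a Heisenberg element, and one that does not is excluded by
  \<open>gM_1\<close>.\<close>

lemma cube_subgroup_Bir:
  fixes A :: "('c, 'm) monoid_scheme"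
  assumes A: "group A"
    and cases: "A \<cong> integer_mod_group 3 \<or> A \<cong> integer_mod_group 3 \<times>\<times> integer_mod_group 3 \<or>
      A \<cong> integer_mod_group 3 \<times>\<times> integer_mod_group 3 \<times>\<times> integer_mod_group 3"
  shows "\<exists>H. subgroup H G \<and> G\<lparr>carrier := H\<rparr> \<cong> A \<and> gS \<in> H"
proof -
  have powM: "gM 1 0 [^]\<^bsub>G\<^esub> j \<otimes>\<^bsub>G\<^esub> gM 0 1 [^]\<^bsub>G\<^esub> k = gM (nat j) (nat k)" if "j \<ge> 0" "k \<ge> 0" for j k :: int
  proof -
    have "gM 1 0 [^]\<^bsub>G\<^esub> j = gM 1 0 [^]\<^bsub>G\<^esub> nat j" "gM 0 1 [^]\<^bsub>G\<^esub> k = gM 0 1 [^]\<^bsub>G\<^esub> nat k"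
      using that by (simp_all flip: int_pow_int)
    then show ?thesis by (simp add: gM_pow gM_mult)
  qed
  have ind: "i = 0 \<and> j = 0 \<and> k = 0"
    if r: "i \<in> {0..<3}" "j \<in> {0..<3}" "k \<in> {0..<3}"
      and e: "gS [^]\<^bsub>G\<^esub> i \<otimes>\<^bsub>G\<^esub> (gM 1 0 [^]\<^bsub>G\<^esub> j \<otimes>\<^bsub>G\<^esub> gM 0 1 [^]\<^bsub>G\<^esub> k) = \<one>\<^bsub>G\<^esub>" for i j k :: int
  proof -
    have e': "gS [^]\<^bsub>G\<^esub> i \<otimes>\<^bsub>G\<^esub> gM (nat j) (nat k) = \<one>\<^bsub>G\<^esub>" using e powM[of j k] r by simp
    have inv: "gM a b \<otimes>\<^bsub>G\<^esub> gM (2 * a) (2 * b) = \<one>\<^bsub>G\<^esub>" for a b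
      unfolding gM_mult gM_0[symmetric] by (rule gM_mod) simp_all
    have "i = 0 \<or> i = 1 \<or> i = 2" using r(1) by auto
    then show ?thesis
    proof (elim disjE)
      assume i: "i = 0"
      then have "gM (nat j) (nat k) = \<one>\<^bsub>G\<^esub>" using e' by simp
      from gM_1[OF this] have "nat j mod 3 = 0" "nat k mod 3 = 0" by simp_all
      moreover have "nat j < 3" "nat k < 3" using r by auto
      ultimately have "nat j = 0" "nat k = 0" by (simp_all only: mod_less)
      then show ?thesis using r i by simp
    next
      assume i: "i = 1"
      then have "gS \<otimes>\<^bsub>G\<^esub> gM (nat j) (nat k) = \<one>\<^bsub>G\<^esub>" using e' by simp
      then have "gS \<otimes>\<^bsub>G\<^esub> gM (nat j) (nat k) \<otimes>\<^bsub>G\<^esub> gM (2 * nat j) (2 * nat k) = gM (2 * nat j) (2 * nat k)" by simp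
      then have "gS = gM (2 * nat j) (2 * nat k)" by (simp add: G.m_assoc inv)
      then show ?thesis using gS_neq_gM by blast
    next
      assume i: "i = 2"
      have "gS [^]\<^bsub>G\<^esub> (2::int) = gS \<otimes>\<^bsub>G\<^esub> gS" 
        by (metis G.nat_pow_Suc G.nat_pow_0 G.l_one gS_carrier int_pow_int numeral_2_eq_2 of_nat_numeral)
      then have "gS \<otimes>\<^bsub>G\<^esub> (gS \<otimes>\<^bsub>G\<^esub> gS \<otimes>\<^bsub>G\<^esub> gM (nat j) (nat k)) = gS" using e' i by simp
      moreover have "gS \<otimes>\<^bsub>G\<^esub> (gS \<otimes>\<^bsub>G\<^esub> gS) = \<one>\<^bsub>G\<^esub>" using gS3 by (simp add: numeral_3_eq_3 G.m_assoc)
      ultimately have "gM (nat j) (nat k) = gS" by (simp flip: G.m_assoc)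
      then show ?thesis using gS_neq_gM by metis
    qed
  qed
  have M: "gM 1 0 \<otimes>\<^bsub>G\<^esub> gM 0 1 = gM 0 1 \<otimes>\<^bsub>G\<^esub> gM 1 0" by (simp add: gM_mult)
  note H = G.cube_homs[OF gS_carrier gM_carrier gM_carrier gS_gM gS_gM M gS3 gM3 gM3 ind]
  have one: "(\<lambda>(i, j, k). gS [^]\<^bsub>G\<^esub> (i::int) \<otimes>\<^bsub>G\<^esub> (gM 1 0 [^]\<^bsub>G\<^esub> (j::int) \<otimes>\<^bsub>G\<^esub> gM 0 1 [^]\<^bsub>G\<^esub> (k::int))) (1, 0, 0) = gS"
    by simp
  show ?thesis using G.cube_subgroup[OF H A cases] unfolding one .
qed

end

section \<open>Polynomial triples and linearity of automorphisms of finite order\<close>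

lemma p3_subst:
  assumes c: "\<And>c. R (\<lambda>t. c)" and add: "\<And>f g. R f \<Longrightarrow> R g \<Longrightarrow> R (\<lambda>t. f t + g t)"
    and mult: "\<And>f g. R f \<Longrightarrow> R g \<Longrightarrow> R (\<lambda>t. f t * g t)"
    and f: "R f" and g: "R g" and h: "R h"
  shows "R (\<lambda>t. ev3 P (f t) (g t) (h t))"
proof -
  have 1: "R (\<lambda>t. poly a (h t))" for a
    by (induction a rule: pCons_induct) (simp_all add: c add mult h)
  have e2: "ev2 (pCons a A) y z = poly a z + y * ev2 A y z" for a A y z by (simp add: ev2_def)
  have 2: "R (\<lambda>t. ev2 A (g t) (h t))" for A
    by (induction A rule: pCons_induct) (simp_all add: c add mult g e2 1)
  have e3: "ev3 (pCons a A) x y z = ev2 a y z + x * ev3 A x y z" for a A x y z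
    by (simp add: ev3_def) (simp add: ev2_def)
  show ?thesis
    by (induction P rule: pCons_induct) (simp_all add: c add mult f e3 2)
qed

text \<open>Obtained from \<open>p3_subst\<close> with the functions that are polynomials in
  \<open>c\<close>. The restriction to a line is what makes one-variable arguments possible.\<close>

lemma ev3_line: "\<exists>p. \<forall>c. poly p c = ev3 P (a + c * a') (b + c * b') (d + c * d')"
proof (rule p3_subst[where R = "\<lambda>g. \<exists>p. \<forall>c::complex. poly p c = g c"])
  show "\<exists>p. \<forall>c. poly p c = k" for k :: complex by (rule exI[of _ "[:k:]"]) simp
  show "\<exists>p. \<forall>c. poly p c = f c + g c" if "\<exists>p. \<forall>c. poly p c = f c" "\<exists>p. \<forall>c. poly p c = g c" for f g :: "complex \<Rightarrow> complex"
  proof -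
    from that obtain p q where "\<forall>c. poly p c = f c" "\<forall>c. poly q c = g c" by (elim exE)
    then show ?thesis by (intro exI[of _ "p + q"]) simp
  qed
  show "\<exists>p. \<forall>c. poly p c = f c * g c" if "\<exists>p. \<forall>c. poly p c = f c" "\<exists>p. \<forall>c. poly p c = g c" for f g :: "complex \<Rightarrow> complex"
  proof -
    from that obtain p q where "\<forall>c. poly p c = f c" "\<forall>c. poly q c = g c" by (elim exE)
    then show ?thesis by (intro exI[of _ "p * q"]) simp
  qed
  show "\<exists>p. \<forall>c. poly p c = k + c * l" for k l :: complex by (rule exI[of _ "[:k, l:]"]) simp
  show "\<exists>p. \<forall>c. poly p c = k + c * l" for k l :: complex by (rule exI[of _ "[:k, l:]"]) simp
  show "\<exists>p. \<forall>c. poly p c = k + c * l" for k l :: complex by (rule exI[of _ "[:k, l:]"]) simp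
qed

lemma nonvanishing_poly_const:
  fixes p :: "complex poly"
  assumes "\<And>c. poly p c \<noteq> 0"
  shows "poly p c = poly p d"
  using fundamental_theorem_of_algebra[of p] assms unfolding constant_def by blast

text \<open>Along a line that misses the origin the polynomial has no zero and is constant. Three
  such lines lead from a point with nonzero \<open>x\<close> to \<open>(1, 1, 1)\<close>.\<close>

lemma nonvanishing_const:
  assumes "\<And>x y z. x \<noteq> 0 \<or> y \<noteq> 0 \<or> z \<noteq> 0 \<Longrightarrow> ev3 P x y z \<noteq> 0"
  shows "\<exists>k. k \<noteq> 0 \<and> P = pc k"
proof -
  have line: "ev3 P a b d = ev3 P (a + a') (b + b') (d + d')"
    if "\<And>c. a + c * a' \<noteq> 0 \<or> b + c * b' \<noteq> 0 \<or> d + c * d' \<noteq> 0" for a b d a' b' d'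
  proof -
    obtain p where p: "\<forall>c. poly p c = ev3 P (a + c * a') (b + c * b') (d + c * d')" by (rule exE[OF ev3_line])
    have "poly p 0 = poly p 1" by (rule nonvanishing_poly_const) (use p assms that in simp)
    then show ?thesis using p by simp
  qed
  define k where "k = ev3 P 1 1 1"
  have "ev3 P x y z = k" if "x \<noteq> 0" for x y z
  proof -
    have "ev3 P x y z = ev3 P x y 1" using line[of x 0 y 0 z "1 - z"] that by simp
    also have "\<dots> = ev3 P x 1 1" using line[of x 0 y "1 - y" 1 0] that by simp
    also have "\<dots> = k" using line[of x "1 - x" 1 0 1 0] by (simp add: k_def)
    finally show ?thesis .
  qed
  moreover have "px \<noteq> 0" by (simp add: px_def)
  ultimately have "P - pc k = 0" by (intro ev3_dense[of px]) simp_all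
  moreover have "k \<noteq> 0" unfolding k_def by (rule assms) simp
  ultimately show ?thesis by (intro exI[of _ k]) simp
qed

text \<open>Division by the greatest common divisor. A triple proportional to a triple without
  common factor is a polynomial multiple of it, by unique factorisation.\<close>

lemma coprime_triple:
  fixes P :: "nat \<Rightarrow> p3"
  assumes "P i0 \<noteq> 0" "i0 < 3"
  shows "\<exists>T g. g \<noteq> 0 \<and> (\<forall>i<3. P i = g * T i) \<and>
    (\<forall>Q. (\<forall>i<3. \<forall>j<3. Q i * T j = Q j * T i) \<longrightarrow> (\<exists>q. \<forall>i<3. Q i = q * T i))"
proof -
  define g where "g = gcd (P 0) (gcd (P 1) (P 2))"
  define T where "T i = P i div g" for i
  have gd: "g dvd P 0" "g dvd P 1" "g dvd P 2" by (auto simp: g_def intro: gcd_dvd1 gcd_dvd2 dvd_trans)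
  then have PT: "P i = g * T i" if "i < 3" for i using less_3[OF that] by (auto simp: T_def)
  have g0: "g \<noteq> 0" using PT[OF assms(2)] assms(1) by auto
  define e where "e = gcd (T 0) (gcd (T 1) (T 2))"
  have ed: "e dvd T 0" "e dvd T 1" "e dvd T 2" by (auto simp: e_def intro: gcd_dvd1 gcd_dvd2 dvd_trans)
  then have "g * e dvd P 0" "g * e dvd P 1" "g * e dvd P 2" using PT by (simp_all add: mult_dvd_mono)
  then have "g * e dvd g * 1" unfolding g_def by simp
  then have e1: "e dvd 1" using g0 by (simp only: dvd_times_left_cancel_iff simp_thms)
  have "\<exists>q. \<forall>i<3. Q i = q * T i" if Q: "\<forall>i<3. \<forall>j<3. Q i * T j = Q j * T i" for Q
  proof -
    have Ti: "T i0 \<noteq> 0" using PT[OF assms(2)] assms(1) by auto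
    have d: "T i0 dvd Q i0 * T i" if "i < 3" for i
      using Q assms(2) that by (metis dvd_triv_right)
    have "T i0 dvd gcd (Q i0 * T 0) (gcd (Q i0 * T 1) (Q i0 * T 2))" using d[of 0] d[of 1] d[of 2] by simp
    also have "gcd (Q i0 * T 0) (gcd (Q i0 * T 1) (Q i0 * T 2)) = normalize (Q i0 * e)"
      by (simp add: e_def gcd_mult_left)
    finally have "T i0 dvd Q i0 * e" by simp
    also have "Q i0 * e dvd Q i0 * 1" using e1 by (rule mult_dvd_mono[OF dvd_refl])
    finally obtain q where q: "Q i0 = T i0 * q" by (auto elim: dvdE)
    have "Q i = q * T i" if "i < 3" for i
    proof -
      have "T i0 * Q i = T i0 * (q * T i)" using Q assms(2) that q by (metis mult.assoc mult.commute)
      then show ?thesis using Ti by simp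
    qed
    then show ?thesis by blast
  qed
  then show ?thesis using g0 PT by (intro exI[of _ T] exI[of _ g]) blast
qed

definition evt :: "(nat \<Rightarrow> p3) \<Rightarrow> complex list \<Rightarrow> complex list" where
  "evt T u = map (\<lambda>i. ev3 (T i) (u ! 0) (u ! 1) (u ! 2)) [0..<Suc 2]"

lemma evt_len [simp]: "length (evt T u) = 3" by (simp add: evt_def)

lemma evt_nth: "i < 3 \<Longrightarrow> evt T u ! i = ev3 (T i) (u ! 0) (u ! 1) (u ! 2)"
  unfolding evt_def by (subst nth_map_upt) simp_all

lemma vecs2_iff: "length u = 3 \<Longrightarrow> u \<in> vecs 2 \<longleftrightarrow> (\<exists>i<3. u ! i \<noteq> 0)"
  by (auto simp: vecs_def less_Suc_eq_le numeral_3_eq_3 numeral_2_eq_2)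

lemma len3_E:
  assumes "length u = 3"
  obtains x y z where "u = [x, y, z]"
  using list3[OF assms] by blast

text \<open>Both triples are polynomial multiples of the same triple without common factor. The
  multipliers have no zero away from the origin, so they are constants.\<close>

lemma parallel_nonvanishing:
  assumes T: "\<And>u. u \<in> vecs 2 \<Longrightarrow> evt T u \<in> vecs 2" and Q: "\<And>u. u \<in> vecs 2 \<Longrightarrow> evt Q u \<in> vecs 2"
    and par: "\<And>u. u \<in> vecs 2 \<Longrightarrow> \<exists>c. evt Q u = map ((*) c) (evt T u)"
  shows "\<exists>k. k \<noteq> 0 \<and> (\<forall>u. evt Q u = map ((*) k) (evt T u))"
proof -
  have e1: "[1, 0, 0] \<in> vecs 2" by (simp add: vecs2)
  obtain i0 where "i0 < 3" "evt T [1, 0, 0] ! i0 \<noteq> 0"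
    using T[OF e1] unfolding vecs2_iff[OF evt_len] by (elim exE conjE)
  then have i0: "i0 < 3" "T i0 \<noteq> 0" by (auto simp: evt_nth)
  obtain T' g where g: "g \<noteq> 0" "\<forall>i<3. T i = g * T' i"
    "\<forall>Q. (\<forall>i<3. \<forall>j<3. Q i * T' j = Q j * T' i) \<longrightarrow> (\<exists>q. \<forall>i<3. Q i = q * T' i)"
    using coprime_triple[where P = T and ?i0.0 = i0, OF i0(2,1)] by (elim exE conjE)
  have "Q i * T j - Q j * T i = 0" if ij: "i < 3" "j < 3" for i j
  proof (rule ev3_dense[of px])
    fix x y z assume "ev3 px x y z \<noteq> 0"
    then have v: "[x, y, z] \<in> vecs 2" by (simp add: vecs2)
    obtain c where c: "evt Q [x, y, z] = map ((*) c) (evt T [x, y, z])" using par[OF v] by (elim exE)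
    have "ev3 (Q i) x y z = c * ev3 (T i) x y z" if "i < 3" for i
      using arg_cong[OF c, of "\<lambda>v. v ! i"] that by (simp add: evt_nth)
    then show "ev3 (Q i * T j - Q j * T i) x y z = 0" using ij by simp
  qed (simp add: px_def)
  then have "g * (Q i * T' j) = g * (Q j * T' i)" if "i < 3" "j < 3" for i j
    using that g(2) by (simp add: mult_ac)
  then have "\<forall>i<3. \<forall>j<3. Q i * T' j = Q j * T' i" using g(1) by simp
  then obtain q where q: "\<forall>i<3. Q i = q * T' i" using g(3)[rule_format, of Q] by blast
  have gv: "ev3 g x y z \<noteq> 0" if xyz: "x \<noteq> 0 \<or> y \<noteq> 0 \<or> z \<noteq> 0" for x y z
  proof -
    have "[x, y, z] \<in> vecs 2" using xyz by (simp add: vecs2)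
    from T[OF this] obtain i where "i < 3" "ev3 (T i) x y z \<noteq> 0" by (auto simp: vecs2_iff evt_nth)
    then show ?thesis using g(2) by auto
  qed
  have qv: "ev3 q x y z \<noteq> 0" if xyz: "x \<noteq> 0 \<or> y \<noteq> 0 \<or> z \<noteq> 0" for x y z
  proof -
    have "[x, y, z] \<in> vecs 2" using xyz by (simp add: vecs2)
    from Q[OF this] obtain i where "i < 3" "ev3 (Q i) x y z \<noteq> 0" by (auto simp: vecs2_iff evt_nth)
    then show ?thesis using q by auto
  qed
  obtain a where a: "a \<noteq> 0" "g = pc a" using nonvanishing_const[of g] gv by blast
  obtain b where b: "b \<noteq> 0" "q = pc b" using nonvanishing_const[of q] qv by blast
  have "evt Q u = map ((*) (b / a)) (evt T u)" for u
    by (rule nth_equalityI) (use a b g(2) q in \<open>simp_all add: evt_nth\<close>)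
  then show ?thesis using a b by (intro exI[of _ "b / a"]) simp
qed

lemma evt_comp: "\<exists>Q. \<forall>u. evt Q u = evt P (evt T u)"
proof -
  have "\<exists>Q. \<forall>t. ev3 Q (t ! 0) (t ! 1) (t ! 2) = ev3 (P i) (evt T t ! 0) (evt T t ! 1) (evt T t ! 2)" for i
  proof (rule p3_subst[where R = "\<lambda>g. \<exists>p. \<forall>t. ev3 p (t ! 0) (t ! 1) (t ! 2) = g t"])
    let ?e = "\<lambda>p t. ev3 p (t ! 0) (t ! 1) (t ! 2)"
    show "\<exists>p. \<forall>t. ?e p t = k" for k by (rule exI[of _ "pc k"]) simp
    show "\<exists>p. \<forall>t. ?e p t = f t + g t" if "\<exists>p. \<forall>t. ?e p t = f t" "\<exists>p. \<forall>t. ?e p t = g t" for f g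
    proof -
      from that obtain p q where "\<forall>t. ?e p t = f t" "\<forall>t. ?e q t = g t" by (elim exE)
      then show ?thesis by (intro exI[of _ "p + q"]) simp
    qed
    show "\<exists>p. \<forall>t. ?e p t = f t * g t" if "\<exists>p. \<forall>t. ?e p t = f t" "\<exists>p. \<forall>t. ?e p t = g t" for f g
    proof -
      from that obtain p q where "\<forall>t. ?e p t = f t" "\<forall>t. ?e q t = g t" by (elim exE)
      then show ?thesis by (intro exI[of _ "p * q"]) simp
    qed
    show "\<exists>p. \<forall>t. ?e p t = evt T t ! 0" by (rule exI[of _ "T 0"]) (simp add: evt_nth)
    show "\<exists>p. \<forall>t. ?e p t = evt T t ! 1" by (rule exI[of _ "T 1"]) (simp add: evt_nth)
    show "\<exists>p. \<forall>t. ?e p t = evt T t ! 2" by (rule exI[of _ "T 2"]) (simp add: evt_nth)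
  qed
  then have ex: "\<forall>i. \<exists>Q. \<forall>t. ev3 Q (t ! 0) (t ! 1) (t ! 2) = ev3 (P i) (evt T t ! 0) (evt T t ! 1) (evt T t ! 2)" by blast
  obtain Q where Q: "\<forall>i. \<forall>t. ev3 (Q i) (t ! 0) (t ! 1) (t ! 2) = ev3 (P i) (evt T t ! 0) (evt T t ! 1) (evt T t ! 2)"
    using choice[OF ex] by (elim exE)
  have "evt Q u = evt P (evt T u)" for u
    by (rule nth_equalityI) (simp_all only: evt_len evt_nth[where T = Q] evt_nth[where T = P] Q simp_thms)
  then show ?thesis by (intro exI[of _ Q] allI)
qed

lemma p3_split: "\<exists>B C D. \<forall>x y z. ev3 P x y z = ev3 P 0 0 0 + x * ev3 B x y z + y * ev3 C x y z + z * ev3 D x y z"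
proof (cases P rule: pCons_cases)
  case (pCons a B)
  obtain b C where a: "a = pCons b C" by (rule pCons_cases)
  obtain c D where b: "b = pCons c D" by (rule pCons_cases)
  show ?thesis
    unfolding pCons a b
    by (rule exI[of _ B], rule exI[of _ "[:C:]"], rule exI[of _ "[:[:D:]:]"]) (simp add: ev3_def ev2_def algebra_simps)
qed

text \<open>Divided by \<open>c\<close>, the value at the scaled point is a polynomial in
  \<open>c\<close> that is constant for nonzero \<open>c\<close>. Its value at \<open>c = 0\<close>
  is the linear part.\<close>

lemma homogeneous_linear:
  assumes "\<And>c x y z. c \<noteq> 0 \<Longrightarrow> ev3 P (c * x) (c * y) (c * z) = c * ev3 P x y z"
  shows "\<exists>a b d. \<forall>x y z. ev3 P x y z = a * x + b * y + d * z"
proof -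
  obtain B C D where s: "\<forall>x y z. ev3 P x y z = ev3 P 0 0 0 + x * ev3 B x y z + y * ev3 C x y z + z * ev3 D x y z"
    using p3_split[of P] by (elim exE)
  have z: "ev3 P 0 0 0 = 0" using assms[of 2 0 0 0] by simp
  have "ev3 P x y z = ev3 B 0 0 0 * x + ev3 C 0 0 0 * y + ev3 D 0 0 0 * z" for x y z
  proof -
    obtain b where b: "\<forall>c. poly b c = ev3 B (0 + c * x) (0 + c * y) (0 + c * z)" by (rule exE[OF ev3_line])
    obtain e where e: "\<forall>c. poly e c = ev3 C (0 + c * x) (0 + c * y) (0 + c * z)" by (rule exE[OF ev3_line])
    obtain d where d: "\<forall>c. poly d c = ev3 D (0 + c * x) (0 + c * y) (0 + c * z)" by (rule exE[OF ev3_line])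
    define F where "F = [:x:] * b + [:y:] * e + [:z:] * d - [:ev3 P x y z:]"
    have F: "poly F c = 0" if "c \<noteq> 0" for c
    proof -
      have "c * ev3 P x y z = c * (x * poly b c + y * poly e c + z * poly d c)"
        unfolding assms[OF that, symmetric] s[rule_format, of "c * x"] using b d e z by (simp add: algebra_simps)
      then show ?thesis using that by (simp add: F_def)
    qed
    have "infinite (UNIV - {0::complex})" using infinite_UNIV_char_0 by simp
    then have "F = 0" by (rule infinite_roots_0) (simp add: F)
    then have "poly F 0 = 0" by simp
    then show ?thesis using b d e by (simp add: F_def mult_ac)
  qed
  then show ?thesis by blast
qed

text \<open>Scaling the argument by \<open>c\<close> scales \<open>T\<close> by a factor
  \<open>p c\<close> that is polynomial in \<open>c\<close>. Period three makes the threefold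
  iterate of \<open>p\<close> the identity, so \<open>p\<close> has degree one; multiplicativity
  then gives \<open>p c = c\<close>, and \<open>T\<close> is linear.\<close>

lemma cubic_periodic_linear:
  assumes T: "\<And>u. u \<in> vecs 2 \<Longrightarrow> evt T u \<in> vecs 2"
    and scale: "\<And>u c. u \<in> vecs 2 \<Longrightarrow> c \<noteq> 0 \<Longrightarrow> \<exists>k. evt T (map ((*) c) u) = map ((*) k) (evt T u)"
    and per: "\<And>u. u \<in> vecs 2 \<Longrightarrow> \<exists>k. evt T (evt T (evt T u)) = map ((*) k) u"
  shows "\<exists>A h. h \<noteq> 0 \<and> (\<forall>u. length u = 3 \<longrightarrow> evt T (evt T (evt T u)) = map ((*) h) u) \<and>
    (\<forall>i<3. \<forall>x y z. ev3 (T i) x y z = (A i 0 * x + A i 1 * y + A i (2::nat) * z))"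
proof -
  have list3': "u = [u ! 0, u ! 1, u ! 2]" if "length u = 3" for u :: "complex list" by (rule list3[OF that])
  have evt_u: "evt T [u ! 0, u ! 1, u ! 2] = evt T u" for T u
    by (simp add: evt_def)
  define I where "I i = (if i = 0 then px else if i = 1 then py else pz)" for i :: nat
  have I: "evt I u = u" if "length u = 3" for u
    by (rule nth_equalityI) (use that less_3 in \<open>fastforce simp: evt_nth I_def\<close>)+
  obtain T2 where T2: "\<forall>u. evt T2 u = evt T (evt T u)" by (rule exE[OF evt_comp])
  obtain T3 where T3: "\<forall>u. evt T3 u = evt T (evt T2 u)" by (rule exE[OF evt_comp])
  have "\<exists>k. k \<noteq> 0 \<and> (\<forall>u. evt T3 u = map ((*) k) (evt I u))"
  proof (rule parallel_nonvanishing)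
    show "evt I u \<in> vecs 2" if "u \<in> vecs 2" for u using that I[of u] by (simp add: vecs_def)
    show "evt T3 u \<in> vecs 2" if "u \<in> vecs 2" for u using that T T2 T3 by simp
    show "\<exists>c. evt T3 u = map ((*) c) (evt I u)" if "u \<in> vecs 2" for u
      using per[OF that] T2 T3 I[of u] that by (simp add: vecs_def)
  qed
  then obtain h where h: "h \<noteq> 0" "\<forall>u. evt T3 u = map ((*) h) (evt I u)" by (elim exE conjE)
  have h': "evt T (evt T (evt T u)) = map ((*) h) u" if "length u = 3" for u
    using h(2)[rule_format, of u] T2 T3 I[OF that] by simp
  have q: "\<exists>k. k \<noteq> 0 \<and> (\<forall>u. length u = 3 \<longrightarrow> evt T (map ((*) c) u) = map ((*) k) (evt T u))" if c: "c \<noteq> 0" for c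
  proof -
    have cI: "evt (\<lambda>i. pc c * I i) u = map ((*) c) u" if "length u = 3" for u
    proof (rule nth_equalityI)
      fix i assume "i < length (evt (\<lambda>i. pc c * I i) u)"
      then have i: "i < 3" by simp
      have "ev3 (I i) (u ! 0) (u ! 1) (u ! 2) = u ! i" using evt_nth[OF i, of I u] I[OF that] by simp
      then show "evt (\<lambda>i. pc c * I i) u ! i = map ((*) c) u ! i" using i that by (simp only: evt_nth ev3_simps nth_map)
    qed (simp add: that)
    obtain Q where Q: "\<forall>u. evt Q u = evt T (evt (\<lambda>i. pc c * I i) u)" by (rule exE[OF evt_comp])
    have l: "length u = 3" if "u \<in> vecs 2" for u using that by (simp add: vecs_def)
    have cu: "map ((*) c) u \<in> vecs 2" if "u \<in> vecs 2" for u using that c by (auto simp: vecs_def)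
    have "\<exists>k. k \<noteq> 0 \<and> (\<forall>u. evt Q u = map ((*) k) (evt T u))"
    proof (rule parallel_nonvanishing[OF T])
      show "evt Q u \<in> vecs 2" if "u \<in> vecs 2" for u using T[OF cu[OF that]] cI[OF l[OF that]] Q by simp
      show "\<exists>k. evt Q u = map ((*) k) (evt T u)" if "u \<in> vecs 2" for u
        using scale[OF that c] cI[OF l[OF that]] Q by simp
    qed
    then obtain k where k: "k \<noteq> 0" "\<forall>u. evt Q u = map ((*) k) (evt T u)" by (elim exE conjE)
    have "evt T (map ((*) c) u) = map ((*) k) (evt T u)" if "length u = 3" for u
      using k(2)[rule_format, of u] Q[rule_format, of u] unfolding cI[OF that] by simp
    then show ?thesis using k(1) by (intro exI[of _ k]) simp
  qed
  have e1: "[1, 0, 0] \<in> vecs 2" by (simp add: vecs2)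
  obtain i0 where "i0 < 3" "evt T [1, 0, 0] ! i0 \<noteq> 0"
    using T[OF e1] unfolding vecs2_iff[OF evt_len] by (elim exE conjE)
  then have i0: "i0 < 3" "ev3 (T i0) 1 0 0 \<noteq> 0" by (simp_all add: evt_nth)
  obtain p0 where p0: "\<forall>c. poly p0 c = ev3 (T i0) (0 + c * 1) (0 + c * 0) (0 + c * 0)" by (rule exE[OF ev3_line])
  \<comment> \<open>The scaling factor is read off from one coordinate that does not vanish at
    \<open>[1, 0, 0]\<close>; along this line it is visibly a polynomial.\<close>
  define p where "p = smult (1 / ev3 (T i0) 1 0 0) p0"
  have pq: "poly p c \<noteq> 0 \<and> (\<forall>u. length u = 3 \<longrightarrow> evt T (map ((*) c) u) = map ((*) (poly p c)) (evt T u))" if c: "c \<noteq> 0" for c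
  proof -
    obtain k where k: "k \<noteq> 0" "\<forall>u. length u = 3 \<longrightarrow> evt T (map ((*) c) u) = map ((*) k) (evt T u)"
      using q[OF c] by (elim exE conjE)
    have "evt T (map ((*) c) [1, 0, 0]) = map ((*) k) (evt T [1, 0, 0])" by (rule k(2)[rule_format]) simp
    from arg_cong[OF this, of "\<lambda>v. v ! i0"] have "ev3 (T i0) c 0 0 = k * ev3 (T i0) 1 0 0" using i0(1) by (simp add: evt_nth)
    then have "poly p c = k" using i0(2) p0 by (simp add: p_def)
    then show ?thesis using k by simp
  qed
  have pw: "a = b" if e: "map ((*) a) u = map ((*) b) u" and u: "u \<in> vecs 2" for a b and u :: "complex list"
  proof -
    have l: "length u = 3" using u by (simp add: vecs_def)
    obtain i where "i < 3" "u ! i \<noteq> 0" using u unfolding vecs2_iff[OF l] by blast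
    then show ?thesis using arg_cong[OF e, of "\<lambda>v. v ! i"] l by simp
  qed
  have u3: "length [1, 0, 0] = 3" by simp
  have ppp: "poly p (poly p (poly p c)) = c" if c: "c \<noteq> 0" for c
  proof -
    let ?u = "[1, 0, 0] :: complex list"
    have p1: "poly p c \<noteq> 0" "poly p (poly p c) \<noteq> 0" using pq[OF c] pq by blast+
    have "map ((*) (h * c)) ?u = map ((*) h) (map ((*) c) ?u)" by simp
    also have "\<dots> = evt T (evt T (evt T (map ((*) c) ?u)))" by (rule h'[symmetric]) simp
    also have "evt T (map ((*) c) ?u) = map ((*) (poly p c)) (evt T ?u)" using pq[OF c] u3 by blast
    also have "evt T (map ((*) (poly p c)) (evt T ?u)) = map ((*) (poly p (poly p c))) (evt T (evt T ?u))"
      using pq[OF p1(1)] evt_len by blast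
    also have "evt T (map ((*) (poly p (poly p c))) (evt T (evt T ?u))) = map ((*) (poly p (poly p (poly p c)))) (evt T (evt T (evt T ?u)))"
      using pq[OF p1(2)] evt_len by blast
    also have "evt T (evt T (evt T ?u)) = map ((*) h) ?u" by (rule h') simp
    finally have "h * c = h * poly p (poly p (poly p c))" by simp
    then show ?thesis using h(1) by simp
  qed
  \<comment> \<open>Degrees multiply under composition, so the cube of the degree is 1.\<close>
  have deg: "degree p = 1"
  proof -
    define F where "F = pcompose p (pcompose p p) - [:0, 1:]"
    have "infinite (UNIV - {0::complex})" using infinite_UNIV_char_0 by simp
    then have "F = 0" by (rule infinite_roots_0) (simp add: F_def poly_pcompose ppp)
    then have "pcompose p (pcompose p p) = [:0, 1:]" by (simp add: F_def)
    then have "degree (pcompose p (pcompose p p)) = 1" by simp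
    then show ?thesis by (simp add: degree_pcompose)
  qed
  define \<alpha> where "\<alpha> = coeff p 0"
  define \<beta> where "\<beta> = coeff p 1"
  have p: "poly p c = \<alpha> + \<beta> * c" for c
    by (simp add: poly_altdef deg \<alpha>_def \<beta>_def)
  have \<beta>0: "\<beta> \<noteq> 0" using deg unfolding \<beta>_def by (metis leading_coeff_0_iff degree_0 zero_neq_one)
  \<comment> \<open>For \<open>c = 1\<close> and \<open>c = - 1\<close> scaling twice by
    \<open>c\<close> is scaling by 1. The two equations give \<open>\<alpha> * \<beta> = 0\<close>
    and then \<open>\<beta> = 1\<close>.\<close>
  have sq: "poly p 1 = poly p c * poly p c" if "c = 1 \<or> c = - 1" for c
  proof -
    let ?u = "[1, 0, 0] :: complex list"
    have c: "c \<noteq> 0" "c * c = 1" using that by auto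
    have "map ((*) (poly p 1)) (evt T ?u) = evt T (map ((*) 1) ?u)"
      by (rule pq[of 1, THEN conjunct2, rule_format, symmetric]) simp_all
    also have "map ((*) 1) ?u = map ((*) c) (map ((*) c) ?u)" using c(2) by simp
    also have "evt T (map ((*) c) (map ((*) c) ?u)) = map ((*) (poly p c)) (evt T (map ((*) c) ?u))"
      by (rule pq[OF c(1), THEN conjunct2, rule_format]) simp
    also have "evt T (map ((*) c) ?u) = map ((*) (poly p c)) (evt T ?u)" using pq[OF c(1)] u3 by blast
    finally have "map ((*) (poly p 1)) (evt T ?u) = map ((*) (poly p c * poly p c)) (evt T ?u)"
      by (simp add: o_def mult.assoc)
    then show ?thesis by (rule pw[OF _ T[OF e1]])
  qed
  have "\<alpha> * \<beta> = 0" using sq[of 1] sq[of "- 1"] by (simp add: p algebra_simps)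
  then have \<alpha>: "\<alpha> = 0" using \<beta>0 by simp
  have "\<beta> = 1" using sq[of 1] \<beta>0 by (simp add: p \<alpha>)
  then have pc: "poly p c = c" for c using \<alpha> by (simp add: p)
  have "\<exists>a b d. \<forall>x y z. ev3 (T i) x y z = a * x + b * y + d * z" if i: "i < 3" for i
  proof (rule homogeneous_linear)
    fix c x y z :: complex assume c: "c \<noteq> 0"
    have "evt T (map ((*) c) [x, y, z]) = map ((*) c) (evt T [x, y, z])" by (rule pq[OF c, THEN conjunct2, rule_format, unfolded pc]) simp
    from arg_cong[OF this, of "\<lambda>v. v ! i"] show "ev3 (T i) (c * x) (c * y) (c * z) = c * ev3 (T i) x y z"
      using i by (simp add: evt_nth)
  qed
  then have ex: "\<forall>i. \<exists>a. i < 3 \<longrightarrow> (\<forall>x y z. ev3 (T i) x y z = a 0 * x + a 1 * y + a (2::nat) * z)"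
  proof (intro allI)
    fix i
    show "\<exists>a. i < 3 \<longrightarrow> (\<forall>x y z. ev3 (T i) x y z = a 0 * x + a 1 * y + a (2::nat) * z)"
    proof (cases "i < 3")
      case True
      then obtain a b d where "\<forall>x y z. ev3 (T i) x y z = a * x + b * y + d * z"
        using \<open>\<And>i. i < 3 \<Longrightarrow> \<exists>a b d. \<forall>x y z. ev3 (T i) x y z = a * x + b * y + d * z\<close> by blast
      then show ?thesis by (intro exI[of _ "\<lambda>j. if j = 0 then a else if j = 1 then b else d"]) simp
    qed simp
  qed
  from choice[OF ex] obtain A where "\<forall>i. i < 3 \<longrightarrow> (\<forall>x y z. ev3 (T i) x y z = A i 0 * x + A i 1 * y + A i (2::nat) * z)" by (elim exE)
  then show ?thesis using h(1) h' by (intro exI[of _ A] exI[of _ h]) simp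
qed

context severi_brauer
begin

lemma Rm_pull:
  assumes F: "\<And>m. m < 9 \<Longrightarrow> F m \<in> ffun UNIV 8 d" and i: "i < 3"
  shows "(\<lambda>v. Rm (map (\<lambda>m. F m v) [0..<Suc 8]) i j) \<in> ffun UNIV 8 d"
proof -
  interpret L: subring_C UNIV by (rule subring_C_UNIV)
  have "(\<lambda>v. Rm (map (\<lambda>m. F m v) [0..<Suc 8]) i j) = (\<lambda>v. \<Sum>k<3. w ^ (i * k) *
      (al ^ ((3 * k + (j + 2 * i) mod 3) div 3) * be ^ ((3 * k + (j + 2 * i) mod 3) mod 3) * F (3 * k + (j + 2 * i) mod 3) v))"
  proof (rule ext, unfold rm_def, rule sum.cong[OF refl])
    fix v k assume "k \<in> {..<3::nat}"
    then have l: "3 * k + (j + 2 * i) mod 3 < 9" by (intro idx_less) simp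
    show "w ^ (i * k) * sc al be (map (\<lambda>m. F m v) [0..<Suc 8]) ! (3 * k + (j + 2 * i) mod 3) = w ^ (i * k) *
      (al ^ ((3 * k + (j + 2 * i) mod 3) div 3) * be ^ ((3 * k + (j + 2 * i) mod 3) mod 3) * F (3 * k + (j + 2 * i) mod 3) v)"
      unfolding sc_nth[OF l] using l by (subst nth_map_upt) simp_all
  qed
  also have "\<dots> \<in> ffun UNIV 8 d"
    by (intro L.ffun_sum L.ffun_smult F UNIV_I idx_less) simp_all
  finally show ?thesis .
qed

lemma S_col:
  assumes "pt v \<in> S" "length v = 9"
  shows "\<exists>y c. y \<in> vecs 2 \<and> c \<noteq> 0 \<and> v = map ((*) c) (phi y)"
  using assms by (auto simp: S_def pt_eq_iff)

lemma col_phi_pt: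
  assumes "y \<in> vecs 2" "v = map ((*) c) (phi y)" "j < 3" "col j v \<in> vecs 2"
  shows "pt (phi (col j v)) = pt (phi y)"
  by (rule pt_phi_scaled[OF assms(4)]) (simp only: assms(2) col_phi[OF len_vecs[OF assms(1)] assms(3)])

lemma pull3:
  assumes "\<And>i. i < 3 \<Longrightarrow> h i \<in> ffun UNIV 8 d"
  shows "\<exists>P. \<forall>u i. length u = 3 \<longrightarrow> i < 3 \<longrightarrow> evt P u ! i = h i (phi u)"
proof -
  have ex: "\<forall>i. \<exists>P. i < 3 \<longrightarrow> (\<forall>x y z. ev3 P x y z = h i (phi [x, y, z]))"
    using pull_S[OF assms] by simp
  from choice[OF ex] obtain P where P: "\<forall>i. i < 3 \<longrightarrow> (\<forall>x y z. ev3 (P i) x y z = h i (phi [x, y, z]))" by (elim exE)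
  have "evt P u ! i = h i (phi u)" if u: "length u = 3" "i < 3" for u i
    unfolding evt_nth[OF u(2)] P[rule_format, OF u(2)] list3[OF u(1), symmetric] ..
  then show ?thesis by (intro exI[of _ P]) simp
qed

text \<open>Around each point a nonzero column of the matrix of the image gives a polynomial triple
  for \<open>t\<close>. Dividing one such triple by its greatest common divisor yields a triple that
  represents \<open>t\<close> everywhere.\<close>

lemma regular_lift:
  assumes t: "V.regS S t"
  shows "\<exists>T. \<forall>u\<in>vecs 2. evt T u \<in> vecs 2 \<and> t (pt (phi u)) = pt (phi (evt T u))"
proof -
  have local: "\<exists>P. evt P x \<in> vecs 2 \<and> (\<forall>u\<in>vecs 2. evt P u \<in> vecs 2 \<longrightarrow> t (pt (phi u)) = pt (phi (evt P u)))"
    if x: "x \<in> vecs 2" for x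
  proof -
    have inS: "pt (phi u) \<in> S" if "u \<in> vecs 2" for u using that by (auto simp: S_def)
    obtain d F a where loc: "V.loc S t (pt (phi x)) d F a" using V.regS_local[OF t inS[OF x]] by (elim exE)
    have F: "F m \<in> ffun UNIV 8 d" if "m < 9" for m
      using V.locD(1)[OF loc, of m] that by (intro ffun_mono[OF subset_UNIV, of "F m"]) simp
    define v where "v u = map (\<lambda>m. F m (phi u)) [0..<Suc 8]" for u
    have vl: "length (v u) = 9" for u by (simp add: v_def)
    have vn: "v u ! m = F m (phi u)" if "m < 9" for u m using that unfolding v_def by (subst nth_map_upt) simp_all
    have tv: "t (pt (phi u)) = pt (v u)" if "u \<in> vecs 2" "m < 9" "v u ! m \<noteq> 0" for u m
      unfolding v_def by (rule V.locD(4)[OF loc inS[OF that(1)] pt_self, of m]) (use that vn in simp_all)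
    have a: "a < 9" "v x ! a \<noteq> 0"
    proof -
      show "a < 9" using V.locD(2)[OF loc] by simp
      then show "v x ! a \<noteq> 0" using V.locD(3)[OF loc] nz_S_iff[OF F x] vn by simp
    qed
    have "pt (v x) \<in> S" using tv[OF x a] V.regS_maps[OF t inS[OF x]] by simp
    then obtain y c where y: "y \<in> vecs 2" "c \<noteq> 0" "v x = map ((*) c) (phi y)" using S_col vl by blast
    \<comment> \<open>Column \<open>j\<close> of the image matrix at \<open>x\<close> is then
      nonzero.\<close>
    obtain j where j: "j < 3" "y ! j \<noteq> 0" using y(1) vecs2_iff[OF len_vecs[OF y(1)]] by blast
    obtain P where P: "\<forall>u i. length u = 3 \<longrightarrow> i < 3 \<longrightarrow> evt P u ! i = Rm (map (\<lambda>m. F m (phi u)) [0..<Suc 8]) i j"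
      by (rule exE[OF pull3[of "\<lambda>i v. Rm (map (\<lambda>m. F m v) [0..<Suc 8]) i j", OF Rm_pull[OF F]]])
    have Pc: "evt P u = col j (v u)" if "length u = 3" for u
      by (rule nth_equalityI) (use P that in \<open>simp_all only: evt_len col_len col_nth v_def\<close>)
    have "evt P x \<in> vecs 2"
      unfolding Pc[OF len_vecs[OF x]] y(3) col_phi[OF len_vecs[OF y(1)] j(1)] using j y by (simp add: vecs_scale_iff)
    moreover have "t (pt (phi u)) = pt (phi (evt P u))" if u: "u \<in> vecs 2" "evt P u \<in> vecs 2" for u
    proof -
      have c: "col j (v u) \<in> vecs 2" using u Pc[OF len_vecs[OF u(1)]] by simp
      have "\<exists>m<9. v u ! m \<noteq> 0"
      proof (rule ccontr)
        assume "\<not> (\<exists>m<9. v u ! m \<noteq> 0)"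
        then have z: "v u = map ((*) 0) (v u)" by (intro nth_equalityI) (simp_all add: vl)
        have "Rm (v u) i j = 0" if "i < 3" for i by (subst z, subst Rm_scale[OF vl that]) simp
        then show False using c unfolding vecs2_iff[OF col_len] by (auto simp: col_nth)
      qed
      then obtain m where m: "m < 9" "v u ! m \<noteq> 0" by blast
      have tu: "t (pt (phi u)) = pt (v u)" by (rule tv[OF u(1) m])
      then have "pt (v u) \<in> S" using V.regS_maps[OF t inS[OF u(1)]] by simp
      then obtain y c where y: "y \<in> vecs 2" "c \<noteq> 0" "v u = map ((*) c) (phi y)" using S_col vl by blast
      have "pt (phi (evt P u)) = pt (phi y)" unfolding Pc[OF len_vecs[OF u(1)]] by (rule col_phi_pt[OF y(1,3) j(1) c])
      also have "\<dots> = pt (v u)" unfolding y(3) using y(2) by (rule pt_eqI[symmetric])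
      finally show ?thesis using tu by simp
    qed
    ultimately show ?thesis by (intro exI[of _ P] conjI ballI impI)
  qed
  have e1: "[1, 0, 0] \<in> vecs 2" by (simp add: vecs2)
  obtain P0 where P0: "evt P0 [1, 0, 0] \<in> vecs 2"
      "\<forall>u\<in>vecs 2. evt P0 u \<in> vecs 2 \<longrightarrow> t (pt (phi u)) = pt (phi (evt P0 u))"
    using local[OF e1] by (elim exE conjE)
  obtain i0 where "i0 < 3" "evt P0 [1, 0, 0] ! i0 \<noteq> 0" using P0(1) unfolding vecs2_iff[OF evt_len] by (elim exE conjE)
  then have i0: "i0 < 3" "P0 i0 \<noteq> 0" by (auto simp: evt_nth)
  obtain T g where g: "g \<noteq> 0" "\<forall>i<3. P0 i = g * T i"
    "\<forall>Q. (\<forall>i<3. \<forall>j<3. Q i * T j = Q j * T i) \<longrightarrow> (\<exists>q. \<forall>i<3. Q i = q * T i)"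
    using coprime_triple[where P = P0 and ?i0.0 = i0, OF i0(2,1)] by (elim exE conjE)
  have "evt T x \<in> vecs 2 \<and> t (pt (phi x)) = pt (phi (evt T x))" if x: "x \<in> vecs 2" for x
  proof -
    obtain P where P: "evt P x \<in> vecs 2" "\<forall>u\<in>vecs 2. evt P u \<in> vecs 2 \<longrightarrow> t (pt (phi u)) = pt (phi (evt P u))"
      using local[OF x] by (elim exE conjE)
    \<comment> \<open>The local triple at \<open>x\<close> is proportional to the first one, hence a
      multiple of \<open>T\<close>. As it is nonzero at \<open>x\<close>, so is
      \<open>T\<close>.\<close>
    have "P i * P0 j - P j * P0 i = 0" if ij: "i < 3" "j < 3" for i j
    proof (rule ev3_dense[of px])
      fix x y z assume "ev3 px x y z \<noteq> 0"
      then have u: "[x, y, z] \<in> vecs 2" (is "?u \<in> _") by (simp add: vecs2)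
      have "ev3 (P i) x y z * ev3 (P0 j) x y z = ev3 (P j) x y z * ev3 (P0 i) x y z"
      proof (cases "evt P ?u \<in> vecs 2 \<and> evt P0 ?u \<in> vecs 2")
        case True
        then have "pt (phi (evt P ?u)) = pt (phi (evt P0 ?u))" using P(2) P0(2) u by metis
        then have "pt (evt P ?u) = pt (evt P0 ?u)" using pt_phi_inj True by blast
        then obtain c where c: "evt P ?u = map ((*) c) (evt P0 ?u)" unfolding pt_eq_iff by (elim exE conjE)
        have "ev3 (P i) x y z = c * ev3 (P0 i) x y z" if "i < 3" for i
          using arg_cong[OF c, of "\<lambda>v. v ! i"] that by (simp add: evt_nth)
        then show ?thesis using ij by simp
      next
        case False
        then have "(\<forall>i<3. ev3 (P i) x y z = 0) \<or> (\<forall>i<3. ev3 (P0 i) x y z = 0)"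
          by (auto simp: vecs2_iff evt_nth)
        then show ?thesis using ij by auto
      qed
      then show "ev3 (P i * P0 j - P j * P0 i) x y z = 0" by simp
    qed (simp add: px_def)
    then have "g * (P i * T j) = g * (P j * T i)" if "i < 3" "j < 3" for i j
      using that g(2) by (simp add: mult_ac)
    then have "\<forall>i<3. \<forall>j<3. P i * T j = P j * T i" using g(1) by simp
    then obtain q where q: "\<forall>i<3. P i = q * T i" using g(3)[rule_format, of P] by blast
    have s: "evt P x = map ((*) (ev3 q (x ! 0) (x ! 1) (x ! 2))) (evt T x)"
      by (rule nth_equalityI) (use q in \<open>simp_all add: evt_nth\<close>)
    have "pt (phi (evt P x)) = pt (phi (evt T x))" by (rule pt_phi_scaled[OF P(1) s])
    moreover have "evt T x \<in> vecs 2" using P(1) unfolding s by (auto simp: vecs_def)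
    ultimately show ?thesis using P x by simp
  qed
  then show ?thesis by blast
qed

end

section \<open>Forms along the fixed curve\<close>

abbreviation evu :: "p3 \<Rightarrow> complex list \<Rightarrow> complex" where
  "evu P u \<equiv> ev3 P (u ! 0) (u ! 1) (u ! 2)"

lemma evu_comp: "\<exists>Q. \<forall>u. evu Q u = evu P (evt T u)"
proof -
  obtain Q where Q: "\<forall>u. evt Q u = evt (\<lambda>i. P) (evt T u)" by (rule exE[OF evt_comp])
  have "evu (Q 0) u = evu P (evt T u)" for u
    using arg_cong[OF Q[rule_format, of u], of "\<lambda>v. v ! 0"] evt_nth[of 0] by simp
  then show ?thesis by (intro exI[of _ "Q 0"] allI)
qed

lemma evu_dense:
  assumes "g \<noteq> 0" "\<And>u. length u = 3 \<Longrightarrow> evu g u \<noteq> 0 \<Longrightarrow> evu h u = 0"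
  shows "h = 0"
proof (rule ev3_dense[OF assms(1)])
  fix x y z assume "ev3 g x y z \<noteq> 0"
  then show "ev3 h x y z = 0" using assms(2)[of "[x, y, z]"] by simp
qed

lemma ev3_smult: "ev3 (smult a p) x y z = ev2 a y z * ev3 p x y z"
  by (simp add: ev3_def)

lemma ev2_sum: "ev2 (sum f A) y z = (\<Sum>i\<in>A. ev2 (f i) y z)"
  by (induction A rule: infinite_finite_induct) auto

context cube_root_1
begin

text \<open>If \<open>s\<close> multiplies \<open>V\<close> by \<open>\<chi>\<close> and the curve
  equation by \<open>k\<close>, the cofactor transforms accordingly. The division is legitimate off
  the curve, and density extends the identity to the curve, where it will be used.\<close>

lemma fC_twist:
  assumes V: "V = fC ^ m * V'" and s: "\<And>u. length u = 3 \<Longrightarrow> s u = evt P u"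
    and VV: "\<And>u. length u = 3 \<Longrightarrow> evu V (s u) = \<chi> * evu V u"
    and ff: "\<And>u. length u = 3 \<Longrightarrow> evu fC (s u) = k * evu fC u" and u: "length u = 3"
  shows "k ^ m * evu V' (s u) = \<chi> * evu V' u"
proof -
  obtain Q where Q: "\<forall>u. evu Q u = evu V' (evt P u)" by (rule exE[OF evu_comp])
  have "pc (k ^ m) * Q - pc \<chi> * V' = 0"
  proof (rule evu_dense[OF fC_nz])
    fix u :: "complex list" assume u: "length u = 3" "evu fC u \<noteq> 0"
    have "evu fC u ^ m * (k ^ m * evu Q u) = (k * evu fC u) ^ m * evu V' (s u)"
      using Q s[OF u(1)] by (simp add: power_mult_distrib mult_ac)
    also have "\<dots> = evu V (s u)" unfolding V ff[OF u(1), symmetric] by simp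
    also have "\<dots> = evu fC u ^ m * (\<chi> * evu V' u)" unfolding VV[OF u(1)] by (simp add: V)
    finally have "k ^ m * evu Q u = \<chi> * evu V' u" using u(2) by simp
    then show "evu (pc (k ^ m) * Q - pc \<chi> * V') u = 0" by simp
  qed
  then have "evu (pc (k ^ m) * Q) u = evu (pc \<chi> * V') u" by simp
  then show ?thesis using Q s[OF u] by simp
qed

lemma vanC_D: "vanC h \<Longrightarrow> cv x y z = 0 \<Longrightarrow> x \<noteq> 0 \<Longrightarrow> y \<noteq> 0 \<Longrightarrow> z \<noteq> 0 \<Longrightarrow> ev3 h x y z = 0"
  by (simp add: vanC_def)

text \<open>The factor by which \<open>sg\<close> multiplies the coordinates of a point of the
  curve, by \<open>sg_curve\<close>.\<close>

definition lamP :: p3 where "lamP = pz * (px * pz - py\<^sup>2)"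

text \<open>Over \<open>y = z = 1\<close> the curve has two points, whereas \<open>lamP\<close> is
  \<open>x - 1\<close> there. Thus \<open>sg\<close> does not degenerate along the whole
  curve.\<close>

lemma not_vanC_lamP: "\<not> vanC lamP"
proof
  assume v: "vanC lamP"
  obtain x x' where x: "x \<noteq> x'" "x \<noteq> 0" "x' \<noteq> 0" "cv x 1 1 = 0" "cv x' 1 1 = 0"
    using cv_roots[of 1 1] by (metis (no_types) diff_numeral_special(11) eq_iff_diff_eq_0 mult.right_neutral one_eq_numeral_iff one_neq_zero power_one semiring_norm(83))
  have "ev3 lamP x 1 1 = 0" "ev3 lamP x' 1 1 = 0" using vanC_D[OF v] x by simp_all
  then show False using x(1) by (simp add: lamP_def)
qed

end

context severi_brauer
begin

text \<open>Modulo the equation of the curve \<open>sg\<close> is multiplication by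
  \<open>lamP\<close>; this is why it fixes the curve pointwise.\<close>

lemma sg_curve: "sg [x, y, z] = [ev3 lamP x y z * x, ev3 lamP x y z * y + w * y * cv x y z, ev3 lamP x y z * z - w\<^sup>2 * z * cv x y z]"
  by (simp add: sg_def Let_def lamP_def cv_def w_pow_num; simp add: ww ww' algebra_simps power2_eq_square)

lemma sg_evt: "length u = 3 \<Longrightarrow> sg u = evt (\<lambda>i. if i = 0 then px * pz * (px * pz - py\<^sup>2)
    else if i = 1 then pc w * (px * py * (px * py - pz\<^sup>2)) else pc (w\<^sup>2) * (py * pz * (py * pz - px\<^sup>2))) u"
  by (rule nth_equalityI) (auto dest!: less_3 simp: evt_nth sg_def Let_def)

lemma scale_evt: "length u = 3 \<Longrightarrow> map ((*) c) u = evt (\<lambda>i. pc c * pv i) u"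
proof -
  assume "length u = 3"
  then obtain x y z where "u = [x, y, z]" by (rule len3_E)
  then show ?thesis by (intro nth_equalityI) (auto dest!: less_3 simp: evt_nth pv_def)
qed

lemma Mt_3: "Mt p q u = [u ! (p mod 3), w ^ q * u ! ((1 + p) mod 3), w ^ (2 * q) * u ! ((2 + p) mod 3)]"
proof (rule nth_equalityI)
  fix i assume "i < length (Mt p q u)"
  then have "i = 0 \<or> i = 1 \<or> i = 2" by auto
  then show "Mt p q u ! i = [u ! (p mod 3), w ^ q * u ! ((1 + p) mod 3), w ^ (2 * q) * u ! ((2 + p) mod 3)] ! i"
    by (elim disjE) (simp_all add: Mt_nth)
qed simp

lemma Mt_evt: "length u = 3 \<Longrightarrow> Mt p q u = evt (\<lambda>i. pc (w ^ (i * q)) * pv ((i + p) mod 3)) u"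
proof -
  assume "length u = 3"
  then obtain x y z where u: "u = [x, y, z]" by (rule len3_E)
  show ?thesis by (rule nth_equalityI) (simp_all add: evt_nth Mt_nth ev3_pv u)
qed

lemma cv_scale: "length u = 3 \<Longrightarrow> evu fC (map ((*) c) u) = c ^ 3 * evu fC u"
  by (simp add: cv_def algebra_simps power2_eq_square power3_eq_cube)

text \<open>The equation is an eigenvector of the Heisenberg group, which therefore maps the curve
  to itself.\<close>

lemma cv_Mt:
  assumes "length u = 3"
  shows "evu fC (Mt p q u) = w ^ (p mod 3 + q) * evu fC u"
proof -
  obtain x y z where u: "u = [x, y, z]" using assms by (rule len3_E)
  define t where "t = w ^ q"
  have t3: "t * (t * t) = 1" using w_pow3[of q] by (simp add: t_def power3_eq_cube mult.assoc)
  have t2: "w ^ (2 * q) = t * t" by (simp add: t_def mult_2 power_add)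
  have tt: "t * (t * (t * a)) = a" for a using t3 by (metis mult.assoc mult_1)
  have "cv a (t * b) (t * t * c) = t * cv a b c" for a b c
    by (simp add: cv_def power2_eq_square algebra_simps tt)
  then have "evu fC (Mt p q u) = t * cv (u ! (p mod 3)) (u ! ((1 + p) mod 3)) (u ! ((2 + p) mod 3))"
    unfolding Mt_3 t2 t_def[symmetric] by simp
  also have "cv (u ! (p mod 3)) (u ! ((1 + p) mod 3)) (u ! ((2 + p) mod 3)) = w ^ (p mod 3) * cv x y z"
  proof -
    have "p mod 3 = 0 \<or> p mod 3 = 1 \<or> p mod 3 = 2" by presburger
    then show ?thesis
    proof (elim disjE)
      assume p: "p mod 3 = 0"
      then have "(1 + p) mod 3 = 1" "(2 + p) mod 3 = 2" by presburger+
      then show ?thesis using p by (simp add: u)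
    next
      assume p: "p mod 3 = 1"
      then have "(1 + p) mod 3 = 2" "(2 + p) mod 3 = 0" by presburger+
      then show ?thesis using p by (simp add: u cv_def w_pow_num; simp add: ww ww' algebra_simps power2_eq_square)
    next
      assume p: "p mod 3 = 2"
      then have "(1 + p) mod 3 = 0" "(2 + p) mod 3 = 1" by presburger+
      then show ?thesis using p by (simp add: u cv_def w_pow_num; simp add: ww ww' algebra_simps power2_eq_square)
    qed
  qed
  finally show ?thesis by (simp add: u t_def power_add mult_ac)
qed

definition mat :: "(nat \<Rightarrow> p3) \<Rightarrow> nat \<Rightarrow> nat \<Rightarrow> p3" where
  "mat F i j = (\<Sum>k<3. pc (w ^ (i * k) * (al ^ k * be ^ ((j + 2 * i) mod 3))) * F (3 * k + (j + 2 * i) mod 3))"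

lemma Rm_map: "Rm (map f [0..<Suc 8]) i j =
    (\<Sum>k<3. w ^ (i * k) * (al ^ k * be ^ ((j + 2 * i) mod 3)) * f (3 * k + (j + 2 * i) mod 3))"
  unfolding rm_def
proof (rule sum.cong[OF refl])
  fix k assume "k \<in> {..<3::nat}"
  then have l: "3 * k + (j + 2 * i) mod 3 < 9" by (intro idx_less) simp
  show "w ^ (i * k) * sc al be (map f [0..<Suc 8]) ! (3 * k + (j + 2 * i) mod 3) =
    w ^ (i * k) * (al ^ k * be ^ ((j + 2 * i) mod 3)) * f (3 * k + (j + 2 * i) mod 3)"
    unfolding sc_nth[OF l] using l by (subst nth_map_upt) simp_all
qed

lemma ev_mat: "evu (mat F i j) u = Rm (map (\<lambda>m. evu (F m) u) [0..<Suc 8]) i j"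
  unfolding Rm_map mat_def by simp

text \<open>The condition that \<open>\<xi>\<close> kills the columns is restated as linear
  relations between the nine coordinates. In this form it passes from polynomials to their
  remainders and then to their values.\<close>

lemma Rm_linear: "\<exists>\<kappa>. \<forall>f j. (\<Sum>i<3. \<xi> i * Rm (map f [0..<Suc 8]) i j) = (\<Sum>m<9. \<kappa> j m * f m)"
proof -
  define \<kappa> where "\<kappa> j m = (\<Sum>i<3. \<Sum>k<3. if m = 3 * k + (j + 2 * i) mod 3
    then \<xi> i * (w ^ (i * k) * (al ^ k * be ^ ((j + 2 * i) mod 3))) else 0)" for j m :: nat
  have "(\<Sum>i<3. \<xi> i * Rm (map f [0..<Suc 8]) i j) = (\<Sum>m<9. \<kappa> j m * f m)" for f j
  proof -
    have "(\<Sum>m<9. \<kappa> j m * f m) = (\<Sum>m<9. \<Sum>i<3. \<Sum>k<3. if m = 3 * k + (j + 2 * i) mod 3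
      then \<xi> i * (w ^ (i * k) * (al ^ k * be ^ ((j + 2 * i) mod 3))) * f m else 0)"
      unfolding \<kappa>_def sum_distrib_right by (intro sum.cong refl) simp
    also have "\<dots> = (\<Sum>i<3. \<Sum>k<3. \<Sum>m<9. if m = 3 * k + (j + 2 * i) mod 3
      then \<xi> i * (w ^ (i * k) * (al ^ k * be ^ ((j + 2 * i) mod 3))) * f m else 0)"
      by (rule trans[OF sum.swap], rule sum.cong[OF refl], rule sum.swap)
    also have "\<dots> = (\<Sum>i<3. \<Sum>k<3. \<xi> i * (w ^ (i * k) * (al ^ k * be ^ ((j + 2 * i) mod 3))) * f (3 * k + (j + 2 * i) mod 3))"
    proof (intro sum.cong refl)
      fix i k assume "k \<in> {..<3::nat}"
      then have "3 * k + (j + 2 * i) mod 3 \<in> {..<9}" using idx_less[of k "j + 2 * i"] by simp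
      then show "(\<Sum>m<9. if m = 3 * k + (j + 2 * i) mod 3 then \<xi> i * (w ^ (i * k) * (al ^ k * be ^ ((j + 2 * i) mod 3))) * f m else 0)
        = \<xi> i * (w ^ (i * k) * (al ^ k * be ^ ((j + 2 * i) mod 3))) * f (3 * k + (j + 2 * i) mod 3)"
        by (subst sum.delta) auto
    qed
    finally show ?thesis unfolding Rm_map by (simp only: sum_distrib_left mult.assoc)
  qed
  then show ?thesis by (intro exI[of _ \<kappa>] allI)
qed

lemma infinite_K: "infinite K"
proof
  assume f: "finite K"
  have "of_nat n \<in> K" for n
    by (induction n) (use sK in \<open>auto simp: sring_def\<close>)
  then have "range (of_nat :: nat \<Rightarrow> complex) \<subseteq> K" by blast
  then have "finite (range (of_nat :: nat \<Rightarrow> complex))" using f finite_subset by blast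
  then show False using finite_imageD[of "of_nat :: nat \<Rightarrow> complex" UNIV] inj_of_nat by simp
qed

text \<open>Modulo the curve a form over \<open>K\<close> reduces to a pair of forms in two variables; a rank-deficient matrix
  of such forms can be specialised to points of \<open>K\<close>, where the division algebra leaves only zero.\<close>

lemma curve_no_singular:
  assumes v: "\<And>m. m < 9 \<Longrightarrow> v m \<in> K3 K" and xi: "i0 < 3" "\<xi> i0 \<noteq> 0"
    and ker: "\<And>x y z j. cv x y z = 0 \<Longrightarrow> x \<noteq> 0 \<Longrightarrow> y \<noteq> 0 \<Longrightarrow> z \<noteq> 0 \<Longrightarrow> j < 3 \<Longrightarrow>
      (\<Sum>i<3. \<xi> i * Rm (map (\<lambda>m. ev3 (v m) x y z) [0..<Suc 8]) i j) = 0"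
    and m: "m < 9"
  shows "vanC (v m)"
proof -
  obtain \<kappa> where \<kappa>: "\<forall>f j. (\<Sum>i<3. \<xi> i * Rm (map f [0..<Suc 8]) i j) = (\<Sum>m<9. \<kappa> j m * f m)"
    by (rule exE[OF Rm_linear])
  have ex: "\<forall>m. \<exists>t. m < 9 \<longrightarrow> fst (snd t) \<in> K2 K \<and> fst (snd (snd t)) \<in> K2 K \<and>
      py ^ fst t * v m = snd (snd (snd t)) * fC + [:fst (snd t):] + px * [:fst (snd (snd t)):]"
  proof
    fix m
    show "\<exists>t. m < 9 \<longrightarrow> fst (snd t) \<in> K2 K \<and> fst (snd (snd t)) \<in> K2 K \<and>
      py ^ fst t * v m = snd (snd (snd t)) * fC + [:fst (snd t):] + px * [:fst (snd (snd t)):]"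
    proof (cases "m < 9")
      case True
      obtain n A B q where "A \<in> K2 K \<and> B \<in> K2 K \<and> py ^ n * v m = q * fC + [:A:] + px * [:B:]"
        using curve_reduction[OF sK wK v[OF True]] by (elim exE)
      then show ?thesis by (intro exI[of _ "(n, A, B, q)"]) simp
    qed simp
  qed
  obtain t where t: "\<forall>m. m < 9 \<longrightarrow> fst (snd (t m)) \<in> K2 K \<and> fst (snd (snd (t m))) \<in> K2 K \<and>
      py ^ fst (t m) * v m = snd (snd (snd (t m))) * fC + [:fst (snd (t m)):] + px * [:fst (snd (snd (t m))):]"
    using choice[OF ex] by (elim exE)
  \<comment> \<open>A common exponent of \<open>y\<close> for the nine reductions.\<close>
  define N where "N = (\<Sum>m<9. fst (t m))"
  have vyK: "vy \<in> K2 K"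
    using sK sring_polyset[OF sK] by (auto simp: vy_def K2_def polyset_pCons polyset_0 sringD)
  define A where "A m = vy ^ (N - fst (t m)) * fst (snd (t m))" for m
  define B where "B m = vy ^ (N - fst (t m)) * fst (snd (snd (t m)))" for m
  define q where "q m = py ^ (N - fst (t m)) * snd (snd (snd (t m)))" for m
  have AB: "A m \<in> K2 K" "B m \<in> K2 K" if "m < 9" for m
    unfolding A_def B_def using t that sring_K2[OF sK] vyK by (auto intro!: sringD sring_power)
  have eq: "y ^ N * ev3 (v m) x y z = ev3 (q m) x y z * cv x y z + ev2 (A m) y z + x * ev2 (B m) y z" if m: "m < 9" for m x y z
  proof -
    have le: "fst (t m) \<le> N" unfolding N_def by (rule member_le_sum) (use m in auto)
    then have "y ^ N = y ^ (N - fst (t m)) * y ^ fst (t m)" by (simp flip: power_add)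
    moreover have "y ^ fst (t m) * ev3 (v m) x y z = ev3 (snd (snd (snd (t m)))) x y z * cv x y z + ev2 (fst (snd (t m))) y z + x * ev2 (fst (snd (snd (t m)))) y z"
      using arg_cong[OF t[rule_format, OF m, THEN conjunct2, THEN conjunct2], of "\<lambda>p. ev3 p x y z"] by (simp only: ev3_simps ev3_const ev3_fC)
    ultimately have "y ^ N * ev3 (v m) x y z = y ^ (N - fst (t m)) * (ev3 (snd (snd (snd (t m)))) x y z * cv x y z + ev2 (fst (snd (t m))) y z + x * ev2 (fst (snd (snd (t m)))) y z)"
      by (simp only: mult.assoc)
    then show ?thesis by (simp add: A_def B_def q_def algebra_simps)
  qed
  \<comment> \<open>By uniqueness of remainders both halves \<open>A\<close> and \<open>B\<close>
    inherit the complex linear relations separately.\<close>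
  have red: "(\<Sum>m<9. vc (\<kappa> j m) * A m) = 0 \<and> (\<Sum>m<9. vc (\<kappa> j m) * B m) = 0" if j: "j < 3" for j
  proof -
    define R where "R = (\<Sum>m<9. pc (\<kappa> j m) * v m)"
    have "vanC R"
      unfolding vanC_def R_def using ker[OF _ _ _ _ j] \<kappa> by simp
    moreover have "py ^ N * R = (\<Sum>m<9. pc (\<kappa> j m) * q m) * fC + [:\<Sum>m<9. vc (\<kappa> j m) * A m:] + px * [:\<Sum>m<9. vc (\<kappa> j m) * B m:]"
    proof (rule ev3_eq)
      fix x y z
      have "ev3 (py ^ N * R) x y z = (\<Sum>m<9. \<kappa> j m * (y ^ N * ev3 (v m) x y z))"
        by (simp add: R_def sum_distrib_left mult_ac)
      also have "\<dots> = (\<Sum>m<9. \<kappa> j m * (ev3 (q m) x y z * cv x y z + ev2 (A m) y z + x * ev2 (B m) y z))"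
        by (intro sum.cong refl) (simp add: eq)
      also have "\<dots> = ev3 ((\<Sum>m<9. pc (\<kappa> j m) * q m) * fC + [:\<Sum>m<9. vc (\<kappa> j m) * A m:] + px * [:\<Sum>m<9. vc (\<kappa> j m) * B m:]) x y z"
        by (simp add: ev3_const ev3_smult ev2_sum distrib_left sum.distrib sum_distrib_left sum_distrib_right mult_ac)
      finally show "ev3 (py ^ N * R) x y z = \<dots>" .
    qed
    ultimately show ?thesis using vanC_reduced by blast
  qed
  \<comment> \<open>At \<open>y\<close> and \<open>z\<close> in \<open>K\<close> the values form a
    vector over \<open>K\<close> with singular matrix, hence zero; infinitely many such values make
    the polynomial zero.\<close>
  have zero: "F m = 0"
    if FK: "\<And>m. m < 9 \<Longrightarrow> F m \<in> K2 K" and F0: "\<And>j. j < 3 \<Longrightarrow> (\<Sum>m<9. vc (\<kappa> j m) * F m) = 0" for F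
  proof (rule ev2_zero[OF infinite_K])
    fix y z assume yz: "y \<in> K" "z \<in> K"
    let ?v = "map (\<lambda>m. ev2 (F m) y z) [0..<Suc 8]"
    have nth: "?v ! m = ev2 (F m) y z" if "m < 9" for m using that by (subst nth_map_upt) simp_all
    have "?v ! m = 0"
    proof (rule no_singular[where xi = \<xi>, OF _ _ xi _ m])
      show "?v ! m \<in> K" if "m < 9" for m unfolding nth[OF that] by (rule K2_ev2[OF sK FK[OF that] yz])
      show "(\<Sum>i<3. \<xi> i * Rm ?v i j) = 0" if "j < 3" for j
        using arg_cong[OF F0[OF that], of "\<lambda>p. ev2 p y z"] unfolding \<kappa>[rule_format] by (simp add: ev2_sum)
    qed simp
    then show "ev2 (F m) y z = 0" unfolding nth[OF m] .
  qed
  have "A m = 0" by (rule zero) (use AB red in blast)+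
  moreover have "B m = 0" by (rule zero) (use AB red in blast)+
  ultimately have "py ^ N * v m = q m * fC"
    by (intro ev3_eq) (simp add: eq[OF m])
  then show ?thesis by (rule reduced_vanC)
qed

lemma fvec_pull:
  assumes "h \<in> ffun K 8 d"
  shows "\<exists>P\<in>K3 K. \<forall>u. length u = 3 \<longrightarrow> evu P u = h (fvec u)"
proof -
  define fP where "fP m = (\<Sum>i<3. pc (w ^ (2 * i * (m div 3))) * (pv i * (pv ((i + m mod 3) mod 3))\<^sup>2))" for m
  note s3 = sring_K3[OF sK]
  have "pv i \<in> K3 K" for i using K3_vars[OF sK] by (simp add: pv_def)
  moreover have "pc (w ^ n) \<in> K3 K" for n by (rule K3_vars(4)[OF sK]) (intro K.kpow wK)
  ultimately have "fP m \<in> K3 K" for m unfolding fP_def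
    by (intro sring_sum[OF s3] sringD[OF s3] sring_power[OF s3])
  then obtain P where P: "P \<in> K3 K" "\<forall>x y z. ev3 P x y z = h (map (\<lambda>j. ev3 (fP j) x y z) [0..<Suc 8])"
    using ffun_pull[OF K.subring_C_axioms assms, of fP] by blast
  have "evu P u = h (fvec u)" if l: "length u = 3" for u
  proof -
    obtain x y z where u: "u = [x, y, z]" using l by (rule len3_E)
    have "map (\<lambda>j. ev3 (fP j) x y z) [0..<Suc 8] = fvec u"
      unfolding fvec_def by (rule map_cong[OF refl]) (simp add: fP_def fkl_def ev3_pv u cong: sum.cong_simp)
    then show ?thesis using P(2) by (simp add: u)
  qed
  then show ?thesis using P(1) by blast
qed

text \<open>Pulled back to the plane, a form over \<open>K\<close> on the surface involves
  \<open>al\<close> and \<open>be\<close>. Splitting by characters isolates them as scalar factors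
  of components with coefficients in \<open>K\<close>.\<close>

lemma phi_split:
  assumes h: "h \<in> ffun K 8 d"
  shows "\<exists>V. (\<forall>a<3. \<forall>b<3. V a b \<in> K3 K) \<and>
    (\<forall>u. length u = 3 \<longrightarrow> h (phi u) = (\<Sum>a<3. \<Sum>b<3. inverse al ^ a * inverse be ^ b * evu (V a b) u)) \<and>
    (\<forall>a<3. \<forall>b<3. \<forall>u p q. length u = 3 \<longrightarrow> evu (V a b) (Mt p q u) = (w ^ p) ^ a * (w ^ (2 * q)) ^ b * evu (V a b) u) \<and>
    (\<forall>a<3. \<forall>b<3. \<forall>u c. length u = 3 \<longrightarrow> evu (V a b) (map ((*) c) u) = c ^ (3 * d) * evu (V a b) u)"
proof -
  obtain H where H: "\<forall>i<3. \<forall>j<3. H i j \<in> ffun K 8 d"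
    "\<forall>v. length v = 9 \<longrightarrow> h v = (\<Sum>i<3. \<Sum>j<3. H i j v)"
    "\<forall>g e v i j. g ^ 3 = 1 \<longrightarrow> e ^ 3 = 1 \<longrightarrow> length v = 9 \<longrightarrow> i < 3 \<longrightarrow> j < 3 \<longrightarrow>
       H i j (sc g e v) = g ^ i * e ^ j * H i j v"
    "\<forall>g t i j. g ^ 3 \<in> K \<longrightarrow> t ^ 3 \<in> K \<longrightarrow> i < 3 \<longrightarrow> j < 3 \<longrightarrow>
       (\<exists>H'\<in>ffun K 8 d. \<forall>v. length v = 9 \<longrightarrow> H i j (sc g t v) = g ^ i * t ^ j * H' v)"
    using character_split[OF K.subring_C_axioms h] by (elim exE conjE)
  let ?g = "inverse al" and ?t = "inverse be"
  have gt: "?g ^ 3 \<in> K" "?t ^ 3 \<in> K"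
    using Kinv[of 2] Kinv[of w] by (simp_all add: power_inverse al3 be3)
  have ex: "\<exists>P. P \<in> K3 K \<and> (\<forall>u. length u = 3 \<longrightarrow> H a b (phi u) = ?g ^ a * ?t ^ b * evu P u) \<and>
      (\<forall>u p q. length u = 3 \<longrightarrow> evu P (Mt p q u) = (w ^ p) ^ a * (w ^ (2 * q)) ^ b * evu P u) \<and>
      (\<forall>u c. length u = 3 \<longrightarrow> evu P (map ((*) c) u) = c ^ (3 * d) * evu P u)" if ab: "a < 3" "b < 3" for a b
  proof -
    obtain H' where H': "H' \<in> ffun K 8 d" "\<forall>v. length v = 9 \<longrightarrow> H a b (sc ?g ?t v) = ?g ^ a * ?t ^ b * H' v"
      using H(4)[rule_format, OF gt ab] by (elim bexE)
    obtain P where P: "P \<in> K3 K" "\<forall>u. length u = 3 \<longrightarrow> evu P u = H' (fvec u)"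
      using fvec_pull[OF H'(1)] by (elim bexE)
    have 1: "H a b (phi u) = ?g ^ a * ?t ^ b * evu P u" if "length u = 3" for u
      unfolding phi_def H'(2)[rule_format, OF fvec_len] P(2)[rule_format, OF that] ..
    have 2: "evu P (Mt p q u) = (w ^ p) ^ a * (w ^ (2 * q)) ^ b * evu P u" if u: "length u = 3" for u p q
    proof -
      have "?g ^ a * ?t ^ b * evu P (Mt p q u) = H a b (phi (Mt p q u))" by (rule 1[OF Mt_len, symmetric])
      also have "phi (Mt p q u) = sc (w ^ p) (w ^ (2 * q)) (phi u)"
        unfolding phi_def fvec_Mt by (simp add: sc_sc mult.commute)
      also have "H a b \<dots> = (w ^ p) ^ a * (w ^ (2 * q)) ^ b * H a b (phi u)"
        by (rule H(3)[rule_format, OF w_pow3 w_pow3 phi_len ab])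
      also have "\<dots> = ?g ^ a * ?t ^ b * ((w ^ p) ^ a * (w ^ (2 * q)) ^ b * evu P u)"
        unfolding 1[OF u] by (simp only: mult_ac)
      finally show ?thesis by simp
    qed
    have 3: "evu P (map ((*) c) u) = c ^ (3 * d) * evu P u" if u: "length u = 3" for u c
      using P(2)[rule_format, of "map ((*) c) u"] P(2)[rule_format, OF u] u fvec_scale[OF u, of c] ffun_scale[OF H'(1), of "fvec u" "c ^ 3"] by (simp add: power_mult)
    show ?thesis using P(1) 1 2 3 by blast
  qed
  define V where "V a b = (SOME P. P \<in> K3 K \<and> (\<forall>u. length u = 3 \<longrightarrow> H a b (phi u) = ?g ^ a * ?t ^ b * evu P u) \<and>
      (\<forall>u p q. length u = 3 \<longrightarrow> evu P (Mt p q u) = (w ^ p) ^ a * (w ^ (2 * q)) ^ b * evu P u) \<and>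
      (\<forall>u c. length u = 3 \<longrightarrow> evu P (map ((*) c) u) = c ^ (3 * d) * evu P u))" for a b
  have V: "V a b \<in> K3 K \<and> (\<forall>u. length u = 3 \<longrightarrow> H a b (phi u) = ?g ^ a * ?t ^ b * evu (V a b) u) \<and>
      (\<forall>u p q. length u = 3 \<longrightarrow> evu (V a b) (Mt p q u) = (w ^ p) ^ a * (w ^ (2 * q)) ^ b * evu (V a b) u) \<and>
      (\<forall>u c. length u = 3 \<longrightarrow> evu (V a b) (map ((*) c) u) = c ^ (3 * d) * evu (V a b) u)" if "a < 3" "b < 3" for a b
    unfolding V_def by (rule someI_ex[OF ex[OF that]])
  have "h (phi u) = (\<Sum>a<3. \<Sum>b<3. ?g ^ a * ?t ^ b * evu (V a b) u)" if u: "length u = 3" for u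
    unfolding H(2)[rule_format, OF phi_len]
  proof (intro sum.cong refl)
    fix a b assume "a \<in> {..<3::nat}" "b \<in> {..<3::nat}"
    then have "a < 3" "b < 3" by simp_all
    from V[OF this] u show "H a b (phi u) = ?g ^ a * ?t ^ b * evu (V a b) u" by blast
  qed
  then show ?thesis using V by (intro exI[of _ V]) blast
qed

end

section \<open>Consequences of a conjugation into the automorphism group\<close>

context severi_brauer
begin

lemma bir_morphism:
  assumes "inverse_morphisms CC K 8 S 8 S t t'"
  shows "V.bir (S, t)"
proof -
  have r: "V.regS S t" "V.regS S t'"
    using assms V.open_S V.S_ne by (auto simp: inverse_morphisms_def V.regS_def)
  have inv: "t' (t x) = x" "t (t' x) = x" if "x \<in> S" for x
    using assms that by (auto simp: inverse_morphisms_def)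
  obtain x where x: "x \<in> S" using V.S_ne by blast
  have "inverse_rat_reps (S, t) (S, t')"
    unfolding inverse_rat_reps_def using x V.regS_maps[OF r(1)] V.regS_maps[OF r(2)] inv by auto
  then have "V.invs (S, t) (S, t')" using r by (simp add: V.invs_def)
  then show ?thesis using V.bir_iff by blast
qed

text \<open>\<open>t\<close> is conjugate to \<open>sg\<close>, so its cube is the identity in
  \<open>Bir\<close>. As \<open>t\<close> is defined on all of \<open>S\<close>, the equality holds
  at every point.\<close>

lemma period_3:
  assumes t: "V.bir (S, t)" and g: "g \<in> carrier G"
    and eq: "g \<otimes>\<^bsub>G\<^esub> gS = V.cl (S, t) \<otimes>\<^bsub>G\<^esub> g" and x: "x \<in> S"
  shows "t (t (t x)) = x"
proof -
  define c where "c = V.cl (S, t)"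
  have c: "c \<in> carrier G" using t by (auto simp: c_def V.Bir_carrier)
  note eq = eq[folded c_def]
  have "c \<otimes>\<^bsub>G\<^esub> (c \<otimes>\<^bsub>G\<^esub> c) \<otimes>\<^bsub>G\<^esub> g = c \<otimes>\<^bsub>G\<^esub> (c \<otimes>\<^bsub>G\<^esub> (g \<otimes>\<^bsub>G\<^esub> gS))"
    using c g by (simp add: G.m_assoc eq)
  also have "\<dots> = c \<otimes>\<^bsub>G\<^esub> ((c \<otimes>\<^bsub>G\<^esub> g) \<otimes>\<^bsub>G\<^esub> gS)" using c g by (simp only: G.m_assoc gS_carrier)
  also have "\<dots> = c \<otimes>\<^bsub>G\<^esub> ((g \<otimes>\<^bsub>G\<^esub> gS) \<otimes>\<^bsub>G\<^esub> gS)" by (simp only: eq)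
  also have "\<dots> = (c \<otimes>\<^bsub>G\<^esub> g) \<otimes>\<^bsub>G\<^esub> (gS \<otimes>\<^bsub>G\<^esub> gS)" using c g by (simp only: G.m_assoc gS_carrier G.m_closed)
  also have "\<dots> = (g \<otimes>\<^bsub>G\<^esub> gS) \<otimes>\<^bsub>G\<^esub> (gS \<otimes>\<^bsub>G\<^esub> gS)" by (simp only: eq)
  also have "\<dots> = g \<otimes>\<^bsub>G\<^esub> (gS \<otimes>\<^bsub>G\<^esub> (gS \<otimes>\<^bsub>G\<^esub> gS))" using c g by (simp only: G.m_assoc gS_carrier G.m_closed)
  also have "gS \<otimes>\<^bsub>G\<^esub> (gS \<otimes>\<^bsub>G\<^esub> gS) = \<one>\<^bsub>G\<^esub>" using gS3 by (simp add: numeral_3_eq_3 G.m_assoc)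
  finally have "c \<otimes>\<^bsub>G\<^esub> (c \<otimes>\<^bsub>G\<^esub> c) \<otimes>\<^bsub>G\<^esub> g = \<one>\<^bsub>G\<^esub> \<otimes>\<^bsub>G\<^esub> g" using g by simp
  then have "c \<otimes>\<^bsub>G\<^esub> (c \<otimes>\<^bsub>G\<^esub> c) = \<one>\<^bsub>G\<^esub>" using c g by (simp only: G.r_cancel G.m_closed G.one_closed)
  then have e: "V.cl (V.cmp (S, t) (V.cmp (S, t) (S, t))) = V.cl (S, id)"
    unfolding c_def by (simp add: V.Bir_mult V.bir_cmp t V.Bir_one)
  have "V.eqr (V.cmp (S, t) (V.cmp (S, t) (S, t))) (S, id)"
    using V.cl_eq[OF V.bir_reg[OF V.bir_cmp[OF V.bir_cmp[OF t t] t]]] e by blast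
  moreover have "t x \<in> S" if "x \<in> S" for x using V.regS_maps[of S t, OF _ that] V.bir_reg[OF t] that by simp
  ultimately show ?thesis using x by (auto simp: V.eqr_def V.cmp_def)
qed

text \<open>The period comes from conjugacy with \<open>sg\<close>; with it
  \<open>cubic_periodic_linear\<close> turns the polynomial lift of \<open>t\<close> into a matrix
  whose cube is scalar.\<close>

lemma linear_lift:
  assumes t: "V.bir (S, t)" and g: "g \<in> carrier G"
    and eq: "g \<otimes>\<^bsub>G\<^esub> gS = V.cl (S, t) \<otimes>\<^bsub>G\<^esub> g"
  obtains A h where "h \<noteq> 0"
    "\<And>u i. length u = 3 \<Longrightarrow> i < 3 \<Longrightarrow> (\<Sum>j<3. A i j * (\<Sum>k<3. A j k * (\<Sum>l<3. A k l * u ! l))) = h * u ! i"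
    "\<And>u. u \<in> vecs 2 \<Longrightarrow> map (\<lambda>i. \<Sum>k<3. A i k * u ! k) [0..<Suc 2] \<in> vecs 2 \<and>
       t (pt (phi u)) = pt (phi (map (\<lambda>i. \<Sum>k<3. A i k * u ! k) [0..<Suc 2]))"
proof -
  have "V.regS S t" using V.bir_reg[OF t] by simp
  then obtain T where T: "\<forall>u\<in>vecs 2. evt T u \<in> vecs 2 \<and> t (pt (phi u)) = pt (phi (evt T u))"
    using regular_lift by (elim exE[OF regular_lift])
  have par: "\<exists>k. a = map ((*) k) b" if "pt (phi a) = pt (phi b)" "a \<in> vecs 2" "b \<in> vecs 2" for a b
    using pt_phi_inj[OF that(2,3,1)] unfolding pt_eq_iff by blast
  have "\<exists>A h. h \<noteq> 0 \<and> (\<forall>u. length u = 3 \<longrightarrow> evt T (evt T (evt T u)) = map ((*) h) u) \<and>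
    (\<forall>i<3. \<forall>x y z. ev3 (T i) x y z = (A i 0 * x + A i 1 * y + A i (2::nat) * z))"
  proof (rule cubic_periodic_linear)
    show "evt T u \<in> vecs 2" if "u \<in> vecs 2" for u using T that by blast
    show "\<exists>k. evt T (map ((*) c) u) = map ((*) k) (evt T u)" if u: "u \<in> vecs 2" "c \<noteq> 0" for u c
    proof (rule par)
      have cu: "map ((*) c) u \<in> vecs 2" using u by (simp add: vecs_scale_iff)
      have "pt (phi (map ((*) c) u)) = pt (phi u)" by (rule pt_phi_scaled[OF cu refl])
      then show "pt (phi (evt T (map ((*) c) u))) = pt (phi (evt T u))" using T cu u(1) by metis
    qed (use T u in \<open>simp_all add: vecs_scale_iff\<close>)
    show "\<exists>k. evt T (evt T (evt T u)) = map ((*) k) u" if u: "u \<in> vecs 2" for u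
    proof (rule par)
      have "pt (phi u) \<in> S" using u by (auto simp: S_def)
      from period_3[OF t g eq this] show "pt (phi (evt T (evt T (evt T u)))) = pt (phi u)"
        using T u by simp
    qed (use T u in simp_all)
  qed
  then obtain A h where A: "h \<noteq> 0" "\<forall>u. length u = 3 \<longrightarrow> evt T (evt T (evt T u)) = map ((*) h) u"
    "\<forall>i<3. \<forall>x y z. ev3 (T i) x y z = (A i 0 * x + A i 1 * y + A i (2::nat) * z)" by (elim exE conjE)
  have n: "evt T u ! i = (\<Sum>k<3. A i k * u ! k)" if "i < 3" for u i
    using A(3) that by (simp add: evt_nth sum3)
  have m: "evt T u = map (\<lambda>i. \<Sum>k<3. A i k * u ! k) [0..<Suc 2]" for u
    by (rule nth_equalityI) (simp_all add: n nth_map_upt del: upt_Suc)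
  have "(\<Sum>j<3. A i j * (\<Sum>k<3. A j k * (\<Sum>l<3. A k l * u ! l))) = h * u ! i" if u: "length u = 3" "i < 3" for u i
  proof -
    have "(\<Sum>j<3. A i j * (\<Sum>k<3. A j k * (\<Sum>l<3. A k l * u ! l))) = (\<Sum>j<3. A i j * (\<Sum>k<3. A j k * evt T u ! k))"
      by (intro sum.cong refl arg_cong2[where f = "(*)"]) (simp add: n)
    also have "\<dots> = (\<Sum>j<3. A i j * evt T (evt T u) ! j)"
      by (intro sum.cong refl arg_cong2[where f = "(*)"]) (simp add: n)
    also have "\<dots> = evt T (evt T (evt T u)) ! i" using n[OF u(2)] by simp
    also have "\<dots> = h * u ! i" using A(2) u by simp
    finally show ?thesis .
  qed
  then show ?thesis using that[OF A(1)] T unfolding m by blast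
qed

lemma not_scalar:
  assumes t: "V.bir (S, t)" and g: "g \<in> carrier G"
    and eq: "g \<otimes>\<^bsub>G\<^esub> gS = V.cl (S, t) \<otimes>\<^bsub>G\<^esub> g" and id: "\<And>x. x \<in> S \<Longrightarrow> t x = x"
  shows False
proof -
  have "V.eqr (S, t) (S, id)" using V.bir_reg[OF t] V.regS_id id by (simp add: V.eqr_def)
  then have "V.cl (S, t) = \<one>\<^bsub>G\<^esub>" using V.cl_eq[OF V.bir_reg[OF t]] V.Bir_one by simp
  then have "g \<otimes>\<^bsub>G\<^esub> gS = g \<otimes>\<^bsub>G\<^esub> \<one>\<^bsub>G\<^esub>" using eq g by simp
  then have "gS = \<one>\<^bsub>G\<^esub>" using g by (simp only: G.l_cancel gS_carrier G.one_closed)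
  then show False using gS_neq_gM gM_0 by metis
qed

text \<open>\<open>sg\<close> does not map the plane into the curve, so powers of the curve equation
  at \<open>sg u\<close> can be cancelled at general \<open>u\<close>.\<close>

lemma fC_sg_nz: "evu fC (sg [1, 2, 3]) \<noteq> 0"
proof
  assume "evu fC (sg [1, 2, 3]) = 0"
  then have "8580 + 2574 * w = 0"
    by (simp add: sg_def Let_def cv_def w_pow_num; simp add: ww ww' algebra_simps power2_eq_square)
  then have e: "2574 * w = - 8580" by (simp add: eq_neg_iff_add_eq_0 add.commute)
  have "w = 2574 * w / 2574" by simp
  also have "\<dots> = - 8580 / 2574" by (simp only: e)
  finally have w: "w = - 8580 / 2574" .
  show False using w_eq unfolding w by (simp add: power2_eq_square)
qed

text \<open>A birational map is given by a matrix of forms (all of whose columns are proportional to the image point);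
  the common factor vanishing along the curve is removed.\<close>

lemma generic_relation:
  assumes r: "V.bir r" and t: "V.bir (S, t)"
    and eq: "V.cl r \<otimes>\<^bsub>G\<^esub> gS = V.cl (S, t) \<otimes>\<^bsub>G\<^esub> V.cl r"
    and A: "\<And>u. u \<in> vecs 2 \<Longrightarrow> map (\<lambda>i. \<Sum>k<3. A i k * u ! k) [0..<Suc 2] \<in> vecs 2 \<and>
       t (pt (phi u)) = pt (phi (map (\<lambda>i. \<Sum>k<3. A i k * u ! k) [0..<Suc 2]))"
  obtains d E P a where "\<And>m. m < 9 \<Longrightarrow> E m \<in> ffun K 8 d" "P \<noteq> 0" "a < 9" "\<exists>u. length u = 3 \<and> E a (phi u) \<noteq> 0"
    "\<And>u i i' j j'. length u = 3 \<Longrightarrow> evu P u \<noteq> 0 \<Longrightarrow> i < 3 \<Longrightarrow> i' < 3 \<Longrightarrow> j < 3 \<Longrightarrow> j' < 3 \<Longrightarrow>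
       Rm (map (\<lambda>m. E m (phi (sg u))) [0..<Suc 8]) i j * (\<Sum>k<3. A i' k * Rm (map (\<lambda>m. E m (phi u)) [0..<Suc 8]) k j')
     = Rm (map (\<lambda>m. E m (phi (sg u))) [0..<Suc 8]) i' j * (\<Sum>k<3. A i k * Rm (map (\<lambda>m. E m (phi u)) [0..<Suc 8]) k j')"
proof -
  obtain U f where rUf: "r = (U, f)" by (cases r)
  have reg: "V.regS U f" using V.bir_reg[OF r] by (simp add: rUf)
  then obtain x0 where x0: "x0 \<in> U" unfolding V.regS_def by blast
  obtain d E a where loc: "V.loc U f x0 d E a" using V.regS_local[OF reg x0] by (elim exE)
  have E: "E m \<in> ffun K 8 d" if "m < 9" for m using V.locD(1)[OF loc, of m] that by simp
  have a: "a < 9" using V.locD(2)[OF loc] by simp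
  have "open_over CC K 8 S U" using reg by (simp add: V.regS_def)
  then obtain e h where h: "h \<in> ffun K 8 e" "x0 \<in> nz S h" "nz S h \<subseteq> U" using V.open_iff x0 by blast
  \<comment> \<open>Where \<open>gg\<close> is nonzero the point lies in \<open>U\<close> and the
    forms \<open>E\<close> compute its image.\<close>
  define gg where "gg v = h v * E a v" for v
  have gg: "gg \<in> ffun K 8 (e + d)" unfolding gg_def by (rule K.ffun_mult[OF h(1) E[OF a]])
  have gg': "gg \<in> ffun UNIV 8 (e + d)" by (rule ffun_mono[OF subset_UNIV gg])
  have "x0 \<in> nz S gg" unfolding gg_def V.nz_mult[OF h(1) E[OF a]] using h(2) V.locD(3)[OF loc] by blast
  then have ne: "nz S gg \<noteq> {}" by blast
  obtain P1 where P1: "\<forall>x y z. ev3 P1 x y z = gg (phi [x, y, z])" using pull_S[OF gg'] by (elim exE)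
  have P1': "evu P1 u = gg (phi u)" if "length u = 3" for u
    unfolding P1[rule_format] list3[OF that, symmetric] ..
  define sT where "sT = (\<lambda>i. if i = (0::nat) then px * pz * (px * pz - py\<^sup>2)
    else if i = 1 then pc w * (px * py * (px * py - pz\<^sup>2)) else pc (w\<^sup>2) * (py * pz * (py * pz - px\<^sup>2)))"
  have sT: "sg u = evt sT u" if "length u = 3" for u unfolding sT_def by (rule sg_evt[OF that])
  obtain P2 where P2: "\<forall>u. evu P2 u = evu P1 (evt sT u)" by (rule exE[OF evu_comp])
  have P2': "evu P2 u = gg (phi (sg u))" if "length u = 3" for u
    using P2 P1'[of "sg u"] sT[OF that] by simp
  have "P1 \<noteq> 0"
  proof
    assume 0: "P1 = 0"
    obtain u where u: "u \<in> vecs 2" "x0 = pt (phi u)" using x0 V.regS_sub[OF reg] by (auto simp: S_def)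
    then have "gg (phi u) \<noteq> 0" using nz_S_iff[OF gg' u(1)] \<open>x0 \<in> nz S gg\<close> by simp
    then show False using P1'[OF len_vecs[OF u(1)]] 0 by simp
  qed
  moreover have "P2 \<noteq> 0"
  proof
    assume 0: "P2 = 0"
    have "{x \<in> fst (rp sg). snd (rp sg) x \<in> nz S gg} \<noteq> {}"
      by (rule V.bir_preimage[OF bir_sg(1) V.open_nz[OF gg] ne])
    then obtain x where x: "x \<in> dom sg" "lft sg x \<in> nz S gg" by auto
    obtain u where u: "u \<in> vecs 2" "x = pt (phi u)" "sg u \<in> vecs 2" using x(1) unfolding dom_def mem_Collect_eq by (elim exE conjE)
    have "pt (phi (sg u)) \<in> nz S gg" using x(2) unfolding u(2) lft_pt[OF hmg_sg u(1)] .
    then have "gg (phi (sg u)) \<noteq> 0" using nz_S_iff[OF gg' u(3)] by simp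
    then show False using P2'[OF len_vecs[OF u(1)]] 0 by simp
  qed
  moreover have "sT 0 \<noteq> 0"
  proof
    assume "sT 0 = 0"
    then have "ev3 (sT 0) 1 2 3 = 0" by simp
    then show False by (simp add: sT_def)
  qed
  \<comment> \<open>Nonvanishing of this product makes both \<open>u\<close> and \<open>sg u\<close>
    general enough for the local formula, and \<open>sg u\<close> a point.\<close>
  ultimately have nz: "P1 * P2 * sT 0 \<noteq> 0" by simp
  have exu: "\<exists>u. length u = 3 \<and> E a (phi u) \<noteq> 0"
  proof -
    obtain u where u: "u \<in> vecs 2" "x0 = pt (phi u)" using x0 V.regS_sub[OF reg] by (auto simp: S_def)
    then have "gg (phi u) \<noteq> 0" using nz_S_iff[OF gg' u(1)] \<open>x0 \<in> nz S gg\<close> by simp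
    then show ?thesis using len_vecs[OF u(1)] unfolding gg_def by auto
  qed
  have gS: "V.bir (rp sg)" by (rule bir_sg(1))
  have "V.cl (V.cmp r (rp sg)) = V.cl (V.cmp (S, t) r)"
    using eq unfolding gS_def V.Bir_mult[OF gS r] V.Bir_mult[OF r t] .
  then have eqr: "V.eqr (V.cmp r (rp sg)) (V.cmp (S, t) r)"
    using V.cl_eq[OF V.bir_reg[OF V.bir_cmp[OF gS r]]] by blast
  define Xv where "Xv u = map (\<lambda>m. E m (phi u)) [0..<Suc 8]" for u
  have Xl: "length (Xv u) = 9" for u by (simp add: Xv_def)
  have rel: "Rm (Xv (sg u)) i j * (\<Sum>k<3. A i' k * Rm (Xv u) k j') = Rm (Xv (sg u)) i' j * (\<Sum>k<3. A i k * Rm (Xv u) k j')"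
    if u: "length u = 3" "evu (P1 * P2 * sT 0) u \<noteq> 0" and ij: "i < 3" "i' < 3" "j < 3" "j' < 3" for u i i' j j'
  proof -
    have nzs: "gg (phi u) \<noteq> 0" "gg (phi (sg u)) \<noteq> 0" "sg u ! 0 \<noteq> 0"
      using u(2) P1'[OF u(1)] P2'[OF u(1)] evt_nth[of 0 sT u] sT[OF u(1)] by auto
    have s2: "sg u \<in> vecs 2" using nzs(3) unfolding vecs2_iff[OF sg_len] by (intro exI[of _ 0]) simp
    have "u ! 0 \<noteq> 0" using nzs(3) by (auto simp: sg_def Let_def)
    then have u2: "u \<in> vecs 2" unfolding vecs2_iff[OF u(1)] by (intro exI[of _ 0]) simp
    have pU: "pt (phi v) \<in> U \<and> f (pt (phi v)) = pt (Xv v)" if v: "v \<in> vecs 2" "gg (phi v) \<noteq> 0" for v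
    proof -
      have "h (phi v) \<noteq> 0" "E a (phi v) \<noteq> 0" using v(2) by (auto simp: gg_def)
      then have 1: "pt (phi v) \<in> U" using nz_S_iff[OF ffun_mono[OF subset_UNIV h(1)] v(1)] h(3) by blast
      have "f (pt (phi v)) = pt (Xv v)" unfolding Xv_def
        by (rule V.locD(4)[OF loc 1 pt_self, of a]) (use a \<open>E a (phi v) \<noteq> 0\<close> in simp_all)
      then show ?thesis using 1 by simp
    qed
    have inS: "pt (Xv v) \<in> S" if v: "v \<in> vecs 2" "gg (phi v) \<noteq> 0" for v
      using pU[OF v] V.regS_maps[OF reg, of "pt (phi v)"] by simp
    obtain y c where y: "y \<in> vecs 2" "c \<noteq> 0" "Xv u = map ((*) c) (phi y)" using S_col[OF inS[OF u2 nzs(1)] Xl] by blast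
    define y' where "y' = map (\<lambda>i. \<Sum>k<3. A i k * y ! k) [0..<Suc 2]"
    have y': "y' \<in> vecs 2" "t (pt (phi y)) = pt (phi y')" using A[OF y(1)] unfolding y'_def by blast+
    have y'n: "y' ! i = (\<Sum>k<3. A i k * y ! k)" if "i < 3" for i unfolding y'_def using that by (subst nth_map_upt) simp_all
    have dsg: "pt (phi u) \<in> dom sg" "lft sg (pt (phi u)) = pt (phi (sg u))"
      using dom_pt[OF hmg_sg u2] s2 lft_pt[OF hmg_sg u2] by blast+
    have conj: "f (lft sg x) = t (f x)" if "x \<in> dom sg" "lft sg x \<in> U" "x \<in> U" "f x \<in> S" for x
      using eqr that unfolding V.eqr_def V.cmp_def rUf by simp
    have "f (lft sg (pt (phi u))) = t (f (pt (phi u)))"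
      by (rule conj) (simp_all only: dsg pU[OF u2 nzs(1)] pU[OF s2 nzs(2)] inS[OF u2 nzs(1)])
    then have "pt (Xv (sg u)) = t (pt (phi y))"
      using dsg pU[OF u2 nzs(1)] pU[OF s2 nzs(2)] y(3) pt_eqI[OF y(2), of "phi y"] by simp
    then have "pt (Xv (sg u)) = pt (phi y')" using y'(2) by simp
    then obtain c' where c': "Xv (sg u) = map ((*) c') (phi y')" unfolding pt_eq_iff by blast
    have M1: "Rm (Xv u) k j = c * (3 * (y ! k * (y ! j)\<^sup>2))" if "k < 3" "j < 3" for k j
      unfolding y(3) Rm_scale[OF phi_len that(1)] Rm_phi[OF that] ..
    have M2: "Rm (Xv (sg u)) k j = c' * (3 * (y' ! k * (y' ! j)\<^sup>2))" if "k < 3" "j < 3" for k j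
      unfolding c' Rm_scale[OF phi_len that(1)] Rm_phi[OF that] ..
    \<comment> \<open>All columns at \<open>u\<close> are multiples of \<open>y\<close>, so
      \<open>A\<close> maps them to multiples of \<open>y'\<close>, to which the columns at
      \<open>sg u\<close> are proportional as well.\<close>
    have AM: "(\<Sum>k<3. A i k * Rm (Xv u) k j') = y' ! i * (c * 3 * (y ! j')\<^sup>2)" if "i < 3" for i
      unfolding y'n[OF that] sum_distrib_right by (intro sum.cong refl) (simp add: M1 ij)
    show ?thesis unfolding AM[OF ij(1)] AM[OF ij(2)] M2[OF ij(1,3)] M2[OF ij(2,3)] by (simp only: mult_ac)
  qed
  show ?thesis
    by (rule that[where E = E and d = d and P = "P1 * P2 * sT 0" and a = a], erule E, rule nz, rule a, rule exu, rule rel[unfolded Xv_def])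
qed

end

section \<open>Eigenvectors along the curve and the final contradiction\<close>

lemma complex_cube_root: "\<exists>z::complex. z ^ 3 = c"
proof -
  have "\<not> constant (poly [:- c, 0, 0, 1:])" by (simp add: constant_degree)
  from fundamental_theorem_of_algebra[OF this] obtain z where "poly [:- c, 0, 0, 1:] z = 0" by (elim exE)
  then show ?thesis by (intro exI[of _ z]) (simp add: power3_eq_cube mult.assoc)
qed

context cube_root_1
begin

lemma vanC_I:
  assumes "\<And>u. length u = 3 \<Longrightarrow> evu fC u = 0 \<Longrightarrow> u ! 0 \<noteq> 0 \<Longrightarrow> u ! 1 \<noteq> 0 \<Longrightarrow> u ! 2 \<noteq> 0 \<Longrightarrow> evu h u = 0"
  shows "vanC h"
  unfolding vanC_def
proof (intro allI impI)
  fix x y z assume "cv x y z = 0" "x \<noteq> 0" "y \<noteq> 0" "z \<noteq> 0"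
  then show "ev3 h x y z = 0" using assms[of "[x, y, z]"] by simp
qed

lemma vanC_E: "vanC h \<Longrightarrow> evu fC u = 0 \<Longrightarrow> u ! 0 \<noteq> 0 \<Longrightarrow> u ! 1 \<noteq> 0 \<Longrightarrow> u ! 2 \<noteq> 0 \<Longrightarrow> evu h u = 0"
  using vanC_D[of h "u ! 0" "u ! 1" "u ! 2"] by simp

text \<open>On the curve the columns of \<open>N\<close> are eigenvectors of \<open>A\<close>; there are only three eigenvalues, and since
  the curve is irreducible one of them is attained identically.\<close>

lemma common_left_kernel:
  fixes A :: "nat \<Rightarrow> nat \<Rightarrow> complex" and N :: "nat \<Rightarrow> nat \<Rightarrow> p3"
  assumes h: "h \<noteq> 0"
    and cube: "\<And>u i. length u = 3 \<Longrightarrow> i < 3 \<Longrightarrow> (\<Sum>j<3. A i j * (\<Sum>k<3. A j k * (\<Sum>l<3. A k l * u ! l))) = h * u ! i"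
    and ns: "\<And>\<theta>. \<exists>i<3. \<exists>k<3. A i k \<noteq> (if k = i then \<theta> else 0)"
    and rel: "\<And>i i' j j'. i < 3 \<Longrightarrow> i' < 3 \<Longrightarrow> j < 3 \<Longrightarrow> j' < 3 \<Longrightarrow>
      vanC (N i j * (\<Sum>k<3. pc (A i' k) * N k j') - N i' j * (\<Sum>k<3. pc (A i k) * N k j'))"
  shows "\<exists>\<xi> i0. i0 < 3 \<and> \<xi> i0 \<noteq> 0 \<and> (\<forall>j<3. vanC (\<Sum>k<3. pc (\<xi> k) * N k j))"
proof (cases "\<forall>i<3. \<forall>j<3. vanC (N i j)")
  case True
  \<comment> \<open>If the whole matrix vanishes on the curve, any linear form serves.\<close>
  have "vanC (\<Sum>k<3. pc 1 * N k j)" if j: "j < 3" for j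
  proof (rule vanC_I)
    fix u :: "complex list" assume "length u = 3" "evu fC u = 0" "u ! 0 \<noteq> 0" "u ! 1 \<noteq> 0" "u ! 2 \<noteq> 0"
    then have "evu (N k j) u = 0" if "k < 3" for k using True that j vanC_E by blast
    then show "evu (\<Sum>k<3. pc 1 * N k j) u = 0" by simp
  qed
  then show ?thesis by (intro exI[of _ "\<lambda>_. 1"] exI[of _ 0]) simp
next
  case False
  then obtain i0 j0 where ij: "i0 < 3" "j0 < 3" "\<not> vanC (N i0 j0)" by blast
  define on where "on u \<longleftrightarrow> length u = 3 \<and> evu fC u = 0 \<and> u ! 0 \<noteq> 0 \<and> u ! 1 \<noteq> 0 \<and> u ! 2 \<noteq> 0" for u
  have I: "vanC p" if "\<And>u. on u \<Longrightarrow> evu p u = 0" for p by (rule vanC_I) (use that in \<open>simp add: on_def\<close>)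
  have E: "evu p u = 0" if "vanC p" "on u" for p u by (rule vanC_E[OF that(1)]) (use that(2) in \<open>simp_all add: on_def\<close>)
  obtain \<theta>0 where \<theta>0: "\<theta>0 ^ 3 = h" by (rule exE[OF complex_cube_root])
  define \<theta> where "\<theta> s = \<theta>0 * w ^ s" for s :: nat
  have \<theta>nz: "\<theta> s \<noteq> 0" for s using \<theta>0 h by (auto simp: \<theta>_def)
  define b where "b u k = evu (N k j0) u" for u k
  define tb where "tb u i = (\<Sum>k<3. A i k * b u k)" for u i
  \<comment> \<open>Column \<open>j0\<close> of \<open>N\<close> multiplied by \<open>A\<close>
    minus the eigenvalue \<open>\<theta> s\<close>.\<close>
  define D where "D s i = (\<Sum>k<3. pc (A i k) * N k j0) - pc (\<theta> s) * N i j0" for s i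
  have D: "evu (D s i) u = tb u i - \<theta> s * b u i" for s i u by (simp add: D_def tb_def b_def)
  have R: "evu (N i j) u * tb u i' = evu (N i' j) u * tb u i" if "on u" "i < 3" "i' < 3" "j < 3" for u i i' j
    using E[OF rel[OF that(2,3,4) ij(2)] that(1)] by (simp add: tb_def b_def)
  have Rb: "b u i * tb u i' = b u i' * tb u i" if "on u" "i < 3" "i' < 3" for u i i'
    using R[OF that ij(2)] by (simp add: b_def)
  \<comment> \<open>At a point of the curve column \<open>j0\<close> is zero or an eigenvector, and
    its eigenvalue is one of the three cube roots of \<open>h\<close>. So one of the three factors
    vanishes there.\<close>
  have vD: "vanC (D 0 i * D 1 i' * D 2 i'')" if i: "i < 3" "i' < 3" "i'' < 3" for i i' i''
  proof (rule I)
    fix u assume u: "on u"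
    show "evu (D 0 i * D 1 i' * D 2 i'') u = 0"
    proof (cases "\<forall>k<3. b u k = 0")
      case True
      then have "tb u i = 0" by (simp add: tb_def)
      then show ?thesis using D[of 0 i u] True i by simp
    next
      case False
      then obtain l where l: "l < 3" "b u l \<noteq> 0" by blast
      define t where "t = tb u l / b u l"
      have tb: "tb u i = t * b u i" if "i < 3" for i
        using Rb[OF u l(1) that] l(2) by (simp add: t_def field_simps)
      have nth: "[b u 0, b u 1, b u 2] ! k = b u k" if "k < 3" for k using less_3[OF that] by auto
      have s1: "(\<Sum>l<3. A k l * [b u 0, b u 1, b u 2] ! l) = t * b u k" if "k < 3" for k
        using tb[OF that] by (simp add: tb_def sum3)
      have "(\<Sum>k<3. A j k * (\<Sum>l<3. A k l * [b u 0, b u 1, b u 2] ! l)) = t * (t * b u j)" if "j < 3" for j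
      proof -
        have "(\<Sum>k<3. A j k * (\<Sum>l<3. A k l * [b u 0, b u 1, b u 2] ! l)) = (\<Sum>k<3. t * (A j k * b u k))"
          by (intro sum.cong refl) (simp only: s1 lessThan_iff mult_ac)
        then show ?thesis using tb[OF that] by (simp add: tb_def sum_distrib_left[symmetric])
      qed
      then have "(\<Sum>j<3. A l j * (\<Sum>k<3. A j k * (\<Sum>l<3. A k l * [b u 0, b u 1, b u 2] ! l))) = (\<Sum>j<3. t * (t * (A l j * b u j)))"
        by (intro sum.cong refl) (simp only: lessThan_iff mult_ac)
      also have "\<dots> = t * (t * tb u l)" by (simp add: tb_def sum_distrib_left)
      finally have "h * [b u 0, b u 1, b u 2] ! l = t * (t * tb u l)"
        by (subst (asm) cube) (simp_all add: l(1))
      then have "t * (t * t) * b u l = h * b u l" unfolding nth[OF l(1)] tb[OF l(1)] by (simp only: mult.assoc)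
      then have "t * (t * t) = h" using l(2) by simp
      then have t3: "t ^ 3 = \<theta>0 ^ 3" unfolding \<theta>0 by (simp add: power3_eq_cube mult.assoc)
      have "(t - \<theta> 0) * (t - \<theta> 1) * (t - \<theta> 2) = t ^ 3 - \<theta>0 ^ 3"
        unfolding \<theta>_def by (simp add: ww ww' algebra_simps power2_eq_square power3_eq_cube)
      then have t0: "(t - \<theta> 0) * (t - \<theta> 1) * (t - \<theta> 2) = 0" unfolding t3 by simp
      have f: "evu (D s i) u = (t - \<theta> s) * b u i" if "i < 3" for s i
        unfolding D tb[OF that] by (rule left_diff_distrib[symmetric])
      have "evu (D 0 i * D 1 i' * D 2 i'') u = (t - \<theta> 0) * (t - \<theta> 1) * (t - \<theta> 2) * (b u i * b u i' * b u i'')"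
        unfolding ev3_simps f[OF i(1)] f[OF i(2)] f[OF i(3)] by (simp only: mult_ac)
      then show ?thesis unfolding t0 by simp
    qed
  qed
  \<comment> \<open>Otherwise each eigenvalue would fail in some coordinate, against irreducibility
    of the curve.\<close>
  have "\<exists>s. \<forall>i<3. vanC (D s i)"
  proof (rule ccontr)
    assume "\<not> ?thesis"
    then obtain i i' i'' where "i < 3" "i' < 3" "i'' < 3" "\<not> vanC (D 0 i)" "\<not> vanC (D 1 i')" "\<not> vanC (D 2 i'')" by metis
    then show False using vD vanC_mult by blast
  qed
  then obtain s where s: "\<forall>i<3. vanC (D s i)" by (elim exE)
  have tbs: "tb u i = \<theta> s * b u i" if "on u" "i < 3" for u i
    using E[OF s[rule_format, OF that(2)] that(1)] unfolding D by simp
  obtain i k0 where ik: "i < 3" "k0 < 3" "A i k0 \<noteq> (if k0 = i then \<theta> s else 0)" using ns by blast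
  \<comment> \<open>A nonzero row of \<open>A\<close> minus the eigenvalue; it exists because
    \<open>A\<close> is not scalar.\<close>
  define \<xi> where "\<xi> k = A i k - (if k = i then \<theta> s else 0)" for k
  have \<xi>b: "(\<Sum>k<3. \<xi> k * b u k) = 0" if "on u" for u
  proof -
    have "(\<Sum>k<3. \<xi> k * b u k) = tb u i - (\<Sum>k<3. if k = i then \<theta> s * b u k else 0)"
      unfolding tb_def sum_subtractf[symmetric] by (intro sum.cong refl) (simp add: \<xi>_def left_diff_distrib)
    also have "\<dots> = tb u i - \<theta> s * b u i" using ik(1) by simp
    finally show ?thesis using tbs[OF that ik(1)] by simp
  qed
  have "vanC (\<Sum>k<3. pc (\<xi> k) * N k j)" if j: "j < 3" for j
  proof -
    \<comment> \<open>The other columns are proportional to column \<open>j0\<close> on the curve.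
      The factor \<open>N i0 j0\<close> clears the denominator and is cancelled by
      irreducibility.\<close>
    have "vanC (N i0 j0 * (\<Sum>k<3. pc (\<xi> k) * N k j))"
    proof (rule I)
      fix u assume u: "on u"
      have e: "evu (N k j) u * b u i0 = evu (N i0 j) u * b u k" if "k < 3" for k
        using R[OF u that ij(1) j] tbs[OF u ij(1)] tbs[OF u that] \<theta>nz[of s] by (simp add: mult_ac)
      have "evu (N i0 j0 * (\<Sum>k<3. pc (\<xi> k) * N k j)) u = (\<Sum>k<3. \<xi> k * (evu (N k j) u * b u i0))"
        by (simp add: b_def sum_distrib_left mult_ac)
      also have "\<dots> = (\<Sum>k<3. evu (N i0 j) u * (\<xi> k * b u k))"
        by (intro sum.cong refl, subst e) (simp_all only: lessThan_iff mult_ac)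
      also have "\<dots> = 0" unfolding sum_distrib_left[symmetric] \<xi>b[OF u] by simp
      finally show "evu (N i0 j0 * (\<Sum>k<3. pc (\<xi> k) * N k j)) u = 0" .
    qed
    then show ?thesis using vanC_mult ij(3) by blast
  qed
  moreover have "\<xi> k0 \<noteq> 0" using ik(3) by (simp add: \<xi>_def)
  ultimately show ?thesis using ik(2) by blast
qed

end

context severi_brauer
begin

text \<open>The contradiction is with the choice of the exponent in \<open>fC_order\<close>: the
  divided components over \<open>K\<close> cannot all vanish on the curve, yet the division algebra
  forces one that does not vanish there to do so.\<close>

lemma not_conjugate:
  assumes t: "V.bir (S, t)" and g: "g \<in> carrier G"
    and eq: "g \<otimes>\<^bsub>G\<^esub> gS = V.cl (S, t) \<otimes>\<^bsub>G\<^esub> g"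
  shows False
proof -
  obtain r where r: "V.bir r" "g = V.cl r" using g by (auto simp: V.Bir_carrier)
  obtain A h where A: "h \<noteq> 0"
    "\<And>u i. length u = 3 \<Longrightarrow> i < 3 \<Longrightarrow> (\<Sum>j<3. A i j * (\<Sum>k<3. A j k * (\<Sum>l<3. A k l * u ! l))) = h * u ! i"
    "\<And>u. u \<in> vecs 2 \<Longrightarrow> map (\<lambda>i. \<Sum>k<3. A i k * u ! k) [0..<Suc 2] \<in> vecs 2 \<and>
       t (pt (phi u)) = pt (phi (map (\<lambda>i. \<Sum>k<3. A i k * u ! k) [0..<Suc 2]))"
    by (rule linear_lift[OF t g eq]) blast
  \<comment> \<open>A scalar matrix would make \<open>t\<close> the identity and hence
    \<open>sg\<close> trivial.\<close>
  have ns: "\<exists>i<3. \<exists>k<3. A i k \<noteq> (if k = i then \<theta> else 0)" for \<theta>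
  proof (rule ccontr)
    assume "\<not> ?thesis"
    then have d: "A i k = (if k = i then \<theta> else 0)" if "i < 3" "k < 3" for i k using that by blast
    have "t x = x" if xS: "x \<in> S" for x
    proof -
      obtain u where u: "u \<in> vecs 2" "x = pt (phi u)" using xS by (auto simp: S_def)
      have "(\<Sum>k<3. A i k * u ! k) = \<theta> * u ! i" if "i < 3" for i
      proof -
        have "(\<Sum>k<3. A i k * u ! k) = (\<Sum>k<3. if k = i then \<theta> * u ! k else 0)"
          by (intro sum.cong refl) (simp add: d that)
        then show ?thesis using that by simp
      qed
      then have m: "map (\<lambda>i. \<Sum>k<3. A i k * u ! k) [0..<Suc 2] = map ((*) \<theta>) u"
        by (intro nth_equalityI) (simp_all add: len_vecs[OF u(1)] nth_map_upt del: upt_Suc)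
      have "pt (phi (map (\<lambda>i. \<Sum>k<3. A i k * u ! k) [0..<Suc 2])) = pt (phi u)"
        by (rule pt_phi_scaled[OF A(3)[OF u(1), THEN conjunct1] m])
      then show ?thesis using A(3)[OF u(1)] u(2) by simp
    qed
    then show False using not_scalar[OF t g eq] by blast
  qed
  have "\<exists>d E P a. (\<forall>m<9. E m \<in> ffun K 8 d) \<and> P \<noteq> 0 \<and> a < 9 \<and> (\<exists>u. length u = 3 \<and> E a (phi u) \<noteq> 0) \<and>
    (\<forall>u i i' j j'. length u = 3 \<longrightarrow> evu P u \<noteq> 0 \<longrightarrow> i < 3 \<longrightarrow> i' < 3 \<longrightarrow> j < 3 \<longrightarrow> j' < 3 \<longrightarrow>
       Rm (map (\<lambda>m. E m (phi (sg u))) [0..<Suc 8]) i j * (\<Sum>k<3. A i' k * Rm (map (\<lambda>m. E m (phi u)) [0..<Suc 8]) k j')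
     = Rm (map (\<lambda>m. E m (phi (sg u))) [0..<Suc 8]) i' j * (\<Sum>k<3. A i k * Rm (map (\<lambda>m. E m (phi u)) [0..<Suc 8]) k j'))" (is "\<exists>d E P a. ?Q d E P a")
  proof (rule generic_relation[OF r(1) t eq[unfolded r(2)] A(3)])
    fix d E P a
    assume H: "\<And>m. m < 9 \<Longrightarrow> E m \<in> ffun K 8 d" "P \<noteq> 0" "a < (9::nat)" "\<exists>u. length u = 3 \<and> E a (phi u) \<noteq> 0"
      "\<And>u i i' j j'. length u = 3 \<Longrightarrow> evu P u \<noteq> 0 \<Longrightarrow> i < 3 \<Longrightarrow> i' < 3 \<Longrightarrow> j < 3 \<Longrightarrow> j' < 3 \<Longrightarrow>
       Rm (map (\<lambda>m. E m (phi (sg u))) [0..<Suc 8]) i j * (\<Sum>k<3. A i' k * Rm (map (\<lambda>m. E m (phi u)) [0..<Suc 8]) k j')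
     = Rm (map (\<lambda>m. E m (phi (sg u))) [0..<Suc 8]) i' j * (\<Sum>k<3. A i k * Rm (map (\<lambda>m. E m (phi u)) [0..<Suc 8]) k j')"
    show "\<exists>d E P a. ?Q d E P a"
      by (rule exI[of _ d], rule exI[of _ E], rule exI[of _ P], rule exI[of _ a], intro conjI allI impI H)
  qed
  then obtain d E P a where Q: "?Q d E P a" by (elim exE)
  have E: "E m \<in> ffun K 8 d" if "m < 9" for m by (rule Q[THEN conjunct1, rule_format, OF that])
  note P = Q[THEN conjunct2, THEN conjunct1]
  note a = Q[THEN conjunct2, THEN conjunct2, THEN conjunct1]
  note exu = Q[THEN conjunct2, THEN conjunct2, THEN conjunct2, THEN conjunct1]
  note rel = Q[THEN conjunct2, THEN conjunct2, THEN conjunct2, THEN conjunct2, rule_format]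
  let ?c = "\<lambda>a b. inverse al ^ a * inverse be ^ b"
  \<comment> \<open>The splitting of \<open>phi_split\<close>: components over \<open>K\<close> that
    are homogeneous of degree \<open>3 * d\<close> and transform by characters.\<close>
  define sp where "sp V m \<longleftrightarrow> (\<forall>a<3. \<forall>b<3. V a b \<in> K3 K) \<and>
    (\<forall>u. length u = 3 \<longrightarrow> E m (phi u) = (\<Sum>a<3. \<Sum>b<3. ?c a b * evu (V a b) u)) \<and>
    (\<forall>a<3. \<forall>b<3. \<forall>u p q. length u = 3 \<longrightarrow> evu (V a b) (Mt p q u) = (w ^ p) ^ a * (w ^ (2 * q)) ^ b * evu (V a b) u) \<and>
    (\<forall>a<3. \<forall>b<3. \<forall>u c. length u = 3 \<longrightarrow> evu (V a b) (map ((*) c) u) = c ^ (3 * d) * evu (V a b) u)" for V m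
  have "\<exists>V. m < 9 \<longrightarrow> sp V m" for m
  proof (cases "m < 9")
    case True
    have "\<exists>V. sp V m" unfolding sp_def by (rule phi_split[OF E[OF True]])
    then obtain V where "sp V m" by (elim exE)
    then show ?thesis by (intro exI[of _ V] impI)
  qed simp
  then have "\<forall>m. \<exists>V. m < 9 \<longrightarrow> sp V m" by (rule allI)
  from choice[OF this] obtain V where V: "\<forall>m. m < 9 \<longrightarrow> sp (V m) m" by (elim exE)
  note V' = V[rule_format, unfolded sp_def]
  have V1: "V m a b \<in> K3 K" if "m < 9" "a < 3" "b < 3" for m a b
    by (rule V'[OF that(1), THEN conjunct1, rule_format, OF that(2,3)])
  have V2: "E m (phi u) = (\<Sum>a<3. \<Sum>b<3. ?c a b * evu (V m a b) u)" if "m < 9" "length u = 3" for m u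
    by (rule V'[OF that(1), THEN conjunct2, THEN conjunct1, rule_format, OF that(2)])
  have V3: "evu (V m a b) (Mt p q u) = (w ^ p) ^ a * (w ^ (2 * q)) ^ b * evu (V m a b) u"
    if "m < 9" "a < 3" "b < 3" "length u = 3" for m a b u p q
    by (rule V'[OF that(1), THEN conjunct2, THEN conjunct2, THEN conjunct1, rule_format, OF that(2-4)])
  have V4: "evu (V m a b) (map ((*) c) u) = c ^ (3 * d) * evu (V m a b) u"
    if "m < 9" "a < 3" "b < 3" "length u = 3" for m a b u c
    by (rule V'[OF that(1), THEN conjunct2, THEN conjunct2, THEN conjunct2, rule_format, OF that(2-4)])
  define I where "I = {..<9::nat} \<times> {..<3::nat} \<times> {..<3::nat}"
  obtain u0 where u0: "length u0 = 3" "E a (phi u0) \<noteq> 0" using exu by blast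
  have "\<exists>a'<3. \<exists>b'<3. V a a' b' \<noteq> 0"
  proof (rule ccontr)
    assume "\<not> ?thesis"
    then have "V a a' b' = 0" if "a' < 3" "b' < 3" for a' b' using that by blast
    then show False using V2[OF a u0(1)] u0(2) by simp
  qed
  then obtain a' b' where ab: "a' < 3" "b' < 3" "V a a' b' \<noteq> 0" by blast
  \<comment> \<open>One power of the curve equation is divided out of all components of all nine
    coordinates at once, leaving a component that survives on the curve.\<close>
  have "\<exists>m V'. (\<forall>i\<in>I. (\<lambda>(m, a, b). V m a b) i = fC ^ m * V' i) \<and> (\<exists>i\<in>I. \<not> vanC (V' i))"
    by (rule fC_order[of I "(a, a', b')"]) (use a ab in \<open>auto simp: I_def\<close>)
  then obtain \<mu> V' where V': "\<forall>i\<in>I. (\<lambda>(m, a, b). V m a b) i = fC ^ \<mu> * V' i" "\<exists>i\<in>I. \<not> vanC (V' i)" by (elim exE conjE)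
  define W where "W m a b = V' (m, a, b)" for m a b
  have VW: "V m a b = fC ^ \<mu> * W m a b" if "m < 9" "a < 3" "b < 3" for m a b
    using V'(1)[rule_format, of "(m, a, b)"] that by (simp add: I_def W_def)
  obtain mm aa bb where nv: "mm < 9" "aa < 3" "bb < 3" "\<not> vanC (W mm aa bb)"
    using V'(2) by (auto simp: I_def W_def)
  have fCK: "fC ^ \<mu> \<in> K3 K"
    using K3_vars[OF sK] sring_K3[OF sK] K.kpow[OF wK] unfolding fC_def
    by (intro sring_power sringD) auto
  \<comment> \<open>Exact division does not leave the polynomials over \<open>K\<close>.\<close>
  have WK: "W m a b \<in> K3 K" if "m < 9" "a < 3" "b < 3" for m a b
    using divclosed_K3[OF sK Kinv] V1[OF that] fCK unfolding VW[OF that] divclosed_def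
    by (metis fC_nz mult.commute power_not_zero)
  define F where "F m = (\<Sum>a<3. \<Sum>b<3. pc (?c a b) * W m a b)" for m
  have EF: "E m (phi u) = evu fC u ^ \<mu> * evu (F m) u" if "m < 9" "length u = 3" for m u
  proof -
    have "E m (phi u) = (\<Sum>a<3. \<Sum>b<3. evu fC u ^ \<mu> * (?c a b * evu (W m a b) u))"
      unfolding V2[OF that] by (intro sum.cong refl) (simp add: VW that(1) mult_ac)
    then show ?thesis by (simp add: F_def sum_distrib_left)
  qed
  define N where "N i j = mat F i j" for i j
  have RN: "Rm (map f [0..<Suc 8]) i j = k * evu (N i j) u" if "\<And>m. m < 9 \<Longrightarrow> f m = k * evu (F m) u" for f k i j u
    unfolding N_def ev_mat Rm_map sum_distrib_left
    by (intro sum.cong refl, subst that[OF idx_less]) (simp_all only: lessThan_iff mult_ac)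
  define TN where "TN i j = (\<Sum>k<3. pc (A i k) * N k j)" for i j
  have RE: "Rm (map (\<lambda>m. E m (phi u)) [0..<Suc 8]) i j = evu fC u ^ \<mu> * evu (N i j) u" if "length u = 3" for u i j
    by (rule RN) (use EF that in blast)
  define sT where "sT = (\<lambda>i. if i = (0::nat) then px * pz * (px * pz - py\<^sup>2)
    else if i = 1 then pc w * (px * py * (px * py - pz\<^sup>2)) else pc (w\<^sup>2) * (py * pz * (py * pz - px\<^sup>2)))"
  have sT: "sg u = evt sT u" if "length u = 3" for u unfolding sT_def by (rule sg_evt[OF that])
  obtain FS where FS: "\<forall>u. evu FS u = evu fC (evt sT u)" by (rule exE[OF evu_comp])
  have FS0: "FS \<noteq> 0"
  proof
    assume "FS = 0"
    then have "evu fC (sg [1, 2, 3]) = 0" using FS[rule_format, of "[1, 2, 3]"] sT[of "[1, 2, 3]"] by (simp del: ev3_fC)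
    then show False using fC_sg_nz by blast
  qed
  \<comment> \<open>Cancelling the powers of the curve equation is possible off the curve and its
    preimage. Density then gives the relation at every \<open>u\<close>, in particular on the
    curve.\<close>
  have rel': "evu (N i j) (sg u) * evu (TN i' j') u = evu (N i' j) (sg u) * evu (TN i j') u"
    if ij: "i < 3" "i' < 3" "j < 3" "j' < 3" and u: "length u = 3" for u i i' j j'
  proof -
    obtain N1 where N1: "\<forall>u. evu N1 u = evu (N i j) (evt sT u)" by (rule exE[OF evu_comp])
    obtain N2 where N2: "\<forall>u. evu N2 u = evu (N i' j) (evt sT u)" by (rule exE[OF evu_comp])
    have "N1 * TN i' j' - N2 * TN i j' = 0"
    proof (rule evu_dense[of "P * fC * FS"])
      show "P * fC * FS \<noteq> 0" using P FS0 by simp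
      fix u :: "complex list" assume l: "length u = 3" and "evu (P * fC * FS) u \<noteq> 0"
      then have nz: "evu P u \<noteq> 0" "evu fC u \<noteq> 0" "evu fC (sg u) \<noteq> 0"
        using FS sT[OF l] by (auto simp del: ev3_fC)
      let ?x = "evu fC u ^ \<mu>" and ?y = "evu fC (sg u) ^ \<mu>"
      have s: "(\<Sum>k<3. A i k * (?x * evu (N k j') u)) = ?x * evu (TN i j') u" for i
        by (simp add: TN_def sum_distrib_left mult_ac del: ev3_fC)
      have "?y * evu (N i j) (sg u) * (?x * evu (TN i' j') u) = ?y * evu (N i' j) (sg u) * (?x * evu (TN i j') u)"
        using rel[OF l nz(1) ij] unfolding RE[OF l] RE[OF sg_len] s .
      then have "?x * ?y * (evu (N i j) (sg u) * evu (TN i' j') u) = ?x * ?y * (evu (N i' j) (sg u) * evu (TN i j') u)"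
        by (simp only: mult_ac)
      then have "evu (N i j) (sg u) * evu (TN i' j') u = evu (N i' j) (sg u) * evu (TN i j') u"
        using nz by (simp del: ev3_fC)
      then show "evu (N1 * TN i' j' - N2 * TN i j') u = 0" using N1 N2 sT[OF l] by simp
    qed
    then have "evu (N1 * TN i' j') u = evu (N2 * TN i j') u" by simp
    then show ?thesis using N1 N2 sT[OF u] by simp
  qed
  have relC: "vanC (N i j * (\<Sum>k<3. pc (A i' k) * N k j') - N i' j * (\<Sum>k<3. pc (A i k) * N k j'))"
    if ij: "i < 3" "i' < 3" "j < 3" "j' < 3" for i i' j j'
  proof -
    \<comment> \<open>The factor \<open>lamP\<close> covers the points of the curve at which
      \<open>sg u\<close> is the zero vector; it is cancelled at the end by irreducibility.\<close>
    have "vanC (lamP * (N i j * TN i' j' - N i' j * TN i j'))"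
    proof (rule vanC_I)
      fix u :: "complex list" assume u: "length u = 3" "evu fC u = 0"
      define l where "l = evu lamP u"
      show "evu (lamP * (N i j * TN i' j' - N i' j * TN i j')) u = 0"
      proof (cases "l = 0")
        case False
        obtain x y z where xyz: "u = [x, y, z]" using u(1) by (rule len3_E)
        \<comment> \<open>On the curve \<open>sg\<close> only rescales, so the matrix at
          \<open>sg u\<close> is a nonzero multiple of the one at \<open>u\<close>. The relation now
          says that its columns are eigenvectors of \<open>A\<close>.\<close>
        have sgl: "sg u = map ((*) l) u" using u(2) unfolding xyz sg_curve by (simp add: l_def xyz)
        have Wl: "(l ^ 3) ^ \<mu> * evu (W m a b) (map ((*) l) u) = l ^ (3 * d) * evu (W m a b) u"
          if "m < 9" "a < 3" "b < 3" for m a b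
          by (rule fC_twist[OF VW[OF that] scale_evt V4[OF that] cv_scale u(1)])
        have Fl: "evu (F m) (map ((*) l) u) = l ^ (3 * d) / (l ^ 3) ^ \<mu> * evu (F m) u" if "m < 9" for m
        proof -
          have "evu (W m a b) (map ((*) l) u) = l ^ (3 * d) / (l ^ 3) ^ \<mu> * evu (W m a b) u" if "a < 3" "b < 3" for a b
            using Wl[OF \<open>m < 9\<close> that] False by (simp add: field_simps)
          then have "evu (F m) (map ((*) l) u) = (\<Sum>a<3. \<Sum>b<3. ?c a b * (l ^ (3 * d) / (l ^ 3) ^ \<mu> * evu (W m a b) u))"
            unfolding F_def ev3_sum ev3_simps by (intro sum.cong refl) (simp only: lessThan_iff)
          also have "\<dots> = l ^ (3 * d) / (l ^ 3) ^ \<mu> * evu (F m) u"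
            unfolding F_def ev3_sum ev3_simps sum_distrib_left by (intro sum.cong refl) (simp only: mult_ac)
          finally show ?thesis .
        qed
        have Nl: "evu (N i j) (sg u) = l ^ (3 * d) / (l ^ 3) ^ \<mu> * evu (N i j) u" for i j
        proof -
          have "evu (N i j) (sg u) = Rm (map (\<lambda>m. evu (F m) (sg u)) [0..<Suc 8]) i j" unfolding N_def by (rule ev_mat)
          also have "\<dots> = l ^ (3 * d) / (l ^ 3) ^ \<mu> * evu (N i j) u" unfolding sgl by (rule RN[OF Fl])
          finally show ?thesis .
        qed
        have "l ^ (3 * d) / (l ^ 3) ^ \<mu> * (evu (N i j) u * evu (TN i' j') u) = l ^ (3 * d) / (l ^ 3) ^ \<mu> * (evu (N i' j) u * evu (TN i j') u)"
          using rel'[OF ij u(1)] unfolding Nl by (simp only: mult.assoc)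
        then have "evu (N i j) u * evu (TN i' j') u = evu (N i' j) u * evu (TN i j') u" using False by simp
        then show ?thesis by simp
      qed (simp add: l_def)
    qed
    then show ?thesis using vanC_mult not_vanC_lamP unfolding TN_def by blast
  qed
  have "\<exists>\<xi> i0. i0 < 3 \<and> \<xi> i0 \<noteq> 0 \<and> (\<forall>j<3. vanC (\<Sum>k<3. pc (\<xi> k) * N k j))"
    by (rule common_left_kernel[where A = A and h = h and N = N], rule A(1), rule A(2), assumption, assumption,
      rule ns, rule relC)
  then obtain \<xi> i0 where \<xi>: "i0 < 3" "\<xi> i0 \<noteq> 0" "\<forall>j<3. vanC (\<Sum>k<3. pc (\<xi> k) * N k j)"
    by (elim exE conjE)
  obtain \<kappa> where \<kappa>: "\<forall>f j. (\<Sum>i<3. \<xi> i * Rm (map f [0..<Suc 8]) i j) = (\<Sum>m<9. \<kappa> j m * f m)"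
    by (rule exE[OF Rm_linear])
  have "vanC (W mm aa bb)"
  proof (rule curve_no_singular[where \<xi> = \<xi> and ?i0.0 = i0 and v = "\<lambda>m. W m aa bb", OF _ \<xi>(1,2) _ nv(1)])
    show "W m aa bb \<in> K3 K" if "m < 9" for m by (rule WK[OF that nv(2,3)])
    fix x y z j assume xyz: "cv x y z = 0" "x \<noteq> 0" "y \<noteq> 0" "z \<noteq> 0" and j: "j < (3::nat)"
    let ?u = "[x, y, z]"
    have l: "length ?u = 3" by simp
    \<comment> \<open>The relation holds on the whole curve, hence also at all Heisenberg translates
      of the point.\<close>
    have Mz: "(\<Sum>m<9. \<kappa> j m * evu (F m) (Mt p q ?u)) = 0" for p q
    proof -
      have nzM: "Mt p q ?u ! i \<noteq> 0" if "i < 3" for i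
      proof -
        have "?u ! k \<noteq> 0" if "k < 3" for k using less_3[OF that] xyz by auto
        then show ?thesis using that by (simp add: Mt_nth)
      qed
      have zM: "evu fC (Mt p q ?u) = 0" unfolding cv_Mt[OF l] using xyz(1) by simp
      have "evu (\<Sum>k<3. pc (\<xi> k) * N k j) (Mt p q ?u) = 0"
        by (rule vanC_E[OF \<xi>(3)[rule_format, OF j] zM nzM nzM nzM]) simp_all
      then have "(\<Sum>k<3. \<xi> k * Rm (map (\<lambda>m. evu (F m) (Mt p q ?u)) [0..<Suc 8]) k j) = 0"
        unfolding ev3_sum ev3_simps N_def ev_mat .
      then show ?thesis unfolding \<kappa>[rule_format] .
    qed
    \<comment> \<open>The contribution of one character component to the relation. Comparing the
      translates isolates it, which is how the coefficients \<open>al\<close> and \<open>be\<close>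
      are removed.\<close>
    define c where "c a b = ?c a b * (\<Sum>m<9. \<kappa> j m * evu (W m a b) ?u)" for a b
    have "c aa bb = 0"
    proof (rule fourier9[OF _ nv(2,3)])
      fix p q :: nat
      \<comment> \<open>The divided components still transform by their characters up to this common
        factor from the power of the curve equation.\<close>
      define k where "k = (w ^ (p mod 3 + 2 * q)) ^ \<mu>"
      have "2 * (2 * q) mod 3 = q mod 3" by presburger
      then have w4: "w ^ (2 * (2 * q)) = w ^ q" using w_pow_mod[of "2 * (2 * q)"] w_pow_mod[of q] by simp
      have Wt: "k * evu (W m a b) (Mt p (2 * q) ?u) = (w ^ p) ^ a * (w ^ q) ^ b * evu (W m a b) ?u"
        if "m < 9" "a < 3" "b < 3" for m a b
        using fC_twist[OF VW[OF that] Mt_evt V3[OF that] cv_Mt l, of p "2 * q"] unfolding k_def w4 .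
      have Ft: "k * evu (F m) (Mt p (2 * q) ?u) = (\<Sum>a<3. \<Sum>b<3. ?c a b * ((w ^ p) ^ a * (w ^ q) ^ b * evu (W m a b) ?u))"
        if "m < 9" for m
      proof -
        have "k * evu (F m) (Mt p (2 * q) ?u) = (\<Sum>a<3. \<Sum>b<3. ?c a b * (k * evu (W m a b) (Mt p (2 * q) ?u)))"
          unfolding F_def ev3_sum ev3_simps sum_distrib_left by (intro sum.cong refl) (simp only: mult_ac)
        also have "\<dots> = (\<Sum>a<3. \<Sum>b<3. ?c a b * ((w ^ p) ^ a * (w ^ q) ^ b * evu (W m a b) ?u))"
          by (intro sum.cong refl) (simp only: Wt[OF that] lessThan_iff)
        finally show ?thesis .
      qed
      have "0 = (\<Sum>m<9. \<kappa> j m * (k * evu (F m) (Mt p (2 * q) ?u)))"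
      proof -
        have "(\<Sum>m<9. \<kappa> j m * (k * evu (F m) (Mt p (2 * q) ?u))) = k * (\<Sum>m<9. \<kappa> j m * evu (F m) (Mt p (2 * q) ?u))"
          unfolding sum_distrib_left by (intro sum.cong refl) (simp only: mult_ac)
        then show ?thesis unfolding Mz by simp
      qed
      also have "\<dots> = (\<Sum>m<9. \<Sum>a<3. \<Sum>b<3. \<kappa> j m * (?c a b * ((w ^ p) ^ a * (w ^ q) ^ b * evu (W m a b) ?u)))"
        by (intro sum.cong refl) (simp only: Ft lessThan_iff sum_distrib_left)
      also have "\<dots> = (\<Sum>a<3. \<Sum>b<3. \<Sum>m<9. \<kappa> j m * (?c a b * ((w ^ p) ^ a * (w ^ q) ^ b * evu (W m a b) ?u)))"
        by (rule trans[OF sum.swap], rule sum.cong[OF refl], rule sum.swap)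
      also have "\<dots> = (\<Sum>a<3. \<Sum>b<3. (w ^ p) ^ a * (w ^ q) ^ b * c a b)"
        unfolding c_def sum_distrib_left by (intro sum.cong refl) (simp only: mult_ac)
      finally show "(\<Sum>a<3. \<Sum>b<3. (w ^ p) ^ a * (w ^ q) ^ b * c a b) = 0" by (rule sym)
    qed
    then have "(\<Sum>m<9. \<kappa> j m * evu (W m aa bb) ?u) = 0" by (simp add: c_def)
    then show "(\<Sum>i<3. \<xi> i * Rm (map (\<lambda>m. ev3 (W m aa bb) x y z) [0..<Suc 8]) i j) = 0"
      unfolding \<kappa>[rule_format] by simp
  qed
  then show False using nv(4) by blast
qed

end

theorem theorem1p2:
  fixes G :: "('g, 'm) monoid_scheme"
  assumes "group G"
    and "G \<cong> integer_mod_group 3 \<or>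
         G \<cong> integer_mod_group 3 \<times>\<times> integer_mod_group 3 \<or>
         G \<cong> integer_mod_group 3 \<times>\<times> integer_mod_group 3 \<times>\<times> integer_mod_group 3"
  shows "\<exists>(L :: complex ring) K n S.
           algebraic_closure L K \<and> has_char_zero (L\<lparr>carrier := K\<rparr>) \<and>
           nontrivial_severi_brauer_surface L K n S \<and>
           (\<exists>H. subgroup H (Bir L K n S) \<and> (Bir L K n S)\<lparr>carrier := H\<rparr> \<cong> G \<and>
              \<not> (\<exists>g \<in> carrier (Bir L K n S).
                   subgroup (conjugate_subgroup (Bir L K n S) g H) (Aut L K n S)))"
proof -
  have "\<not> constant (poly [:1, 1, 1 :: complex:])" by (simp add: constant_degree)
  from fundamental_theorem_of_algebra[OF this] obtain w :: complex where "poly [:1, 1, 1:] w = 0" by (elim exE)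
  then have w: "w\<^sup>2 + w + 1 = 0" by (simp add: power2_eq_square algebra_simps)
  interpret W: cube_root_1 w by unfold_locales (rule w)
  obtain al :: complex where al: "al ^ 3 = 2" by (rule exE[OF complex_cube_root])
  obtain be :: complex where be: "be ^ 3 = w" by (rule exE[OF complex_cube_root])
  obtain K where K: "W.good_field K" "\<forall>K'. W.good_field K' \<longrightarrow> K \<subseteq> K' \<longrightarrow> K' = K"
    using W.ex_max_good by (elim exE conjE)
  interpret B: severi_brauer w al be K by unfold_locales (rule al be K(1))+
  obtain H where H: "subgroup H (Bir CC K 8 B.S)" "(Bir CC K 8 B.S)\<lparr>carrier := H\<rparr> \<cong> G" "B.gS \<in> H"
    using B.cube_subgroup_Bir[OF assms] by (elim exE conjE)
  have ac: "algebraic_closure CC K"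
    by (rule algebraic_closure_CC[OF B.K.subring_C_axioms B.Kinv W.max_good_algebraic[OF K(1)]]) (use K(2) in blast)+
  have ch: "has_char_zero (CC\<lparr>carrier := K\<rparr>)" by (rule has_char_zero_CC[OF B.K.k1])
  have sb: "nontrivial_severi_brauer_surface CC K 8 B.S"
    unfolding nontrivial_severi_brauer_surface_def using B.S_severi_brauer B.S_not_rational by blast
  \<comment> \<open>The single element \<open>gS\<close> of \<open>H\<close> is the obstruction:
    already it cannot be conjugated into an automorphism.\<close>
  have "\<not> subgroup (conjugate_subgroup (Bir CC K 8 B.S) g H) (Aut CC K 8 B.S)"
    if g: "g \<in> carrier (Bir CC K 8 B.S)" for g
  proof
    let ?B = "Bir CC K 8 B.S"
    assume "subgroup (conjugate_subgroup ?B g H) (Aut CC K 8 B.S)"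
    then have "conjugate_subgroup ?B g H \<subseteq> carrier (Aut CC K 8 B.S)" by (rule subgroup.subset)
    moreover have "g \<otimes>\<^bsub>?B\<^esub> B.gS \<otimes>\<^bsub>?B\<^esub> inv\<^bsub>?B\<^esub> g \<in> conjugate_subgroup ?B g H"
      unfolding conjugate_subgroup_def by (rule imageI[OF H(3)])
    ultimately have "g \<otimes>\<^bsub>?B\<^esub> B.gS \<otimes>\<^bsub>?B\<^esub> inv\<^bsub>?B\<^esub> g \<in> carrier (Aut CC K 8 B.S)" by (rule subsetD)
    then obtain t t' where t: "g \<otimes>\<^bsub>?B\<^esub> B.gS \<otimes>\<^bsub>?B\<^esub> inv\<^bsub>?B\<^esub> g = rat_class CC K 8 B.S (B.S, t)"
      "inverse_morphisms CC K 8 B.S 8 B.S t t'" by (auto simp: Aut_def)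
    have "rat_class CC K 8 B.S (B.S, t) \<otimes>\<^bsub>?B\<^esub> g = g \<otimes>\<^bsub>?B\<^esub> B.gS"
      unfolding t(1)[symmetric] using g B.gS_carrier by (simp add: B.G.m_assoc)
    then show False using B.not_conjugate[OF B.bir_morphism[OF t(2)] g] by simp
  qed
  then show ?thesis using ac ch sb H(1,2) by blast
qed

end
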